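(* Let $X$ be a Riemannian manifold, $\mu$ a probability measure on $\varGamma_X$, $\{\eta_x\}_{x\in X}$ a measurable family of probability measures on $\mathfrak{X}=\bigsqcup_{n=0}^\infty X^n$, and $\mu_{\mathrm{cl}}$ the corresponding cluster measure, and assume that the standing assumptions (A1)–(A4) listed in the context hold. Let $v\in\mathrm{Vect}_0(X)$. Then for any function $F\in\mathcal{FC}(\varGamma_X)$ the following integration-by-parts formula holds: $$\int_{\varGamma_X}\sum_{x\in\gamma}\nabla_xF(\gamma)\cdot v(x)\,\mu_{\mathrm{cl}}(d\gamma)=-\int_{\varGamma_X}F(\gamma)\,B^v_{\mu_{\mathrm{cl}}}(\gamma)\,\mu_{\mathrm{cl}}(d\gamma),$$ where $B^v_{\mu_{\mathrm{cl}}}:=\mathcal{I}_{\mathfrak{q}}^*B^{\hat v}_{\hat\mu}\in L^1(\varGamma_X,\mu_{\mathrm{cl}})$ and $B^{\hat v}_{\hat\mu}(\hat\gamma):=\sum_{(x,\bar y)\in\hat\gamma}\beta_\eta^{\hat v}(x,\bar y)$.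
   Context: Configurations: a configuration in $S$ is a measure $\gamma=\sum_i\delta_{s_i}$ (countably many points); it is proper if finite on compact sets and without multiple points; $\varGamma_S$ is the set of proper configurations with the $\sigma$-algebra generated by $\gamma\mapsto\gamma(B)$. $\langle f,\gamma\rangle=\sum_{s\in\gamma}f(s)$. For $\bar y=(y_i)\in\mathfrak{X}$: $\mathfrak{p}(\bar y)=\sum_i\delta_{y_i}$, $N_X(\bar y)$ is the number of coordinates, $\mathfrak{X}_B$ is the set of $\bar y$ with at least one coordinate in $B$; $\mathcal{Z}=X\times\mathfrak{X}$, $\mathcal{Z}_B=X\times\mathfrak{X}_B$. $\mathfrak{X}$ carries the componentwise Riemannian structure and volume $d\bar y$. "Measurable family" means $x\mapsto\eta_x(\bar B)$ is measurable for each Borel $\bar B\subset\mathfrak{X}$. $\mathcal{M}^1_\theta(\varGamma_X)$: the probability measures $\mu$ on $\varGamma_X$ with $\int|\langle f,\gamma\rangle|\,d\mu<\infty$ for all $f\in L^1(X,\theta)$ (elements of $L^1$ being classes of $\theta$-a.e. equal functions, so that $\langle f,\gamma\rangle$ is required to be $\mu$-a.s. independent of the representative). Cluster measure $\mu_{\mathrm{cl}}$: the law of $\sum_{x\in\gamma_c}\gamma'_x$, where $\gamma_c\sim\mu$ and, given $\gamma_c$, the $\gamma'_x$ are independent with laws $\eta_x\circ\mathfrak{p}^{-1}$ (supported on $\varGamma_X$ under the present assumptions). $\hat\mu(d\hat\gamma)=\bigotimes_{x\in\gamma}\eta_x(d\bar y_x)\,\mu(d\gamma)$ on $\varGamma_{\mathcal{Z}}$,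 $\hat\gamma=\sum_{x\in\gamma}\delta_{(x,\bar y_x)}$; $\mathfrak{q}(\hat\gamma)=\sum_{(x,\bar y)\in\hat\gamma}\mathfrak{p}(\bar y)$, so that $\mu_{\mathrm{cl}}=\hat\mu\circ\mathfrak{q}^{-1}$. For $G\in L^1(\hat\mu)$, $\mathcal{I}^*_{\mathfrak{q}}G\in L^1(\mu_{\mathrm{cl}})$ is determined by $\int F\,\mathcal{I}^*_{\mathfrak{q}}G\,d\mu_{\mathrm{cl}}=\int (F\circ\mathfrak{q})\,G\,d\hat\mu$ for all $F\in L^\infty(\mu_{\mathrm{cl}})$. $\mathrm{Vect}_0(X)$: compactly supported $C^\infty$ vector fields on $X$. $\mathcal{FC}(\varGamma_X)$: functions $F(\gamma)=f(\langle\phi_1,\gamma\rangle,\dots,\langle\phi_k,\gamma\rangle)$ with $k\in\mathbb{N}$, $f\in C_b^\infty(\mathbb{R}^k)$ (bounded with all derivatives), $\phi_i\in C_0^\infty(X)$. For $x\in\gamma$, $\nabla_xF(\gamma)$ is the gradient at $y=x$ of $y\mapsto F((\gamma\setminus\{x\})\cup\{y\})$; the dot is the inner product in $T_xX$. For $v\in\mathrm{Vect}_0(X)$: $\hat v(x,\bar y):=(v(y_i))_{y_i\in\bar y}$, a vector field in the $\bar y$-variable. With $h_x(\bar y)=\eta_x(d\bar y)/d\bar y$: $\beta_\eta(x,\bar y):=\nabla h_x(\bar y)/h_x(\bar y)\in T_{\bar y}\mathfrak{X}$, with components $\beta_\eta(x,\bar y)_i$; $\|\beta_\eta(x,\bar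 y)\|_1:=\sum_i|\beta_\eta(x,\bar y)_i|$; and $\beta_\eta^{\hat v}(x,\bar y):=(\beta_\eta(x,\bar y),\hat v(x,\bar y))_{T_{\bar y}\mathfrak{X}}+\sum_{y_i\in\bar y}\mathrm{div}\,v(y_i)$. Standing assumptions: (A1) there is a measure $\theta$ on $X$, finite on compact sets, with $\mu\in\mathcal{M}^1_\theta(\varGamma_X)$; (A2) for every compact $B\subset X$, $\int_X\eta_x(\mathfrak{X}_B)\,\theta(dx)<\infty$ and $\int_X\int_{\mathfrak{X}_B}N_X(\bar y)\,\eta_x(d\bar y)\,\theta(dx)<\infty$; (A3) each $\eta_x$ is absolutely continuous with respect to $d\bar y$ with differentiable density $h_x$ and satisfies, for all $v\in\mathrm{Vect}_0(X)$ and $f\in C_0^\infty(\mathfrak{X})$, $\int_{\mathfrak{X}}\nabla^{\hat v}f\,d\eta_x=-\int_{\mathfrak{X}}f(\bar y)\,\beta_\eta^{\hat v}(x,\bar y)\,\eta_x(d\bar y)$, where $\nabla^{\hat v}$ is the derivative along $\hat v$; (A4) $\int_{\mathcal{Z}_B}\|\beta_\eta(z)\|_1\,\hat\sigma(dz)<\infty$ for every compact $B\subset X$, where $\hat\sigma(dx\times d\bar y)=\eta_x(d\bar y)\,\theta(dx)$. *)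

theory Defs
  imports "HOL-Analysis.Analysis" "HOL-Probability.Probability"
begin

section \<open>Smooth functions on open subsets of a normed space\<close>

text \<open>The iterated directional derivative \<open>D\<^sub>v\<^sub>1 \<dots> D\<^sub>v\<^sub>k f\<close> for \<open>vs = [v\<^sub>1, \<dots>, v\<^sub>k]\<close>.\<close>

primrec iter_deriv ::
  "('a::real_normed_vector \<Rightarrow> 'b::real_normed_vector) \<Rightarrow> 'a list \<Rightarrow> 'a \<Rightarrow> 'b" where
  "iter_deriv f [] = f"
| "iter_deriv f (v # vs) = (\<lambda>x. frechet_derivative (iter_deriv f vs) (at x) v)"

text \<open>Meant for open \<open>S\<close>. Since each iterated derivative is again differentiable, hence
  continuous, this is the class \<open>C\<^sup>\<infinity>\<close> whenever \<open>f\<close> depends on finitely many coordinates.\<close>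

definition smooth_on ::
  "'a::real_normed_vector set \<Rightarrow> ('a \<Rightarrow> 'b::real_normed_vector) \<Rightarrow> bool" where
  "smooth_on S f \<longleftrightarrow> (\<forall>vs. \<forall>x\<in>S. iter_deriv f vs differentiable (at x))"

definition Cb_inf :: "('a::real_normed_vector \<Rightarrow> real) set" where
  "Cb_inf = {f. smooth_on UNIV f \<and> (\<forall>vs. bounded (range (iter_deriv f vs)))}"

section \<open>Riemannian manifolds\<close>

text \<open>A chart is a pair of its domain and its coordinate map; only the values of the
  coordinate map on the domain matter.\<close>

type_synonym ('x, 'n) chart = "'x set \<times> ('x \<Rightarrow> real ^ 'n)"

text \<open>A tangent vector at \<open>x\<close> is the family of its components in all charts at \<open>x\<close>.\<close>

type_synonym ('x, 'n) tangent = "('x, 'n) chart \<Rightarrow> real ^ 'n"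

record ('x, 'n) riem =
  Charts :: "('x, 'n) chart set"
  Metric :: "'x \<Rightarrow> ('x, 'n) tangent \<Rightarrow> ('x, 'n) tangent \<Rightarrow> real"

abbreviation chart_dom :: "('x, 'n::finite) chart \<Rightarrow> 'x set" where
  "chart_dom \<equiv> fst"

abbreviation coord :: "('x, 'n::finite) chart \<Rightarrow> 'x \<Rightarrow> real ^ 'n" where
  "coord \<equiv> snd"

definition chart_img :: "('x, 'n::finite) chart \<Rightarrow> (real ^ 'n) set" where
  "chart_img c = coord c ` chart_dom c"

definition unchart :: "('x, 'n::finite) chart \<Rightarrow> real ^ 'n \<Rightarrow> 'x" where
  "unchart c = inv_into (chart_dom c) (coord c)"

definition smooth_atlas ::
  "('x::{second_countable_topology,t2_space}, 'n::finite) chart set \<Rightarrow> bool" where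
  "smooth_atlas C \<longleftrightarrow>
     (\<forall>c\<in>C. open (chart_dom c) \<and> open (chart_img c) \<and>
             homeomorphism (chart_dom c) (chart_img c) (coord c) (unchart c)) \<and>
     (\<Union>c\<in>C. chart_dom c) = UNIV \<and>
     (\<forall>c\<in>C. \<forall>d\<in>C. smooth_on (coord c ` (chart_dom c \<inter> chart_dom d)) (coord d \<circ> unchart c))"

definition charts_at :: "('x, 'n::finite) riem \<Rightarrow> 'x \<Rightarrow> ('x, 'n) chart set" where
  "charts_at X x = {c \<in> Charts X. x \<in> chart_dom c}"

definition transition_deriv ::
  "('x, 'n::finite) chart \<Rightarrow> ('x, 'n) chart \<Rightarrow> 'x \<Rightarrow> real ^ 'n \<Rightarrow> real ^ 'n" where
  "transition_deriv c d x = frechet_derivative (coord d \<circ> unchart c) (at (coord c x))"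

text \<open>Components in charts away from \<open>x\<close> are set to \<open>0\<close>, so that a tangent vector
  is determined by its components in the charts at \<open>x\<close>.\<close>

definition tangent_space :: "('x, 'n::finite) riem \<Rightarrow> 'x \<Rightarrow> ('x, 'n) tangent set" where
  "tangent_space X x =
     {\<xi>. (\<forall>c. c \<notin> charts_at X x \<longrightarrow> \<xi> c = 0) \<and>
          (\<forall>c\<in>charts_at X x. \<forall>d\<in>charts_at X x. \<xi> d = transition_deriv c d x (\<xi> c))}"

definition tangent_add ::
  "('x, 'n::finite) tangent \<Rightarrow> ('x, 'n) tangent \<Rightarrow> ('x, 'n) tangent" where
  "tangent_add \<xi> \<zeta> = (\<lambda>c. \<xi> c + \<zeta> c)"

definition tangent_scale :: "real \<Rightarrow> ('x, 'n::finite) tangent \<Rightarrow> ('x, 'n) tangent" where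
  "tangent_scale a \<xi> = (\<lambda>c. a *\<^sub>R \<xi> c)"

text \<open>The tangent vector at \<open>x\<close> with component \<open>w\<close> in the chart \<open>c\<close>.\<close>

definition tangent_of ::
  "('x, 'n::finite) riem \<Rightarrow> ('x, 'n) chart \<Rightarrow> 'x \<Rightarrow> real ^ 'n \<Rightarrow> ('x, 'n) tangent" where
  "tangent_of X c x w = (\<lambda>d. if d \<in> charts_at X x then transition_deriv c d x w else 0)"

definition gram :: "('x, 'n::finite) riem \<Rightarrow> ('x, 'n) chart \<Rightarrow> 'x \<Rightarrow> real ^ 'n ^ 'n" where
  "gram X c x =
     (\<chi> i j. Metric X x (tangent_of X c x (axis i 1)) (tangent_of X c x (axis j 1)))"

definition riemannian_manifold ::
  "('x::{second_countable_topology,t2_space}, 'n::finite) riem \<Rightarrow> bool" where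
  "riemannian_manifold X \<longleftrightarrow>
     smooth_atlas (Charts X) \<and>
     (\<forall>x. \<forall>\<xi>\<in>tangent_space X x. \<forall>\<zeta>\<in>tangent_space X x.
        Metric X x \<xi> \<zeta> = Metric X x \<zeta> \<xi> \<and>
        (\<forall>a. Metric X x (tangent_scale a \<xi>) \<zeta> = a * Metric X x \<xi> \<zeta>) \<and>
        (\<forall>\<xi>'\<in>tangent_space X x.
           Metric X x (tangent_add \<xi> \<xi>') \<zeta> = Metric X x \<xi> \<zeta> + Metric X x \<xi>' \<zeta>)) \<and>
     (\<forall>x. \<forall>\<xi>\<in>tangent_space X x. \<xi> \<noteq> (\<lambda>_. 0) \<longrightarrow> Metric X x \<xi> \<xi> > 0) \<and>
     (\<forall>c\<in>Charts X. \<forall>i j. smooth_on (chart_img c) (\<lambda>w. gram X c (unchart c w) $ i $ j))"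

definition tangent_norm :: "('x, 'n::finite) riem \<Rightarrow> 'x \<Rightarrow> ('x, 'n) tangent \<Rightarrow> real" where
  "tangent_norm X x \<xi> = sqrt (Metric X x \<xi> \<xi>)"

text \<open>The Riemannian volume: the unique Borel measure that in every chart has density
  \<open>sqrt (det g)\<close> with respect to Lebesgue measure.\<close>

definition is_riem_volume ::
  "('x::{second_countable_topology,t2_space}, 'n::finite) riem \<Rightarrow> 'x measure \<Rightarrow> bool" where
  "is_riem_volume X M \<longleftrightarrow> sets M = sets borel \<and>
     (\<forall>c\<in>Charts X. \<forall>B\<in>sets borel. B \<subseteq> chart_dom c \<longrightarrow>
        emeasure M B =
          (\<integral>\<^sup>+w. ennreal (sqrt (det (gram X c (unchart c w)))) * indicator (coord c ` B) w \<partial>lborel))"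

definition riem_volume ::
  "('x::{second_countable_topology,t2_space}, 'n::finite) riem \<Rightarrow> 'x measure" where
  "riem_volume X = (THE M. is_riem_volume X M)"

subsection \<open>Calculus on the manifold\<close>

definition chart_at :: "('x, 'n::finite) riem \<Rightarrow> 'x \<Rightarrow> ('x, 'n) chart" where
  "chart_at X x = (SOME c. c \<in> charts_at X x)"

definition smooth_fun :: "('x, 'n::finite) riem \<Rightarrow> ('x \<Rightarrow> real) \<Rightarrow> bool" where
  "smooth_fun X f \<longleftrightarrow> (\<forall>c\<in>Charts X. smooth_on (chart_img c) (f \<circ> unchart c))"

definition C0_inf :: "('x::topological_space, 'n::finite) riem \<Rightarrow> ('x \<Rightarrow> real) set" where
  "C0_inf X = {f. smooth_fun X f \<and> (\<exists>K. compact K \<and> (\<forall>x. x \<notin> K \<longrightarrow> f x = 0))}"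

text \<open>The differential of \<open>f\<close> at \<open>x\<close>; for differentiable \<open>f\<close> it does not depend on
  the chart.\<close>

definition differential ::
  "('x, 'n::finite) riem \<Rightarrow> ('x \<Rightarrow> real) \<Rightarrow> 'x \<Rightarrow> ('x, 'n) tangent \<Rightarrow> real" where
  "differential X f x \<xi> =
     (let c = chart_at X x in frechet_derivative (f \<circ> unchart c) (at (coord c x)) (\<xi> c))"

definition gradient ::
  "('x, 'n::finite) riem \<Rightarrow> ('x \<Rightarrow> real) \<Rightarrow> 'x \<Rightarrow> ('x, 'n) tangent" where
  "gradient X f x =
     (THE \<xi>. \<xi> \<in> tangent_space X x \<and>
              (\<forall>\<zeta>\<in>tangent_space X x. Metric X x \<xi> \<zeta> = differential X f x \<zeta>))"

definition Vect0 :: "('x::topological_space, 'n::finite) riem \<Rightarrow> ('x \<Rightarrow> ('x, 'n) tangent) set" where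
  "Vect0 X =
     {v. (\<forall>x. v x \<in> tangent_space X x) \<and>
         (\<forall>c\<in>Charts X. smooth_on (chart_img c) (\<lambda>w. v (unchart c w) c)) \<and>
         (\<exists>K. compact K \<and> (\<forall>x. x \<notin> K \<longrightarrow> v x = (\<lambda>_. 0)))}"

text \<open>\<open>div v = (det g)\<^sup>-\<^sup>1\<^sup>/\<^sup>2 \<Sum>\<^sub>i \<partial>\<^sub>i ((det g)\<^sup>1\<^sup>/\<^sup>2 v\<^sup>i)\<close> in local coordinates.\<close>

definition divergence ::
  "('x, 'n::finite) riem \<Rightarrow> ('x \<Rightarrow> ('x, 'n) tangent) \<Rightarrow> 'x \<Rightarrow> real" where
  "divergence X v x =
     (let c = chart_at X x in
      (\<Sum>i\<in>UNIV. frechet_derivative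
          (\<lambda>w. sqrt (det (gram X c (unchart c w))) * (v (unchart c w) c $ i))
          (at (coord c x)) (axis i 1))
      / sqrt (det (gram X c x)))"

section \<open>The space of clusters\<close>

text \<open>The disjoint union of the powers \<open>X\<^sup>n\<close>: the pair \<open>(n, y)\<close>, with \<open>y\<close> extensional on
  \<open>{..<n}\<close>, stands for the tuple \<open>(y 0, \<dots>, y (n - 1))\<close>.\<close>

type_synonym 'x cluster = "nat \<times> (nat \<Rightarrow> 'x)"

definition cluster_top :: "'x::topological_space cluster topology" where
  "cluster_top = sum_topology (\<lambda>n. product_topology (\<lambda>_. euclidean) {..<n}) UNIV"

definition borel_of :: "'a topology \<Rightarrow> 'a measure" where
  "borel_of T = sigma (topspace T) {U. openin T U}"

text \<open>The number \<open>N\<^sub>X\<close> of coordinates.\<close>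

definition cluster_size :: "'x cluster \<Rightarrow> nat" where
  "cluster_size ys = fst ys"

text \<open>The configuration \<open>\<pp>(y) = \<Sum>\<^sub>i \<delta>\<^bsub>y i\<^esub>\<close>.\<close>

definition cluster_config :: "'x::topological_space cluster \<Rightarrow> 'x measure" where
  "cluster_config ys = distr (count_space {..<fst ys}) borel (snd ys)"

definition clusters_meeting :: "'x::topological_space set \<Rightarrow> 'x cluster set" where
  "clusters_meeting B = {ys \<in> topspace cluster_top. \<exists>i<fst ys. snd ys i \<in> B}"

definition cluster_volume ::
  "('x::{second_countable_topology,t2_space}, 'n::finite) riem \<Rightarrow> 'x cluster measure" where
  "cluster_volume X =
     measure_of (topspace cluster_top) (sets (borel_of cluster_top))
       (\<lambda>B. \<Sum>n. emeasure (Pi\<^sub>M {..<n} (\<lambda>_. riem_volume X)) {y. (n, y) \<in> B})"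

subsection \<open>Calculus on the space of clusters\<close>

text \<open>A function \<open>f\<close> on the component \<open>X\<^sup>n\<close>, read in the product chart \<open>(cs 0, \<dots>, cs (n - 1))\<close>.
  As \<open>n\<close> varies, the local coordinates in \<open>(real ^ 'n)\<^sup>n\<close> are taken to be the first \<open>n\<close> entries
  of a bounded sequence with values in \<open>real ^ 'n\<close>. The resulting function on the normed
  space of bounded sequences depends on these entries only, so it is differentiable or smooth
  iff the function of \<open>n\<close> variables is.\<close>

definition pull_cluster ::
  "('x cluster \<Rightarrow> real) \<Rightarrow> nat \<Rightarrow> (nat \<Rightarrow> ('x, 'n::finite) chart) \<Rightarrow> (nat \<Rightarrow>\<^sub>C (real ^ 'n)) \<Rightarrow> real" where
  "pull_cluster f n cs = (\<lambda>u. f (n, \<lambda>i\<in>{..<n}. unchart (cs i) (apply_bcontfun u i)))"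

definition cluster_chart_img ::
  "nat \<Rightarrow> (nat \<Rightarrow> ('x, 'n::finite) chart) \<Rightarrow> (nat \<Rightarrow>\<^sub>C (real ^ 'n)) set" where
  "cluster_chart_img n cs = {u. \<forall>i<n. apply_bcontfun u i \<in> chart_img (cs i)}"

definition differentiable_cluster_fun ::
  "('x, 'n::finite) riem \<Rightarrow> ('x cluster \<Rightarrow> real) \<Rightarrow> bool" where
  "differentiable_cluster_fun X f \<longleftrightarrow>
     (\<forall>n cs. (\<forall>i<n. cs i \<in> Charts X) \<longrightarrow>
        (\<forall>u\<in>cluster_chart_img n cs. pull_cluster f n cs differentiable (at u)))"

definition smooth_cluster_fun ::
  "('x, 'n::finite) riem \<Rightarrow> ('x cluster \<Rightarrow> real) \<Rightarrow> bool" where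
  "smooth_cluster_fun X f \<longleftrightarrow>
     (\<forall>n cs. (\<forall>i<n. cs i \<in> Charts X) \<longrightarrow>
        smooth_on (cluster_chart_img n cs) (pull_cluster f n cs))"

definition cluster_C0_inf ::
  "('x::topological_space, 'n::finite) riem \<Rightarrow> ('x cluster \<Rightarrow> real) set" where
  "cluster_C0_inf X =
     {f. smooth_cluster_fun X f \<and>
         (\<exists>K. compactin cluster_top K \<and> (\<forall>ys\<in>topspace cluster_top. ys \<notin> K \<longrightarrow> f ys = 0))}"

text \<open>A tangent vector at \<open>(y\<^sub>0, \<dots>, y\<^sub>n\<^sub>-\<^sub>1)\<close> is a sequence of tangent vectors to \<open>X\<close> at
  the points \<open>y\<^sub>i\<close>; entries with index \<open>i \<ge> n\<close> are irrelevant.\<close>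

definition vary_coord :: "('x cluster \<Rightarrow> real) \<Rightarrow> 'x cluster \<Rightarrow> nat \<Rightarrow> 'x \<Rightarrow> real" where
  "vary_coord f ys i = (\<lambda>z. f (fst ys, (snd ys)(i := z)))"

definition cluster_gradient ::
  "('x, 'n::finite) riem \<Rightarrow> ('x cluster \<Rightarrow> real) \<Rightarrow> 'x cluster \<Rightarrow> nat \<Rightarrow> ('x, 'n) tangent" where
  "cluster_gradient X f ys i = gradient X (vary_coord f ys i) (snd ys i)"

definition cluster_inner ::
  "('x, 'n::finite) riem \<Rightarrow> 'x cluster \<Rightarrow> (nat \<Rightarrow> ('x, 'n) tangent) \<Rightarrow> (nat \<Rightarrow> ('x, 'n) tangent) \<Rightarrow> real"
  where
  "cluster_inner X ys a b = (\<Sum>i<fst ys. Metric X (snd ys i) (a i) (b i))"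

definition lift_field ::
  "('x \<Rightarrow> ('x, 'n::finite) tangent) \<Rightarrow> 'x cluster \<Rightarrow> nat \<Rightarrow> ('x, 'n) tangent" where
  "lift_field v ys i = v (snd ys i)"

definition cluster_dir_deriv ::
  "('x, 'n::finite) riem \<Rightarrow> ('x cluster \<Rightarrow> nat \<Rightarrow> ('x, 'n) tangent) \<Rightarrow> ('x cluster \<Rightarrow> real) \<Rightarrow>
     'x cluster \<Rightarrow> real" where
  "cluster_dir_deriv X V f ys =
     (\<Sum>i<fst ys. differential X (vary_coord f ys i) (snd ys i) (V ys i))"

text \<open>The logarithmic gradient \<open>\<nabla>h / h\<close> of a density \<open>h\<close>, equal to \<open>0\<close> where \<open>h = 0\<close>.\<close>

definition log_gradient ::
  "('x, 'n::finite) riem \<Rightarrow> ('x cluster \<Rightarrow> real) \<Rightarrow> 'x cluster \<Rightarrow> nat \<Rightarrow> ('x, 'n) tangent" where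
  "log_gradient X h ys i = tangent_scale (1 / h ys) (cluster_gradient X h ys i)"

definition log_gradient_norm1 ::
  "('x, 'n::finite) riem \<Rightarrow> ('x cluster \<Rightarrow> real) \<Rightarrow> 'x cluster \<Rightarrow> real" where
  "log_gradient_norm1 X h ys = (\<Sum>i<fst ys. tangent_norm X (snd ys i) (log_gradient X h ys i))"

text \<open>The function \<open>\<beta>\<^sub>\<eta>\<close> along the lift of \<open>v\<close>, with \<open>h\<close> the family of the densities of \<open>\<eta>\<close>.\<close>

definition log_deriv_along ::
  "('x, 'n::finite) riem \<Rightarrow> ('x \<Rightarrow> 'x cluster \<Rightarrow> real) \<Rightarrow> ('x \<Rightarrow> ('x, 'n) tangent) \<Rightarrow>
     'x \<times> 'x cluster \<Rightarrow> real" where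
  "log_deriv_along X h v = (\<lambda>(x, ys).
     cluster_inner X ys (log_gradient X (h x) ys) (lift_field v ys) +
     (\<Sum>i<fst ys. divergence X v (snd ys i)))"

section \<open>Configurations\<close>

text \<open>A configuration is a measure \<open>\<Sum>\<^sub>i\<^sub>\<in>\<^sub>I \<delta>\<^bsub>s i\<^esub>\<close> with a countable index set \<open>I\<close>.\<close>

definition configuration :: "'s topology \<Rightarrow> 's measure \<Rightarrow> bool" where
  "configuration T \<gamma> \<longleftrightarrow>
     (\<exists>(I::nat set) s. s \<in> I \<rightarrow> topspace T \<and> \<gamma> = distr (count_space I) (borel_of T) s)"

definition proper_configuration :: "'s topology \<Rightarrow> 's measure \<Rightarrow> bool" where
  "proper_configuration T \<gamma> \<longleftrightarrow> configuration T \<gamma> \<and>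
     (\<forall>K. compactin T K \<longrightarrow> emeasure \<gamma> K < \<infinity>) \<and>
     (\<forall>s\<in>topspace T. emeasure \<gamma> {s} \<le> 1)"

text \<open>The \<open>\<sigma>\<close>-algebra on a set of configurations generated by the maps \<open>\<gamma> \<mapsto> \<gamma>(B)\<close>.\<close>

definition count_algebra :: "'s topology \<Rightarrow> 's measure set \<Rightarrow> 's measure measure" where
  "count_algebra T \<Omega> = (SUP B\<in>sets (borel_of T). vimage_algebra \<Omega> (\<lambda>\<gamma>. emeasure \<gamma> B) borel)"

text \<open>\<open>Config\<close> is the space of all configurations and \<open>Proper_Config\<close> the space \<open>\<Gamma>\<close> of the
  proper ones.\<close>

definition Config :: "'s topology \<Rightarrow> 's measure measure" where
  "Config T = count_algebra T {\<gamma>. configuration T \<gamma>}"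

definition Proper_Config :: "'s topology \<Rightarrow> 's measure measure" where
  "Proper_Config T = count_algebra T {\<gamma>. proper_configuration T \<gamma>}"

definition pts :: "'s measure \<Rightarrow> 's set" where
  "pts \<gamma> = {s \<in> space \<gamma>. emeasure \<gamma> {s} \<noteq> 0}"

definition config_of_set :: "'s topology \<Rightarrow> 's set \<Rightarrow> 's measure" where
  "config_of_set T S = distr (count_space S) (borel_of T) (\<lambda>s. s)"

definition pairing :: "('s \<Rightarrow> real) \<Rightarrow> 's measure \<Rightarrow> real" where
  "pairing f \<gamma> = (\<Sum>\<^sub>\<infinity>s\<in>pts \<gamma>. f s)"

text \<open>The class of probability measures on \<open>\<Gamma>\<close> for which \<open>\<langle>f, \<gamma>\<rangle>\<close> is defined almost surely,
  is almost surely independent of the representative of \<open>f\<close>, and is integrable, for all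
  \<open>f \<in> L\<^sup>1(\<theta>)\<close>. (Real-valued infinite sums converge absolutely and are \<open>0\<close> otherwise, so that
  convergence has to be required explicitly.)\<close>

definition M1 :: "'x::topological_space measure \<Rightarrow> 'x measure measure set" where
  "M1 \<theta> = {\<mu>. prob_space \<mu> \<and> sets \<mu> = sets (Proper_Config euclidean) \<and>
     (\<forall>f. integrable \<theta> f \<longrightarrow>
        (AE \<gamma> in \<mu>. f summable_on pts \<gamma>) \<and> integrable \<mu> (\<lambda>\<gamma>. \<bar>pairing f \<gamma>\<bar>)) \<and>
     (\<forall>f f'. integrable \<theta> f \<and> integrable \<theta> f' \<and> (AE x in \<theta>. f x = f' x) \<longrightarrow>
        (AE \<gamma> in \<mu>. pairing f \<gamma> = pairing f' \<gamma>))}"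

text \<open>Cylinder functions built from \<open>k = CARD('k)\<close> test functions; the argument of type
  \<open>'k itself\<close> only serves to fix \<open>k\<close>.\<close>

definition FC ::
  "'k::finite itself \<Rightarrow> ('x::topological_space, 'n::finite) riem \<Rightarrow> ('x measure \<Rightarrow> real) set" where
  "FC _ X = {F. \<exists>(f :: real ^ 'k \<Rightarrow> real) \<phi>. f \<in> Cb_inf \<and> (\<forall>i. \<phi> i \<in> C0_inf X) \<and>
     F = (\<lambda>\<gamma>. f (\<chi> i. pairing (\<phi> i) \<gamma>))}"

definition config_gradient ::
  "('x::topological_space, 'n::finite) riem \<Rightarrow> ('x measure \<Rightarrow> real) \<Rightarrow> 'x measure \<Rightarrow> 'x \<Rightarrow>
     ('x, 'n) tangent" where
  "config_gradient X F \<gamma> x =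
     gradient X (\<lambda>y. F (config_of_set euclidean ((pts \<gamma> - {x}) \<union> {y}))) x"

section \<open>Cluster measures\<close>

definition cluster_family :: "('x::topological_space \<Rightarrow> 'x cluster measure) \<Rightarrow> bool" where
  "cluster_family \<eta> \<longleftrightarrow>
     (\<forall>x. prob_space (\<eta> x) \<and> sets (\<eta> x) = sets (borel_of cluster_top)) \<and>
     (\<forall>B\<in>sets (borel_of cluster_top). (\<lambda>x. emeasure (\<eta> x) B) \<in> borel_measurable borel)"

text \<open>The space \<open>\<Z> = X \<times> \<XX>\<close> of marked points.\<close>

definition marked_top :: "('x::topological_space \<times> 'x cluster) topology" where
  "marked_top = prod_topology euclidean cluster_top"

definition marked_meeting :: "'x::topological_space set \<Rightarrow> ('x \<times> 'x cluster) set" where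
  "marked_meeting B = UNIV \<times> clusters_meeting B"

text \<open>The measure \<open>\<eta>\<^sub>x(dy) \<theta>(dx)\<close>.\<close>

definition sigma_hat ::
  "'x::topological_space measure \<Rightarrow> ('x \<Rightarrow> 'x cluster measure) \<Rightarrow> ('x \<times> 'x cluster) measure" where
  "sigma_hat \<theta> \<eta> = \<theta> \<bind> (\<lambda>x. distr (\<eta> x) (borel_of marked_top) (\<lambda>ys. (x, ys)))"

text \<open>Given \<open>\<gamma>\<close>, the points \<open>x\<close> of \<open>\<gamma>\<close> receive independent marks with laws \<open>\<eta>\<^sub>x\<close>.\<close>

definition mu_hat ::
  "'x::topological_space measure measure \<Rightarrow> ('x \<Rightarrow> 'x cluster measure) \<Rightarrow>
     ('x \<times> 'x cluster) measure measure" where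
  "mu_hat \<mu> \<eta> = \<mu> \<bind> (\<lambda>\<gamma>.
     distr (Pi\<^sub>M (pts \<gamma>) \<eta>) (Proper_Config marked_top)
       (\<lambda>\<omega>. config_of_set marked_top ((\<lambda>x. (x, \<omega> x)) ` pts \<gamma>)))"

text \<open>The value \<open>\<qq>(\<gamma>')\<close> is a configuration which need not be proper.\<close>

definition q_map :: "('x::topological_space \<times> 'x cluster) measure \<Rightarrow> 'x measure" where
  "q_map \<gamma>' = measure_of UNIV (sets borel)
     (\<lambda>B. \<integral>\<^sup>+z. emeasure (cluster_config (snd z)) B \<partial>count_space (pts \<gamma>'))"

text \<open>The law of \<open>\<qq>\<close> lives on the space of all configurations. Under the standing assumptions it
  is supported on the proper ones and is regarded as a measure there.\<close>

definition mu_cl ::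
  "'x::topological_space measure measure \<Rightarrow> ('x \<Rightarrow> 'x cluster measure) \<Rightarrow> 'x measure measure" where
  "mu_cl \<mu> \<eta> =
     restrict_space (distr (mu_hat \<mu> \<eta>) (Config euclidean) q_map) (space (Proper_Config euclidean))"

text \<open>\<open>H\<close> is \<open>\<I>\<^sub>\<qq>\<^sup>* G\<close>. Functions on \<open>\<Gamma>\<close> are extended by \<open>0\<close> to the (almost surely absent)
  non-proper values of \<open>\<qq>\<close>.\<close>

definition is_q_adjoint ::
  "'x::topological_space measure measure \<Rightarrow> ('x \<Rightarrow> 'x cluster measure) \<Rightarrow>
     (('x \<times> 'x cluster) measure \<Rightarrow> real) \<Rightarrow> ('x measure \<Rightarrow> real) \<Rightarrow> bool" where
  "is_q_adjoint \<mu> \<eta> G H \<longleftrightarrow> integrable (mu_cl \<mu> \<eta>) H \<and>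
     (\<forall>F. F \<in> borel_measurable (mu_cl \<mu> \<eta>) \<and> (\<exists>C. AE \<gamma> in mu_cl \<mu> \<eta>. \<bar>F \<gamma>\<bar> \<le> C) \<longrightarrow>
        (\<integral>\<gamma>. F \<gamma> * H \<gamma> \<partial>mu_cl \<mu> \<eta>) =
        (\<integral>\<gamma>'. indicator (space (Proper_Config euclidean)) (q_map \<gamma>') * F (q_map \<gamma>') * G \<gamma>' \<partial>mu_hat \<mu> \<eta>))"

definition q_adjoint ::
  "'x::topological_space measure measure \<Rightarrow> ('x \<Rightarrow> 'x cluster measure) \<Rightarrow>
     (('x \<times> 'x cluster) measure \<Rightarrow> real) \<Rightarrow> 'x measure \<Rightarrow> real" where
  "q_adjoint \<mu> \<eta> G = (SOME H. is_q_adjoint \<mu> \<eta> G H)"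

definition B_hat ::
  "('x, 'n::finite) riem \<Rightarrow> ('x \<Rightarrow> 'x cluster \<Rightarrow> real) \<Rightarrow> ('x \<Rightarrow> ('x, 'n) tangent) \<Rightarrow>
     ('x \<times> 'x cluster) measure \<Rightarrow> real" where
  "B_hat X h v \<gamma>' = (\<Sum>\<^sub>\<infinity>z\<in>pts \<gamma>'. log_deriv_along X h v z)"

definition B_cl ::
  "('x::topological_space, 'n::finite) riem \<Rightarrow> 'x measure measure \<Rightarrow> ('x \<Rightarrow> 'x cluster measure) \<Rightarrow>
     ('x \<Rightarrow> 'x cluster \<Rightarrow> real) \<Rightarrow> ('x \<Rightarrow> ('x, 'n) tangent) \<Rightarrow> 'x measure \<Rightarrow> real" where
  "B_cl X \<mu> \<eta> h v = q_adjoint \<mu> \<eta> (B_hat X h v)"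

end

theory Submission
  imports Defs
begin

text \<open>For a single cluster, assumption (A3) is tested with \<open>f (c + \<Sum>\<^sub>i \<phi> (y\<^sub>i))\<close> times a cutoff that equals 1 on the
  support of \<open>v\<close>: the derivative of the cutoff along \<open>v\<close> vanishes, and dominated convergence removes the
  cutoff. Given a configuration \<open>\<gamma>\<close> of centres the clusters are independent, so Fubini's theorem reduces
  the sum over the clusters to this case, with \<open>c\<close> the contribution of the other clusters. Campbell's
  formula provides the integrability over \<open>\<gamma>\<close>, and Radon-Nikodym derivatives of the images under \<open>\<qq>\<close> of
  the positive and negative parts of \<open>B\<close> carry the identity over to the cluster measure.\<close>

text \<open>Much of the work is measurability. The space of marks over \<gamma> is a product indexed
  by the points of \<gamma>, so it changes with \<gamma>; that \<open>mark_kernel\<close> is a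
  kernel is therefore checked on void events, which generate the \<sigma>-algebra of proper
  configurations, are closed under intersection, and have limits of finite products as
  probabilities. Assumption (A3) gives regularity of each density in the cluster variable alone, so
  joint measurability in centre and cluster has to be extracted from the kernel. Charts are picked
  by arbitrary choice, so the divergence must be shown independent of the chart before it can be
  bounded or measured. Absolute continuity of the cluster laws has a second role: the Riemannian
  volume has no atoms, so almost surely no two cluster points coincide. With the local finiteness
  from (A2) this makes the image under \<open>q_map\<close> proper. The local assumptions (A2) and
  (A4) suffice because the inner product with v and the divergence of v vanish at points outside the
  support of v. The defining property of \<open>M1\<close> turns integrability over \<theta> into
  integrability over \<mu>.\<close>

abbreviation fderiv :: "('a::real_normed_vector \<Rightarrow> 'b::real_normed_vector) \<Rightarrow> 'a \<Rightarrow> 'a \<Rightarrow> 'b" where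
  "fderiv f x \<equiv> frechet_derivative f (at x)"

abbreviation proper :: "'x::topological_space measure \<Rightarrow> bool" where
  "proper \<equiv> proper_configuration euclidean"

abbreviation (input) clusters :: "'x::topological_space cluster set" where
  "clusters \<equiv> topspace cluster_top"

lemmas measurable_continuous = borel_measurable_continuous_onI

abbreviation count_pts :: "'s measure \<Rightarrow> 's measure" where
  "count_pts \<gamma> \<equiv> count_space (pts \<gamma>)"

lemmas lebesgue_cong = Bochner_Integration.integral_cong[OF refl]

section \<open>Calculus of smooth functions\<close>

text \<open>The order-by-order form of \<open>smooth_on\<close>. The recursion passes from a
  function to its directional derivatives, so closure of smoothness under products and composition
  can be proved by induction on the order.\<close>

primrec kdiff ::
  "nat \<Rightarrow> 'a::real_normed_vector set \<Rightarrow> ('a \<Rightarrow> 'b::real_normed_vector) \<Rightarrow> bool" where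
  "kdiff 0 S f \<longleftrightarrow> True"
| "kdiff (Suc n) S f \<longleftrightarrow> (\<forall>x\<in>S. f differentiable (at x)) \<and> (\<forall>v. kdiff n S (\<lambda>x. fderiv f x v))"

text \<open>Peels off the derivative that is taken first, as \<open>kdiff\<close> does; the
  equations of \<open>iter_deriv\<close> peel off the one taken last.\<close>

lemma iter_deriv_snoc:
  "iter_deriv f (vs @ [v]) = iter_deriv (\<lambda>x. fderiv f x v) vs"
  by (induction vs) auto

lemma kdiff_iter_deriv:
  "kdiff n S f \<longleftrightarrow> (\<forall>vs. length vs < n \<longrightarrow> (\<forall>x\<in>S. iter_deriv f vs differentiable (at x)))"
proof (induction n arbitrary: f)
  case (Suc n)
  show ?case
  proof
    assume L: "kdiff (Suc n) S f"
    show "\<forall>vs. length vs < Suc n \<longrightarrow> (\<forall>x\<in>S. iter_deriv f vs differentiable (at x))"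
    proof (intro allI impI ballI)
      fix vs :: "'a list" and x assume "length vs < Suc n" "x \<in> S"
      then show "iter_deriv f vs differentiable (at x)" using L Suc by (cases vs rule: rev_cases) (auto simp: iter_deriv_snoc)
    qed
  next
    assume R: "\<forall>vs. length vs < Suc n \<longrightarrow> (\<forall>x\<in>S. iter_deriv f vs differentiable (at x))"
    have "f differentiable (at x)" if "x \<in> S" for x using R[rule_format, of "[]" x] that by simp
    moreover have "kdiff n S (\<lambda>x. fderiv f x v)" for v unfolding Suc
    proof (intro allI impI ballI)
      fix vs :: "'a list" and x assume "length vs < n" "x \<in> S"
      then show "iter_deriv (\<lambda>x. fderiv f x v) vs differentiable (at x)"
        using R[rule_format, of "vs @ [v]" x] by (simp add: iter_deriv_snoc)
    qed
    ultimately show "kdiff (Suc n) S f" by simp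
  qed
qed simp

lemma smooth_on_kdiff: "smooth_on S f \<longleftrightarrow> (\<forall>n. kdiff n S f)"
  unfolding smooth_on_def kdiff_iter_deriv by (meson lessI)

lemma kdiff_Suc: "kdiff (Suc n) S f \<Longrightarrow> kdiff n S f"
  by (simp add: kdiff_iter_deriv)

lemma smooth_on_subset: "smooth_on S f \<Longrightarrow> T \<subseteq> S \<Longrightarrow> smooth_on T f"
  by (simp add: smooth_on_def) blast

lemma smooth_on_differentiable: "smooth_on S f \<Longrightarrow> x \<in> S \<Longrightarrow> f differentiable (at x)"
  by (metis iter_deriv.simps(1) smooth_on_def)

lemma smooth_on_has_derivative:
  "smooth_on S f \<Longrightarrow> x \<in> S \<Longrightarrow> (f has_derivative fderiv f x) (at x)"
  using smooth_on_differentiable frechet_derivative_works by blast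

lemma smooth_on_frechet_derivative:
  "smooth_on S f \<Longrightarrow> smooth_on S (\<lambda>x. fderiv f x v)"
  unfolding smooth_on_kdiff by (metis kdiff.simps(2))

lemma smooth_on_continuous_on: "smooth_on S f \<Longrightarrow> continuous_on S f"
  using smooth_on_differentiable differentiable_imp_continuous_within by (metis continuous_at_imp_continuous_on)

lemma frechet_derivative_cong:
  assumes "open S" "x \<in> S" "\<And>y. y \<in> S \<Longrightarrow> f y = g y"
  shows "fderiv f x = fderiv g x"
proof -
  have "(f has_derivative f') (at x) \<longleftrightarrow> (g has_derivative f') (at x)" for f'
    using has_derivative_transform_within_open[OF _ assms(1,2), of f f' UNIV g]
      has_derivative_transform_within_open[OF _ assms(1,2), of g f' UNIV f] assms(3) by auto
  then show ?thesis by (simp add: frechet_derivative_def)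
qed

lemma differentiable_cong_open:
  assumes "open S" "x \<in> S" "\<And>y. y \<in> S \<Longrightarrow> f y = g y"
  shows "f differentiable (at x) \<longleftrightarrow> g differentiable (at x)"
  using has_derivative_transform_within_open[OF _ assms(1,2), of f _ UNIV g]
    has_derivative_transform_within_open[OF _ assms(1,2), of g _ UNIV f] assms(3)
  unfolding differentiable_def by metis

lemma kdiff_cong:
  assumes "open S" "\<And>y. y \<in> S \<Longrightarrow> f y = g y"
  shows "kdiff n S f \<longleftrightarrow> kdiff n S g" using assms(2)
proof (induction n arbitrary: f g)
  case (Suc n)
  have "kdiff n S (\<lambda>x. fderiv f x v) \<longleftrightarrow> kdiff n S (\<lambda>x. fderiv g x v)"
    for v
    using frechet_derivative_cong[OF assms(1), of _ f g] Suc.prems by (intro Suc.IH) auto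
  then show ?case using differentiable_cong_open[OF assms(1), of _ f g] Suc.prems by auto
qed simp

lemma smooth_on_cong:
  "open S \<Longrightarrow> (\<And>y. y \<in> S \<Longrightarrow> f y = g y) \<Longrightarrow> smooth_on S f \<longleftrightarrow> smooth_on S g"
  unfolding smooth_on_kdiff using kdiff_cong by blast

lemma smooth_on_local:
  assumes "\<And>x. x \<in> S \<Longrightarrow> \<exists>U. x \<in> U \<and> smooth_on U f"
  shows "smooth_on S f" using assms unfolding smooth_on_def by blast

text \<open>Lets an explicit formula for the derivative stand in for \<open>fderiv\<close>; the
  closure lemmas below all raise the order through it.\<close>

lemma kdiff_Suc_I:
  assumes "open S" "\<And>x. x \<in> S \<Longrightarrow> (f has_derivative f' x) (at x)"
  and "\<And>v. kdiff n S (\<lambda>x. f' x v)"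
  shows "kdiff (Suc n) S f"
proof -
  have "kdiff n S (\<lambda>x. fderiv f x v)" for v using assms(3)[of v] frechet_derivative_at[OF assms(2)]
    by (subst kdiff_cong[OF assms(1), of _ "\<lambda>x. f' x v"]) auto
  then show ?thesis using assms(2) by (auto simp: differentiable_def)
qed

lemma kdiff_const: "kdiff n S (\<lambda>_. c)"
  by (induction n arbitrary: c) (auto simp: frechet_derivative_const)

lemma smooth_on_const [simp]: "smooth_on S (\<lambda>_. c)"
  by (simp add: smooth_on_kdiff kdiff_const)

lemma smooth_on_bounded_linear:
  assumes "bounded_linear f" shows "smooth_on S f"
proof -
  have "kdiff n UNIV f" for n
  proof (cases n)
    case (Suc m)
    then show ?thesis using kdiff_Suc_I[OF open_UNIV bounded_linear_imp_has_derivative[OF assms], of m]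
      by (simp add: kdiff_const)
  qed simp
  then show ?thesis using smooth_on_subset[of UNIV f S] by (simp add: smooth_on_kdiff)
qed

lemma kdiff_add:
  assumes "open S"
  shows "kdiff n S f \<Longrightarrow> kdiff n S g \<Longrightarrow> kdiff n S (\<lambda>x. f x + g x)"
proof (induction n arbitrary: f g)
  case (Suc n)
  have "kdiff n S (\<lambda>x. fderiv f x v + fderiv g x v)" for v using Suc by auto
  moreover have "((\<lambda>x. f x + g x) has_derivative (\<lambda>v. fderiv f x v + fderiv g x v)) (at x)" if "x \<in> S" for x
    using Suc.prems that by (intro has_derivative_add) (auto simp: frechet_derivative_works)
  ultimately show ?case by (intro kdiff_Suc_I[OF assms])
qed simp

lemma kdiff_bilinear:
  assumes "open S" "bounded_bilinear B"
  shows "kdiff n S f \<Longrightarrow> kdiff n S g \<Longrightarrow> kdiff n S (\<lambda>x. B (f x) (g x))"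
proof (induction n arbitrary: f g)
  case (Suc n)
  have "kdiff n S (\<lambda>x. B (f x) (fderiv g x v) + B (fderiv f x v) (g x))"
    for v
    using Suc kdiff_Suc[of n S f] kdiff_Suc[of n S g] by (intro kdiff_add[OF assms(1)]) auto
  moreover have "((\<lambda>x. B (f x) (g x)) has_derivative (\<lambda>v. B (f x) (fderiv g x v) +
      B (fderiv f x v) (g x))) (at x)" if "x \<in> S" for x using Suc.prems that
    by (intro bounded_bilinear.FDERIV[OF assms(2)]) (auto simp: frechet_derivative_works)
  ultimately show ?case by (intro kdiff_Suc_I[OF assms(1)])
qed simp

lemma smooth_on_add:
  "open S \<Longrightarrow> smooth_on S f \<Longrightarrow> smooth_on S g \<Longrightarrow> smooth_on S (\<lambda>x. f x + g x)"
  by (simp add: smooth_on_kdiff kdiff_add)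

lemma smooth_on_bilinear:
  "open S \<Longrightarrow> bounded_bilinear B \<Longrightarrow> smooth_on S f \<Longrightarrow> smooth_on S g \<Longrightarrow> smooth_on S (\<lambda>x. B (f x) (g x))"
  by (simp add: smooth_on_kdiff kdiff_bilinear)

lemma smooth_on_mult:
  fixes f g :: "'a::real_normed_vector \<Rightarrow> real"
  shows "open S \<Longrightarrow> smooth_on S f \<Longrightarrow> smooth_on S g \<Longrightarrow> smooth_on S (\<lambda>x. f x * g x)"
  by (rule smooth_on_bilinear[OF _ bounded_bilinear_mult])

lemma smooth_on_sum:
  "open S \<Longrightarrow> (\<And>i. i \<in> I \<Longrightarrow> smooth_on S (f i)) \<Longrightarrow> smooth_on S (\<lambda>x. \<Sum>i\<in>I. f i x)"
  by (induction I rule: infinite_finite_induct) (auto intro: smooth_on_add)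

lemma smooth_on_prod:
  fixes f :: "'i \<Rightarrow> 'a::real_normed_vector \<Rightarrow> real"
  shows "open S \<Longrightarrow> (\<And>i. i \<in> I \<Longrightarrow> smooth_on S (f i)) \<Longrightarrow> smooth_on S (\<lambda>x. \<Prod>i\<in>I. f i x)"
  by (induction I rule: infinite_finite_induct) (auto intro: smooth_on_mult)

text \<open>Expanding the inner derivative in a basis of the middle space writes the derivative of
  the composite as a sum of scalars times composites of the same kind, to which the induction
  hypothesis applies. The middle space is therefore Euclidean, while the domain may be the space of
  bounded sequences in which clusters are read.\<close>

lemma kdiff_compose:
  fixes f :: "'b::euclidean_space \<Rightarrow> 'c::real_normed_vector"
  and g :: "'a::real_normed_vector \<Rightarrow> 'b"
  assumes "open S" "open T" "g ` S \<subseteq> T"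
  shows "kdiff n T f \<Longrightarrow> kdiff n S g \<Longrightarrow> kdiff n S (\<lambda>x. f (g x))"
proof (induction n arbitrary: f)
  case (Suc n)
  let ?f' = "\<lambda>x v. fderiv f (g x) (fderiv g x v)"
  have D: "((\<lambda>x. f (g x)) has_derivative ?f' x) (at x)" if "x \<in> S" for x
    using diff_chain_at[of g "fderiv g x" x f "fderiv f (g x)"]
      Suc.prems assms(3) that by (auto simp: o_def frechet_derivative_works)
  have E: "?f' x v = (\<Sum>b\<in>Basis. (fderiv g x v \<bullet> b) *\<^sub>R fderiv f (g x) b)"
    if "x \<in> S" for x v
  proof -
    have "linear (fderiv f (g x))" using Suc.prems assms(3) that by (auto intro: linear_frechet_derivative)
    then show ?thesis by (subst euclidean_representation[symmetric, of "fderiv g x v"])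
        (simp add: linear_sum linear_scale o_def)
  qed
  have "kdiff n S (\<lambda>x. \<Sum>b\<in>Basis. (fderiv g x v \<bullet> b) *\<^sub>R fderiv f (g x) b)" for v
  proof -
    have "kdiff n S (\<lambda>x. \<Sum>b\<in>I. (fderiv g x v \<bullet> b) *\<^sub>R fderiv f (g x) b)"
      for I :: "'b set"
    proof (induction I rule: infinite_finite_induct)
      case (insert b I)
      have "kdiff n S (\<lambda>x. (fderiv g x v \<bullet> b) *\<^sub>R fderiv f (g x) b)" using Suc.prems kdiff_Suc[OF Suc.prems(2)]
        by (intro kdiff_bilinear[OF assms(1) bounded_bilinear_scaleR] Suc.IH
            kdiff_bilinear[OF assms(1) bounded_bilinear_inner] kdiff_const) auto
      then show ?case using insert by (simp add: kdiff_add[OF assms(1)])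
    qed (auto simp: kdiff_const)
    then show ?thesis .
  qed
  then have "kdiff n S (\<lambda>x. ?f' x v)" for v by (subst kdiff_cong[OF assms(1), OF E]) auto
  then show ?case by (intro kdiff_Suc_I[OF assms(1) D])
qed simp

lemma smooth_on_compose:
  fixes f :: "'b::euclidean_space \<Rightarrow> 'c::real_normed_vector"
  and g :: "'a::real_normed_vector \<Rightarrow> 'b"
  assumes "open S" "open T" "g ` S \<subseteq> T" "smooth_on T f" "smooth_on S g"
  shows "smooth_on S (\<lambda>x. f (g x))" using kdiff_compose[OF assms(1,2,3)] assms(4,5) by (auto simp: smooth_on_kdiff)

lemma smooth_on_vec:
  fixes f :: "'a::real_normed_vector \<Rightarrow> 'k::finite \<Rightarrow> real"
  assumes "open S" "\<And>i. smooth_on S (\<lambda>x. f x i)"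
  shows "smooth_on S (\<lambda>x. \<chi> i. f x i)"
proof -
  have "smooth_on S (\<lambda>x. \<Sum>i\<in>UNIV. f x i *\<^sub>R (axis i 1 :: real ^ 'k))"
    by (intro smooth_on_sum smooth_on_bilinear[OF _ bounded_bilinear_scaleR] assms smooth_on_const)
  moreover have "(\<Sum>i\<in>UNIV. f x i *\<^sub>R (axis i 1 :: real ^ 'k)) = (\<chi> i. f x i)" for x
    by (simp add: vec_eq_iff axis_def if_distrib sum.If_cases cong: if_cong)
  ultimately show ?thesis by simp
qed

lemma smooth_on_component:
  fixes f :: "'a::real_normed_vector \<Rightarrow> real ^ 'k"
  shows "open S \<Longrightarrow> smooth_on S f \<Longrightarrow> smooth_on S (\<lambda>x. f x $ i)"
  using smooth_on_bilinear[OF _ bounded_bilinear_inner, of S f "\<lambda>_. axis i 1"] by (simp add: inner_axis)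

text \<open>The derivative of 1/f is a product of 1/f, the derivative of f and 1/f again, so each
  order of 1/f yields the next.\<close>

lemma smooth_on_inverse:
  fixes f :: "'a::real_normed_vector \<Rightarrow> real"
  assumes "open S" "smooth_on S f" "\<And>x. x \<in> S \<Longrightarrow> f x \<noteq> 0"
  shows "smooth_on S (\<lambda>x. inverse (f x))"
proof -
  have "kdiff n S (\<lambda>x. inverse (f x))" for n
  proof (induction n)
    case (Suc n)
    have D: "((\<lambda>x. inverse (f x)) has_derivative (\<lambda>v. - (inverse (f x) * fderiv f x v * inverse (f x)))) (at x)"
      if "x \<in> S" for x
      using that assms smooth_on_has_derivative by (intro Deriv.has_derivative_inverse) auto
    have "kdiff n S (\<lambda>x. - 1 * (inverse (f x) * fderiv f x v * inverse (f x)))" for v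
      using smooth_on_frechet_derivative[OF assms(2), of v] Suc
      by (intro kdiff_bilinear[OF assms(1) bounded_bilinear_mult] kdiff_const)
        (auto simp: smooth_on_kdiff)
    then show ?case by (intro kdiff_Suc_I[OF assms(1) D]) auto
  qed simp
  then show ?thesis by (simp add: smooth_on_kdiff)
qed

text \<open>The derivative is written with \<open>sqrt (f x) * inverse (2 * f x)\<close> in place of
  the usual reciprocal root, so that the root itself reappears and the induction closes.\<close>

lemma smooth_on_sqrt:
  fixes f :: "'a::real_normed_vector \<Rightarrow> real"
  assumes "open S" "smooth_on S f" "\<And>x. x \<in> S \<Longrightarrow> f x > 0"
  shows "smooth_on S (\<lambda>x. sqrt (f x))"
proof -
  have "kdiff n S (\<lambda>x. sqrt (f x))" for n
  proof (induction n)
    case (Suc n)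
    have D: "((\<lambda>x. sqrt (f x)) has_derivative (\<lambda>v. (sqrt (f x) * inverse (2 * f x)) * fderiv f x v)) (at x)"
      if "x \<in> S" for x
    proof -
      have "sqrt (f x) * inverse (2 * f x) = inverse (sqrt (f x)) / 2"
        using assms(3)[OF that] by (simp add: field_simps real_sqrt_mult_self)
      then have "(sqrt has_real_derivative (sqrt (f x) * inverse (2 * f x))) (at (f x))"
        using DERIV_real_sqrt[OF assms(3)[OF that]] by simp
      then show ?thesis using diff_chain_at[OF smooth_on_has_derivative[OF assms(2) that], of sqrt
            "(*) (sqrt (f x) * inverse (2 * f x))"]
        by (simp add: has_field_derivative_def o_def)
    qed
    have "smooth_on S (\<lambda>x. inverse (2 * f x))" using assms by (intro smooth_on_inverse smooth_on_mult) (auto dest: assms(3))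
    then have "kdiff n S (\<lambda>x. (sqrt (f x) * inverse (2 * f x)) * fderiv f x v)" for v
      using smooth_on_frechet_derivative[OF assms(2), of v] Suc
      by (intro kdiff_bilinear[OF assms(1) bounded_bilinear_mult]) (auto simp: smooth_on_kdiff)
    then show ?case by (intro kdiff_Suc_I[OF assms(1) D])
  qed simp
  then show ?thesis by (simp add: smooth_on_kdiff)
qed

subsection \<open>A smooth cutoff\<close>

text \<open>The powers of 1/t are included because differentiation then stays inside the family; k =
  0 is the classical function that is flat at the origin.\<close>

definition exp_flat :: "nat \<Rightarrow> real \<Rightarrow> real" where
  "exp_flat k t = (if t > 0 then (1 / t) ^ k * exp (- (1 / t)) else 0)"

lemma exp_flat_tendsto: "((\<lambda>t. (1 / t) ^ k * exp (- (1 / t))) \<longlongrightarrow> 0) (at_right (0::real))"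
proof -
  have "((\<lambda>s. s ^ k / exp s) \<longlongrightarrow> (0::real)) at_top" by (rule tendsto_power_div_exp_0)
  moreover have "filterlim (\<lambda>t::real. 1 / t) at_top (at_right 0)"
    using filterlim_inverse_at_top_right by (simp add: inverse_eq_divide)
  ultimately have "((\<lambda>t. (1 / t) ^ k / exp (1 / t)) \<longlongrightarrow> (0::real)) (at_right 0)" by (rule filterlim_compose)
  then show ?thesis by (simp add: exp_minus field_simps)
qed

lemma exp_flat_has_derivative:
  "(exp_flat k has_real_derivative (exp_flat (k + 2) t - k * exp_flat (k + 1) t)) (at t)"
proof -
  consider "t > 0" | "t < 0" | "t = 0" by linarith
  then show ?thesis
  proof cases
    case 1
    have "((\<lambda>t. (1 / t) ^ k * exp (- (1 / t))) has_real_derivative (exp_flat (k + 2) t - k * exp_flat (k + 1) t)) (at t)"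
    proof -
      have "((\<lambda>t. (1 / t) ^ k) has_real_derivative - real k * (1 / t) ^ (k + 1)) (at t)"
      proof (induction k)
        case (Suc k)
        have "((\<lambda>t. (1 / t) * (1 / t) ^ k) has_real_derivative
            - (1 / t\<^sup>2) * (1 / t) ^ k + - real k * (1 / t) ^ (k + 1) * (1 / t)) (at t)"
          using 1 by (intro DERIV_mult Suc) (auto intro!: derivative_eq_intros simp: power2_eq_square)
        then show ?case using 1 by (simp add: power2_eq_square field_simps)
      qed simp
      moreover have "((\<lambda>t. exp (- (1 / t))) has_real_derivative exp (- (1 / t)) * (1 / t\<^sup>2)) (at t)"
        using 1 by (auto intro!: derivative_eq_intros simp: power2_eq_square)
      ultimately have "((\<lambda>t. (1 / t) ^ k * exp (- (1 / t))) has_real_derivative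
          - real k * (1 / t) ^ (k + 1) * exp (- (1 / t)) + exp (- (1 / t)) * (1 / t\<^sup>2) * (1 / t) ^ k) (at t)"
        by (rule DERIV_mult)
      then show ?thesis using 1 by (simp add: exp_flat_def power2_eq_square field_simps)
    qed
    then show ?thesis by (rule has_field_derivative_transform_within_open[where S = "{0<..}"])
        (use 1 in \<open>auto simp: exp_flat_def\<close>)
  next
    case 2
    have "((\<lambda>t. 0) has_real_derivative (exp_flat (k + 2) t - k * exp_flat (k + 1) t)) (at t)"
      using 2 by (simp add: exp_flat_def)
    then show ?thesis by (rule has_field_derivative_transform_within_open[where S = "{..<0}"])
        (use 2 in \<open>auto simp: exp_flat_def\<close>)
  next
    case 3
    \<comment> \<open>At the origin the difference quotient is \<open>exp_flat (Suc k)\<close> on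
      the right and zero on the left.\<close>
    have "((\<lambda>t. exp_flat k t / t) \<longlongrightarrow> 0) (at_right 0)"
    proof (rule Lim_transform_eventually[OF exp_flat_tendsto[of "Suc k"]])
      show "\<forall>\<^sub>F t in at_right 0. (1 / t) ^ Suc k * exp (- (1 / t)) = exp_flat k t / t"
        using eventually_at_right_less[of 0] by eventually_elim (simp add: exp_flat_def field_simps)
    qed
    moreover have "((\<lambda>t. exp_flat k t / t) \<longlongrightarrow> 0) (at_left 0)"
    proof (rule Lim_transform_eventually[OF tendsto_const])
      show "\<forall>\<^sub>F t in at_left 0. (0::real) = exp_flat k t / t" unfolding eventually_at_filter by (auto simp: exp_flat_def)
    qed
    ultimately have "((\<lambda>t. exp_flat k t / t) \<longlongrightarrow> 0) (at 0)" by (simp add: filterlim_split_at)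
    then show ?thesis using 3 by (simp add: has_field_derivative_iff exp_flat_def)
  qed
qed

lemma smooth_exp_flat: "smooth_on UNIV (exp_flat k)"
proof -
  have "kdiff n UNIV (exp_flat k)" for n
  proof (induction n arbitrary: k)
    case (Suc n)
    have "kdiff n UNIV (\<lambda>t. (exp_flat (k + 2) t + (- real k) * exp_flat (k + 1) t) * v)" for v
      using Suc by (intro kdiff_bilinear[OF open_UNIV bounded_bilinear_mult] kdiff_add kdiff_const) auto
    then show ?case using exp_flat_has_derivative[of k]
      by (intro kdiff_Suc_I[OF open_UNIV, of _ "\<lambda>t v. (exp_flat (k + 2) t - real k * exp_flat (k + 1) t) * v"])
        (auto simp: has_field_derivative_def)
  qed simp
  then show ?thesis by (simp add: smooth_on_kdiff)
qed

text \<open>The standard smooth transition between 0 on t \<le> 0 and 1 on t \<ge> 1. The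
  denominator is positive because t and 1 - t are never both nonpositive.\<close>

definition smooth_step :: "real \<Rightarrow> real" where
  "smooth_step t = exp_flat 0 t * inverse (exp_flat 0 t + exp_flat 0 (1 - t))"

lemma exp_flat_0_pos: "exp_flat 0 t > 0 \<longleftrightarrow> t > 0"
  and exp_flat_0_nonneg: "exp_flat 0 t \<ge> 0"
  by (auto simp: exp_flat_def)

lemma smooth_smooth_step: "smooth_on UNIV smooth_step"
proof -
  have "smooth_on UNIV (\<lambda>t. exp_flat 0 (1 + (- 1) * t))"
    by (intro smooth_on_compose[OF open_UNIV open_UNIV _ smooth_exp_flat] smooth_on_add smooth_on_mult
        smooth_on_bounded_linear[OF bounded_linear_ident]) auto
  then have "smooth_on UNIV (\<lambda>t. exp_flat 0 t * inverse (exp_flat 0 t + exp_flat 0 (1 - t)))"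
  proof (intro smooth_on_mult smooth_on_inverse smooth_on_add smooth_exp_flat)
    fix t :: real
    have "exp_flat 0 t > 0 \<or> exp_flat 0 (1 - t) > 0" by (simp add: exp_flat_0_pos) linarith
    then show "exp_flat 0 t + exp_flat 0 (1 - t) \<noteq> 0" using exp_flat_0_nonneg[of t] exp_flat_0_nonneg[of "1 - t"] by linarith
  qed auto
  then show ?thesis by (simp add: smooth_step_def[abs_def])
qed

lemma smooth_step_eq_1: "t \<ge> 1 \<Longrightarrow> smooth_step t = 1"
  by (simp add: smooth_step_def exp_flat_def)

lemma smooth_step_eq_0: "t \<le> 0 \<Longrightarrow> smooth_step t = 0"
  by (simp add: smooth_step_def exp_flat_def)

lemma smooth_step_bounds: "0 \<le> smooth_step t" "smooth_step t \<le> 1"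
  using exp_flat_0_nonneg[of t] exp_flat_0_nonneg[of "1 - t"] by (auto simp: smooth_step_def field_simps divide_le_eq)

section \<open>Riemannian manifolds\<close>

locale riemannian =
  fixes X :: "('x::{second_countable_topology,t2_space}, 'n::finite) riem"
  assumes riem: "riemannian_manifold X"
begin

lemma atlas: "smooth_atlas (Charts X)"
  using riem by (simp add: riemannian_manifold_def)

lemma
  assumes "c \<in> Charts X"
  shows open_chart_dom [intro]: "open (chart_dom c)"
  and open_chart_img [intro]: "open (chart_img c)"
  and chart_homeomorphism: "homeomorphism (chart_dom c) (chart_img c) (coord c) (unchart c)"
  using atlas assms by (auto simp: smooth_atlas_def)

lemma charts_atD: "c \<in> charts_at X x \<Longrightarrow> c \<in> Charts X" "c \<in> charts_at X x \<Longrightarrow> x \<in> chart_dom c"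
  by (auto simp: charts_at_def)

lemma charts_atI: "c \<in> Charts X \<Longrightarrow> x \<in> chart_dom c \<Longrightarrow> c \<in> charts_at X x"
  by (auto simp: charts_at_def)

lemma unchart_coord [simp]: "c \<in> Charts X \<Longrightarrow> x \<in> chart_dom c \<Longrightarrow> unchart c (coord c x) = x"
  using homeomorphism_apply1[OF chart_homeomorphism] .

lemma coord_unchart [simp]: "c \<in> Charts X \<Longrightarrow> w \<in> chart_img c \<Longrightarrow> coord c (unchart c w) = w"
  using homeomorphism_apply2[OF chart_homeomorphism] .

lemma unchart_in [simp]: "c \<in> Charts X \<Longrightarrow> w \<in> chart_img c \<Longrightarrow> unchart c w \<in> chart_dom c"
  using homeomorphism_image2[OF chart_homeomorphism] by blast

lemma coord_in [simp]: "x \<in> chart_dom c \<Longrightarrow> coord c x \<in> chart_img c"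
  by (simp add: chart_img_def)

lemma continuous_on_coord: "c \<in> Charts X \<Longrightarrow> continuous_on (chart_dom c) (coord c)"
  using homeomorphism_cont1[OF chart_homeomorphism] .

lemma continuous_on_unchart: "c \<in> Charts X \<Longrightarrow> continuous_on (chart_img c) (unchart c)"
  using homeomorphism_cont2[OF chart_homeomorphism] .

lemma ex_chart: "\<exists>c. c \<in> charts_at X x"
proof -
  have "x \<in> (\<Union>c\<in>Charts X. chart_dom c)" using atlas by (simp add: smooth_atlas_def)
  then show ?thesis by (auto simp: charts_at_def)
qed

lemma chart_at_in: "chart_at X x \<in> charts_at X x"
  unfolding chart_at_def using ex_chart by (rule someI_ex)

lemma coord_image:
  "c \<in> Charts X \<Longrightarrow> A \<subseteq> chart_dom c \<Longrightarrow> coord c ` A = chart_img c \<inter> unchart c -` A"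
  by (auto intro!: image_eqI[where x = "unchart c _"])

lemma unchart_image:
  "c \<in> Charts X \<Longrightarrow> B \<subseteq> chart_img c \<Longrightarrow> unchart c ` B = chart_dom c \<inter> coord c -` B"
  by (auto intro!: image_eqI[where x = "coord c _"] dest: subsetD)

lemma open_coord_image:
  assumes "c \<in> Charts X" "open A" "A \<subseteq> chart_dom c" shows "open (coord c ` A)"
  unfolding coord_image[OF assms(1,3)] using continuous_on_unchart[OF assms(1)] assms by (intro continuous_open_preimage) auto

lemma open_unchart_image:
  assumes "c \<in> Charts X" "open B" "B \<subseteq> chart_img c" shows "open (unchart c ` B)"
  unfolding unchart_image[OF assms(1,3)] using continuous_on_coord[OF assms(1)] assms by (intro continuous_open_preimage) auto

lemma open_overlap:
  "c \<in> Charts X \<Longrightarrow> d \<in> Charts X \<Longrightarrow> open (coord c ` (chart_dom c \<inter> chart_dom d))"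
  by (rule open_coord_image) auto

lemma smooth_transition:
  "c \<in> Charts X \<Longrightarrow> d \<in> Charts X \<Longrightarrow> smooth_on (coord c ` (chart_dom c \<inter> chart_dom d)) (coord d \<circ> unchart c)"
  using atlas by (auto simp: smooth_atlas_def)

lemma transition_has_derivative:
  assumes "c \<in> charts_at X x" "d \<in> charts_at X x"
  shows "((coord d \<circ> unchart c) has_derivative transition_deriv c d x) (at (coord c x))" unfolding transition_deriv_def
  using assms smooth_transition[of c d] by (intro smooth_on_has_derivative) (auto simp: charts_at_def)

lemma linear_transition_deriv:
  "c \<in> charts_at X x \<Longrightarrow> d \<in> charts_at X x \<Longrightarrow> linear (transition_deriv c d x)"
  using transition_has_derivative has_derivative_linear by blast

lemma has_derivative_chart_change:
  assumes "c \<in> charts_at X x" "d \<in> charts_at X x"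
  and "((f \<circ> unchart d) has_derivative f') (at (coord d x))"
  shows "((f \<circ> unchart c) has_derivative f' \<circ> transition_deriv c d x) (at (coord c x))"
proof -
  have cd: "c \<in> Charts X" "d \<in> Charts X" "x \<in> chart_dom c" "x \<in> chart_dom d" using assms by (auto simp: charts_at_def)
  then have "(coord d \<circ> unchart c) (coord c x) = coord d x" by simp
  then have "((f \<circ> unchart d) \<circ> (coord d \<circ> unchart c) has_derivative f' \<circ> transition_deriv c d x) (at (coord c x))"
    using assms(3) by (intro diff_chain_at transition_has_derivative[OF assms(1,2)]) auto
  then show ?thesis by (rule has_derivative_transform_within_open[OF _ open_overlap[OF cd(1,2)]]) (use cd in auto)
qed

lemma transition_deriv_cocycle:
  assumes "c \<in> charts_at X x" "d \<in> charts_at X x" "e \<in> charts_at X x"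
  shows "transition_deriv d e x (transition_deriv c d x w) = transition_deriv c e x w"
  using has_derivative_chart_change[OF assms(1,2) transition_has_derivative[OF assms(2,3)]]
    has_derivative_unique[OF _ transition_has_derivative[OF assms(1,3)]] by (metis comp_apply)

lemma transition_deriv_refl [simp]:
  assumes "c \<in> charts_at X x" shows "transition_deriv c c x w = w"
proof -
  have "((\<lambda>w. w) has_derivative (\<lambda>w. w)) (at (coord c x))" by simp
  then have "((coord c \<circ> unchart c) has_derivative (\<lambda>w. w)) (at (coord c x))"
    using assms by (elim has_derivative_transform_within_open[OF _ open_chart_img[of c]]) (auto simp: charts_at_def)
  then show ?thesis using transition_has_derivative[OF assms assms] has_derivative_unique by metis
qed

subsection \<open>Tangent vectors\<close>

lemma tangent_of_self: "c \<in> charts_at X x \<Longrightarrow> tangent_of X c x w c = w"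
  by (simp add: tangent_of_def)

lemma tangent_of_in [intro]: "c \<in> charts_at X x \<Longrightarrow> tangent_of X c x w \<in> tangent_space X x"
  by (auto simp: tangent_of_def tangent_space_def transition_deriv_cocycle)

lemma tangent_space_outside: "\<xi> \<in> tangent_space X x \<Longrightarrow> c \<notin> charts_at X x \<Longrightarrow> \<xi> c = 0"
  unfolding tangent_space_def by blast

lemma tangent_space_change:
  "\<xi> \<in> tangent_space X x \<Longrightarrow> c \<in> charts_at X x \<Longrightarrow> d \<in> charts_at X x \<Longrightarrow> transition_deriv c d x (\<xi> c) = \<xi> d"
  unfolding tangent_space_def by fastforce

lemma tangent_of_component:
  "c \<in> charts_at X x \<Longrightarrow> \<xi> \<in> tangent_space X x \<Longrightarrow> tangent_of X c x (\<xi> c) = \<xi>"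
  by (rule ext) (simp add: tangent_of_def tangent_space_change tangent_space_outside)

lemma tangent_of_change:
  "c \<in> charts_at X x \<Longrightarrow> d \<in> charts_at X x \<Longrightarrow> tangent_of X c x w = tangent_of X d x (transition_deriv c d x w)"
  by (auto simp: tangent_of_def fun_eq_iff transition_deriv_cocycle)

lemma tangent_of_add:
  "c \<in> charts_at X x \<Longrightarrow> tangent_of X c x (a + b) = tangent_add (tangent_of X c x a) (tangent_of X c x b)"
  by (auto simp: tangent_of_def tangent_add_def fun_eq_iff linear_add[OF linear_transition_deriv])

lemma tangent_of_scale:
  "c \<in> charts_at X x \<Longrightarrow> tangent_of X c x (r *\<^sub>R a) = tangent_scale r (tangent_of X c x a)"
  by (auto simp: tangent_of_def tangent_scale_def fun_eq_iff linear_scale[OF linear_transition_deriv])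

lemma zero_tangent: "(\<lambda>_. 0) \<in> tangent_space X x"
proof -
  have "transition_deriv c d x 0 = 0" if "c \<in> charts_at X x" "d \<in> charts_at X x" for c d
    using linear_0[OF linear_transition_deriv[OF that]] .
  then show ?thesis by (auto simp: tangent_space_def)
qed

lemma Metric_sym:
  "\<xi> \<in> tangent_space X x \<Longrightarrow> \<zeta> \<in> tangent_space X x \<Longrightarrow> Metric X x \<xi> \<zeta> = Metric X x \<zeta> \<xi>"
  using riem unfolding riemannian_manifold_def by blast

lemma Metric_scale:
  "\<xi> \<in> tangent_space X x \<Longrightarrow> \<zeta> \<in> tangent_space X x \<Longrightarrow> Metric X x (tangent_scale a \<xi>) \<zeta> = a * Metric X x \<xi> \<zeta>"
  using riem unfolding riemannian_manifold_def by blast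

lemma Metric_add:
  "\<xi> \<in> tangent_space X x \<Longrightarrow> \<xi>' \<in> tangent_space X x \<Longrightarrow> \<zeta> \<in> tangent_space X x \<Longrightarrow>
    Metric X x (tangent_add \<xi> \<xi>') \<zeta> = Metric X x \<xi> \<zeta> + Metric X x \<xi>' \<zeta>" using riem unfolding riemannian_manifold_def by blast

lemma Metric_pos: "\<xi> \<in> tangent_space X x \<Longrightarrow> \<xi> \<noteq> (\<lambda>_. 0) \<Longrightarrow> Metric X x \<xi> \<xi> > 0"
  using riem unfolding riemannian_manifold_def by blast

lemma gram_smooth:
  "c \<in> Charts X \<Longrightarrow> smooth_on (chart_img c) (\<lambda>w. gram X c (unchart c w) $ i $ j)"
  using riem by (auto simp: riemannian_manifold_def)

lemma Metric_gram:
  assumes c: "c \<in> charts_at X x"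
  shows "Metric X x (tangent_of X c x a) (tangent_of X c x b) = a \<bullet> (gram X c x *v b)"
proof -
  let ?m = "\<lambda>a b. Metric X x (tangent_of X c x a) (tangent_of X c x b)"
  have sym: "?m a b = ?m b a" for a b using c by (intro Metric_sym) auto
  have lin: "linear (\<lambda>a. ?m a b)" for b
    using c by (intro linearI) (auto simp: tangent_of_add tangent_of_scale Metric_add Metric_scale tangent_of_in)
  have exp: "?m a b = (\<Sum>i\<in>UNIV. a $ i * ?m (axis i 1) b)" for a b by (subst basis_expansion[of a, symmetric])
      (simp add: linear_sum[OF lin] linear_scale[OF lin] scalar_mult_eq_scaleR)
  \<comment> \<open>The metric axioms give linearity in the first slot only: expand there, swap by
    symmetry, expand again.\<close>
  have "?m a b = (\<Sum>i\<in>UNIV. a $ i * (\<Sum>j\<in>UNIV. b $ j * ?m (axis j 1) (axis i 1)))" by (subst exp, subst sym, subst exp) simp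
  also have "\<dots> = a \<bullet> (gram X c x *v b)" by (simp add: inner_vec_def matrix_vector_mult_def gram_def sym mult.commute)
  finally show ?thesis .
qed

lemma gram_symmetric: "c \<in> charts_at X x \<Longrightarrow> gram X c x $ i $ j = gram X c x $ j $ i"
  unfolding gram_def by (simp add: Metric_sym tangent_of_in)

lemma gram_pos:
  assumes "c \<in> charts_at X x" "a \<noteq> 0" shows "a \<bullet> (gram X c x *v a) > 0"
proof -
  have "tangent_of X c x a \<noteq> (\<lambda>_. 0)" using tangent_of_self[OF assms(1), of a] assms(2) by auto
  then show ?thesis using assms by (simp add: Metric_gram[symmetric] Metric_pos tangent_of_in)
qed

end

text \<open>The segment from the identity to a positive definite matrix stays away from
  the singular matrices, so the determinant keeps its sign.\<close>

lemma det_pos_definite: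
  fixes A :: "real ^ 'n ^ 'n"
  assumes "\<And>a. a \<noteq> 0 \<Longrightarrow> a \<bullet> (A *v a) > 0"
  shows "det A > 0"
proof (rule ccontr)
  define M where "M t = (\<chi> i j. (1 - t) * (mat 1 :: real ^ 'n ^ 'n) $ i $ j + t * A $ i $ j)" for t
  have Mv: "M t *v a = (1 - t) *\<^sub>R a + t *\<^sub>R (A *v a)" for t a
  proof -
    have "M t = (1 - t) *\<^sub>R mat 1 + t *\<^sub>R A" by (simp add: M_def vec_eq_iff)
    then show ?thesis by (simp add: matrix_vector_mult_add_rdistrib scaleR_matrix_vector_assoc[symmetric])
  qed
  have nz: "det (M t) \<noteq> 0" if "0 \<le> t" "t \<le> 1" for t
  proof
    assume "det (M t) = 0"
    then have "\<not> invertible (M t)" by (simp add: invertible_det_nz)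
    then obtain a where a: "a \<noteq> 0" "M t *v a = 0" using matrix_left_invertible_ker invertible_left_inverse by blast
    then have "0 = a \<bullet> (M t *v a)" by simp
    also have "\<dots> = (1 - t) * (a \<bullet> a) + t * (a \<bullet> (A *v a))" by (simp add: Mv inner_add_right)
    also have "\<dots> > 0"
    proof (cases "t = 0")
      case False
      then show ?thesis using assms[OF a(1)] that a(1) by (intro add_nonneg_pos) auto
    qed (use a in auto)
    finally show False by simp
  qed
  have cont: "continuous_on {0..1} (\<lambda>t. det (M t))" unfolding det_def M_def by (auto intro!: continuous_intros)
  assume "\<not> det A > 0"
  moreover have "M 1 = A" "M 0 = mat 1" by (simp_all add: M_def vec_eq_iff)
  ultimately have "det (M 1) \<le> 0" "0 \<le> det (M 0)" by simp_all
  then obtain t where "0 \<le> t" "t \<le> 1" "det (M t) = 0" using IVT2'[of "\<lambda>t. det (M t)" 1 0 0] cont by auto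
  then show False using nz by blast
qed

context riemannian
begin

lemma det_gram_pos: "c \<in> charts_at X x \<Longrightarrow> det (gram X c x) > 0"
  by (rule det_pos_definite) (rule gram_pos)

lemma gram_change:
  assumes "c \<in> charts_at X x" "d \<in> charts_at X x"
  defines "A \<equiv> matrix (transition_deriv c d x)"
  shows "gram X c x = transpose A ** gram X d x ** A"
proof -
  have A: "transition_deriv c d x w = A *v w" for w
    using linear_transition_deriv[OF assms(1,2)] by (simp add: A_def matrix_works)
  have e: "Metric X x (tangent_of X c x a) (tangent_of X c x b) = a \<bullet> ((transpose A ** gram X d x ** A) *v b)" for a b
    using assms(1,2) by (simp add: tangent_of_change[OF assms(1,2)] Metric_gram A
        matrix_vector_mul_assoc[symmetric] dot_lmul_matrix inner_commute)
      (metis dot_lmul_matrix inner_commute matrix_vector_mul_assoc transpose_matrix_vector)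
  show ?thesis by (simp add: vec_eq_iff gram_def e inner_axis' matrix_vector_mult_basis column_def)
qed

text \<open>The transformation rule of the volume density: the absolute Jacobian is exactly the
  factor that the change of variables formula produces.\<close>

lemma sqrt_det_gram_change:
  assumes "c \<in> charts_at X x" "d \<in> charts_at X x"
  shows "sqrt (det (gram X c x)) = \<bar>det (matrix (transition_deriv c d x))\<bar> * sqrt (det (gram X d x))"
proof -
  have "det (gram X c x) = (det (matrix (transition_deriv c d x)))\<^sup>2 * det (gram X d x)"
    by (simp add: gram_change[OF assms] det_mul det_transpose power2_eq_square)
  then show ?thesis by (simp add: real_sqrt_mult)
qed

lemma Cauchy_Schwarz_Metric:
  assumes "\<xi> \<in> tangent_space X x" "\<zeta> \<in> tangent_space X x"
  shows "\<bar>Metric X x \<xi> \<zeta>\<bar> \<le> tangent_norm X x \<xi> * tangent_norm X x \<zeta>"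
proof -
  obtain c where c: "c \<in> charts_at X x" using ex_chart by blast
  let ?G = "gram X c x"
  let ?m = "\<lambda>a b. a \<bullet> (?G *v b)"
  define a b where "a = \<xi> c" and "b = \<zeta> c"
  have e: "Metric X x \<xi> \<zeta> = ?m a b" "Metric X x \<xi> \<xi> = ?m a a" "Metric X x \<zeta> \<zeta> = ?m b b"
    "Metric X x \<zeta> \<xi> = ?m b a"
    unfolding a_def b_def Metric_gram[OF c, symmetric] using tangent_of_component[OF c] assms by simp_all
  have s: "?m b a = ?m a b" using e Metric_sym[OF assms] by simp
  have nn: "?m w w \<ge> 0" for w using gram_pos[OF c, of w] by (cases "w = 0") auto
  have "(?m a b)\<^sup>2 \<le> ?m a a * ?m b b"
  proof (cases "b = 0")
    case False
    then have pos: "?m b b > 0" using gram_pos[OF c] by blast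
    \<comment> \<open>The minimiser of the quadratic polynomial t \<mapsto>
      \<open>?m (a - t *\<^sub>R b) (a - t *\<^sub>R b)\<close>.\<close>
    define t where "t = ?m a b / ?m b b"
    have "0 \<le> ?m (a - t *\<^sub>R b) (a - t *\<^sub>R b)" by (rule nn)
    also have "\<dots> = ?m a a - 2 * t * ?m a b + t\<^sup>2 * ?m b b"
      using s by (simp add: matrix_vector_mult_diff_distrib matrix_vector_mult_scaleR inner_diff_left
          inner_diff_right power2_eq_square algebra_simps)
    also have "\<dots> = ?m a a - (?m a b)\<^sup>2 / ?m b b" using pos by (simp add: t_def power2_eq_square field_simps)
    finally show ?thesis using pos by (simp add: field_simps)
  qed simp
  then have "sqrt ((?m a b)\<^sup>2) \<le> sqrt (?m a a * ?m b b)" by (rule real_sqrt_le_mono)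
  then show ?thesis by (simp add: tangent_norm_def e real_sqrt_mult)
qed

subsection \<open>Differentials and gradients\<close>

definition differentiable_pt :: "('x \<Rightarrow> real) \<Rightarrow> 'x \<Rightarrow> bool" where
  "differentiable_pt f x \<longleftrightarrow> (\<forall>c\<in>charts_at X x. (f \<circ> unchart c) differentiable (at (coord c x)))"

lemma differentiable_ptI:
  assumes "c \<in> charts_at X x" "(f \<circ> unchart c) differentiable (at (coord c x))"
  shows "differentiable_pt f x" unfolding differentiable_pt_def
  using has_derivative_chart_change[OF _ assms(1)] assms(2) unfolding differentiable_def by blast

lemma differential_eq:
  assumes f: "differentiable_pt f x" and c: "c \<in> charts_at X x" and \<xi>: "\<xi> \<in> tangent_space X x"
  shows "differential X f x \<xi> = fderiv (f \<circ> unchart c) (coord c x) (\<xi> c)"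
proof -
  let ?d = "chart_at X x"
  have d: "?d \<in> charts_at X x" by (rule chart_at_in)
  have "((f \<circ> unchart c) has_derivative fderiv (f \<circ> unchart c) (coord c x)) (at (coord c x))"
    using f c by (simp add: differentiable_pt_def frechet_derivative_works)
  then have "((f \<circ> unchart ?d) has_derivative fderiv (f \<circ> unchart c) (coord c x) \<circ> transition_deriv ?d c x) (at (coord ?d x))"
    by (rule has_derivative_chart_change[OF d c])
  then have "fderiv (f \<circ> unchart ?d) (coord ?d x) = fderiv (f \<circ> unchart c) (coord c x) \<circ> transition_deriv ?d c x"
    by (rule frechet_derivative_at[symmetric])
  moreover have "transition_deriv ?d c x (\<xi> ?d) = \<xi> c" using \<xi> d c by (simp add: tangent_space_change)
  ultimately show ?thesis by (simp add: differential_def Let_def)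
qed

text \<open>Shows that the description in \<open>gradient\<close> determines a vector. The Gram
  matrix is positive definite, hence invertible; its inverse turns the vector of partial derivatives
  into a representing tangent vector.\<close>

lemma gradient:
  assumes f: "differentiable_pt f x"
  shows "gradient X f x \<in> tangent_space X x"
  and "\<zeta> \<in> tangent_space X x \<Longrightarrow> Metric X x (gradient X f x) \<zeta> = differential X f x \<zeta>"
proof -
  obtain c where c: "c \<in> charts_at X x" using ex_chart by blast
  let ?G = "gram X c x"
  let ?D = "fderiv (f \<circ> unchart c) (coord c x)"
  have lin: "linear ?D" using f c by (auto simp: differentiable_pt_def intro: linear_frechet_derivative)
  have inv: "invertible ?G" using det_gram_pos[OF c] by (simp add: invertible_det_nz)
  obtain H where H: "?G ** H = mat 1" using inv unfolding invertible_def by blast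
  define b :: "real ^ 'n" where "b = (\<chi> i. ?D (axis i 1))"
  define \<xi> where "\<xi> = tangent_of X c x (H *v b)"
  have tr: "transpose ?G = ?G" by (simp add: transpose_def vec_eq_iff gram_symmetric[OF c])
  have M: "Metric X x \<xi> \<zeta> = differential X f x \<zeta>" if "\<zeta> \<in> tangent_space X x" for \<zeta>
  proof -
    have "Metric X x \<xi> \<zeta> = Metric X x \<xi> (tangent_of X c x (\<zeta> c))" using tangent_of_component[OF c that] by simp
    also have "\<dots> = (H *v b) \<bullet> (?G *v \<zeta> c)" by (simp add: \<xi>_def Metric_gram[OF c])
    also have "\<dots> = (?G *v (H *v b)) \<bullet> \<zeta> c" by (metis dot_lmul_matrix tr transpose_matrix_vector)
    also have "\<dots> = b \<bullet> \<zeta> c" by (simp add: matrix_vector_mul_assoc H)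
    also have "\<dots> = ?D (\<Sum>i\<in>UNIV. (\<zeta> c $ i) *s axis i 1)"
      by (simp add: b_def inner_vec_def linear_sum[OF lin] linear_scale[OF lin] scalar_mult_eq_scaleR mult.commute)
    also have "\<dots> = differential X f x \<zeta>" by (simp add: differential_eq[OF f c that] basis_expansion)
    finally show ?thesis .
  qed
  have \<xi>: "\<xi> \<in> tangent_space X x" using c by (auto simp: \<xi>_def)
  have "gradient X f x = \<xi>" unfolding gradient_def
  proof (rule the_equality)
    fix \<xi>' assume *: "\<xi>' \<in> tangent_space X x \<and> (\<forall>\<zeta>\<in>tangent_space X x. Metric X x \<xi>' \<zeta> = differential X f x \<zeta>)"
    \<comment> \<open>The difference of two representing vectors is orthogonal to itself, hence
      zero.\<close>
    define \<delta> where "\<delta> = tangent_of X c x (\<xi>' c - \<xi> c)"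
    have \<delta>: "\<delta> \<in> tangent_space X x" using c by (auto simp: \<delta>_def)
    have "tangent_add \<delta> \<xi> = tangent_of X c x ((\<xi>' c - \<xi> c) + \<xi> c)"
      unfolding tangent_of_add[OF c] \<delta>_def tangent_of_component[OF c \<xi>] ..
    then have "tangent_add \<delta> \<xi> = \<xi>'" using tangent_of_component[OF c] * by simp
    then have "Metric X x \<delta> \<delta> + Metric X x \<xi> \<delta> = Metric X x \<xi>' \<delta>" using Metric_add[OF \<delta> \<xi> \<delta>] by simp
    then have "Metric X x \<delta> \<delta> = 0" using M[OF \<delta>] * \<delta> by simp
    then have "\<delta> = (\<lambda>_. 0)" using Metric_pos[OF \<delta>] by fastforce
    then show "\<xi>' = \<xi>" using \<open>tangent_add \<delta> \<xi> = \<xi>'\<close> by (simp add: tangent_add_def)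
  qed (use \<xi> M in auto)
  then show "gradient X f x \<in> tangent_space X x"
  and "\<zeta> \<in> tangent_space X x \<Longrightarrow> Metric X x (gradient X f x) \<zeta> = differential X f x \<zeta>"
    using \<xi> M by auto
qed

lemma tangent_scale_in: "\<xi> \<in> tangent_space X x \<Longrightarrow> tangent_scale r \<xi> \<in> tangent_space X x"
proof -
  assume \<xi>: "\<xi> \<in> tangent_space X x"
  obtain c where c: "c \<in> charts_at X x" using ex_chart by blast
  show ?thesis using tangent_of_in[OF c, of "r *\<^sub>R \<xi> c"] tangent_of_scale[OF c] tangent_of_component[OF c \<xi>] by simp
qed

lemma smooth_funD: "smooth_fun X f \<Longrightarrow> c \<in> Charts X \<Longrightarrow> smooth_on (chart_img c) (f \<circ> unchart c)"
  by (simp add: smooth_fun_def)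

lemma smooth_fun_differentiable_pt: "smooth_fun X f \<Longrightarrow> differentiable_pt f x"
  unfolding differentiable_pt_def using smooth_funD smooth_on_differentiable charts_atD coord_in by metis

lemma continuous_in_charts:
  fixes f :: "'x \<Rightarrow> 'b::topological_space"
  assumes "\<And>c. c \<in> Charts X \<Longrightarrow> continuous_on (chart_img c) (f \<circ> unchart c)"
  shows "continuous_on UNIV f"
proof -
  have "isCont f x" for x
  proof -
    obtain c where c: "c \<in> Charts X" "x \<in> chart_dom c" using ex_chart charts_atD by blast
    have "continuous_on (chart_dom c) ((f \<circ> unchart c) \<circ> coord c)"
      using continuous_on_compose[OF continuous_on_coord[OF c(1)] assms[OF c(1), unfolded chart_img_def]] .
    then have "continuous_on (chart_dom c) f" by (rule continuous_on_eq) (use c in auto)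
    then show ?thesis using c open_chart_dom[of c] continuous_on_eq_continuous_at by blast
  qed
  then show ?thesis by (simp add: continuous_on_eq_continuous_at)
qed

lemma smooth_fun_continuous: "smooth_fun X f \<Longrightarrow> continuous_on UNIV f"
  by (rule continuous_in_charts) (blast intro: smooth_funD smooth_on_continuous_on)

lemma Vect0D:
  assumes "v \<in> Vect0 X"
  shows "v x \<in> tangent_space X x"
  and "c \<in> Charts X \<Longrightarrow> smooth_on (chart_img c) (\<lambda>w. v (unchart c w) c)"
  using assms by (auto simp: Vect0_def)

lemma smooth_fun_differential:
  assumes f: "smooth_fun X f" and v: "v \<in> Vect0 X"
  shows "smooth_fun X (\<lambda>x. differential X f x (v x))" unfolding smooth_fun_def
proof
  fix c assume c: "c \<in> Charts X"
  have sm: "smooth_on (chart_img c) (f \<circ> unchart c)" using f c by (auto simp: smooth_fun_def)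
  have "smooth_on (chart_img c) (\<lambda>w. \<Sum>i\<in>UNIV. v (unchart c w) c $ i * fderiv (f \<circ> unchart c) w (axis i 1))"
    using c v by (intro smooth_on_sum smooth_on_mult smooth_on_component smooth_on_frechet_derivative sm Vect0D) auto
  moreover have "(\<Sum>i\<in>UNIV. v (unchart c w) c $ i * fderiv (f \<circ> unchart c) w (axis i 1)) =
     differential X f (unchart c w) (v (unchart c w))" if w: "w \<in> chart_img c" for w proof -
    have ca: "c \<in> charts_at X (unchart c w)" using c w by (auto intro: charts_atI)
    have lin: "linear (fderiv (f \<circ> unchart c) w)" using smooth_on_differentiable[OF sm w] by (rule linear_frechet_derivative)
    have "differential X f (unchart c w) (v (unchart c w)) =
       fderiv (f \<circ> unchart c) w (\<Sum>i\<in>UNIV. (v (unchart c w) c $ i) *s axis i 1)" unfolding basis_expansion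
      using differential_eq[OF smooth_fun_differentiable_pt[OF f] ca Vect0D(1)[OF v]] c w by simp
    then show ?thesis by (simp add: linear_sum[OF lin] linear_scale[OF lin] scalar_mult_eq_scaleR)
  qed
  ultimately show "smooth_on (chart_img c) ((\<lambda>x. differential X f x (v x)) \<circ> unchart c)"
    using c by (subst smooth_on_cong[OF open_chart_img[OF c]]) auto
qed

lemma differential_zero: "differential X f x (\<lambda>_. 0) = 0" if "differentiable_pt f x"
proof -
  obtain c where c: "c \<in> charts_at X x" using ex_chart by blast
  have "linear (fderiv (f \<circ> unchart c) (coord c x))"
    using that c by (auto simp: differentiable_pt_def intro: linear_frechet_derivative)
  then show ?thesis by (simp add: differential_eq[OF that c zero_tangent] linear_0)
qed

lemma continuous_tangent_norm:
  assumes v: "v \<in> Vect0 X" shows "continuous_on UNIV (\<lambda>x. tangent_norm X x (v x))"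
proof (rule continuous_in_charts)
  fix c assume c: "c \<in> Charts X"
  have "continuous_on (chart_img c) (\<lambda>w. gram X c (unchart c w) $ i $ j)" for i j
    using gram_smooth[OF c] by (rule smooth_on_continuous_on)
  then have "continuous_on (chart_img c) (\<lambda>w. gram X c (unchart c w))"
    by (intro continuous_on_vec_lambda[where f = "\<lambda>i w. \<chi> j. gram X c (unchart c w) $ i $ j", simplified]
        continuous_on_vec_lambda[where f = "\<lambda>j w. gram X c (unchart c w) $ _ $ j", simplified])
  moreover have cv: "continuous_on (chart_img c) (\<lambda>w. v (unchart c w) c)"
    using Vect0D(2)[OF v c] by (rule smooth_on_continuous_on)
  ultimately have "continuous_on (chart_img c)
     (\<lambda>w. sqrt (\<Sum>i\<in>UNIV. v (unchart c w) c $ i * (\<Sum>j\<in>UNIV. gram X c (unchart c w) $ i $ j * v (unchart c w) c $ j)))"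
    by (intro continuous_intros)
  moreover have "tangent_norm X (unchart c w) (v (unchart c w)) =
     sqrt (\<Sum>i\<in>UNIV. v (unchart c w) c $ i * (\<Sum>j\<in>UNIV. gram X c (unchart c w) $ i $ j * v (unchart c w) c $ j))"
    if w: "w \<in> chart_img c" for w
  proof -
    have ca: "c \<in> charts_at X (unchart c w)" using c w by (auto intro: charts_atI)
    show ?thesis unfolding tangent_norm_def by (subst (1 2) tangent_of_component[OF ca Vect0D(1)[OF v], symmetric])
        (simp add: Metric_gram[OF ca] inner_vec_def matrix_vector_mult_def)
  qed
  ultimately show "continuous_on (chart_img c) ((\<lambda>x. tangent_norm X x (v x)) \<circ> unchart c)"
    using continuous_on_eq by (fastforce simp: o_def)
qed

subsection \<open>Compact exhaustion and cutoff functions\<close>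

text \<open>Local compactness, read off from a small closed ball in a chart.\<close>

lemma open_subset_compact:
  fixes W :: "'x set"
  assumes "open W" "x \<in> W"
  obtains U L where "open U" "x \<in> U" "U \<subseteq> L" "compact L" "L \<subseteq> W"
proof -
  obtain c where c: "c \<in> Charts X" "x \<in> chart_dom c" using ex_chart charts_atD by blast
  have "open (coord c ` (chart_dom c \<inter> W))" using c assms by (intro open_coord_image) auto
  then obtain r where r: "r > 0" "cball (coord c x) r \<subseteq> coord c ` (chart_dom c \<inter> W)"
    using open_contains_cball c assms by blast
  then have sub: "cball (coord c x) r \<subseteq> chart_img c" by (auto simp: chart_img_def)
  show ?thesis
  proof
    show "open (unchart c ` ball (coord c x) r)" using sub ball_subset_cball by (intro open_unchart_image c) blast+
    show "compact (unchart c ` cball (coord c x) r)"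
      using continuous_on_subset[OF continuous_on_unchart[OF c(1)] sub] by (intro compact_continuous_image) auto
    show "x \<in> unchart c ` ball (coord c x) r" using c r by (intro image_eqI[where x = "coord c x"]) auto
    show "unchart c ` cball (coord c x) r \<subseteq> W" using r(2) c by force
  qed (auto)
qed

text \<open>Countably many sets of a base lie inside compact sets, and they cover the manifold.
  \<open>K n\<close> is the union of the first n + 1 of these compact sets; a compact set needs only
  finitely many of the base sets, so some \<open>K n\<close> contains it.\<close>

lemma compact_exhaustion:
  obtains K :: "nat \<Rightarrow> 'x set"
  where "\<And>n. compact (K n)" "incseq K" "\<And>L. compact L \<Longrightarrow> \<exists>n. L \<subseteq> K n" "(\<Union>n. K n) = UNIV"
proof -
  obtain B :: "'x set set" where B: "countable B" "topological_basis B" using ex_countable_basis by blast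
  define C where "C = {U\<in>B. \<exists>L. compact L \<and> U \<subseteq> L}"
  have C: "countable C" using B by (auto simp: C_def)
  have cov: "\<exists>U\<in>C. x \<in> U" for x
  proof -
    obtain U L where U: "open U" "x \<in> U" "U \<subseteq> L" "compact L" by (rule open_subset_compact[OF open_UNIV UNIV_I[of x]]) blast
    then obtain U' where "U' \<in> B" "x \<in> U'" "U' \<subseteq> U" using B(2) by (meson topological_basisE)
    then show ?thesis using U by (auto simp: C_def)
  qed
  then have ne: "C \<noteq> {}" by auto
  have "\<forall>U\<in>C. \<exists>L. compact L \<and> U \<subseteq> L" by (simp add: C_def)
  then obtain L where L: "\<And>U. U \<in> C \<Longrightarrow> compact (L U) \<and> U \<subseteq> L U" by (auto dest!: bchoice)
  define K where "K n = (\<Union>k\<le>n. L (from_nat_into C k))" for n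
  have cpt: "compact (K n)" for n using L from_nat_into[OF ne] by (auto simp: K_def intro!: compact_UN)
  have inc: "incseq K" by (auto simp: incseq_def K_def intro: order_trans)
  have sub: "U \<subseteq> K (to_nat_on C U)" if U: "U \<in> C" for U
  proof -
    have "U \<subseteq> L (from_nat_into C (to_nat_on C U))" using L[OF U] by (simp add: from_nat_into_to_nat_on[OF C U])
    then show ?thesis unfolding K_def by blast
  qed
  have "\<exists>n. M \<subseteq> K n" if M: "compact M" for M
  proof -
    have "\<And>U. U \<in> C \<Longrightarrow> open U" using B by (auto simp: C_def topological_basis_open)
    then obtain D where D: "D \<subseteq> C" "finite D" "M \<subseteq> \<Union>D" using M cov compactE[of M C] by (metis UnionI subsetI)
    have "U \<subseteq> K (Max (insert 0 (to_nat_on C ` D)))" if "U \<in> D" for U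
    proof -
      have "to_nat_on C U \<le> Max (insert 0 (to_nat_on C ` D))" using D that by auto
      then have "K (to_nat_on C U) \<subseteq> K (Max (insert 0 (to_nat_on C ` D)))" using inc by (rule incseqD[rotated])
      then show ?thesis using sub[of U] D(1) that by blast
    qed
    then show ?thesis using D by blast
  qed
  moreover have "(\<Union>n. K n) = UNIV" using cov sub by blast
  ultimately show ?thesis using that cpt inc by blast
qed

text \<open>Take \<open>exp_flat 0\<close> of the squared radius minus the squared coordinate
  distance. It vanishes outside the image L of a closed ball, and L is closed in the manifold, so
  the extension by zero is smooth in every other chart as well.\<close>

lemma ex_bump:
  assumes W: "open W" "p \<in> W"
  obtains b L where "b \<in> C0_inf X" "\<And>x. b x \<ge> 0" "b p > 0" "compact L" "L \<subseteq> W" "\<And>x. x \<notin> L \<Longrightarrow> b x = 0"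
proof -
  obtain c where c: "c \<in> Charts X" "p \<in> chart_dom c" using ex_chart charts_atD by blast
  have "open (coord c ` (chart_dom c \<inter> W))" using c assms by (intro open_coord_image) auto
  then obtain r where r: "r > 0" "cball (coord c p) r \<subseteq> coord c ` (chart_dom c \<inter> W)"
    using open_contains_cball c assms by blast
  then have sub: "cball (coord c p) r \<subseteq> chart_img c" by (auto simp: chart_img_def)
  define L where "L = unchart c ` cball (coord c p) r"
  define q where "q w = r\<^sup>2 + (- 1) * ((w - coord c p) \<bullet> (w - coord c p))" for w
  define b where "b x = (if x \<in> chart_dom c then exp_flat 0 (q (coord c x)) else 0)" for x
  have L: "compact L" unfolding L_def
    using continuous_on_subset[OF continuous_on_unchart[OF c(1)] sub] by (intro compact_continuous_image) auto
  have LW: "L \<subseteq> W" using r(2) c by (force simp: L_def)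
  have off: "b x = 0" if "x \<notin> L" for x
  proof (cases "x \<in> chart_dom c")
    case True
    have "coord c x \<notin> cball (coord c p) r" using that True c by (force simp: L_def intro: image_eqI[where x = "coord c x"])
    then have "r < norm (coord c x - coord c p)" by (simp add: dist_norm norm_minus_commute)
    then have "r\<^sup>2 < (norm (coord c x - coord c p))\<^sup>2" using r(1) by (intro power_strict_mono) auto
    then show ?thesis using True by (simp add: b_def q_def exp_flat_def power2_norm_eq_inner)
  qed (simp add: b_def)
  have qs: "smooth_on UNIV q"
  proof -
    have "smooth_on UNIV (\<lambda>w. w + - coord c p)"
      by (intro smooth_on_add smooth_on_bounded_linear[OF bounded_linear_ident]) auto
    then show ?thesis unfolding q_def
      by (intro smooth_on_add smooth_on_mult smooth_on_bilinear[OF _ bounded_bilinear_inner]) auto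
  qed
  have "smooth_on (chart_img d) (b \<circ> unchart d)" if d: "d \<in> Charts X" for d
  proof (rule smooth_on_local)
    fix w assume w: "w \<in> chart_img d"
    show "\<exists>U. w \<in> U \<and> smooth_on U (b \<circ> unchart d)"
    proof (cases "unchart d w \<in> chart_dom c")
      case True
      let ?U = "coord d ` (chart_dom d \<inter> chart_dom c)"
      have U: "open ?U" using open_overlap[OF d c(1)] .
      have "smooth_on ?U (\<lambda>w. exp_flat 0 (q ((coord c \<circ> unchart d) w)))"
        by (intro smooth_on_compose[OF U open_UNIV _ smooth_exp_flat] smooth_on_compose[OF U open_UNIV _ qs]
            smooth_transition d c) auto
      then have "smooth_on ?U (b \<circ> unchart d)"
        by (subst smooth_on_cong[OF U, of _ "\<lambda>w. exp_flat 0 (q ((coord c \<circ> unchart d) w))"])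
          (use d in \<open>auto simp: b_def\<close>)
      then show ?thesis using True w d by (intro exI[of _ ?U]) (auto intro!: image_eqI[where x = "unchart d w"])
    next
      case False
      let ?U = "chart_img d \<inter> unchart d -` (- L)"
      have U: "open ?U" using continuous_on_unchart[OF d] d compact_imp_closed[OF L] by (intro continuous_open_preimage) auto
      have "smooth_on ?U (b \<circ> unchart d)" by (subst smooth_on_cong[OF U, of _ "\<lambda>w. 0"]) (auto simp: off)
      moreover have "L \<subseteq> chart_dom c" using sub c by (auto simp: L_def)
      ultimately show ?thesis using False w by (intro exI[of _ ?U]) auto
    qed
  qed
  then have "smooth_fun X b" by (simp add: smooth_fun_def)
  then have "b \<in> C0_inf X" unfolding C0_inf_def using L off by blast
  moreover have "b x \<ge> 0" for x by (simp add: b_def exp_flat_0_nonneg)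
  moreover have "b p > 0" using c r(1) by (simp add: b_def q_def exp_flat_0_pos)
  ultimately show ?thesis using that L LW off by blast
qed

text \<open>A finite sum s of bumps is positive on K. With \<epsilon> half the minimum of s on K,
  \<open>smooth_step\<close> of s/\<epsilon> is 1 on the open set where s exceeds \<epsilon>, which
  contains K.\<close>

lemma ex_cutoff:
  assumes K: "compact K"
  obtains \<rho> U where "\<rho> \<in> C0_inf X" "\<And>x. 0 \<le> \<rho> x" "\<And>x. \<rho> x \<le> 1" "open U" "K \<subseteq> U" "\<And>x. x \<in> U \<Longrightarrow> \<rho> x = 1"
proof -
  have "\<exists>b. b \<in> C0_inf X \<and> (\<forall>x. b x \<ge> 0) \<and> b p > 0" for p by (rule ex_bump[OF open_UNIV UNIV_I[of p]]) blast
  then obtain b where b: "\<And>p. b p \<in> C0_inf X" "\<And>p x. b p x \<ge> 0" "\<And>p. b p p > 0" by metis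
  have bc: "continuous_on UNIV (b p)" for p using b(1)[of p] by (intro smooth_fun_continuous) (auto simp: C0_inf_def)
  have op: "open {x. b p x > 0}" for p using bc by (intro open_Collect_less) auto
  have cov: "K \<subseteq> (\<Union>p. {x. b p x > 0})" using b(3) by blast
  obtain P where P: "finite P" "K \<subseteq> (\<Union>p\<in>P. {x. b p x > 0})" by (rule compactE_image[OF K op cov]) blast
  define s where "s x = (\<Sum>p\<in>P. b p x)" for x
  have s_pos: "s x > 0" if x: "x \<in> K" for x
  proof -
    obtain p where p: "p \<in> P" "b p x > 0" using P(2) x by blast
    then show ?thesis unfolding s_def by (intro sum_pos2[where f = "\<lambda>p. b p x", OF P(1) p] b(2))
  qed
  have sc: "continuous_on UNIV s" unfolding s_def by (intro continuous_on_sum bc)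
  obtain \<epsilon> where \<epsilon>: "\<epsilon> > 0" "\<And>x. x \<in> K \<Longrightarrow> s x > \<epsilon>"
  proof (cases "K = {}")
    case False
    obtain x0 where x0: "x0 \<in> K" "\<And>x. x \<in> K \<Longrightarrow> s x0 \<le> s x"
      using continuous_attains_inf[OF K False continuous_on_subset[OF sc subset_UNIV]] by blast
    show ?thesis
    proof (rule that[of "s x0 / 2"])
      fix x assume "x \<in> K" then show "s x0 / 2 < s x" using x0 s_pos[of x0] by (smt (verit) field_sum_of_halves)
    qed (use s_pos[OF x0(1)] in auto)
  qed (use that[of 1] in auto)
  define \<rho> where "\<rho> x = smooth_step (inverse \<epsilon> * s x)" for x
  have sm: "smooth_on (chart_img c) (\<lambda>w. inverse \<epsilon> * (\<Sum>p\<in>P. (b p \<circ> unchart c) w))" if "c \<in> Charts X" for c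
  proof -
    have "smooth_on (chart_img c) (b p \<circ> unchart c)" for p
      using b(1)[of p] that by (intro smooth_funD) (auto simp: C0_inf_def)
    then show ?thesis using open_chart_img[OF that] by (intro smooth_on_mult smooth_on_sum smooth_on_const)
  qed
  have "smooth_on (chart_img c) (\<rho> \<circ> unchart c)" if c: "c \<in> Charts X" for c
    using smooth_on_compose[OF open_chart_img[OF c] open_UNIV _ smooth_smooth_step sm[OF c]] by (simp add: o_def \<rho>_def s_def)
  moreover have "\<exists>L. compact L \<and> (\<forall>x. x \<notin> L \<longrightarrow> \<rho> x = 0)"
  proof -
    have "\<forall>p. \<exists>L. compact L \<and> (\<forall>x. x \<notin> L \<longrightarrow> b p x = 0)" using b(1) by (auto simp: C0_inf_def)
    then obtain L where L: "\<And>p. compact (L p)" "\<And>p x. x \<notin> L p \<Longrightarrow> b p x = 0" by metis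
    have "compact (\<Union>p\<in>P. L p)" using P L by auto
    moreover have "\<rho> x = 0" if "x \<notin> (\<Union>p\<in>P. L p)" for x using L(2) that by (simp add: \<rho>_def s_def smooth_step_eq_0)
    ultimately show ?thesis by blast
  qed
  ultimately have "\<rho> \<in> C0_inf X" unfolding C0_inf_def smooth_fun_def by blast
  moreover have "open {x. s x > \<epsilon>}" using sc by (intro open_Collect_less) auto
  moreover have "\<rho> x = 1" if "x \<in> {x. s x > \<epsilon>}" for x
    unfolding \<rho>_def using that \<epsilon>(1) by (intro smooth_step_eq_1) (auto simp: field_simps)
  moreover have "0 \<le> \<rho> x" "\<rho> x \<le> 1" for x by (simp_all add: \<rho>_def smooth_step_bounds)
  ultimately show ?thesis using that[of \<rho> "{x. s x > \<epsilon>}"] \<epsilon>(2) by blast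
qed

end

section \<open>Change of variables\<close>

text \<open>The theorem on absolutely integrable functions transfers integrability and value in both
  directions at once. If either side is finite it applies; otherwise both sides are
  infinite.\<close>

lemma nn_change_of_variables_wellorder:
  fixes T :: "real ^ 'm::{finite,wellorder} \<Rightarrow> real ^ 'm::_"
  assumes B: "B \<in> sets borel" "T ` B \<in> sets borel"
  and T: "inj_on T B" "\<And>w. w \<in> B \<Longrightarrow> (T has_derivative T' w) (at w within B)"
  and g: "g \<in> borel_measurable borel" "\<And>z. g z \<ge> 0"
  and k: "k \<in> borel_measurable borel" "\<And>z. k z \<ge> 0"
  and eq: "\<And>w. w \<in> B \<Longrightarrow> k w = \<bar>det (matrix (T' w))\<bar> * g (T w)"
  shows "(\<integral>\<^sup>+w. ennreal (k w) * indicator B w \<partial>lborel) = (\<integral>\<^sup>+z. ennreal (g z) * indicator (T ` B) z \<partial>lborel)"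
proof -
  have cov: "k absolutely_integrable_on B \<and> integral B k = b \<longleftrightarrow>
      g absolutely_integrable_on T ` B \<and> integral (T ` B) g = b" for b proof -
    \<comment> \<open>Scalars are passed as vectors of length one, the form in which the theorem
      takes its integrand.\<close>
    have "(\<lambda>w. \<bar>det (matrix (T' w))\<bar> *\<^sub>R (vec (g (T w)) :: real ^ 1)) absolutely_integrable_on B \<and>
        integral B (\<lambda>w. \<bar>det (matrix (T' w))\<bar> *\<^sub>R (vec (g (T w)) :: real ^ 1)) = vec b \<longleftrightarrow>
       (\<lambda>z. vec (g z) :: real ^ 1) absolutely_integrable_on (T ` B) \<and>
        integral (T ` B) (\<lambda>z. vec (g z) :: real ^ 1) = vec b"
      using B(1) T by (intro has_absolute_integral_change_of_variables) auto
    moreover have "\<bar>det (matrix (T' w))\<bar> *\<^sub>R (vec (g (T w)) :: real ^ 1) = vec (k w)" if "w \<in> B" for w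
      using eq[OF that] by (simp add: vec_eq_iff)
    ultimately have "(\<lambda>w. vec (k w) :: real ^ 1) absolutely_integrable_on B \<and> integral B (\<lambda>w. vec (k w) :: real ^ 1) = vec b \<longleftrightarrow>
       (\<lambda>z. vec (g z) :: real ^ 1) absolutely_integrable_on (T ` B) \<and>
        integral (T ` B) (\<lambda>z. vec (g z) :: real ^ 1) = vec b" by (simp cong: set_integrable_cong integral_cong)
    then show ?thesis by (simp add: absolutely_integrable_on_1_iff integral_on_1_eq)
  qed
  have main: "(\<integral>\<^sup>+w. ennreal (f w) * indicator A w \<partial>lborel) = ennreal (integral A f)"
    if "f absolutely_integrable_on A" "\<And>z. f z \<ge> 0" for f :: "real ^ 'm::_ \<Rightarrow> real" and A
    using that by (intro nn_integral_has_integral_lebesgue')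
      (auto simp: absolutely_integrable_on_def integrable_integral)
  have fin: "f absolutely_integrable_on A"
    if "f \<in> borel_measurable borel" "\<And>z. f z \<ge> 0" "A \<in> sets borel"
      "(\<integral>\<^sup>+w. ennreal (f w) * indicator A w \<partial>lborel) < \<infinity>" for f :: "real ^ 'm::_ \<Rightarrow> real" and A
  proof -
    have "integrable lborel (\<lambda>w. f w * indicator A w)"
      using that by (intro integrableI_nonneg) (auto simp: ennreal_mult'' ennreal_indicator)
    then have "integrable lebesgue (\<lambda>w. f w * indicator A w)" by (intro integrable_completion[THEN iffD2]) auto
    then show ?thesis by (simp add: set_integrable_def mult.commute)
  qed
  let ?P = "\<integral>\<^sup>+w. ennreal (k w) * indicator B w \<partial>lborel"
  let ?Q = "\<integral>\<^sup>+z. ennreal (g z) * indicator (T ` B) z \<partial>lborel"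
  consider "?P < \<infinity>" | "?Q < \<infinity>" | "?P = \<infinity>" "?Q = \<infinity>"
    by (metis infinity_ennreal_def top.not_eq_extremum)
  then show ?thesis
  proof cases
    case 1
    then have "k absolutely_integrable_on B" using fin k B by blast
    then show ?thesis using cov[of "integral B k"] main k g by metis
  next
    case 2
    then have "g absolutely_integrable_on T ` B" using fin g B by blast
    then show ?thesis using cov[of "integral (T ` B) g"] main k g by metis
  qed simp
qed

text \<open>The library's change of variables asks for a well-ordered index type; a general finite index
  type is transported to the following one.\<close>

typedef ('n::finite) fin_ord = "{..<CARD('n)}"
  by (rule exI[of _ 0]) simp

instance fin_ord :: (finite) finite
proof
  have "UNIV = (Abs_fin_ord :: nat \<Rightarrow> 'a fin_ord) ` {..<CARD('a)}"
    using Rep_fin_ord Rep_fin_ord_inverse by (metis UNIV_eq_I imageI)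
  then show "finite (UNIV :: 'a fin_ord set)" by (metis finite_imageI finite_lessThan)
qed

instantiation fin_ord :: (finite) wellorder
begin

definition "x \<le> y \<longleftrightarrow> Rep_fin_ord x \<le> Rep_fin_ord y"
definition "x < y \<longleftrightarrow> Rep_fin_ord x < Rep_fin_ord y"

instance
proof
  fix P and a :: "'a fin_ord"
  assume *: "\<And>x :: 'a fin_ord. (\<And>y. y < x \<Longrightarrow> P y) \<Longrightarrow> P x"
  show "P a" by (induction "Rep_fin_ord a" arbitrary: a rule: less_induct) (rule *, simp add: less_fin_ord_def)
qed (auto simp: less_eq_fin_ord_def less_fin_ord_def Rep_fin_ord_inject)

end

definition fin_ord_of :: "'n::finite \<Rightarrow> 'n fin_ord" where
  "fin_ord_of = (SOME e. bij e)"

lemma bij_fin_ord_of: "bij (fin_ord_of :: 'n::finite \<Rightarrow> 'n fin_ord)"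
proof -
  have "bij_betw (Abs_fin_ord :: nat \<Rightarrow> 'n fin_ord) {..<CARD('n)} UNIV"
    using Abs_fin_ord_inject Rep_fin_ord Rep_fin_ord_inverse
    by (intro bij_betwI[where g = Rep_fin_ord]) (auto simp: Abs_fin_ord_inverse)
  then have "card (UNIV :: 'n fin_ord set) = CARD('n)" by (metis bij_betw_same_card card_lessThan)
  then have "\<exists>e :: 'n \<Rightarrow> 'n fin_ord. bij e" using finite_same_card_bij[of "UNIV :: 'n set" "UNIV :: 'n fin_ord set"] by simp
  then show ?thesis unfolding fin_ord_of_def by (rule someI_ex)
qed

definition vec_ord :: "real ^ 'n::finite \<Rightarrow> real ^ 'n fin_ord" where
  "vec_ord x = (\<chi> j. x $ inv fin_ord_of j)"

definition vec_unord :: "real ^ 'n fin_ord \<Rightarrow> real ^ 'n::finite" where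
  "vec_unord y = (\<chi> i. y $ fin_ord_of i)"

lemma inv_fin_ord_of [simp]: "inv fin_ord_of (fin_ord_of i) = i"
  by (rule inv_f_f[OF bij_is_inj[OF bij_fin_ord_of]])

lemma fin_ord_of_inv [simp]: "fin_ord_of (inv fin_ord_of j) = j"
  by (rule surj_f_inv_f[OF bij_is_surj[OF bij_fin_ord_of]])

lemma fin_ord_of_inject [simp]: "fin_ord_of i = fin_ord_of j \<longleftrightarrow> i = j"
  by (metis inv_fin_ord_of)

lemma vec_unord_ord [simp]: "vec_unord (vec_ord x) = x"
  and vec_ord_unord [simp]: "vec_ord (vec_unord y) = y"
  by (simp_all add: vec_ord_def vec_unord_def vec_eq_iff)

lemma linear_vec_ord: "linear vec_ord"
  and linear_vec_unord: "linear vec_unord"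
  by (auto intro!: linearI simp: vec_ord_def vec_unord_def vec_eq_iff)

lemma bounded_linear_vec_ord: "bounded_linear vec_ord"
  and bounded_linear_vec_unord: "bounded_linear vec_unord"
  using linear_vec_ord linear_vec_unord linear_conv_bounded_linear by blast+

lemma measurable_vec_ord [measurable]: "vec_ord \<in> borel_measurable borel"
  and measurable_vec_unord [measurable]: "vec_unord \<in> borel_measurable borel"
  using linear_continuous_on[OF bounded_linear_vec_ord, of UNIV]
    linear_continuous_on[OF bounded_linear_vec_unord, of UNIV]
  by (auto intro: measurable_continuous)

lemma prod_Basis_vec: "(\<Prod>b\<in>Basis. (x :: real ^ 'n::finite) \<bullet> b) = (\<Prod>i\<in>UNIV. x $ i)"
proof -
  have B: "Basis = range (\<lambda>i. axis i 1 :: real ^ 'n)" by (auto simp: Basis_vec_def)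
  have "inj (\<lambda>i. axis i 1 :: real ^ 'n)" by (auto intro: injI simp: axis_eq_axis)
  then show ?thesis unfolding B by (subst prod.reindex) (auto simp: inner_axis)
qed

text \<open>Lebesgue measure is determined by its values on boxes, and relabelling the coordinates
  only permutes the side lengths.\<close>

lemma distr_vec_ord: "distr lborel borel vec_ord = (lborel :: (real ^ 'n::finite fin_ord) measure)"
proof (rule lborel_eqI[symmetric])
  fix l u :: "real ^ 'n fin_ord"
  assume le: "\<And>b. b \<in> Basis \<Longrightarrow> l \<bullet> b \<le> u \<bullet> b"
  have le': "l $ j \<le> u $ j" for j using le[of "axis j 1"] by (simp add: inner_axis axis_in_Basis_iff)
  have "vec_ord -` box l u = (box (vec_unord l) (vec_unord u) :: (real ^ 'n) set)"
    by (auto simp: mem_box_cart vec_ord_def vec_unord_def) (metis inv_fin_ord_of fin_ord_of_inv)+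
  then have "emeasure (distr lborel borel vec_ord) (box l u) = emeasure lborel (box (vec_unord l) (vec_unord u))"
    by (simp add: emeasure_distr)
  also have "\<dots> = ennreal (\<Prod>i\<in>UNIV. (u - l) $ fin_ord_of i)"
  proof -
    have "vec_unord l \<bullet> b \<le> vec_unord u \<bullet> b" if "b \<in> Basis" for b :: "real ^ 'n"
      using that le' by (auto simp: Basis_vec_def inner_axis vec_unord_def)
    then show ?thesis by (subst emeasure_lborel_box) (auto simp: prod_Basis_vec vec_unord_def)
  qed
  also have "(\<Prod>i\<in>UNIV. (u - l) $ fin_ord_of i) = (\<Prod>j\<in>UNIV. (u - l) $ j)"
    using bij_fin_ord_of by (intro prod.reindex_bij_betw) auto
  finally show "emeasure (distr lborel borel vec_ord) (box l u) = (\<Prod>b\<in>Basis. (u - l) \<bullet> b)" by (simp add: prod_Basis_vec)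
qed simp

text \<open>Conjugation by the relabelling is a bijection between the permutations of the two index
  types that preserves the sign, so the Leibniz sums agree term by term.\<close>

lemma det_reindex:
  fixes A :: "real ^ 'n ^ 'n"
  shows "det (\<chi> j j'. A $ inv fin_ord_of j $ inv fin_ord_of j') = det A"
proof -
  let ?e = "fin_ord_of :: 'n \<Rightarrow> 'n fin_ord"
  have conj: "inv ?e \<circ> (?e \<circ> p \<circ> inv ?e) \<circ> ?e = p" "?e \<circ> (inv ?e \<circ> q \<circ> ?e) \<circ> inv ?e = q" for p q by (simp_all add: fun_eq_iff)
  have perm: "?e \<circ> p \<circ> inv ?e permutes UNIV" if "p permutes UNIV" for p
    by (intro bij_imp_permutes bij_comp bij_imp_bij_inv bij_fin_ord_of permutes_bij[OF that]) auto
  have perm': "inv ?e \<circ> q \<circ> ?e permutes UNIV" if "q permutes UNIV" for q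
    by (intro bij_imp_permutes bij_comp bij_imp_bij_inv bij_fin_ord_of permutes_bij[OF that]) auto
  \<comment> \<open>Sign and permutation property are carried together along a product of
    transpositions, because multiplicativity of the sign asks for both factors to be
    permutations.\<close>
  have sgn: "sign (?e \<circ> p \<circ> inv ?e) = sign p \<and> permutation (?e \<circ> p \<circ> inv ?e)" if "p permutes UNIV" for p
    using that finite[of "UNIV :: 'n set"]
  proof (induction rule: permutes_induct)
    case id
    have "?e \<circ> id \<circ> inv ?e = id" by (simp add: fun_eq_iff)
    then show ?case by simp
  next
    case (swap a b p)
    have e: "?e \<circ> (Transposition.transpose a b \<circ> p) \<circ> inv ?e = Transposition.transpose (?e a) (?e b) \<circ> (?e \<circ> p \<circ> inv ?e)"
      by (auto simp: fun_eq_iff Transposition.transpose_def)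
    have "permutation p" using \<open>p permutes UNIV\<close> by (intro permutes_imp_permutation[of UNIV]) auto
    moreover have "sign (?e \<circ> p \<circ> inv ?e) = sign p" "permutation (?e \<circ> p \<circ> inv ?e)" using swap.IH by blast+
    ultimately show ?case unfolding e using \<open>a \<noteq> b\<close>
      by (simp only: sign_compose permutation_swap_id sign_swap_id permutation_compose fin_ord_of_inject simp_thms)
  qed
  have "det A = (\<Sum>p | p permutes UNIV. of_int (sign p) * (\<Prod>i\<in>UNIV. A $ i $ p i))" by (simp add: det_def)
  also have "\<dots> = (\<Sum>q | q permutes UNIV. of_int (sign q) * (\<Prod>j\<in>UNIV. A $ inv fin_ord_of j $ inv fin_ord_of (q j)))"
  proof (rule sum.reindex_bij_witness[where i = "\<lambda>q. inv ?e \<circ> q \<circ> ?e" and j = "\<lambda>p. ?e \<circ> p \<circ> inv ?e"])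
    fix p :: "'n \<Rightarrow> 'n" assume "p \<in> {p. p permutes UNIV}"
    then have "sign (?e \<circ> p \<circ> inv ?e) = sign p" using sgn by auto
    moreover have "(\<Prod>j\<in>UNIV. A $ inv ?e j $ inv ?e ((?e \<circ> p \<circ> inv ?e) j)) = (\<Prod>i\<in>UNIV. A $ i $ p i)"
      using prod.reindex_bij_betw[OF bij_fin_ord_of, of "\<lambda>j. A $ inv ?e j $ p (inv ?e j)"] by simp
    ultimately show "of_int (sign (?e \<circ> p \<circ> inv ?e)) * (\<Prod>j\<in>UNIV. A $ inv ?e j $ inv ?e ((?e \<circ> p \<circ> inv ?e) j)) =
      of_int (sign p) * (\<Prod>i\<in>UNIV. A $ i $ p i)" by simp qed (auto simp: conj perm perm')
  finally show ?thesis by (simp add: det_def)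
qed

text \<open>Conjugate the map by the relabelling of coordinates, which preserves Lebesgue measure
  and, by \<open>det_reindex\<close>, the Jacobian.\<close>

lemma nn_change_of_variables:
  fixes T :: "real ^ 'n::finite \<Rightarrow> real ^ 'n"
  assumes B: "B \<in> sets borel" "T ` B \<in> sets borel"
  and T: "inj_on T B" "\<And>w. w \<in> B \<Longrightarrow> (T has_derivative T' w) (at w)"
  and g: "g \<in> borel_measurable borel" "\<And>z. g z \<ge> 0"
  and k: "k \<in> borel_measurable borel" "\<And>z. k z \<ge> 0"
  and eq: "\<And>w. w \<in> B \<Longrightarrow> k w = \<bar>det (matrix (T' w))\<bar> * g (T w)"
  shows "(\<integral>\<^sup>+w. ennreal (k w) * indicator B w \<partial>lborel) = (\<integral>\<^sup>+z. ennreal (g z) * indicator (T ` B) z \<partial>lborel)"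
proof -
  let ?p = "vec_ord :: real ^ 'n \<Rightarrow> real ^ 'n fin_ord" and ?q = "vec_unord :: real ^ 'n fin_ord \<Rightarrow> real ^ 'n"
  have im: "?p ` C = ?q -` C" for C by (auto intro!: image_eqI[where x = "?q _"])
  have ms: "?p ` C \<in> sets borel" if "C \<in> sets borel" for C
    unfolding im using measurable_sets[OF measurable_vec_unord that] by simp
  have tr: "(\<integral>\<^sup>+w. ennreal (f w) * indicator C w \<partial>lborel) = (\<integral>\<^sup>+y. ennreal (f (?q y)) * indicator (?p ` C) y \<partial>lborel)"
    if [measurable]: "f \<in> borel_measurable borel" "C \<in> sets borel" for f :: "real ^ 'n \<Rightarrow> real" and C
  proof -
    have [measurable]: "?p ` C \<in> sets borel" by (rule ms) fact
    have "(\<integral>\<^sup>+y. ennreal (f (?q y)) * indicator (?p ` C) y \<partial>lborel) =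
        (\<integral>\<^sup>+y. ennreal (f (?q y)) * indicator (?p ` C) y \<partial>distr lborel borel ?p)" by (simp add: distr_vec_ord)
    also have "\<dots> = (\<integral>\<^sup>+w. ennreal (f w) * indicator (?p ` C) (?p w) \<partial>lborel)" by (subst nn_integral_distr) auto
    also have "\<dots> = (\<integral>\<^sup>+w. ennreal (f w) * indicator C w \<partial>lborel)" by (simp add: im indicator_def)
    finally show ?thesis by simp
  qed
  define S where "S = ?p \<circ> T \<circ> ?q"
  define S' where "S' y = ?p \<circ> T' (?q y) \<circ> ?q" for y
  have img: "S ` ?p ` B = ?p ` T ` B" by (simp add: S_def image_image)
  have d: "(S has_derivative S' y) (at y within ?p ` B)" if "y \<in> ?p ` B" for y
  proof -
    have "(T has_derivative T' (?q y)) (at (?q y))" using T(2) that by auto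
    then have "(S has_derivative S' y) (at y)" unfolding S_def S'_def
      by (intro diff_chain_at bounded_linear_imp_has_derivative bounded_linear_vec_ord bounded_linear_vec_unord)
        (auto simp: o_def)
    then show ?thesis by (rule has_derivative_at_withinI)
  qed
  have det: "det (matrix (S' y)) = det (matrix (T' (?q y)))" for y
  proof -
    have "?q (axis j 1) = axis (inv fin_ord_of j) 1" for j by (auto simp: vec_unord_def axis_def vec_eq_iff)
    then have "matrix (S' y) = (\<chi> j j'. matrix (T' (?q y)) $ inv fin_ord_of j $ inv fin_ord_of j')"
      by (simp add: matrix_def S'_def vec_ord_def)
    then show ?thesis by (simp add: det_reindex)
  qed
  have "(\<integral>\<^sup>+w. ennreal (k w) * indicator B w \<partial>lborel) = (\<integral>\<^sup>+y. ennreal (k (?q y)) * indicator (?p ` B) y \<partial>lborel)"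
    using k B by (intro tr)
  also have "\<dots> = (\<integral>\<^sup>+y. ennreal (g (?q y)) * indicator (S ` ?p ` B) y \<partial>lborel)"
  proof (rule nn_change_of_variables_wellorder[OF _ _ _ d])
    show "inj_on S (?p ` B)"
    proof (rule inj_onI)
      fix y y' assume "y \<in> ?p ` B" "y' \<in> ?p ` B" "S y = S y'"
      then show "y = y'" using T(1) by (auto simp: S_def inj_on_def) (metis vec_unord_ord)
    qed
    show "?p ` B \<in> sets borel" "S ` ?p ` B \<in> sets borel" unfolding img by (intro ms B)+
    show "(\<lambda>y. g (?q y)) \<in> borel_measurable borel" "(\<lambda>y. k (?q y)) \<in> borel_measurable borel" using g(1) k(1) by measurable
    show "k (?q y) = \<bar>det (matrix (S' y))\<bar> * g (?q (S y))" if "y \<in> ?p ` B" for y using that eq by (auto simp: det S_def)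
  qed (use g k in auto)
  also have "\<dots> = (\<integral>\<^sup>+z. ennreal (g z) * indicator (T ` B) z \<partial>lborel)" unfolding img using g B by (intro tr[symmetric])
  finally show ?thesis .
qed

section \<open>Sums of measures\<close>

text \<open>Sums of measures are written as integrals against counting measure, so that one
  statement serves the gluing of the Riemannian volume, the volume on clusters and
  \<open>q_map\<close>.\<close>

lemma sum_measure:
  fixes N :: "'i \<Rightarrow> 'a measure"
  assumes S: "\<And>i. i \<in> I \<Longrightarrow> sets (N i) = sets S"
  and M: "M = measure_of (space S) (sets S) (\<lambda>B. \<integral>\<^sup>+i. emeasure (N i) B \<partial>count_space I)"
  shows "sets M = sets S" "space M = space S"
  and "B \<in> sets S \<Longrightarrow> emeasure M B = (\<integral>\<^sup>+i. emeasure (N i) B \<partial>count_space I)"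
  and "f \<in> borel_measurable S \<Longrightarrow> (\<integral>\<^sup>+x. f x \<partial>M) = (\<integral>\<^sup>+i. \<integral>\<^sup>+x. f x \<partial>N i \<partial>count_space I)"
proof -
  show sM [simp]: "sets M = sets S" and spM: "space M = space S"
    using sets.space_closed[of S] by (simp_all add: M sets.sigma_sets_eq)
  have em: "emeasure M B = (\<integral>\<^sup>+i. emeasure (N i) B \<partial>count_space I)" if "B \<in> sets S" for B
  proof (rule emeasure_measure_of[OF M])
    show "positive (sets M) (\<lambda>B. \<integral>\<^sup>+i. emeasure (N i) B \<partial>count_space I)" by (simp add: positive_def)
    show "countably_additive (sets M) (\<lambda>B. \<integral>\<^sup>+i. emeasure (N i) B \<partial>count_space I)"
    proof (rule countably_additiveI)
      fix A :: "nat \<Rightarrow> 'a set" assume A: "range A \<subseteq> sets M" "disjoint_family A"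
      have "(\<Sum>k. \<integral>\<^sup>+i. emeasure (N i) (A k) \<partial>count_space I) = (\<integral>\<^sup>+i. (\<Sum>k. emeasure (N i) (A k)) \<partial>count_space I)"
        by (rule nn_integral_suminf[symmetric]) simp
      also have "\<dots> = (\<integral>\<^sup>+i. emeasure (N i) (\<Union>k. A k) \<partial>count_space I)"
        using A S by (intro nn_integral_cong suminf_emeasure) auto
      finally show "(\<Sum>k. \<integral>\<^sup>+i. emeasure (N i) (A k) \<partial>count_space I) = (\<integral>\<^sup>+i. emeasure (N i) (\<Union>k. A k) \<partial>count_space I)" .
    qed
  qed (use that sets.space_closed[of S] in auto)
  then show "B \<in> sets S \<Longrightarrow> emeasure M B = (\<integral>\<^sup>+i. emeasure (N i) B \<partial>count_space I)" .
  assume f: "f \<in> borel_measurable S"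
  have fM: "f \<in> borel_measurable M" using f measurable_cong_sets[OF sM refl] by blast
  have mN: "g \<in> borel_measurable (N i)" if "i \<in> I" "g \<in> borel_measurable M" for i and g :: "'a \<Rightarrow> ennreal"
    using that S measurable_cong_sets sM by metis
  show "(\<integral>\<^sup>+x. f x \<partial>M) = (\<integral>\<^sup>+i. \<integral>\<^sup>+x. f x \<partial>N i \<partial>count_space I)" using fM
  proof (induction rule: borel_measurable_induct)
    case (cong f g)
    have sp: "space (N i) = space M" if "i \<in> I" for i using S[OF that] sets_eq_imp_space_eq spM by blast
    have "(\<integral>\<^sup>+i. \<integral>\<^sup>+x. f x \<partial>N i \<partial>count_space I) = (\<integral>\<^sup>+i. \<integral>\<^sup>+x. g x \<partial>N i \<partial>count_space I)"
      by (intro nn_integral_cong) (simp add: sp cong(3))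
    then show ?case using cong by (simp cong: nn_integral_cong)
  next
    case (set A)
    have "(\<integral>\<^sup>+i. \<integral>\<^sup>+x. indicator A x \<partial>N i \<partial>count_space I) = (\<integral>\<^sup>+i. emeasure (N i) A \<partial>count_space I)"
      using set S by (intro nn_integral_cong nn_integral_indicator) auto
    then show ?case using set em by simp
  next
    case (mult u c)
    have "(\<integral>\<^sup>+i. \<integral>\<^sup>+x. c * u x \<partial>N i \<partial>count_space I) = (\<integral>\<^sup>+i. c * \<integral>\<^sup>+x. u x \<partial>N i \<partial>count_space I)"
      using mN[OF _ \<open>u \<in> borel_measurable M\<close>] by (intro nn_integral_cong nn_integral_cmult) simp
    then show ?case using mult by (simp add: nn_integral_cmult)
  next
    case (add u v)
    have "(\<integral>\<^sup>+i. \<integral>\<^sup>+x. v x + u x \<partial>N i \<partial>count_space I) = (\<integral>\<^sup>+i. (\<integral>\<^sup>+x. v x \<partial>N i) + (\<integral>\<^sup>+x. u x \<partial>N i) \<partial>count_space I)"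
      using mN[OF _ \<open>u \<in> borel_measurable M\<close>] mN[OF _ \<open>v \<in> borel_measurable M\<close>]
      by (intro nn_integral_cong nn_integral_add) simp_all
    then show ?case using add by (simp add: nn_integral_add)
  next
    case (seq U)
    have "(\<integral>\<^sup>+i. \<integral>\<^sup>+x. (SUP k. U k) x \<partial>N i \<partial>count_space I) = (\<integral>\<^sup>+i. (SUP k. \<integral>\<^sup>+x. U k x \<partial>N i) \<partial>count_space I)"
      unfolding SUP_apply using mN[OF _ seq(1)] seq(3) by (intro nn_integral_cong nn_integral_monotone_convergence_SUP) simp_all
    also have "\<dots> = (SUP k. \<integral>\<^sup>+i. \<integral>\<^sup>+x. U k x \<partial>N i \<partial>count_space I)"
      using seq(3) by (intro nn_integral_monotone_convergence_SUP)
        (auto simp: incseq_def le_fun_def intro!: nn_integral_mono)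
    also have "\<dots> = (SUP k. \<integral>\<^sup>+x. U k x \<partial>M)" using seq by simp
    also have "\<dots> = (\<integral>\<^sup>+x. (SUP k. U k) x \<partial>M)"
      unfolding SUP_apply using seq(1,3) by (intro nn_integral_monotone_convergence_SUP[symmetric]) simp_all
    finally show ?case by simp
  qed
qed

section \<open>The Riemannian volume\<close>

lemma open_not_null:
  fixes A :: "'a::euclidean_space set"
  assumes "open A" "A \<noteq> {}" shows "emeasure lborel A > 0"
proof (rule ccontr)
  assume "\<not> emeasure lborel A > 0"
  then have "A \<in> null_sets lborel" using assms by (auto simp: null_sets_def)
  then have "A \<in> null_sets lebesgue" by (rule null_sets_completionI)
  then show False using open_not_negligible[OF assms] by (simp add: negligible_iff_null_sets)
qed

context riemannian
begin

text \<open>This and the next two definitions choose default values off the chart so that the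
  functions are Borel on the whole space.\<close>

definition vol_density :: "('x, 'n) chart \<Rightarrow> real ^ 'n \<Rightarrow> real" where
  "vol_density c w = (if w \<in> chart_img c then sqrt (det (gram X c (unchart c w))) else 0)"

definition unchart_total :: "('x, 'n) chart \<Rightarrow> real ^ 'n \<Rightarrow> 'x" where
  "unchart_total c w = (if w \<in> chart_img c then unchart c w else undefined)"

definition coord_total :: "('x, 'n) chart \<Rightarrow> 'x \<Rightarrow> real ^ 'n" where
  "coord_total c x = (if x \<in> chart_dom c then coord c x else 0)"

definition chart_vol :: "('x, 'n) chart \<Rightarrow> 'x measure" where
  "chart_vol c = distr (density lborel (\<lambda>w. ennreal (vol_density c w))) borel (unchart_total c)"

lemma smooth_sqrt_det_gram:
  assumes c: "c \<in> Charts X"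
  shows "smooth_on (chart_img c) (\<lambda>w. sqrt (det (gram X c (unchart c w))))"
proof (rule smooth_on_sqrt)
  show "open (chart_img c)" using c by auto
  then show "smooth_on (chart_img c) (\<lambda>w. det (gram X c (unchart c w)))" unfolding det_def using c
    by (intro smooth_on_sum smooth_on_mult smooth_on_const smooth_on_prod gram_smooth)
  show "det (gram X c (unchart c w)) > 0" if "w \<in> chart_img c" for w using that c by (intro det_gram_pos charts_atI) auto
qed

lemma measurable_vol_density [measurable]:
  "c \<in> Charts X \<Longrightarrow> vol_density c \<in> borel_measurable borel"
  unfolding vol_density_def[abs_def] using smooth_on_continuous_on[OF smooth_sqrt_det_gram]
  by (intro borel_measurable_continuous_on_if) (auto intro: borel_open)

lemma measurable_unchart_total [measurable]:
  "c \<in> Charts X \<Longrightarrow> unchart_total c \<in> borel_measurable borel"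
  unfolding unchart_total_def[abs_def]
  using continuous_on_unchart by (intro borel_measurable_continuous_on_if) (auto intro: borel_open)

lemma measurable_coord_total [measurable]:
  "c \<in> Charts X \<Longrightarrow> coord_total c \<in> borel_measurable borel"
  unfolding coord_total_def[abs_def]
  using continuous_on_coord by (intro borel_measurable_continuous_on_if) (auto intro: borel_open)

lemma chart_dom_borel [measurable]: "c \<in> Charts X \<Longrightarrow> chart_dom c \<in> sets borel"
  and chart_img_borel [measurable]: "c \<in> Charts X \<Longrightarrow> chart_img c \<in> sets borel"
  by (auto intro: borel_open)

lemma vol_density_nonneg: "c \<in> Charts X \<Longrightarrow> vol_density c w \<ge> 0"
  and vol_density_pos: "c \<in> Charts X \<Longrightarrow> w \<in> chart_img c \<Longrightarrow> vol_density c w > 0"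
  using det_gram_pos[of c "unchart c w"] by (auto simp: vol_density_def charts_at_def less_imp_le)

lemma coord_image_borel:
  assumes "c \<in> Charts X" "B \<in> sets borel" "B \<subseteq> chart_dom c"
  shows "coord c ` B \<in> sets borel"
proof -
  have "coord c ` B = chart_img c \<inter> unchart_total c -` B"
    unfolding coord_image[OF assms(1,3)] by (auto simp: unchart_total_def)
  then show ?thesis using assms measurable_sets[OF measurable_unchart_total[OF assms(1)] assms(2)] by auto
qed

lemma sets_chart_vol [simp, measurable_cong]: "sets (chart_vol c) = sets borel"
  by (simp add: chart_vol_def)

lemma emeasure_chart_vol:
  assumes c: "c \<in> Charts X" and B: "B \<in> sets borel" "B \<subseteq> chart_dom c"
  shows "emeasure (chart_vol c) B = (\<integral>\<^sup>+w. ennreal (vol_density c w) * indicator (coord c ` B) w \<partial>lborel)"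
proof -
  have "emeasure (chart_vol c) B = (\<integral>\<^sup>+w. ennreal (vol_density c w) * indicator (unchart_total c -` B) w \<partial>lborel)"
    unfolding chart_vol_def using c B measurable_sets[OF measurable_unchart_total[OF c] B(1)]
    by (subst emeasure_distr) (auto simp: emeasure_density)
  also have "\<dots> = (\<integral>\<^sup>+w. ennreal (vol_density c w) * indicator (coord c ` B) w \<partial>lborel)" unfolding coord_image[OF c B(2)]
    by (intro nn_integral_cong) (auto simp: vol_density_def unchart_total_def split: split_indicator)
  finally show ?thesis .
qed

text \<open>The transition map is injective, and its Jacobian relates the two densities by
  \<open>sqrt_det_gram_change\<close>; the claim is the change of variables formula for it.\<close>

lemma chart_vol_overlap:
  assumes c: "c \<in> Charts X" and d: "d \<in> Charts X"
  and B: "B \<in> sets borel" "B \<subseteq> chart_dom c \<inter> chart_dom d"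
  shows "emeasure (chart_vol c) B = emeasure (chart_vol d) B"
proof -
  let ?T = "coord d \<circ> unchart c"
  have Bc: "B \<subseteq> chart_dom c" and Bd: "B \<subseteq> chart_dom d" using B(2) by blast+
  have im: "?T ` coord c ` B = coord d ` B" using c Bc by (simp add: image_image subset_iff)
  have bc: "coord c ` B \<in> sets borel" "coord d ` B \<in> sets borel" using B c d by (auto intro: coord_image_borel)
  have "(\<integral>\<^sup>+w. ennreal (vol_density c w) * indicator (coord c ` B) w \<partial>lborel) =
      (\<integral>\<^sup>+w. ennreal (vol_density d w) * indicator (?T ` coord c ` B) w \<partial>lborel)" proof (rule nn_change_of_variables)
    show "inj_on ?T (coord c ` B)"
    proof (rule inj_onI)
      fix w w' assume w: "w \<in> coord c ` B" "w' \<in> coord c ` B" "?T w = ?T w'"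
      then obtain x x' where x: "x \<in> B" "w = coord c x" "x' \<in> B" "w' = coord c x'" by blast
      have xd: "x \<in> chart_dom c" "x' \<in> chart_dom c" "x \<in> chart_dom d" "x' \<in> chart_dom d" using x B(2) by blast+
      then have "coord d x = coord d x'" using w(3) x c by simp
      then have "unchart d (coord d x) = unchart d (coord d x')" by simp
      then have "x = x'" using xd d by simp
      then show "w = w'" using x by simp
    qed
    fix w assume "w \<in> coord c ` B"
    then obtain x where x: "x \<in> B" "w = coord c x" by blast
    have xd: "x \<in> chart_dom c" "x \<in> chart_dom d" using x B(2) by blast+
    then have xc: "c \<in> charts_at X x" "d \<in> charts_at X x" using c d by (auto intro: charts_atI)
    have u: "unchart c w = x" using x xd c by simp
    show "(?T has_derivative transition_deriv c d (unchart c w)) (at w)" using transition_has_derivative[OF xc] x u by simp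
    show "vol_density c w = \<bar>det (matrix (transition_deriv c d (unchart c w)))\<bar> * vol_density d (?T w)"
      using sqrt_det_gram_change[OF xc] x xd c d by (simp add: vol_density_def)
  qed (use c d bc vol_density_nonneg im in auto)
  then show ?thesis unfolding im emeasure_chart_vol[OF c B(1) Bc] emeasure_chart_vol[OF d B(1) Bd] .
qed

lemma is_riem_volume_iff:
  "is_riem_volume X M \<longleftrightarrow> sets M = sets borel \<and>
    (\<forall>c\<in>Charts X. \<forall>B\<in>sets borel. B \<subseteq> chart_dom c \<longrightarrow> emeasure M B = emeasure (chart_vol c) B)" proof -
  have "emeasure (chart_vol c) B = (\<integral>\<^sup>+w. ennreal (sqrt (det (gram X c (unchart c w)))) * indicator (coord c ` B) w \<partial>lborel)"
    if "c \<in> Charts X" "B \<in> sets borel" "B \<subseteq> chart_dom c" for c B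
    unfolding emeasure_chart_vol[OF that] using that(3)
    by (intro nn_integral_cong) (auto simp: vol_density_def split: split_indicator)
  then show ?thesis unfolding is_riem_volume_def by auto
qed

lemma countable_atlas:
  obtains cs :: "nat \<Rightarrow> ('x, 'n) chart"
  where "\<And>n. cs n \<in> Charts X" "(\<Union>n. chart_dom (cs n)) = UNIV"
proof -
  obtain F where F: "F \<subseteq> chart_dom ` Charts X" "countable F" "\<Union>F = \<Union>(chart_dom ` Charts X)"
    by (rule Lindelof[of "chart_dom ` Charts X"]) (use open_chart_dom in blast)+
  have U: "\<Union>F = UNIV" using F(3) atlas by (simp add: smooth_atlas_def)
  then have ne: "F \<noteq> {}" by auto
  have "\<forall>n. \<exists>c. c \<in> Charts X \<and> chart_dom c = from_nat_into F n" using F(1) from_nat_into[OF ne] by (metis imageE subsetD)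
  then obtain cs where cs: "\<And>n. cs n \<in> Charts X" "\<And>n. chart_dom (cs n) = from_nat_into F n" by metis
  have "(\<Union>n. chart_dom (cs n)) = UNIV" unfolding cs(2) using U range_from_nat_into[OF ne F(2)] by simp
  then show ?thesis using that cs(1) by blast
qed

text \<open>Cut the manifold into disjoint Borel pieces D n, each inside one chart of a countable
  atlas. Existence: add up the chart volumes of the pieces; agreement on overlaps makes the sum
  correct in every chart. Uniqueness: the charts fix the values on subsets of each piece.\<close>

lemma riem_volume_ex1: "\<exists>!M. is_riem_volume X M"
proof -
  obtain cs :: "nat \<Rightarrow> ('x, 'n) chart"
    where cs: "\<And>n. cs n \<in> Charts X" "(\<Union>n. chart_dom (cs n)) = UNIV" by (rule countable_atlas) blast
  define D where "D = disjointed (\<lambda>n. chart_dom (cs n))"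
  have D: "disjoint_family D" "(\<Union>n. D n) = UNIV" "\<And>n. D n \<subseteq> chart_dom (cs n)"
    using cs(2) disjointed_subset[of "\<lambda>n. chart_dom (cs n)"] unfolding D_def
    by (simp_all only: disjoint_family_disjointed UN_disjointed_eq)
  have "range D \<subseteq> sets borel" unfolding D_def using chart_dom_borel[OF cs(1)] by (intro sets.range_disjointed_sets) auto
  then have Dm: "D n \<in> sets borel" for n by auto
  have split: "emeasure M B = (\<Sum>n. emeasure M (B \<inter> D n))" if "sets M = sets borel" "B \<in> sets borel" for M B
  proof -
    have "(\<Sum>n. emeasure M (B \<inter> D n)) = emeasure M (\<Union>n. B \<inter> D n)"
    proof (rule suminf_emeasure)
      show "range (\<lambda>n. B \<inter> D n) \<subseteq> sets M" using that Dm by auto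
      show "disjoint_family (\<lambda>n. B \<inter> D n)" using D(1) unfolding disjoint_family_on_def by blast
    qed
    moreover have "(\<Union>n. B \<inter> D n) = B" using D(2) by blast
    ultimately show ?thesis by simp
  qed
  define N where "N n = density (chart_vol (cs n)) (indicator (D n))" for n
  define M where "M = measure_of (space borel) (sets borel) (\<lambda>B. \<integral>\<^sup>+n. emeasure (N n) B \<partial>count_space UNIV)"
  have sN: "sets (N n) = sets borel" for n by (simp add: N_def)
  note sm = sum_measure[of UNIV N borel, OF sN M_def]
  have eN: "emeasure (N n) B = emeasure (chart_vol (cs n)) (B \<inter> D n)" if "B \<in> sets borel" for n B
    using that Dm by (simp add: N_def emeasure_restricted Int_commute)
  have eM: "emeasure M B = (\<Sum>n. emeasure (chart_vol (cs n)) (B \<inter> D n))" if "B \<in> sets borel" for B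
    using sm(3)[OF that] by (simp add: nn_integral_count_space_nat eN[OF that])
  have "is_riem_volume X M" unfolding is_riem_volume_iff
  proof (intro conjI ballI impI)
    show "sets M = sets borel" by (rule sm(1))
    fix c B assume c: "c \<in> Charts X" and B: "B \<in> sets borel" "B \<subseteq> chart_dom c"
    have "emeasure (chart_vol (cs n)) (B \<inter> D n) = emeasure (chart_vol c) (B \<inter> D n)" for n
      using B D(3)[of n] Dm[of n] c cs(1)[of n] by (intro chart_vol_overlap) auto
    then show "emeasure M B = emeasure (chart_vol c) B" unfolding eM[OF B(1)] using split[of "chart_vol c" B] B by simp
  qed
  moreover have "M1 = M2" if "is_riem_volume X M1" "is_riem_volume X M2" for M1 M2
  proof (rule measure_eqI)
    show "sets M1 = sets M2" using that by (simp add: is_riem_volume_iff)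
    fix B assume "B \<in> sets M1"
    then have B: "B \<in> sets borel" using that by (simp add: is_riem_volume_iff)
    have "emeasure M1 (B \<inter> D n) = emeasure M2 (B \<inter> D n)" for n
    proof -
      have "B \<inter> D n \<subseteq> chart_dom (cs n)" "B \<inter> D n \<in> sets borel" using D(3)[of n] B Dm[of n] by auto
      then show ?thesis using that cs(1)[of n] unfolding is_riem_volume_iff by metis
    qed
    then show "emeasure M1 B = emeasure M2 B" using split[of M1 B] split[of M2 B] that B by (simp add: is_riem_volume_iff)
  qed
  ultimately show ?thesis by blast
qed

abbreviation vol :: "'x measure" where "vol \<equiv> riem_volume X"

abbreviation vol_prod :: "nat \<Rightarrow> (nat \<Rightarrow> 'x) measure" where
  "vol_prod n \<equiv> Pi\<^sub>M {..<n} (\<lambda>_. vol)"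

lemma is_riem_volume: "is_riem_volume X vol"
  unfolding riem_volume_def by (rule theI'[OF riem_volume_ex1])

lemma sets_vol [simp, measurable_cong]: "sets vol = sets borel"
  using is_riem_volume by (simp add: is_riem_volume_iff)

lemma space_vol [simp]: "space vol = UNIV"
  using sets_eq_imp_space_eq[OF sets_vol] by simp

lemma emeasure_vol:
  "c \<in> Charts X \<Longrightarrow> B \<in> sets borel \<Longrightarrow> B \<subseteq> chart_dom c \<Longrightarrow> emeasure vol B = emeasure (chart_vol c) B"
  using is_riem_volume by (simp add: is_riem_volume_iff)

lemma emeasure_chart_vol_open:
  assumes c: "c \<in> Charts X" and W: "open W" "W \<noteq> {}" "W \<subseteq> chart_dom c"
  shows "emeasure (chart_vol c) W > 0"
proof (rule ccontr)
  assume "\<not> emeasure (chart_vol c) W > 0"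
  then have "(\<integral>\<^sup>+w. ennreal (vol_density c w) * indicator (coord c ` W) w \<partial>lborel) = 0"
    using W c by (simp add: emeasure_chart_vol[symmetric])
  moreover have m: "coord c ` W \<in> sets borel" using W c by (intro coord_image_borel) auto
  ultimately have "AE w in lborel. ennreal (vol_density c w) * indicator (coord c ` W) w = 0"
    using c by (subst (asm) nn_integral_0_iff_AE) auto
  then have "AE w in lborel. w \<notin> coord c ` W"
  proof eventually_elim
    case (elim w)
    show ?case
    proof
      assume "w \<in> coord c ` W"
      then have "vol_density c w > 0" using W c by (intro vol_density_pos) (auto simp: chart_img_def)
      then show False using elim \<open>w \<in> coord c ` W\<close> by simp
    qed
  qed
  then have "coord c ` W \<in> null_sets lborel" using m by (simp add: AE_iff_null_sets)
  moreover have "open (coord c ` W)" using W c by (intro open_coord_image) auto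
  ultimately show False using open_not_null[of "coord c ` W"] W(2) by (auto simp: null_sets_def)
qed

lemma emeasure_vol_open:
  assumes "open W" "W \<noteq> {}" shows "emeasure vol W > 0"
proof -
  obtain x where x: "x \<in> W" using assms by auto
  obtain c where c: "c \<in> Charts X" "x \<in> chart_dom c" using ex_chart charts_atD by blast
  have "0 < emeasure (chart_vol c) (W \<inter> chart_dom c)" using c x assms by (intro emeasure_chart_vol_open) auto
  also have "\<dots> = emeasure vol (W \<inter> chart_dom c)" using c assms by (intro emeasure_vol[symmetric]) auto
  also have "\<dots> \<le> emeasure vol W" using assms by (intro emeasure_mono) auto
  finally show ?thesis .
qed

text \<open>The absence of atoms is what later rules out coincident cluster points.\<close>

lemma emeasure_vol_singleton [simp]: "emeasure vol {x} = 0"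
proof -
  obtain c where c: "c \<in> Charts X" "x \<in> chart_dom c" using ex_chart charts_atD by blast
  have "emeasure vol {x} = (\<integral>\<^sup>+w. ennreal (vol_density c w) * indicator {coord c x} w \<partial>lborel)"
    using c by (simp add: emeasure_vol emeasure_chart_vol)
  also have "\<dots> = (\<integral>\<^sup>+(w :: real ^ 'n). 0 \<partial>lborel)"
  proof (rule nn_integral_cong_AE)
    show "AE w in lborel. ennreal (vol_density c w) * indicator {coord c x} w = 0"
      using AE_lborel_singleton[of "coord c x"] by eventually_elim auto
  qed
  finally show ?thesis by simp
qed

text \<open>The volume density is continuous, hence bounded on a closed coordinate ball.\<close>

lemma vol_locally_finite:
  assumes "open W" "x \<in> W"
  obtains U where "open U" "x \<in> U" "U \<subseteq> W" "emeasure vol U < \<infinity>"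
proof -
  obtain c where c: "c \<in> Charts X" "x \<in> chart_dom c" using ex_chart charts_atD by blast
  have "open (coord c ` (chart_dom c \<inter> W))" using c assms by (intro open_coord_image) auto
  then obtain r where r: "r > 0" "cball (coord c x) r \<subseteq> coord c ` (chart_dom c \<inter> W)"
    using open_contains_cball c assms by blast
  then have sub: "cball (coord c x) r \<subseteq> chart_img c" by (auto simp: chart_img_def)
  let ?b = "ball (coord c x) r"
  have bs: "?b \<subseteq> chart_img c" using sub ball_subset_cball by blast
  define U where "U = unchart c ` ?b"
  have U: "open U" "x \<in> U" "U \<subseteq> W" "U \<subseteq> chart_dom c"
  proof -
    show "open U" unfolding U_def using bs by (intro open_unchart_image c) auto
    show "x \<in> U" unfolding U_def using c r by (intro image_eqI[where x = "coord c x"]) auto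
    show "U \<subseteq> W" unfolding U_def using r(2) ball_subset_cball c by fastforce
    show "U \<subseteq> chart_dom c" unfolding U_def using bs c by auto
  qed
  have "compact ((\<lambda>w. sqrt (det (gram X c (unchart c w)))) ` cball (coord c x) r)"
    using continuous_on_subset[OF smooth_on_continuous_on[OF smooth_sqrt_det_gram[OF c(1)]] sub]
    by (intro compact_continuous_image) auto
  then obtain C where C: "\<And>w. w \<in> cball (coord c x) r \<Longrightarrow> sqrt (det (gram X c (unchart c w))) \<le> C"
    using compact_imp_bounded bounded_imp_bdd_above unfolding bdd_above_def by (metis imageI)
  have "(\<lambda>w. coord c (unchart c w)) ` ?b = (\<lambda>w. w) ` ?b" using bs c(1) by (intro image_cong) auto
  then have "coord c ` U = ?b" by (simp add: U_def image_image)
  then have "emeasure vol U = (\<integral>\<^sup>+w. ennreal (vol_density c w) * indicator ?b w \<partial>lborel)"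
    using c U by (simp add: emeasure_vol emeasure_chart_vol)
  also have "\<dots> \<le> (\<integral>\<^sup>+w. ennreal C * indicator ?b w \<partial>lborel)"
    using C by (intro nn_integral_mono) (auto simp: vol_density_def split: split_indicator intro!: ennreal_leI)
  also have "\<dots> = ennreal C * emeasure lborel ?b" by (rule nn_integral_cmult_indicator) simp
  also have "\<dots> < \<infinity>" using emeasure_lborel_ball_finite[of "coord c x" r] by (simp add: ennreal_mult_less_top)
  finally show ?thesis using that U by blast
qed

lemma sigma_finite_vol: "sigma_finite_measure vol"
proof -
  define F where "F = {U. open U \<and> emeasure vol U < \<infinity>}"
  have "\<Union>F = UNIV"
  proof -
    have "\<exists>U\<in>F. x \<in> U" for x by (rule vol_locally_finite[OF open_UNIV UNIV_I[of x]]) (auto simp: F_def)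
    then show ?thesis by blast
  qed
  moreover obtain G where "G \<subseteq> F" "countable G" "\<Union>G = \<Union>F" by (rule Lindelof[of F]) (auto simp: F_def)
  moreover have "U \<in> sets vol \<and> emeasure vol U \<noteq> \<infinity>" if "U \<in> F" for U using that by (auto simp: F_def borel_open)
  ultimately show ?thesis unfolding sigma_finite_measure_def by (intro exI[of _ G]) (metis space_vol subset_iff)
qed

subsection \<open>The divergence\<close>

text \<open>That the coordinate expression of the divergence does not depend on the chart is proved by
  integrating it against bump functions: by parts it is determined by the volume and the field.\<close>

definition chart_div :: "('x, 'n) chart \<Rightarrow> ('x \<Rightarrow> ('x, 'n) tangent) \<Rightarrow> 'x \<Rightarrow> real" where
  "chart_div c v x = (\<Sum>i\<in>UNIV. frechet_derivative
      (\<lambda>w. sqrt (det (gram X c (unchart c w))) * (v (unchart c w) c $ i)) (at (coord c x)) (axis i 1))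
    / sqrt (det (gram X c x))"

lemma divergence_chart_div: "divergence X v x = chart_div (chart_at X x) v x"
  by (simp add: divergence_def chart_div_def Let_def)

end

text \<open>By translation invariance every difference quotient of G has integral zero, and
  dominated convergence passes this on to the derivative.\<close>

lemma integral_deriv_compact:
  fixes G :: "'a::euclidean_space \<Rightarrow> real"
  assumes G: "smooth_on UNIV G" and L: "compact L" "\<And>w. w \<notin> L \<Longrightarrow> G w = 0"
  shows "integrable lborel (\<lambda>w. fderiv G w e)"
  and "(\<integral>w. fderiv G w e \<partial>lborel) = 0"
proof -
  let ?D = "\<lambda>w. fderiv G w e"
  have Dc: "continuous_on UNIV ?D" using smooth_on_frechet_derivative[OF G] by (rule smooth_on_continuous_on)
  have oL: "open (- L)" using compact_imp_closed[OF L(1)] by (simp add: open_Compl)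
  have D0: "?D w = 0" if "w \<notin> L" for w using frechet_derivative_cong[OF oL, of w G "\<lambda>_. 0"] that L(2)
    by (simp add: frechet_derivative_const)
  have "integrable lborel (\<lambda>w. indicator L w *\<^sub>R ?D w)"
    using L(1) continuous_on_subset[OF Dc] by (intro borel_integrable_compact) auto
  moreover have "(\<lambda>w. indicator L w *\<^sub>R ?D w) = ?D" using D0 by (auto split: split_indicator)
  ultimately show int: "integrable lborel ?D" by (simp only:)
  have "bounded (?D ` L)" using L(1) continuous_on_subset[OF Dc] by (intro compact_imp_bounded compact_continuous_image) auto
  then obtain M where M: "\<And>w. w \<in> L \<Longrightarrow> \<bar>?D w\<bar> \<le> M" by (auto simp: bounded_iff)
  define C where "C = max M 0"
  have C: "\<bar>?D w\<bar> \<le> C" for w using M[of w] D0[of w] by (cases "w \<in> L") (auto simp: C_def)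
  \<comment> \<open>All points from which a shift by t e with 0 \<le> t \<le> 1 leads into L. This
    compact set supports the difference quotients for all steps \<open>h k\<close>; on it the mean
    value theorem bounds them by C.\<close>
  define L' where "L' = (\<lambda>(l, t). l - t *\<^sub>R e) ` (L \<times> {0..1::real})"
  have L': "compact L'" unfolding L'_def using L(1)
    by (intro compact_continuous_image compact_Times) (auto intro!: continuous_intros simp: split_beta)
  define h where "h k = inverse (real (Suc k))" for k
  have h: "0 < h k" "h k \<le> 1" for k by (auto simp: h_def field_simps)
  define s where "s k w = (G (w + h k *\<^sub>R e) - G w) / h k" for k w
  have line: "((\<lambda>t. G (w + t *\<^sub>R e)) has_real_derivative ?D (w + t *\<^sub>R e)) (at t)" for w t
  proof -
    have "((\<lambda>t. w + t *\<^sub>R e) has_derivative (\<lambda>t. t *\<^sub>R e)) (at t)" by (auto intro!: derivative_eq_intros)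
    then have "((\<lambda>t. G (w + t *\<^sub>R e)) has_derivative (\<lambda>s. fderiv G (w + t *\<^sub>R e) (s *\<^sub>R e))) (at t)"
      using diff_chain_at[of _ _ t G] smooth_on_has_derivative[OF G] by (force simp: o_def)
    moreover have "linear (fderiv G (w + t *\<^sub>R e))"
      using smooth_on_differentiable[OF G] by (intro linear_frechet_derivative) auto
    ultimately show ?thesis by (simp add: has_field_derivative_def linear_scale mult.commute[of _ "?D _"] mult_commute_abs)
  qed
  have Gc: "continuous_on UNIV G" using G by (rule smooth_on_continuous_on)
  have Gm [measurable]: "G \<in> borel_measurable borel" using Gc by (rule measurable_continuous)
  have Dm [measurable]: "?D \<in> borel_measurable borel" using Dc by (rule measurable_continuous)
  have Gi: "integrable lborel G"
  proof -
    have "integrable lborel (\<lambda>w. indicator L w *\<^sub>R G w)"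
      using L(1) continuous_on_subset[OF Gc] by (intro borel_integrable_compact) auto
    moreover have "(\<lambda>w. indicator L w *\<^sub>R G w) = G" using L(2) by (auto split: split_indicator)
    ultimately show ?thesis by (simp only:)
  qed
  have "(\<lambda>k. \<integral>w. s k w \<partial>lborel) \<longlonglongrightarrow> (\<integral>w. ?D w \<partial>lborel)"
  proof (rule integral_dominated_convergence[where w = "\<lambda>w. indicator L' w *\<^sub>R C"])
    show "integrable lborel (\<lambda>w. indicator L' w *\<^sub>R C)" by (intro borel_integrable_compact L') auto
    show "s k \<in> borel_measurable lborel" for k unfolding s_def by measurable
    show "AE w in lborel. (\<lambda>k. s k w) \<longlonglongrightarrow> ?D w"
    proof (rule AE_I2)
      fix w
      have "((\<lambda>t. (G (w + t *\<^sub>R e) - G w) / t) \<longlongrightarrow> ?D w) (at 0)" using line[of w 0] by (simp add: has_field_derivative_iff)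
      moreover have "filterlim h (at 0) sequentially" unfolding filterlim_at h_def using LIMSEQ_inverse_real_of_nat by auto
      ultimately show "(\<lambda>k. s k w) \<longlonglongrightarrow> ?D w" unfolding s_def by (rule filterlim_compose)
    qed
    show "AE w in lborel. norm (s k w) \<le> indicator L' w *\<^sub>R C" for k
    proof (rule AE_I2)
      fix w
      show "norm (s k w) \<le> indicator L' w *\<^sub>R C"
      proof (cases "w \<in> L'")
        case True
        obtain z where "G (w + h k *\<^sub>R e) - G (w + 0 *\<^sub>R e) = (h k - 0) * ?D (w + z *\<^sub>R e)"
          using MVT2[of 0 "h k" "\<lambda>t. G (w + t *\<^sub>R e)" "\<lambda>t. ?D (w + t *\<^sub>R e)"] h line by blast
        then have "s k w = ?D (w + z *\<^sub>R e)" using h(1)[of k] by (simp add: s_def)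
        then show ?thesis using C True by simp
      next
        case False
        have "w \<notin> L" using False unfolding L'_def by (force intro: image_eqI[where x = "(w, 0)"])
        moreover have "w + h k *\<^sub>R e \<notin> L"
        proof
          assume "w + h k *\<^sub>R e \<in> L"
          then have "w \<in> L'" unfolding L'_def using h[of k] by (intro image_eqI[where x = "(w + h k *\<^sub>R e, h k)"]) auto
          then show False using False by simp
        qed
        ultimately show ?thesis using L(2) by (simp add: s_def C_def)
      qed
    qed
  qed simp
  moreover have "(\<integral>w. s k w \<partial>lborel) = 0" for k
  proof -
    have tr: "integrable lborel (\<lambda>w. G (w + a)) \<and> (\<integral>w. G (w + a) \<partial>lborel) = (\<integral>w. G w \<partial>lborel)" for a
    proof -
      have "integrable (distr lborel borel ((+) a)) G" "(\<integral>w. G w \<partial>distr lborel borel ((+) a)) = (\<integral>w. G w \<partial>lborel)"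
        using Gi by (simp_all add: lborel_distr_plus)
      then show ?thesis by (simp add: integrable_distr_eq integral_distr add.commute)
    qed
    then have "(\<integral>w. G (w + h k *\<^sub>R e) - G w \<partial>lborel) = 0" using Gi by (subst Bochner_Integration.integral_diff) auto
    then show ?thesis unfolding s_def by simp
  qed
  ultimately show "(\<integral>w. ?D w \<partial>lborel) = 0" by (simp add: LIMSEQ_const_iff)
qed

context riemannian
begin

lemma smooth_chart_div:
  assumes c: "c \<in> Charts X" and v: "v \<in> Vect0 X"
  shows "smooth_on (chart_img c) (chart_div c v \<circ> unchart c)"
proof -
  let ?\<rho> = "\<lambda>w. sqrt (det (gram X c (unchart c w)))"
  have pos: "?\<rho> w > 0" if "w \<in> chart_img c" for w using that c by (simp add: det_gram_pos charts_atI)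
  have "smooth_on (chart_img c) (\<lambda>w. (\<Sum>i\<in>UNIV. frechet_derivative
      (\<lambda>w. ?\<rho> w * (v (unchart c w) c $ i)) (at w) (axis i 1)) * inverse (?\<rho> w))"
    using c v pos by (intro smooth_on_mult smooth_on_sum smooth_on_frechet_derivative
        smooth_on_component smooth_on_inverse smooth_sqrt_det_gram Vect0D(2)) (auto dest: pos)
  then show ?thesis by (subst smooth_on_cong[OF open_chart_img[OF c]])
      (use c in \<open>auto simp: chart_div_def divide_inverse\<close>)
qed

lemma integral_chart_vol:
  fixes f :: "'x \<Rightarrow> real"
  assumes c: "c \<in> Charts X" and f: "f \<in> borel_measurable borel"
  shows "integrable (chart_vol c) f \<longleftrightarrow> integrable lborel (\<lambda>w. vol_density c w * f (unchart_total c w))"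
  and "(\<integral>x. f x \<partial>chart_vol c) = (\<integral>w. vol_density c w * f (unchart_total c w) \<partial>lborel)"
  using c f vol_density_nonneg[OF c] measurable_vol_density[OF c] measurable_unchart_total[OF c]
  by (simp_all add: chart_vol_def integrable_distr_eq integral_distr integrable_density integral_density)

text \<open>The divergence theorem for the field b v inside one chart: the partial derivatives of b
  times density times component integrate to zero, and their sum is the density times (b div v +
  db(v)). The function g is a global Borel version of the product, because
  \<open>chart_div c v\<close> is controlled only on the domain of c.\<close>

lemma integral_bump_chart_div:
  assumes c: "c \<in> Charts X" and v: "v \<in> Vect0 X" and b: "b \<in> C0_inf X"
  and L: "compact L" "L \<subseteq> chart_dom c" "\<And>x. x \<notin> L \<Longrightarrow> b x = 0"
  and g: "g \<in> borel_measurable borel" "\<And>x. x \<in> chart_dom c \<Longrightarrow> g x = b x * chart_div c v x"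
  shows "integrable (chart_vol c) g"
  and "(\<integral>x. g x \<partial>chart_vol c) = - (\<integral>x. differential X b x (v x) \<partial>chart_vol c)"
proof -
  let ?\<rho> = "\<lambda>w. sqrt (det (gram X c (unchart c w)))"
  let ?B = "b \<circ> unchart c"
  let ?V = "\<lambda>i w. ?\<rho> w * (v (unchart c w) c $ i)"
  let ?L = "coord c ` L"
  have oi: "open (chart_img c)" using c by auto
  have bs: "smooth_fun X b" using b by (simp add: C0_inf_def)
  have Bs: "smooth_on (chart_img c) ?B" using smooth_funD[OF bs c] .
  have Vs: "smooth_on (chart_img c) (?V i)" for i
    using c v oi by (intro smooth_on_mult smooth_on_component smooth_sqrt_det_gram Vect0D(2))
  have Lc: "compact ?L" "?L \<subseteq> chart_img c" using continuous_on_subset[OF continuous_on_coord[OF c] L(2)] L(1,2)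
    by (auto intro!: compact_continuous_image simp: chart_img_def)
  define G where "G i w = (if w \<in> chart_img c then ?B w * ?V i w else 0)" for i w
  have G0: "G i w = 0" if "w \<notin> ?L" for i w
  proof (cases "w \<in> chart_img c")
    case True
    then have "unchart c w \<notin> L" using that c by (metis coord_unchart imageI)
    then show ?thesis using L(3) by (simp add: G_def)
  qed (simp add: G_def)
  have Gs: "smooth_on UNIV (G i)" for i
  proof (rule smooth_on_local)
    fix w
    show "\<exists>U. w \<in> U \<and> smooth_on U (G i)"
    proof (cases "w \<in> chart_img c")
      case True
      have "smooth_on (chart_img c) (\<lambda>w. ?B w * ?V i w)" by (intro smooth_on_mult oi Bs Vs)
      then have "smooth_on (chart_img c) (G i)" by (subst smooth_on_cong[OF oi]) (auto simp: G_def)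
      then show ?thesis using True by blast
    next
      case False
      have o: "open (- ?L)" using compact_imp_closed[OF Lc(1)] by auto
      have "smooth_on (- ?L) (G i)" by (subst smooth_on_cong[OF o, of _ "\<lambda>_. 0"]) (auto simp: G0)
      then show ?thesis using False Lc(2) by (intro exI[of _ "- ?L"]) auto
    qed
  qed
  have DG: "fderiv (G i) w (axis i 1) = ?B w * fderiv (?V i) w (axis i 1) + fderiv ?B w (axis i 1) * ?V i w"
    if w: "w \<in> chart_img c" for i w
  proof -
    have "fderiv (G i) w = fderiv (\<lambda>w. ?B w * ?V i w) w" by (rule frechet_derivative_cong[OF oi w]) (simp add: G_def)
    also have "\<dots> = (\<lambda>e. ?B w * fderiv (?V i) w e + fderiv ?B w e * ?V i w)"
      by (rule frechet_derivative_at[symmetric], rule has_derivative_mult)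
        (rule smooth_on_has_derivative[OF Bs w] smooth_on_has_derivative[OF Vs w])+
    finally show ?thesis by simp
  qed
  define q where "q x = differential X b x (v x)" for x
  have qs: "smooth_fun X q" unfolding q_def using bs v by (rule smooth_fun_differential)
  have qm: "q \<in> borel_measurable borel" using smooth_fun_continuous[OF qs] by (rule measurable_continuous)
  have q0: "q x = 0" if "x \<notin> L" for x
  proof -
    have U: "open (- L)" using compact_imp_closed[OF L(1)] by auto
    obtain d where d: "d \<in> charts_at X x" using ex_chart by blast
    then have dc: "d \<in> Charts X" "x \<in> chart_dom d" by (auto dest: charts_atD)
    have "open (coord d ` (chart_dom d \<inter> - L))" using dc U by (intro open_coord_image) auto
    then have "fderiv (b \<circ> unchart d) (coord d x) = fderiv (\<lambda>_. 0) (coord d x)"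
      using dc that L(3) by (elim frechet_derivative_cong) auto
    then show ?thesis unfolding q_def differential_eq[OF smooth_fun_differentiable_pt[OF bs] d Vect0D(1)[OF v]]
      by (simp add: frechet_derivative_const)
  qed
  have id: "(\<Sum>i\<in>UNIV. fderiv (G i) w (axis i 1)) =
     vol_density c w * g (unchart_total c w) + vol_density c w * q (unchart_total c w)" for w proof (cases "w \<in> chart_img c")
    case True
    have ca: "c \<in> charts_at X (unchart c w)" using c True by (auto intro: charts_atI)
    have lin: "linear (fderiv ?B w)" using smooth_on_differentiable[OF Bs True] by (rule linear_frechet_derivative)
    have "q (unchart c w) = fderiv ?B w (\<Sum>i\<in>UNIV. (v (unchart c w) c $ i) *s axis i 1)" unfolding basis_expansion q_def
      using differential_eq[OF smooth_fun_differentiable_pt[OF bs] ca Vect0D(1)[OF v]] c True by simp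
    then have 1: "q (unchart c w) = (\<Sum>i\<in>UNIV. v (unchart c w) c $ i * fderiv ?B w (axis i 1))"
      by (simp add: linear_sum[OF lin] linear_scale[OF lin] scalar_mult_eq_scaleR)
    have "?\<rho> w > 0" using det_gram_pos[OF ca] by simp
    then have 2: "?\<rho> w * chart_div c v (unchart c w) = (\<Sum>i\<in>UNIV. fderiv (?V i) w (axis i 1))"
      using c True by (simp add: chart_div_def)
    have "(\<Sum>i\<in>UNIV. fderiv (G i) w (axis i 1)) = ?B w * (?\<rho> w * chart_div c v (unchart c w)) + ?\<rho> w * q (unchart c w)"
      unfolding 1 2 DG[OF True] by (simp add: sum.distrib sum_distrib_left mult_ac)
    then show ?thesis using True g(2) c by (simp add: vol_density_def unchart_total_def mult_ac)
  next
    case False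
    have "fderiv (G i) w = fderiv (\<lambda>_. 0) w" for i using G0 False Lc compact_imp_closed[OF Lc(1)]
      by (intro frechet_derivative_cong[of "- ?L"]) auto
    then show ?thesis using False by (simp add: vol_density_def frechet_derivative_const)
  qed
  have qi: "integrable lborel (\<lambda>w. vol_density c w * q (unchart_total c w))"
  proof -
    have "continuous_on ?L (\<lambda>w. ?\<rho> w * (q \<circ> unchart c) w)"
      using smooth_on_continuous_on[OF smooth_sqrt_det_gram[OF c]] smooth_on_continuous_on[OF smooth_funD[OF qs c]] Lc(2)
      by (intro continuous_on_mult) (auto intro: continuous_on_subset)
    then have "integrable lborel (\<lambda>w. indicator ?L w *\<^sub>R (?\<rho> w * (q \<circ> unchart c) w))"
      using Lc(1) by (intro borel_integrable_compact)
    moreover have "indicator ?L w *\<^sub>R (?\<rho> w * (q \<circ> unchart c) w) = vol_density c w * q (unchart_total c w)" for w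
    proof (cases "w \<in> ?L")
      case True
      then show ?thesis using Lc(2) by (auto simp: vol_density_def unchart_total_def)
    next
      case False
      then have "w \<notin> chart_img c \<or> unchart c w \<notin> L" using c by (metis coord_unchart imageI)
      then show ?thesis using False q0 by (auto simp: vol_density_def unchart_total_def)
    qed
    ultimately show ?thesis by simp
  qed
  have Si: "integrable lborel (\<lambda>w. \<Sum>i\<in>UNIV. fderiv (G i) w (axis i 1))"
    using integral_deriv_compact(1)[OF Gs Lc(1) G0] by (intro Bochner_Integration.integrable_sum)
  have S0: "(\<integral>w. (\<Sum>i\<in>UNIV. fderiv (G i) w (axis i 1)) \<partial>lborel) = 0"
    using integral_deriv_compact[OF Gs Lc(1) G0] by (subst Bochner_Integration.integral_sum) auto
  have gi: "integrable lborel (\<lambda>w. vol_density c w * g (unchart_total c w))"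
    using Bochner_Integration.integrable_diff[OF Si qi] unfolding id by simp
  then show "integrable (chart_vol c) g" using integral_chart_vol(1)[OF c g(1)] by simp
  have "(\<integral>w. vol_density c w * g (unchart_total c w) \<partial>lborel) + (\<integral>w. vol_density c w * q (unchart_total c w) \<partial>lborel) = 0"
    using S0 unfolding id using gi qi by simp
  then have "(\<integral>x. g x \<partial>chart_vol c) + (\<integral>x. q x \<partial>chart_vol c) = 0"
    using integral_chart_vol(2)[OF c g(1)] integral_chart_vol(2)[OF c qm] by simp
  then show "(\<integral>x. g x \<partial>chart_vol c) = - (\<integral>x. differential X b x (v x) \<partial>chart_vol c)" by (simp add: q_def[symmetric])
qed

lemma integral_chart_vol_overlap:
  fixes f :: "'x \<Rightarrow> real"
  assumes c: "c \<in> Charts X" and d: "d \<in> Charts X" and f: "f \<in> borel_measurable borel"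
  and 0: "\<And>x. x \<notin> chart_dom c \<inter> chart_dom d \<Longrightarrow> f x = 0"
  shows "integrable (chart_vol c) f \<longleftrightarrow> integrable (chart_vol d) f"
  and "(\<integral>x. f x \<partial>chart_vol c) = (\<integral>x. f x \<partial>chart_vol d)"
proof -
  let ?O = "chart_dom c \<inter> chart_dom d"
  have O: "?O \<in> sets borel" using c d by auto
  have eq: "density (chart_vol c) (\<lambda>x. ennreal (indicator ?O x)) = density (chart_vol d) (\<lambda>x. ennreal (indicator ?O x))"
  proof (rule measure_eqI)
    fix B assume "B \<in> sets (density (chart_vol c) (\<lambda>x. ennreal (indicator ?O x)))"
    then have B: "B \<in> sets borel" by simp
    have "emeasure (density (chart_vol e) (\<lambda>x. ennreal (indicator ?O x))) B = emeasure (chart_vol e) (?O \<inter> B)" for e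
      using B O by (simp add: emeasure_restricted ennreal_indicator)
    then show "emeasure (density (chart_vol c) (\<lambda>x. ennreal (indicator ?O x))) B =
        emeasure (density (chart_vol d) (\<lambda>x. ennreal (indicator ?O x))) B"
      using chart_vol_overlap[OF c d, of "?O \<inter> B"] B O by auto
  qed simp
  have i: "integrable (chart_vol e) f \<longleftrightarrow> integrable (density (chart_vol e) (\<lambda>x. ennreal (indicator ?O x))) f"
    "(\<integral>x. f x \<partial>chart_vol e) = (\<integral>x. f x \<partial>density (chart_vol e) (\<lambda>x. ennreal (indicator ?O x)))" for e
  proof -
    have e: "indicator ?O x *\<^sub>R f x = f x" for x using 0 by (auto split: split_indicator)
    have m: "indicator ?O \<in> borel_measurable (chart_vol e)" "f \<in> borel_measurable (chart_vol e)" using O f by auto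
    show "integrable (chart_vol e) f \<longleftrightarrow> integrable (density (chart_vol e) (\<lambda>x. ennreal (indicator ?O x))) f"
      using m by (subst integrable_density) (auto simp: e[unfolded real_scaleR_def])
    show "(\<integral>x. f x \<partial>chart_vol e) = (\<integral>x. f x \<partial>density (chart_vol e) (\<lambda>x. ennreal (indicator ?O x)))"
      using m by (subst integral_density) (auto simp: e[unfolded real_scaleR_def])
  qed
  show "integrable (chart_vol c) f \<longleftrightarrow> integrable (chart_vol d) f" unfolding i eq ..
  show "(\<integral>x. f x \<partial>chart_vol c) = (\<integral>x. f x \<partial>chart_vol d)" unfolding i eq ..
qed

lemma continuous_chart_div:
  assumes c: "c \<in> Charts X" and v: "v \<in> Vect0 X"
  shows "continuous_on (chart_dom c) (chart_div c v)"
proof -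
  have "continuous_on (chart_dom c) ((chart_div c v \<circ> unchart c) \<circ> coord c)"
    using continuous_on_compose[OF continuous_on_coord[OF c]
        smooth_on_continuous_on[OF smooth_chart_div[OF c v], unfolded chart_img_def]] .
  then show ?thesis by (rule continuous_on_eq) (use c in auto)
qed

text \<open>One inequality suffices, since c and d can be exchanged. Were it false at x0, the
  difference would be positive on an open W. Against a bump b supported in W both expressions have
  the integral of -db(v), so a nonnegative function with integral zero would be positive on a
  nonempty open set.\<close>

lemma chart_div_le:
  assumes c: "c \<in> charts_at X x0" and d: "d \<in> charts_at X x0" and v: "v \<in> Vect0 X"
  shows "chart_div c v x0 \<le> chart_div d v x0"
proof (rule ccontr)
  assume neg: "\<not> chart_div c v x0 \<le> chart_div d v x0"
  have cd: "c \<in> Charts X" "d \<in> Charts X" "x0 \<in> chart_dom c" "x0 \<in> chart_dom d" using c d by (auto dest: charts_atD)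
  let ?O = "chart_dom c \<inter> chart_dom d"
  have O: "open ?O" using cd by auto
  have cc: "continuous_on ?O (chart_div c v)" "continuous_on ?O (chart_div d v)"
    using continuous_chart_div[OF cd(1) v] continuous_chart_div[OF cd(2) v] by (auto intro: continuous_on_subset)
  define W where "W = ?O \<inter> (\<lambda>x. chart_div c v x - chart_div d v x) -` {0<..}"
  have W: "open W" "x0 \<in> W" unfolding W_def using O cc cd neg by (auto intro!: continuous_open_preimage continuous_intros)
  obtain b L where b: "b \<in> C0_inf X" "\<And>x. b x \<ge> 0" "b x0 > 0"
  and L: "compact L" "L \<subseteq> W" "\<And>x. x \<notin> L \<Longrightarrow> b x = 0"
    by (rule ex_bump[OF W]) blast
  have LO: "L \<subseteq> chart_dom c" "L \<subseteq> chart_dom d" using L(2) by (auto simp: W_def)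
  have bc: "continuous_on UNIV b" using b(1) by (intro smooth_fun_continuous) (auto simp: C0_inf_def)
  \<comment> \<open>The value zero off the overlap gives a Borel function and changes nothing,
    because b vanishes there.\<close>
  define g where "g e x = (if x \<in> ?O then b x * chart_div e v x else 0)" for e x
  have gm: "g c \<in> borel_measurable borel" "g d \<in> borel_measurable borel" unfolding g_def
    by (intro borel_measurable_continuous_on_if continuous_on_mult continuous_on_subset[OF bc subset_UNIV]
        cc continuous_on_const borel_open O)+
  have gc: "g c x = b x * chart_div c v x" "g d x = b x * chart_div d v x" for x using L(3)[of x] LO by (auto simp: g_def)
  have qd: "(\<integral>x. differential X b x (v x) \<partial>chart_vol c) = (\<integral>x. differential X b x (v x) \<partial>chart_vol d)"
  proof (rule integral_chart_vol_overlap(2)[OF cd(1,2)])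
    show "(\<lambda>x. differential X b x (v x)) \<in> borel_measurable borel"
      using b(1) v by (intro measurable_continuous smooth_fun_continuous smooth_fun_differential)
        (auto simp: C0_inf_def)
    fix x assume "x \<notin> ?O"
    then have xL: "x \<notin> L" using LO by auto
    have U: "open (- L)" using compact_imp_closed[OF L(1)] by auto
    obtain e where e: "e \<in> charts_at X x" using ex_chart by blast
    then have ec: "e \<in> Charts X" "x \<in> chart_dom e" by (auto dest: charts_atD)
    have bs: "smooth_fun X b" using b by (simp add: C0_inf_def)
    have "open (coord e ` (chart_dom e \<inter> - L))" using ec U by (intro open_coord_image) auto
    then have "fderiv (b \<circ> unchart e) (coord e x) = fderiv (\<lambda>_. 0) (coord e x)"
      using ec xL L(3) by (elim frechet_derivative_cong) auto
    then show "differential X b x (v x) = 0"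
      unfolding differential_eq[OF smooth_fun_differentiable_pt[OF bs] e Vect0D(1)[OF v]]
      by (simp add: frechet_derivative_const)
  qed
  note ic = integral_bump_chart_div[OF cd(1) v b(1) L(1) LO(1) L(3) gm(1) gc(1)]
  note idd = integral_bump_chart_div[OF cd(2) v b(1) L(1) LO(2) L(3) gm(2) gc(2)]
  have ov: "integrable (chart_vol c) (g d)" "(\<integral>x. g d x \<partial>chart_vol c) = (\<integral>x. g d x \<partial>chart_vol d)"
  proof -
    have "g d x = 0" if "x \<notin> ?O" for x using that unfolding g_def by (rule if_not_P)
    note o = integral_chart_vol_overlap[OF cd(1,2) gm(2) this]
    show "integrable (chart_vol c) (g d)" "(\<integral>x. g d x \<partial>chart_vol c) = (\<integral>x. g d x \<partial>chart_vol d)" using o idd(1) by blast+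
  qed
  have "(\<integral>x. g c x - g d x \<partial>chart_vol c) = 0" using ic idd ov qd by simp
  moreover have nn: "0 \<le> g c x - g d x" for x
  proof (cases "x \<in> L")
    case True
    then have "chart_div c v x > chart_div d v x" using L(2) by (auto simp: W_def)
    then show ?thesis using b(2)[of x] by (simp add: gc right_diff_distrib[symmetric])
  qed (simp add: gc L(3))
  ultimately have "AE x in chart_vol c. g c x - g d x = 0" using ic(1) ov(1) by (subst (asm) integral_nonneg_eq_0_iff_AE) auto
  moreover have "g c x - g d x \<noteq> 0" if "x \<in> W" "b x > 0" for x
    using that by (auto simp: gc W_def right_diff_distrib[symmetric])
  ultimately have "AE x in chart_vol c. x \<notin> W \<inter> {x. b x > 0}" by (elim AE_mp) auto
  moreover have op: "open (W \<inter> {x. b x > 0})" using W(1) bc by (intro open_Int open_Collect_less) auto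
  ultimately have "emeasure (chart_vol c) (W \<inter> {x. b x > 0}) = 0"
    by (subst (asm) AE_iff_null_sets[symmetric]) (auto simp: null_sets_def intro: borel_open)
  moreover have "emeasure (chart_vol c) (W \<inter> {x. b x > 0}) > 0"
    using W(2) b(3) by (intro emeasure_chart_vol_open cd op) (auto simp: W_def)
  ultimately show False by simp
qed

lemma divergence_eq:
  assumes "c \<in> charts_at X x" "v \<in> Vect0 X"
  shows "divergence X v x = chart_div c v x" unfolding divergence_chart_div
  using chart_div_le[OF assms(1) chart_at_in assms(2)] chart_div_le[OF chart_at_in assms] by linarith

lemma continuous_divergence:
  assumes v: "v \<in> Vect0 X" shows "continuous_on UNIV (divergence X v)"
proof (rule continuous_in_charts)
  fix c assume c: "c \<in> Charts X"
  show "continuous_on (chart_img c) (divergence X v \<circ> unchart c)" using smooth_on_continuous_on[OF smooth_chart_div[OF c v]]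
    by (rule continuous_on_eq) (use c in \<open>simp add: divergence_eq[OF charts_atI[OF c] v]\<close>)
qed

lemma divergence_outside:
  assumes v: "v \<in> Vect0 X" and K: "closed K" "\<And>x. x \<notin> K \<Longrightarrow> v x = (\<lambda>_. 0)" and x: "x \<notin> K"
  shows "divergence X v x = 0"
proof -
  obtain c where c: "c \<in> charts_at X x" using ex_chart by blast
  then have dc: "c \<in> Charts X" "x \<in> chart_dom c" by (auto dest: charts_atD)
  have "open (coord c ` (chart_dom c \<inter> - K))" using dc K by (intro open_coord_image) auto
  then have "fderiv (\<lambda>w. sqrt (det (gram X c (unchart c w))) * (v (unchart c w) c $ i)) (coord c x) =
     fderiv (\<lambda>_. 0) (coord c x)" for i using dc x K(2) by (elim frechet_derivative_cong) auto
  then show ?thesis by (simp add: divergence_eq[OF c v] chart_div_def frechet_derivative_const)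
qed

end

section \<open>Borel sets of second countable topologies\<close>

lemma space_borel_of [simp]: "space (borel_of T) = topspace T"
  and sets_borel_of: "sets (borel_of T) = sigma_sets (topspace T) {U. openin T U}"
proof -
  have "{U. openin T U} \<subseteq> Pow (topspace T)" using openin_subset by blast
  then show "space (borel_of T) = topspace T" "sets (borel_of T) = sigma_sets (topspace T) {U. openin T U}"
    by (simp_all add: borel_of_def)
qed

lemma borel_of_euclidean [simp]: "borel_of euclidean = borel"
  by (simp add: borel_of_def borel_def)

lemma borel_of_openin [intro]: "openin T U \<Longrightarrow> U \<in> sets (borel_of T)"
  by (auto simp: sets_borel_of)

lemma borel_of_closedin: "closedin T C \<Longrightarrow> C \<in> sets (borel_of T)"
proof -
  assume C: "closedin T C"
  then have "space (borel_of T) - (topspace T - C) \<in> sets (borel_of T)" by (intro sets.compl_sets borel_of_openin) auto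
  moreover have "space (borel_of T) - (topspace T - C) = C" using closedin_subset[OF C] by auto
  ultimately show ?thesis by simp
qed

lemma borel_of_singleton: "Hausdorff_space T \<Longrightarrow> x \<in> topspace T \<Longrightarrow> {x} \<in> sets (borel_of T)"
  by (intro borel_of_closedin) (simp add: closedin_Hausdorff_singleton)

lemma measurable_borel_of:
  assumes "f \<in> space M \<rightarrow> topspace T" "\<And>U. openin T U \<Longrightarrow> f -` U \<inter> space M \<in> sets M"
  shows "f \<in> measurable M (borel_of T)" unfolding borel_of_def
  using assms by (intro measurable_measure_of) (auto dest: openin_subset)

lemma continuous_map_measurable:
  "continuous_map S T f \<Longrightarrow> f \<in> measurable (borel_of S) (borel_of T)"
proof (rule measurable_borel_of)
  assume f: "continuous_map S T f"
  show "f \<in> space (borel_of S) \<rightarrow> topspace T" using f by (auto simp: continuous_map_def)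
  fix U assume "openin T U"
  then have "openin S {x \<in> topspace S. f x \<in> U}" using f by (auto simp: continuous_map_def)
  moreover have "f -` U \<inter> space (borel_of S) = {x \<in> topspace S. f x \<in> U}" by auto
  ultimately show "f -` U \<inter> space (borel_of S) \<in> sets (borel_of S)" by auto
qed

text \<open>Second countability for a topology given as an object, with the base as an argument: the
  spaces of clusters and of marked points are not types of a topological class.\<close>

definition countable_base :: "'a topology \<Rightarrow> 'a set set \<Rightarrow> bool" where
  "countable_base T B \<longleftrightarrow> countable B \<and> (\<forall>V\<in>B. openin T V) \<and> (\<forall>U x. openin T U \<and> x \<in> U \<longrightarrow> (\<exists>V\<in>B. x \<in> V \<and> V \<subseteq> U))"

lemma countable_baseD:
  assumes "countable_base T B"
  shows "countable B" "V \<in> B \<Longrightarrow> openin T V"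
  and "openin T U \<Longrightarrow> x \<in> U \<Longrightarrow> \<exists>V\<in>B. x \<in> V \<and> V \<subseteq> U"
  using assms unfolding countable_base_def by blast+

lemma countable_base_Union:
  "countable_base T B \<Longrightarrow> openin T U \<Longrightarrow> U = \<Union>{V\<in>B. V \<subseteq> U}"
  using countable_baseD(3) by fast

lemma countable_base_euclidean:
  obtains B :: "'a::second_countable_topology set set" where "countable_base euclidean B"
proof -
  obtain B :: "'a set set" where B: "countable B" "topological_basis B" using ex_countable_basis by blast
  have "countable_base euclidean B" unfolding countable_base_def
    using B topological_basis_open[OF B(2)] topological_basisE[OF B(2)] by (metis open_openin)
  then show ?thesis using that by blast
qed

lemma measurable_borel_of_base:
  assumes B: "countable_base T B" and f: "f \<in> space M \<rightarrow> topspace T"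
  and V: "\<And>V. V \<in> B \<Longrightarrow> f -` V \<inter> space M \<in> sets M"
  shows "f \<in> measurable M (borel_of T)"
proof (rule measurable_borel_of[OF f])
  fix U assume "openin T U"
  then have "U = \<Union>{V\<in>B. V \<subseteq> U}" by (rule countable_base_Union[OF B])
  then have "f -` U \<inter> space M = (\<Union>V\<in>{V\<in>B. V \<subseteq> U}. f -` V \<inter> space M)" by blast
  also have "\<dots> \<in> sets M" using countable_baseD(1)[OF B] V by (intro sets.countable_UN') auto
  finally show "f -` U \<inter> space M \<in> sets M" .
qed

lemma countable_base_prod:
  assumes B: "countable_base S B" and C: "countable_base T C"
  shows "countable_base (prod_topology S T) ((\<lambda>(U, V). U \<times> V) ` (B \<times> C))" unfolding countable_base_def
proof (intro conjI ballI allI impI)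
  show "countable ((\<lambda>(U, V). U \<times> V) ` (B \<times> C))" using countable_baseD(1)[OF B] countable_baseD(1)[OF C] by auto
  show "openin (prod_topology S T) W" if "W \<in> (\<lambda>(U, V). U \<times> V) ` (B \<times> C)" for W
    using that countable_baseD(2)[OF B] countable_baseD(2)[OF C] by (auto simp: openin_prod_Times_iff)
  fix W z assume W: "openin (prod_topology S T) W \<and> z \<in> W"
  obtain x y where z: "z = (x, y)" by (cases z)
  obtain U V where UV: "openin S U" "openin T V" "x \<in> U" "y \<in> V" "U \<times> V \<subseteq> W"
    using W unfolding z openin_prod_topology_alt by blast
  obtain U' where "U' \<in> B" "x \<in> U'" "U' \<subseteq> U" using countable_baseD(3)[OF B UV(1,3)] by blast
  moreover obtain V' where "V' \<in> C" "y \<in> V'" "V' \<subseteq> V" using countable_baseD(3)[OF C UV(2,4)] by blast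
  ultimately show "\<exists>W'\<in>(\<lambda>(U, V). U \<times> V) ` (B \<times> C). z \<in> W' \<and> W' \<subseteq> W"
    using UV(5) unfolding z by (intro bexI[of _ "U' \<times> V'"]) auto
qed

lemma sets_subset_measurable_id:
  assumes "(\<lambda>z. z) \<in> measurable M N" "space M = space N" shows "sets N \<subseteq> sets M"
proof
  fix A assume A: "A \<in> sets N"
  then have "(\<lambda>z. z) -` A \<inter> space M \<in> sets M" using assms(1) by (rule measurable_sets[rotated])
  moreover have "(\<lambda>z. z) -` A \<inter> space M = A" using sets.sets_into_space[OF A] assms(2) by blast
  ultimately show "A \<in> sets M" by simp
qed

text \<open>With countable bases an open set of the product is a countable union of open rectangles,
  hence in the product \<sigma>-algebra.\<close>

lemma sets_borel_of_prod:
  assumes B: "countable_base S B" and C: "countable_base T C"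
  shows "sets (borel_of (prod_topology S T)) = sets (borel_of S \<Otimes>\<^sub>M borel_of T)"
proof (rule antisym)
  have "(\<lambda>z. z) \<in> measurable (borel_of S \<Otimes>\<^sub>M borel_of T) (borel_of (prod_topology S T))"
  proof (rule measurable_borel_of_base[OF countable_base_prod[OF B C]])
    fix W assume "W \<in> (\<lambda>(U, V). U \<times> V) ` (B \<times> C)"
    then obtain U V where UV: "U \<in> B" "V \<in> C" "W = U \<times> V" by auto
    then have "U \<times> V \<in> sets (borel_of S \<Otimes>\<^sub>M borel_of T)" using countable_baseD(2)[OF B] countable_baseD(2)[OF C] by auto
    then show "(\<lambda>z. z) -` W \<inter> space (borel_of S \<Otimes>\<^sub>M borel_of T) \<in> sets (borel_of S \<Otimes>\<^sub>M borel_of T)" using UV by auto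
  qed (auto simp: space_pair_measure)
  then show "sets (borel_of (prod_topology S T)) \<subseteq> sets (borel_of S \<Otimes>\<^sub>M borel_of T)"
    by (rule sets_subset_measurable_id) (simp add: space_pair_measure)
  have "fst \<in> measurable (borel_of (prod_topology S T)) (borel_of S)"
    "snd \<in> measurable (borel_of (prod_topology S T)) (borel_of T)"
    by (auto intro: continuous_map_measurable continuous_map_fst continuous_map_snd)
  then have "(\<lambda>z. z) \<in> measurable (borel_of (prod_topology S T)) (borel_of S \<Otimes>\<^sub>M borel_of T)"
    by (subst measurable_pair_iff) (auto simp: o_def)
  then show "sets (borel_of S \<Otimes>\<^sub>M borel_of T) \<subseteq> sets (borel_of (prod_topology S T))"
    by (rule sets_subset_measurable_id) (simp add: space_pair_measure)
qed

section \<open>The space of clusters\<close>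

lemma topspace_cluster: "clusters = Sigma UNIV (\<lambda>n. {..<n} \<rightarrow>\<^sub>E UNIV)"
  unfolding cluster_top_def topspace_sum_topology by (simp add: o_def)

lemma in_cluster_iff: "ys \<in> clusters \<longleftrightarrow> snd ys \<in> {..<fst ys} \<rightarrow>\<^sub>E UNIV"
  by (cases ys) (simp add: topspace_cluster)

definition cluster_box :: "nat \<Rightarrow> (nat \<Rightarrow> 'x set) \<Rightarrow> 'x cluster set" where
  "cluster_box n U = {n} \<times> (PiE {..<n} U)"

definition cluster_base :: "'x set set \<Rightarrow> 'x cluster set set" where
  "cluster_base B = (\<Union>n. cluster_box n ` ({..<n} \<rightarrow>\<^sub>E B))"

lemma mem_cluster_box: "(m, y) \<in> cluster_box n U \<longleftrightarrow> m = n \<and> y \<in> PiE {..<n} U"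
  and cluster_box_subset: "cluster_box n U \<subseteq> W \<longleftrightarrow> PiE {..<n} U \<subseteq> {y. (n, y) \<in> W}"
  unfolding cluster_box_def by blast+

lemma openin_cluster_iff:
  "openin (cluster_top :: 'x::topological_space cluster topology) W \<longleftrightarrow> W \<subseteq> clusters \<and>
     (\<forall>n y. (n, y) \<in> W \<longrightarrow> (\<exists>U. (\<forall>i<n. open (U i)) \<and> (n, y) \<in> cluster_box n U \<and> cluster_box n U \<subseteq> W))" proof -
  have 1: "openin (product_topology (\<lambda>_. euclidean) {..<n}) {y. (n, y) \<in> W} \<longleftrightarrow>
     (\<forall>y. (n, y) \<in> W \<longrightarrow> (\<exists>U. (\<forall>i<n. open (U i)) \<and> (n, y) \<in> cluster_box n U \<and> cluster_box n U \<subseteq> W))" for n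
    unfolding openin_product_topology_alt mem_cluster_box cluster_box_subset by (simp add: Ball_def)
  have 2: "openin (cluster_top :: 'x cluster topology) W \<longleftrightarrow> W \<subseteq> clusters \<and>
     (\<forall>n\<in>UNIV. openin (product_topology (\<lambda>_. euclidean) {..<n}) {y. (n, y) \<in> W})"
    unfolding cluster_top_def openin_sum_topology topspace_sum_topology by simp
  show ?thesis unfolding 2 1 by blast
qed

lemma openin_cluster_box: "(\<And>i. i < n \<Longrightarrow> open (U i)) \<Longrightarrow> openin cluster_top (cluster_box n U)"
  unfolding openin_cluster_iff by (auto simp: cluster_box_def topspace_cluster PiE_iff)

lemma countable_base_cluster:
  assumes B: "countable_base (euclidean :: 'x::topological_space topology) B"
  shows "countable_base cluster_top (cluster_base B)" unfolding countable_base_def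
proof (intro conjI ballI allI impI)
  show "countable (cluster_base B)" unfolding cluster_base_def
    using countable_baseD(1)[OF B] by (intro countable_UN countable_image countable_PiE) auto
  show "openin cluster_top W" if "W \<in> cluster_base B" for W
    using that countable_baseD(2)[OF B] by (auto simp: cluster_base_def intro!: openin_cluster_box)
  fix W and z :: "'x cluster" assume W: "openin cluster_top W \<and> z \<in> W"
  obtain n y where z: "z = (n, y)" by (cases z)
  obtain U where U: "\<forall>i<n. open (U i)" "(n, y) \<in> cluster_box n U" "cluster_box n U \<subseteq> W"
    using W unfolding z openin_cluster_iff by blast
  have "\<forall>i\<in>{..<n}. \<exists>V. V \<in> B \<and> y i \<in> V \<and> V \<subseteq> U i"
  proof
    fix i assume i: "i \<in> {..<n}"
    then have "openin euclidean (U i)" "y i \<in> U i" using U(1,2) by (auto simp: cluster_box_def PiE_iff)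
    then show "\<exists>V. V \<in> B \<and> y i \<in> V \<and> V \<subseteq> U i" using countable_baseD(3)[OF B] by blast
  qed
  then obtain V where V: "\<And>i. i < n \<Longrightarrow> V i \<in> B \<and> y i \<in> V i \<and> V i \<subseteq> U i" by (metis lessThan_iff)
  let ?V = "restrict V {..<n}"
  have "cluster_box n ?V \<in> cluster_base B" using V by (auto simp: cluster_base_def intro!: image_eqI)
  moreover have "z \<in> cluster_box n ?V" using U(2) V by (auto simp: z cluster_box_def PiE_iff)
  moreover have "cluster_box n ?V \<subseteq> cluster_box n U" using V by (fastforce simp: cluster_box_def PiE_iff)
  ultimately show "\<exists>V\<in>cluster_base B. z \<in> V \<and> V \<subseteq> W" using U(3) by blast
qed

lemma Hausdorff_cluster: "Hausdorff_space (cluster_top :: 'x::t2_space cluster topology)"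
  unfolding Hausdorff_space_def
proof (intro allI impI)
  fix z z' :: "'x cluster"
  assume *: "z \<in> clusters \<and> z' \<in> clusters \<and> z \<noteq> z'"
  obtain n y m y' where z: "z = (n, y)" "z' = (m, y')" by (cases z, cases z')
  show "\<exists>U V. openin cluster_top U \<and> openin cluster_top V \<and> z \<in> U \<and> z' \<in> V \<and> disjnt U V"
  proof (cases "n = m")
    case False
    then show ?thesis using * z by (intro exI[of _ "cluster_box n (\<lambda>_. UNIV)"] exI[of _ "cluster_box m (\<lambda>_. UNIV)"])
        (auto intro!: openin_cluster_box simp: mem_cluster_box disjnt_def topspace_cluster)
  next
    case True
    then have yy: "y \<noteq> y'" "y \<in> {..<n} \<rightarrow>\<^sub>E UNIV" "y' \<in> {..<n} \<rightarrow>\<^sub>E UNIV" using * z by (auto simp: topspace_cluster)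
    then obtain i where i: "i < n" "y i \<noteq> y' i" by (metis PiE_ext lessThan_iff)
    obtain U V where UV: "open U" "open V" "y i \<in> U" "y' i \<in> V" "U \<inter> V = {}" using hausdorff[OF i(2)] by blast
    have "disjnt (cluster_box n (\<lambda>j. if j = i then U else UNIV)) (cluster_box n (\<lambda>j. if j = i then V else UNIV))"
    proof -
      have "snd w i \<in> U \<inter> V" if "w \<in> cluster_box n (\<lambda>j. if j = i then U else UNIV)"
        "w \<in> cluster_box n (\<lambda>j. if j = i then V else UNIV)" for w :: "'x cluster"
        using that PiE_mem[of "snd w" "{..<n}" _ i] i(1) by (auto simp: cluster_box_def dest: PiE_mem[of _ _ _ i])
      then show ?thesis using UV(5) unfolding disjnt_def by blast
    qed
    moreover have "z \<in> cluster_box n (\<lambda>j. if j = i then U else UNIV)" "z' \<in> cluster_box n (\<lambda>j. if j = i then V else UNIV)"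
      using yy UV by (auto simp: z True[symmetric] cluster_box_def PiE_iff)
    ultimately show ?thesis using UV(1,2) openin_cluster_box[of n "\<lambda>j. if j = i then U else UNIV"]
        openin_cluster_box[of n "\<lambda>j. if j = i then V else UNIV"] by fastforce
  qed
qed

abbreviation cborel :: "'x::topological_space cluster measure" where
  "cborel \<equiv> borel_of cluster_top"

abbreviation pair_borel :: "('a::topological_space \<times> 'x::topological_space cluster) measure" where
  "pair_borel \<equiv> borel \<Otimes>\<^sub>M cborel"

lemma measurable_cluster_size [measurable]:
  "fst \<in> measurable (cborel :: 'x::topological_space cluster measure) (count_space UNIV)"
  unfolding measurable_count_space_eq2_countable
proof (intro conjI ballI)
  fix n :: nat
  have "fst -` {n} \<inter> space cborel = (cluster_box n (\<lambda>_. UNIV) :: 'x cluster set)"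
  proof (rule set_eqI)
    fix ys :: "'x cluster"
    show "ys \<in> fst -` {n} \<inter> space cborel \<longleftrightarrow> ys \<in> cluster_box n (\<lambda>_. UNIV)"
      by (cases ys) (auto simp: mem_cluster_box topspace_cluster)
  qed
  moreover have "openin cluster_top (cluster_box n (\<lambda>_. UNIV) :: 'x cluster set)" by (rule openin_cluster_box) auto
  ultimately show "fst -` {n} \<inter> space (cborel :: 'x cluster measure) \<in> sets cborel"
    by (auto simp del: space_borel_of)
qed auto

lemma measurable_cluster_component [measurable]:
  "(\<lambda>ys. snd ys i) \<in> borel_measurable (cborel :: 'x::topological_space cluster measure)"
proof (rule borel_measurableI)
  fix S :: "'x set" assume S: "open S"
  \<comment> \<open>On clusters with at most i points the extensional tuple has the value
    \<open>undefined\<close> at i, so such clusters belong to the preimage according to whether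
    \<open>undefined\<close> is in S.\<close>
  have "(\<lambda>ys. snd ys i) -` S \<inter> space cborel = (\<Union>n. if i < n then cluster_box n (\<lambda>j. if j = i then S else UNIV) else
        if undefined \<in> S then cluster_box n (\<lambda>_. UNIV) else {})" proof (rule set_eqI) fix ys :: "'x cluster"
    obtain n y where ys: "ys = (n, y)" by (cases ys)
    show "ys \<in> (\<lambda>ys. snd ys i) -` S \<inter> space cborel \<longleftrightarrow>
      ys \<in> (\<Union>n. if i < n then cluster_box n (\<lambda>j. if j = i then S else UNIV) else
        if undefined \<in> S then cluster_box n (\<lambda>_. UNIV) else {})" by (cases "i < n"; cases "undefined \<in> S")
        (auto simp: ys cluster_box_def PiE_iff extensional_def topspace_cluster)
  qed
  moreover have F: "(if i < n then cluster_box n (\<lambda>j. if j = i then S else UNIV) else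
        if undefined \<in> S then cluster_box n (\<lambda>_. UNIV) else {}) \<in> sets cborel" for n
    using S by (auto intro!: openin_cluster_box)
  have "(\<Union>n. if i < n then cluster_box n (\<lambda>j. if j = i then S else UNIV) else
        if undefined \<in> S then cluster_box n (\<lambda>_. UNIV) else {}) \<in> sets cborel"
    by (rule sets.countable_UN) (use F in blast)
  ultimately show "(\<lambda>ys. snd ys i) -` S \<inter> space cborel \<in> sets cborel" by simp
qed

lemma measurable_into_cluster:
  fixes g :: "'a \<Rightarrow> 'x::second_countable_topology cluster"
  assumes g: "g \<in> space M \<rightarrow> clusters"
  and 1: "(\<lambda>x. fst (g x)) \<in> measurable M (count_space UNIV)"
  and 2: "\<And>i. (\<lambda>x. snd (g x) i) \<in> borel_measurable M"
  shows "g \<in> measurable M cborel"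
proof -
  obtain B :: "'x set set" where B: "countable_base euclidean B" by (rule countable_base_euclidean)
  show ?thesis
  proof (rule measurable_borel_of_base[OF countable_base_cluster[OF B] g])
    fix V :: "'x cluster set" assume "V \<in> cluster_base B"
    then obtain n U where V: "V = cluster_box n U" "U \<in> {..<n} \<rightarrow>\<^sub>E B" by (auto simp: cluster_base_def)
    define U' where "U' i = (if i < n then U i else UNIV)" for i
    have [measurable]: "U' i \<in> sets borel" for i
      using V(2) countable_baseD(2)[OF B] by (auto simp: U'_def PiE_iff intro: borel_open)
    note [measurable] = 1 2
    have "{x\<in>space M. fst (g x) = n \<and> (\<forall>i\<in>{..<n}. snd (g x) i \<in> U' i)} \<in> sets M" by measurable
    moreover have "g x \<in> V \<longleftrightarrow> fst (g x) = n \<and> (\<forall>i\<in>{..<n}. snd (g x) i \<in> U' i)" if "x \<in> space M" for x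
    proof -
      have "snd (g x) \<in> {..<fst (g x)} \<rightarrow>\<^sub>E UNIV" using g that in_cluster_iff by blast
      then show ?thesis by (cases "g x") (auto simp: V(1) mem_cluster_box PiE_iff U'_def)
    qed
    then have "g -` V \<inter> space M = {x\<in>space M. fst (g x) = n \<and> (\<forall>i\<in>{..<n}. snd (g x) i \<in> U' i)}" by blast
    ultimately show "g -` V \<inter> space M \<in> sets M" by simp
  qed
qed

subsection \<open>The volume on clusters\<close>

lemma prod_ennreal_pos:
  fixes f :: "'i \<Rightarrow> ennreal"
  shows "(\<And>i. i \<in> I \<Longrightarrow> 0 < f i) \<Longrightarrow> 0 < (\<Prod>i\<in>I. f i)"
  by (induction I rule: infinite_finite_induct) (auto simp: ennreal_zero_less_mult_iff)

lemma prod_ennreal_finite: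
  fixes f :: "'i \<Rightarrow> ennreal"
  shows "(\<And>i. i \<in> I \<Longrightarrow> f i < \<infinity>) \<Longrightarrow> (\<Prod>i\<in>I. f i) < \<infinity>"
  by (induction I rule: infinite_finite_induct) (auto simp: ennreal_mult_less_top)

context riemannian
begin

lemma vol_product: "product_sigma_finite (\<lambda>_::nat. vol)"
  by (rule product_sigma_finite.intro) (rule sigma_finite_vol)

definition vol_n :: "nat \<Rightarrow> 'x cluster measure" where
  "vol_n n = distr (vol_prod n) cborel (\<lambda>y. (n, y))"

lemma measurable_Pair_cluster [measurable]:
  "(\<lambda>y. (n, y)) \<in> measurable (vol_prod n) cborel"
proof (rule measurable_into_cluster)
  show "(\<lambda>y. (n, y)) \<in> space (vol_prod n) \<rightarrow> clusters" by (simp add: space_PiM Pi_iff topspace_cluster)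
  show "(\<lambda>y. snd (n, y) i) \<in> borel_measurable (vol_prod n)" for i
  proof (cases "i < n")
    case False
    then have "snd (n, y) i = undefined" if "y \<in> space (vol_prod n)" for y
      using that by (auto simp: space_PiM PiE_iff extensional_def)
    then have "(\<lambda>y. snd (n, y) i) \<in> borel_measurable (vol_prod n) \<longleftrightarrow> (\<lambda>_. undefined :: 'x) \<in> borel_measurable (vol_prod n)"
      by (rule measurable_cong)
    then show ?thesis by simp
  qed (use measurable_component_singleton[of i "{..<n}" "\<lambda>_. vol"] in auto)
qed simp

lemma sets_vol_n [simp, measurable_cong]: "sets (vol_n n) = sets cborel"
  by (simp add: vol_n_def)

lemma cluster_volume_eq:
  "cluster_volume X = measure_of (space cborel) (sets cborel)
     (\<lambda>B. \<integral>\<^sup>+n. emeasure (vol_n n) B \<partial>count_space UNIV)" unfolding cluster_volume_def space_borel_of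
proof (rule measure_of_eq)
  show "sets cborel \<subseteq> Pow (topspace (cluster_top :: 'x cluster topology))"
    using sets.space_closed[of "cborel :: 'x cluster measure"] by simp
  fix B assume "B \<in> sigma_sets (clusters) (sets (cborel :: 'x cluster measure))"
  then have B: "B \<in> sets (cborel :: 'x cluster measure)"
    using sets.sigma_sets_eq[of "cborel :: 'x cluster measure"] by simp
  have "emeasure (vol_n n) B = emeasure (vol_prod n) {y. (n, y) \<in> B}" for n
  proof -
    have "(\<lambda>y. (n, y)) -` B \<inter> space (vol_prod n) = {y. (n, y) \<in> B}"
      using sets.sets_into_space[OF B] by (auto simp: space_PiM topspace_cluster)
    then show ?thesis unfolding vol_n_def using B by (simp add: emeasure_distr)
  qed
  then show "(\<Sum>n. emeasure (vol_prod n) {y. (n, y) \<in> B}) = (\<integral>\<^sup>+n. emeasure (vol_n n) B \<partial>count_space UNIV)"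
    by (simp add: nn_integral_count_space_nat)
qed

abbreviation cvol :: "'x cluster measure" where "cvol \<equiv> cluster_volume X"

lemmas cvol_sum = sum_measure[of UNIV vol_n cborel, OF sets_vol_n cluster_volume_eq]

lemma sets_cvol [simp, measurable_cong]: "sets cvol = sets cborel"
  and space_cvol [simp]: "space cvol = clusters"
  using cvol_sum by simp_all

lemma emeasure_cvol_box:
  assumes U: "\<And>i. i < n \<Longrightarrow> open (U i)"
  shows "emeasure cvol (cluster_box n U) = (\<Prod>i<n. emeasure vol (U i))"
proof -
  interpret product_sigma_finite "\<lambda>_::nat. vol" by (rule vol_product)
  have m: "cluster_box n U \<in> sets cborel" using openin_cluster_box[OF U] by auto
  have "emeasure (vol_n k) (cluster_box n U) = (\<Prod>i<n. emeasure vol (U i)) * indicator {n} k" for k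
  proof (cases "k = n")
    case True
    have "(\<lambda>y. (n, y)) -` cluster_box n U \<inter> space (vol_prod n) = PiE {..<n} U"
      by (auto simp: cluster_box_def space_PiM PiE_iff)
    moreover have "emeasure (vol_prod n) (PiE {..<n} U) = (\<Prod>i<n. emeasure vol (U i))"
      using U by (subst product_sigma_finite.emeasure_PiM[OF vol_product]) (auto intro: borel_open)
    ultimately show ?thesis using True m by (simp add: vol_n_def emeasure_distr)
  next
    case False
    then have "(\<lambda>y. (k, y)) -` cluster_box n U \<inter> space (Pi\<^sub>M {..<k} (\<lambda>_. vol)) = {}" by (auto simp: cluster_box_def)
    then show ?thesis using False m by (simp add: vol_n_def emeasure_distr)
  qed
  then have "emeasure cvol (cluster_box n U) = (\<integral>\<^sup>+k. (\<Prod>i<n. emeasure vol (U i)) * indicator {n} k \<partial>count_space UNIV)"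
    using cvol_sum(3)[OF m] by simp
  also have "\<dots> = (\<Prod>i<n. emeasure vol (U i))" by (subst nn_integral_cmult_indicator) auto
  finally show ?thesis .
qed

text \<open>The strict bounds on the volume allow a factor to be cancelled: from r vol V \<le> s vol
  V one may conclude r \<le> s. This is used in \<open>h_ge_iff\<close>.\<close>

definition finite_base :: "'x set set \<Rightarrow> bool" where
  "finite_base B \<longleftrightarrow> countable_base euclidean B \<and> (\<forall>U\<in>B. 0 < emeasure vol U \<and> emeasure vol U < \<infinity>)"

lemma ex_finite_base: obtains B where "finite_base B"
proof -
  obtain B :: "'x set set" where B: "countable_base euclidean B" by (rule countable_base_euclidean)
  define C where "C = {U\<in>B. U \<noteq> {} \<and> emeasure vol U < \<infinity>}"
  have "countable_base euclidean C" unfolding countable_base_def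
  proof (intro conjI ballI allI impI)
    show "countable C" using countable_baseD(1)[OF B] by (simp add: C_def)
    show "openin euclidean V" if "V \<in> C" for V using that countable_baseD(2)[OF B] by (simp add: C_def)
    fix U :: "'x set" and x assume "openin euclidean U \<and> x \<in> U"
    then have U: "open U" "x \<in> U" by auto
    obtain W where W: "open W" "x \<in> W" "W \<subseteq> U" "emeasure vol W < \<infinity>" by (rule vol_locally_finite[OF U]) blast
    then obtain V where V: "V \<in> B" "x \<in> V" "V \<subseteq> W" using countable_baseD(3)[OF B, of W x] by auto
    have "emeasure vol V \<le> emeasure vol W" using V(3) W(1) by (intro emeasure_mono) auto
    then have "V \<in> C" using V W(4) by (auto simp: C_def)
    then show "\<exists>V\<in>C. x \<in> V \<and> V \<subseteq> U" using V W by blast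
  qed
  moreover have "0 < emeasure vol U" if "U \<in> C" for U
    using that countable_baseD(2)[OF B] by (intro emeasure_vol_open) (auto simp: C_def)
  ultimately have "finite_base C" by (auto simp: finite_base_def C_def)
  then show ?thesis using that by blast
qed

lemma cvol_cluster_base:
  assumes B: "finite_base B" and W: "W \<in> cluster_base B"
  shows "0 < emeasure cvol W" "emeasure cvol W < \<infinity>"
proof -
  obtain n U where V: "W = cluster_box n U" "U \<in> {..<n} \<rightarrow>\<^sub>E B" using W by (auto simp: cluster_base_def)
  have U: "open (U i)" "0 < emeasure vol (U i)" "emeasure vol (U i) < \<infinity>" if "i < n" for i
    using V(2) that B by (auto simp: finite_base_def PiE_iff countable_base_def)
  have "emeasure cvol W = (\<Prod>i<n. emeasure vol (U i))" unfolding V(1) using U(1) by (rule emeasure_cvol_box)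
  moreover have "0 < (\<Prod>i<n. emeasure vol (U i))" using U(2) by (intro prod_ennreal_pos) auto
  moreover have "(\<Prod>i<n. emeasure vol (U i)) < \<infinity>" using U(3) by (intro prod_ennreal_finite) auto
  ultimately show "0 < emeasure cvol W" "emeasure cvol W < \<infinity>" by auto
qed

subsection \<open>Coincidences of points\<close>

lemma AE_cvol_I:
  assumes "Measurable.pred cborel P" "\<And>n. AE y in vol_prod n. P (n, y)"
  shows "AE ys in cvol. P ys"
proof -
  note assms(1)[measurable]
  have m: "{ys\<in>space cborel. \<not> P ys} \<in> sets cborel" by measurable
  have m': "{ys\<in>space cborel. P ys} \<in> sets cborel" by measurable
  have "emeasure (vol_n n) {ys\<in>space cborel. \<not> P ys} = 0" for n
  proof -
    have "AE ys in vol_n n. P ys"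
      unfolding vol_n_def using assms(2) by (subst AE_distr_iff[OF measurable_Pair_cluster m']) auto
    then show ?thesis using m by (subst (asm) AE_iff_measurable[where N = "{ys\<in>space cborel. \<not> P ys}"])
        (auto simp: sets_eq_imp_space_eq[OF sets_vol_n])
  qed
  then have "emeasure cvol {ys\<in>space cborel. \<not> P ys} = 0" using cvol_sum(3)[OF m] by simp
  then show ?thesis using m by (subst AE_iff_measurable[where N = "{ys\<in>space cborel. \<not> P ys}"]) auto
qed

lemma AE_cvol_avoid:
  assumes S: "countable S"
  shows "AE ys in cvol. \<forall>i<fst ys. snd ys i \<notin> S"
proof (rule AE_cvol_I)
  interpret product_sigma_finite "\<lambda>_::nat. vol" by (rule vol_product)
  have "S \<in> sets borel" using S by (rule sets.countable[rotated]) auto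
  then show "Measurable.pred cborel (\<lambda>ys. \<forall>i<fst ys. snd ys i \<notin> S)" by measurable
  fix n :: nat
  have "AE y in vol_prod n. y i \<noteq> s" if i: "i \<in> {..<n}" for i s
  proof -
    let ?A = "PiE {..<n} (\<lambda>j. if j = i then {s} else UNIV)"
    have "emeasure (vol_prod n) ?A = (\<Prod>j<n. emeasure vol (if j = i then {s} else UNIV))"
      by (subst product_sigma_finite.emeasure_PiM[OF vol_product]) auto
    also have "\<dots> = 0" using i by (intro prod_zero) (auto intro!: bexI[of _ i])
    finally have "?A \<in> null_sets (vol_prod n)" by (auto intro!: sets_PiM_I_finite)
    moreover have "{y\<in>space (vol_prod n). \<not> y i \<noteq> s} \<subseteq> ?A" by (auto simp: space_PiM PiE_iff extensional_def)
    ultimately show ?thesis by (rule AE_I')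
  qed
  then have "AE y in vol_prod n. \<forall>s\<in>S. y i \<noteq> s" if "i \<in> {..<n}" for i using that by (subst AE_ball_countable[OF S]) blast
  then have "AE y in vol_prod n. \<forall>i\<in>{..<n}. \<forall>s\<in>S. y i \<noteq> s" by (rule AE_finite_allI[OF finite_lessThan])
  then show "AE y in vol_prod n. \<forall>i<fst (n, y). snd (n, y) i \<notin> S" by eventually_elim auto
qed

text \<open>The diagonal is closed by the Hausdorff property, and second countability puts closed
  sets of the product into the product \<sigma>-algebra.\<close>

lemma diagonal_measurable: "{z :: 'x \<times> 'x. fst z = snd z} \<in> sets (borel \<Otimes>\<^sub>M borel)"
proof -
  have "{z :: 'x \<times> 'x. fst z = snd z} = {z. \<exists>x. z = (x, x)}" by auto
  then have "{z :: 'x \<times> 'x. fst z = snd z} \<in> sets borel" using closed_diagonal[where 'a = 'x] by (simp add: borel_closed)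
  then show ?thesis unfolding borel_prod .
qed

lemma pred_eq_point [measurable (raw)]:
  assumes [measurable]: "f \<in> borel_measurable M" "g \<in> borel_measurable M"
  shows "Measurable.pred M (\<lambda>x. (f x :: 'x) = g x)"
proof -
  have "(\<lambda>x. (f x, g x)) \<in> measurable M (borel \<Otimes>\<^sub>M borel)" by measurable
  then have "(\<lambda>x. (f x, g x)) -` {z. fst z = snd z} \<inter> space M \<in> sets M" using diagonal_measurable by (rule measurable_sets)
  moreover have "(\<lambda>x. (f x, g x)) -` {z. fst z = snd z} \<inter> space M = {x\<in>space M. f x = g x}" by auto
  ultimately show ?thesis by (simp add: pred_def)
qed

text \<open>By Tonelli with coordinate i integrated first, the coincidence of the coordinates i and
  j has the volume of the single point y j, which is zero.\<close>

lemma AE_cvol_distinct: "AE ys in cvol. inj_on (snd ys) {..<fst ys}"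
proof -
  have "AE ys in cvol. \<forall>i<fst ys. \<forall>j<fst ys. i \<noteq> j \<longrightarrow> snd ys i \<noteq> snd ys j"
  proof (rule AE_cvol_I)
    interpret product_sigma_finite "\<lambda>_::nat. vol" by (rule vol_product)
    show "Measurable.pred cborel (\<lambda>ys :: 'x cluster. \<forall>i<fst ys. \<forall>j<fst ys. i \<noteq> j \<longrightarrow> snd ys i \<noteq> snd ys j)" by measurable
    fix n :: nat
    have "AE y in vol_prod n. y i \<noteq> y j" if ij: "i \<in> {..<n}" "j \<in> {..<n}" "i \<noteq> j" for i j
    proof -
      let ?I = "{..<n} - {i}"
      have I: "insert i ?I = {..<n}" using ij by auto
      have m: "(\<lambda>y. indicator {y. y i = y j} y :: ennreal) \<in> borel_measurable (vol_prod n)"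
      proof -
        have [measurable]: "(\<lambda>y. y i) \<in> borel_measurable (vol_prod n)"
          using measurable_component_singleton[OF ij(1), of "\<lambda>_. vol"] by (simp only: measurable_cong_sets[OF refl sets_vol])
        have [measurable]: "(\<lambda>y. y j) \<in> borel_measurable (vol_prod n)"
          using measurable_component_singleton[OF ij(2), of "\<lambda>_. vol"] by (simp only: measurable_cong_sets[OF refl sets_vol])
        have "(\<lambda>y. indicator {y. y i = y j} y :: ennreal) = (\<lambda>y. if y i = y j then 1 else 0)" by (auto simp: fun_eq_iff)
        then show ?thesis by simp
      qed
      have "(\<integral>\<^sup>+y. indicator {y. y i = y j} y \<partial>vol_prod n) =
          (\<integral>\<^sup>+y. \<integral>\<^sup>+x. indicator {y. y i = y j} (y(i := x)) \<partial>vol \<partial>Pi\<^sub>M ?I (\<lambda>_. vol))"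
        using product_nn_integral_insert[of ?I i "\<lambda>y. indicator {y. y i = y j} y"] m unfolding I by simp
      also have "\<dots> = (\<integral>\<^sup>+y. \<integral>\<^sup>+x. indicator {y j} x \<partial>vol \<partial>Pi\<^sub>M ?I (\<lambda>_. vol))"
        using ij(3) by (intro nn_integral_cong) (auto split: split_indicator)
      also have "\<dots> = 0" by simp
      finally have "AE y in vol_prod n. (indicator {y. y i = y j} y :: ennreal) = 0"
        using m by (subst (asm) nn_integral_0_iff_AE) auto
      then show ?thesis by eventually_elim (auto split: split_indicator_asm)
    qed
    then have "AE y in vol_prod n. \<forall>i\<in>{..<n}. \<forall>j\<in>{..<n}. i \<noteq> j \<longrightarrow> y i \<noteq> y j" by (intro AE_finite_allI) auto
    then show "AE y in vol_prod n. \<forall>i<fst (n, y). \<forall>j<fst (n, y). i \<noteq> j \<longrightarrow> snd (n, y) i \<noteq> snd (n, y) j" by eventually_elim auto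
  qed
  then show ?thesis by eventually_elim (auto simp: inj_on_def)
qed

end

section \<open>Functions on the space of clusters\<close>

lemma pred_countable_Ball:
  assumes X: "countable X" and P: "\<And>i. i \<in> X \<Longrightarrow> Measurable.pred M (P i)"
  shows "Measurable.pred M (\<lambda>x. \<forall>i\<in>X. P i x)"
proof (cases "X = {}")
  case False
  have "Measurable.pred M (\<lambda>x. \<forall>n :: nat. P (from_nat_into X n) x)"
    using P from_nat_into[OF False] by (intro pred_intros_countable) auto
  moreover have "(\<forall>n. P (from_nat_into X n) x) \<longleftrightarrow> (\<forall>i\<in>X. P i x)" for x
    using range_from_nat_into[OF False X] by (metis rangeE rangeI)
  ultimately show ?thesis by simp
qed simp

text \<open>Padding with zeros embeds n local coordinates into the bounded sequences on which
  \<open>pull_cluster\<close> is defined.\<close>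

definition bounded_seq :: "nat \<Rightarrow> (nat \<Rightarrow> 'a::real_normed_vector) \<Rightarrow> nat \<Rightarrow>\<^sub>C 'a" where
  "bounded_seq n w = Bcontfun (\<lambda>i. if i < n then w i else 0)"

lemma apply_bounded_seq [simp]: "apply_bcontfun (bounded_seq n w) i = (if i < n then w i else 0)"
proof -
  have "range (\<lambda>i. if i < n then w i else 0) \<subseteq> insert 0 (w ` {..<n})" by auto
  then have "bounded (range (\<lambda>i. if i < n then w i else 0))"
    by (rule bounded_subset[rotated]) (auto intro: finite_imp_bounded)
  moreover have "continuous_on UNIV (\<lambda>i. if i < n then w i else 0)" by (simp add: continuous_on_open_vimage open_discrete)
  ultimately have "(\<lambda>i. if i < n then w i else 0) \<in> bcontfun" unfolding bcontfun_def by blast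
  then show ?thesis unfolding bounded_seq_def by (simp add: Bcontfun_inverse)
qed

lemma dist_bounded_seq:
  "(\<And>i. i < n \<Longrightarrow> dist (w i) (w' i) \<le> e) \<Longrightarrow> 0 \<le> e \<Longrightarrow> dist (bounded_seq n w) (bounded_seq n w') \<le> e"
  by (rule dist_bound) auto

lemma bounded_linear_bounded_seq:
  "bounded_linear (\<lambda>w. bounded_seq n (\<lambda>j. if j = i then w else 0))"
proof (rule bounded_linear_intro[where K = 1])
  show "norm (bounded_seq n (\<lambda>j. if j = i then w else 0)) \<le> norm w * 1" for w :: 'a by (rule norm_bound) auto
qed (auto intro!: bcontfun_eqI simp: plus_bcontfun.rep_eq scaleR_bcontfun.rep_eq)

lemma pull_cluster_bounded_seq:
  "pull_cluster f n cs (bounded_seq n w) = f (n, \<lambda>i\<in>{..<n}. unchart (cs i) (w i))"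
proof -
  have "(\<lambda>i\<in>{..<n}. unchart (cs i) (apply_bcontfun (bounded_seq n w) i)) = (\<lambda>i\<in>{..<n}. unchart (cs i) (w i))" by auto
  then show ?thesis by (simp add: pull_cluster_def)
qed

type_synonym 'x marked = "'x \<times> 'x cluster"

abbreviation proper_marked :: "'x::topological_space marked measure \<Rightarrow> bool" where
  "proper_marked \<equiv> proper_configuration marked_top"

definition cluster_sum :: "('x \<Rightarrow> 'b::comm_monoid_add) \<Rightarrow> 'x cluster \<Rightarrow> 'b" where
  "cluster_sum f ys = (\<Sum>i<fst ys. f (snd ys i))"

abbreviation count_in :: "'x set \<Rightarrow> 'x cluster \<Rightarrow> 'b::{comm_monoid_add,zero_neq_one}" where
  "count_in K \<equiv> cluster_sum (indicator K)"

lemma measurable_cluster_sum [measurable]: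
  fixes f :: "'x::{second_countable_topology,t2_space} \<Rightarrow> 'b::{second_countable_topology,topological_comm_monoid_add}"
  assumes f [measurable]: "f \<in> borel_measurable borel"
  shows "cluster_sum f \<in> borel_measurable cborel"
proof -
  have "(\<lambda>ys. (\<lambda>n ys. \<Sum>i<n. f (snd ys i)) (fst ys) ys) \<in> borel_measurable cborel"
    by (rule measurable_compose_countable) measurable
  then show ?thesis by (simp add: cluster_sum_def[abs_def])
qed

context riemannian
begin

lemma ex_cluster_charts:
  assumes "y \<in> {..<n} \<rightarrow>\<^sub>E UNIV"
  obtains cs where "\<And>i. cs i \<in> charts_at X (y i)"
  and "y = (\<lambda>i\<in>{..<n}. unchart (cs i) (coord (cs i) (y i)))"
proof
  show c: "chart_at X (y i) \<in> charts_at X (y i)" for i by (rule chart_at_in)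
  show "y = (\<lambda>i\<in>{..<n}. unchart (chart_at X (y i)) (coord (chart_at X (y i)) (y i)))"
    using PiE_arb[OF assms] unchart_coord[OF charts_atD(1)[OF c] charts_atD(2)[OF c]] by (auto simp: fun_eq_iff restrict_def)
qed

text \<open>Differentiability in a product chart gives continuity there, and a ball of bounded
  sequences contains a box of coordinate balls, which is open in the topology of clusters.\<close>

lemma openin_cluster_fun:
  assumes f: "differentiable_cluster_fun X f" and S: "open S"
  shows "openin cluster_top {ys\<in>clusters. f ys \<in> S}" unfolding openin_cluster_iff
proof (intro conjI allI impI)
  fix n y assume "(n, y) \<in> {ys\<in>clusters. f ys \<in> S}"
  then have y: "y \<in> {..<n} \<rightarrow>\<^sub>E UNIV" "f (n, y) \<in> S" by (auto simp: topspace_cluster)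
  obtain cs where cs: "\<And>i. cs i \<in> charts_at X (y i)"
  and ye: "y = (\<lambda>i\<in>{..<n}. unchart (cs i) (coord (cs i) (y i)))"
    by (rule ex_cluster_charts[OF y(1)]) blast
  have cs': "cs i \<in> Charts X" "y i \<in> chart_dom (cs i)" for i using cs charts_atD by blast+
  let ?u = "bounded_seq n (\<lambda>i. coord (cs i) (y i))"
  have u: "?u \<in> cluster_chart_img n cs" using cs' by (auto simp: cluster_chart_img_def)
  then have "pull_cluster f n cs differentiable (at ?u)" using f cs' by (auto simp: differentiable_cluster_fun_def)
  then have cont: "isCont (pull_cluster f n cs) ?u" by (rule differentiable_imp_continuous_within)
  have fu: "pull_cluster f n cs ?u = f (n, y)" unfolding pull_cluster_bounded_seq using ye by simp
  have "\<forall>\<^sub>F u in at ?u. pull_cluster f n cs u \<in> S"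
    by (rule topological_tendstoD[OF cont[unfolded isCont_def] S]) (simp add: fu y(2))
  then obtain \<delta> where \<delta>: "\<delta> > 0" "\<And>u. u \<noteq> ?u \<Longrightarrow> dist u ?u < \<delta> \<Longrightarrow> pull_cluster f n cs u \<in> S" unfolding eventually_at by auto
  then have \<delta>': "pull_cluster f n cs u \<in> S" if "dist u ?u < \<delta>" for u using that fu y(2) by (cases "u = ?u") auto
  \<comment> \<open>Half of \<delta>, because the distance of two sequences is a supremum and so is
    bounded only weakly by a bound on its terms.\<close>
  define U where "U i = unchart (cs i) ` (chart_img (cs i) \<inter> ball (coord (cs i) (y i)) (\<delta> / 2))" for i
  have Uo: "open (U i)" for i unfolding U_def using cs' open_chart_img[OF cs'(1)] by (intro open_unchart_image) auto
  have Uy: "y i \<in> U i" for i unfolding U_def using cs'[of i] \<delta>(1) by (intro image_eqI[where x = "coord (cs i) (y i)"]) auto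
  have sub: "f (n, y') \<in> S" if y': "y' \<in> PiE {..<n} U" for y'
  proof -
    have mem: "y' i \<in> U i" if "i < n" for i using y' that by auto
    have "\<forall>i. \<exists>w. i < n \<longrightarrow> w \<in> chart_img (cs i) \<and> dist (coord (cs i) (y i)) w < \<delta> / 2 \<and> unchart (cs i) w = y' i"
      using mem unfolding U_def by fastforce
    then obtain w where w: "\<And>i. i < n \<Longrightarrow> w i \<in> chart_img (cs i)"
      "\<And>i. i < n \<Longrightarrow> dist (coord (cs i) (y i)) (w i) < \<delta> / 2" "\<And>i. i < n \<Longrightarrow> unchart (cs i) (w i) = y' i"
      by metis
    have "dist (bounded_seq n w) ?u \<le> \<delta> / 2" using w(2) \<delta>(1) by (intro dist_bounded_seq) (auto simp: dist_commute less_imp_le)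
    then have "pull_cluster f n cs (bounded_seq n w) \<in> S" using \<delta>(1) by (intro \<delta>') auto
    moreover have "(\<lambda>i\<in>{..<n}. unchart (cs i) (w i)) = y'" using w(3) y' by (auto simp: fun_eq_iff PiE_iff extensional_def)
    ultimately show ?thesis by (simp add: pull_cluster_bounded_seq)
  qed
  show "\<exists>U. (\<forall>i<n. open (U i)) \<and> (n, y) \<in> cluster_box n U \<and> cluster_box n U \<subseteq> {ys \<in> clusters. f ys \<in> S}"
  proof (intro exI[of _ U] conjI allI impI)
    show "(n, y) \<in> cluster_box n U" using y Uy by (auto simp: mem_cluster_box PiE_iff)
    show "cluster_box n U \<subseteq> {ys \<in> clusters. f ys \<in> S}"
      unfolding cluster_box_subset using sub by (auto simp: topspace_cluster PiE_iff)
  qed (rule Uo)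
qed blast

lemma differentiable_vary_coord:
  assumes f: "differentiable_cluster_fun X f" and ys: "ys \<in> clusters" and i: "i < fst ys"
  shows "differentiable_pt (vary_coord f ys i) (snd ys i)"
proof -
  obtain n y where ny: "ys = (n, y)" by (cases ys)
  have y: "y \<in> {..<n} \<rightarrow>\<^sub>E UNIV" "i < n" using ys i ny by (auto simp: topspace_cluster)
  obtain cs where cs: "\<And>i. cs i \<in> charts_at X (y i)"
  and ye: "y = (\<lambda>i\<in>{..<n}. unchart (cs i) (coord (cs i) (y i)))"
    by (rule ex_cluster_charts[OF y(1)]) blast
  have cs': "cs i \<in> Charts X" "y i \<in> chart_dom (cs i)" for i using cs charts_atD by blast+
  let ?w = "\<lambda>j. coord (cs j) (y j)"
  let ?u = "bounded_seq n ?w"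
  have u: "?u \<in> cluster_chart_img n cs" using cs' by (auto simp: cluster_chart_img_def)
  then have d: "pull_cluster f n cs differentiable (at ?u)" using f cs' by (auto simp: differentiable_cluster_fun_def)
  \<comment> \<open>The affine map that puts w into slot i and keeps the other coordinates;
    composing it with the function in the product chart gives \<open>vary_coord\<close> in the chart
    of slot i.\<close>
  let ?a = "\<lambda>w. bounded_seq n (?w(i := 0)) + bounded_seq n (\<lambda>j. if j = i then w else 0)"
  have a: "?a w = bounded_seq n (?w(i := w))" for w by (rule bcontfun_eqI) (auto simp: plus_bcontfun.rep_eq)
  have "?w(i := ?w i) = ?w" by (rule fun_upd_triv)
  then have au: "?a (?w i) = ?u" unfolding a by (rule arg_cong)
  have "?a differentiable (at (?w i))"
    using bounded_linear_imp_differentiable[OF bounded_linear_bounded_seq] by (intro differentiable_add) auto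
  then have "(pull_cluster f n cs \<circ> ?a) differentiable (at (?w i))" using d au by (intro differentiable_chain_at) auto
  moreover have "(pull_cluster f n cs \<circ> ?a) = vary_coord f ys i \<circ> unchart (cs i)"
  proof
    fix w
    have "(\<lambda>j\<in>{..<n}. unchart (cs j) ((?w(i := w)) j)) = y(i := unchart (cs i) w)"
      using y(2) unchart_coord[OF cs'] PiE_arb[OF y(1)] by (auto simp: fun_eq_iff restrict_def)
    then show "(pull_cluster f n cs \<circ> ?a) w = (vary_coord f ys i \<circ> unchart (cs i)) w"
      unfolding o_def a pull_cluster_bounded_seq by (simp add: vary_coord_def ny)
  qed
  ultimately have "(vary_coord f ys i \<circ> unchart (cs i)) differentiable (at (coord (cs i) (snd ys i)))" by (simp add: ny)
  then show ?thesis using cs[of i] by (intro differentiable_ptI[of "cs i"]) (auto simp: ny)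
qed

end

section \<open>Joint measurability of the densities of the cluster laws\<close>

locale cluster_density = riemannian X
  for X :: "('x::{second_countable_topology,t2_space}, 'n::finite) riem" +
  fixes \<eta> :: "'x \<Rightarrow> 'x cluster measure" and h :: "'x \<Rightarrow> 'x cluster \<Rightarrow> real"
  assumes eta: "cluster_family \<eta>"
  and h_nonneg: "\<And>x ys. ys \<in> clusters \<Longrightarrow> h x ys \<ge> 0"
  and h_diff: "\<And>x. differentiable_cluster_fun X (h x)"
  and eta_density: "\<And>x. \<eta> x = density (cluster_volume X) (\<lambda>ys. ennreal (h x ys))"
  and parts: "\<And>x w g. w \<in> Vect0 X \<Longrightarrow> g \<in> cluster_C0_inf X \<Longrightarrow> integrable (\<eta> x) (\<lambda>ys. g ys * log_deriv_along X h w (x, ys)) \<and>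
      (\<integral>ys. cluster_dir_deriv X (lift_field w) g ys \<partial>\<eta> x) = - (\<integral>ys. g ys * log_deriv_along X h w (x, ys) \<partial>\<eta> x)" begin

abbreviation log_deriv :: "('x \<Rightarrow> ('x, 'n) tangent) \<Rightarrow> 'x \<times> 'x cluster \<Rightarrow> real" where
  "log_deriv \<equiv> log_deriv_along X h"

abbreviation mean_log_deriv :: "('x \<Rightarrow> ('x, 'n) tangent) \<Rightarrow> 'x \<Rightarrow> ennreal" where
  "mean_log_deriv v x \<equiv> \<integral>\<^sup>+ys. ennreal \<bar>log_deriv v (x, ys)\<bar> \<partial>\<eta> x"

lemma prob_eta: "prob_space (\<eta> x)"
  and sets_eta [simp, measurable_cong]: "sets (\<eta> x) = sets cborel"
  using eta by (auto simp: cluster_family_def)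

lemmas measurable_cong_eta = measurable_cong_sets[OF sets_eta refl]

lemma space_eta [simp]: "space (\<eta> x) = clusters"
  using sets_eq_imp_space_eq[OF sets_eta] by simp

lemma eta_kernel [measurable]: "\<eta> \<in> measurable borel (subprob_algebra cborel)"
  using eta by (intro measurable_subprob_algebra prob_space_imp_subprob_space prob_eta)
    (auto simp: cluster_family_def)

lemma measurable_h: "h x \<in> borel_measurable cborel"
proof (rule borel_measurableI)
  fix S :: "real set" assume "open S"
  then have "{ys\<in>clusters. h x ys \<in> S} \<in> sets cborel" by (intro borel_of_openin openin_cluster_fun h_diff)
  moreover have "h x -` S \<inter> space cborel = {ys\<in>clusters. h x ys \<in> S}" by auto
  ultimately show "h x -` S \<inter> space cborel \<in> sets cborel" by simp
qed

lemma emeasure_eta: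
  assumes "A \<in> sets cborel"
  shows "emeasure (\<eta> x) A = (\<integral>\<^sup>+ys. ennreal (h x ys) * indicator A ys \<partial>cvol)"
  unfolding eta_density using assms measurable_h by (subst emeasure_density) auto

lemma AE_eta_cvol: "AE ys in cvol. P ys \<Longrightarrow> AE ys in \<eta> x. P ys"
  unfolding eta_density using measurable_h by (subst AE_density) auto

text \<open>The densities are continuous in the cluster, hence determined by the values of the kernel on
  a countable base; this yields their joint measurability.\<close>

lemma h_ge_iff:
  assumes B: "finite_base B" and W: "openin cluster_top W" and r: "0 \<le> r"
  shows "(\<forall>ys\<in>W. r \<le> h x ys) \<longleftrightarrow> (\<forall>V\<in>cluster_base B. V \<subseteq> W \<longrightarrow> ennreal r * emeasure cvol V \<le> emeasure (\<eta> x) V)"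
proof
  have Bb: "countable_base cluster_top (cluster_base B)" using B by (intro countable_base_cluster) (simp add: finite_base_def)
  assume L: "\<forall>ys\<in>W. r \<le> h x ys"
  show "\<forall>V\<in>cluster_base B. V \<subseteq> W \<longrightarrow> ennreal r * emeasure cvol V \<le> emeasure (\<eta> x) V"
  proof (intro ballI impI)
    fix V assume V: "V \<in> cluster_base B" "V \<subseteq> W"
    then have Vm: "V \<in> sets cborel" using countable_baseD(2)[OF Bb] by auto
    have "ennreal r * emeasure cvol V = (\<integral>\<^sup>+ys. ennreal r * indicator V ys \<partial>cvol)"
      using Vm by (simp add: nn_integral_cmult_indicator)
    also have "\<dots> \<le> (\<integral>\<^sup>+ys. ennreal (h x ys) * indicator V ys \<partial>cvol)"
      using L V(2) by (intro nn_integral_mono) (auto split: split_indicator intro!: ennreal_leI)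
    finally show "ennreal r * emeasure cvol V \<le> emeasure (\<eta> x) V" using emeasure_eta[OF Vm] by simp
  qed
next
  have Bb: "countable_base cluster_top (cluster_base B)" using B by (intro countable_base_cluster) (simp add: finite_base_def)
  assume R: "\<forall>V\<in>cluster_base B. V \<subseteq> W \<longrightarrow> ennreal r * emeasure cvol V \<le> emeasure (\<eta> x) V"
  show "\<forall>ys\<in>W. r \<le> h x ys"
  proof (rule ballI, rule ccontr)
    fix ys assume ys: "ys \<in> W" "\<not> r \<le> h x ys"
    \<comment> \<open>A value strictly between h and r. By continuity h stays below s on some base
      set V inside W, so r vol V \<le> s vol V, although V has positive finite volume.\<close>
    define s where "s = (h x ys + r) / 2"
    have ysT: "ys \<in> clusters" using openin_subset[OF W] ys by blast
    have s: "h x ys < s" "s < r" "0 \<le> s" using ys(2) h_nonneg[OF ysT, of x] by (auto simp: s_def)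
    have "openin cluster_top (W \<inter> {ys\<in>clusters. h x ys \<in> {..<s}})" by (intro openin_Int W openin_cluster_fun h_diff) auto
    moreover have "ys \<in> W \<inter> {ys\<in>clusters. h x ys \<in> {..<s}}" using ys ysT s by auto
    ultimately obtain V where V: "V \<in> cluster_base B" "ys \<in> V" "V \<subseteq> W \<inter> {ys\<in>clusters. h x ys \<in> {..<s}}"
      using countable_baseD(3)[OF Bb] by blast
    then have Vm: "V \<in> sets cborel" using countable_baseD(2)[OF Bb] by auto
    have "ennreal r * emeasure cvol V \<le> emeasure (\<eta> x) V" using R V by blast
    also have "\<dots> \<le> (\<integral>\<^sup>+ys. ennreal s * indicator V ys \<partial>cvol)" unfolding emeasure_eta[OF Vm] using V(3)
      by (intro nn_integral_mono) (auto split: split_indicator intro!: ennreal_leI)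
    also have "\<dots> = ennreal s * emeasure cvol V" using Vm by (simp add: nn_integral_cmult_indicator)
    finally have le: "ennreal r * emeasure cvol V \<le> ennreal s * emeasure cvol V" .
    have "ennreal s * emeasure cvol V < ennreal r * emeasure cvol V" using cvol_cluster_base[OF B V(1)] s
      by (intro ennreal_mult_strict_right_mono) (auto simp: ennreal_less_iff)
    then show False using le by simp
  qed
qed

lemma measurable_h_joint [measurable]:
  "(\<lambda>(x, ys). h x ys) \<in> borel_measurable pair_borel"
proof (rule borel_measurable_iff_greater[THEN iffD2], intro allI)
  fix a :: real
  obtain B where B: "finite_base B" by (rule ex_finite_base)
  have Bb: "countable_base cluster_top (cluster_base B)" using B by (intro countable_base_cluster) (simp add: finite_base_def)
  note Bc = countable_baseD(1)[OF Bb]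
  let ?P = "\<lambda>q V x. \<forall>V'\<in>cluster_base B. V' \<subseteq> V \<longrightarrow> ennreal q * emeasure cvol V' \<le> emeasure (\<eta> x) V'"
  let ?Q = "{q :: real. q \<in> \<rat> \<and> q > a \<and> q \<ge> 0}"
  have Qc: "countable ?Q" by (rule countable_subset[OF _ countable_rat]) auto
  show "{z \<in> space pair_borel. a < (case z of (x, ys) \<Rightarrow> h x ys)} \<in> sets pair_borel"
  proof (cases "a < 0")
    case True
    have "{z \<in> space pair_borel. a < (case z of (x, ys) \<Rightarrow> h x ys)} = space pair_borel"
    proof -
      have "a < h x ys" if "ys \<in> clusters" for x ys using h_nonneg[OF that, of x] True by simp
      then show ?thesis by (auto simp: space_pair_measure)
    qed
    then show ?thesis by simp
  next
    case False
    \<comment> \<open>The density exceeds a at a cluster iff, for some rational q > a, it is at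
      least q on a base set around that cluster. By \<open>h_ge_iff\<close> the condition on x is
      measurable, so the set is a countable union of measurable rectangles.\<close>
    have "{z \<in> space pair_borel. a < (case z of (x, ys) \<Rightarrow> h x ys)} =
      (\<Union>q\<in>?Q. \<Union>V\<in>cluster_base B. {x\<in>space borel. ?P q V x} \<times> V)" (is "?L = ?R") proof (rule set_eqI)
      fix z :: "'x \<times> 'x cluster"
      obtain x ys where z: "z = (x, ys)" by (cases z)
      show "z \<in> ?L \<longleftrightarrow> z \<in> ?R"
      proof
        assume "z \<in> ?L"
        then have ys: "ys \<in> clusters" "a < h x ys" by (auto simp: z space_pair_measure)
        obtain q where q: "q \<in> \<rat>" "a < q" "q < h x ys" using Rats_dense_in_real[OF ys(2)] by blast
        obtain V where V: "V \<in> cluster_base B" "ys \<in> V" "V \<subseteq> {ys\<in>clusters. h x ys \<in> {q<..}}"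
        proof -
          have "openin cluster_top {ys\<in>clusters. h x ys \<in> {q<..}}" by (intro openin_cluster_fun h_diff) auto
          moreover have "ys \<in> {ys\<in>clusters. h x ys \<in> {q<..}}" using ys q by simp
          ultimately show ?thesis using countable_baseD(3)[OF Bb] that by blast
        qed
        have q0: "0 \<le> q" using False q by simp
        have "\<forall>ys\<in>V. q \<le> h x ys" using V(3) by auto
        then have "?P q V x" using h_ge_iff[OF B countable_baseD(2)[OF Bb V(1)] q0] by simp
        then show "z \<in> ?R" using q q0 V by (auto simp: z)
      next
        assume "z \<in> ?R"
        then obtain q V where qV: "q > a" "q \<ge> 0" "V \<in> cluster_base B" "?P q V x" "ys \<in> V" by (auto simp: z)
        then have "q \<le> h x ys" using h_ge_iff[OF B countable_baseD(2)[OF Bb qV(3)] qV(2)] by blast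
        moreover have "ys \<in> clusters" using openin_subset[OF countable_baseD(2)[OF Bb qV(3)]] qV(5) by blast
        ultimately show "z \<in> ?L" using qV(1) by (auto simp: z space_pair_measure)
      qed
    qed
    moreover have "{x\<in>space borel. ?P q V x} \<in> sets borel" for q V
    proof -
      have "Measurable.pred borel (\<lambda>x. V' \<subseteq> V \<longrightarrow> ennreal q * emeasure cvol V' \<le> emeasure (\<eta> x) V')"
        if V': "V' \<in> cluster_base B" for V'
      proof -
        have "V' \<in> sets cborel" using countable_baseD(2)[OF Bb V'] by auto
        then have [measurable]: "(\<lambda>x. emeasure (\<eta> x) V') \<in> borel_measurable borel" by measurable
        show ?thesis by measurable
      qed
      then have "Measurable.pred borel (?P q V)" by (rule pred_countable_Ball[OF Bc])
      then show ?thesis by (simp add: pred_def)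
    qed
    moreover have "V \<in> sets cborel" if "V \<in> cluster_base B" for V using that countable_baseD(2)[OF Bb] by auto
    ultimately show ?thesis using Qc Bc by (simp only:) (intro sets.countable_UN' pair_measureI; blast)
  qed
qed

lemma measurable_h_compose:
  assumes "f \<in> measurable M borel" "g \<in> measurable M cborel"
  shows "(\<lambda>z. h (f z) (g z)) \<in> borel_measurable M"
  using measurable_compose[OF measurable_Pair[OF assms] measurable_h_joint] by simp

section \<open>Measurability and bounds of the logarithmic derivative\<close>

definition coord_deriv :: "('x \<Rightarrow> ('x, 'n) tangent) \<Rightarrow> nat \<Rightarrow> 'x \<times> 'x cluster \<Rightarrow> real" where
  "coord_deriv v i = (\<lambda>(x, ys). if i < fst ys
     then differential X (vary_coord (h x) ys i) (snd ys i) (v (snd ys i)) else 0)"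

text \<open>A straight step in the coordinates of c along v. Difference quotients of the density
  along such steps are jointly measurable and converge to \<open>coord_deriv\<close>.\<close>

definition move_point :: "('x, 'n) chart \<Rightarrow> ('x \<Rightarrow> ('x, 'n) tangent) \<Rightarrow> real \<Rightarrow> 'x \<Rightarrow> 'x" where
  "move_point c v t x = unchart_total c (coord_total c x + t *\<^sub>R (if x \<in> chart_dom c then v x c else 0))"

lemma measurable_move_point [measurable]:
  assumes c: "c \<in> Charts X" and v: "v \<in> Vect0 X"
  shows "move_point c v t \<in> borel_measurable borel"
proof -
  have "continuous_on (chart_dom c) ((\<lambda>w. v (unchart c w) c) \<circ> coord c)"
    using continuous_on_compose[OF continuous_on_coord[OF c]
        smooth_on_continuous_on[OF Vect0D(2)[OF v c], unfolded chart_img_def]] .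
  then have "continuous_on (chart_dom c) (\<lambda>x. v x c)" by (rule continuous_on_eq) (use c in auto)
  then have [measurable]: "(\<lambda>x. if x \<in> chart_dom c then v x c else 0) \<in> borel_measurable borel"
    using c by (intro borel_measurable_continuous_on_if) (auto intro: borel_open)
  note measurable_unchart_total[OF c, measurable] measurable_coord_total[OF c, measurable]
  show ?thesis unfolding move_point_def[abs_def] by measurable
qed

lemma coord_deriv_limit:
  assumes c: "c \<in> Charts X" and v: "v \<in> Vect0 X"
  and ys: "ys \<in> clusters" and i: "i < fst ys" "snd ys i \<in> chart_dom c"
  shows "(\<lambda>m. real (Suc m) * (h x (fst ys, (snd ys)(i := move_point c v (inverse (real (Suc m))) (snd ys i))) - h x ys))
    \<longlonglongrightarrow> coord_deriv v i (x, ys)" proof - let ?p = "snd ys i" let ?f = "vary_coord (h x) ys i \<circ> unchart c"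
  have ca: "c \<in> charts_at X ?p" using c i by (intro charts_atI)
  have dp: "differentiable_pt (vary_coord (h x) ys i) ?p" by (rule differentiable_vary_coord[OF h_diff ys i(1)])
  have D: "coord_deriv v i (x, ys) = fderiv ?f (coord c ?p) (v ?p c)"
    using i by (simp add: coord_deriv_def differential_eq[OF dp ca Vect0D(1)[OF v]])
  have f: "(?f has_derivative fderiv ?f (coord c ?p)) (at (coord c ?p))"
    using dp ca by (simp add: differentiable_pt_def frechet_derivative_works)
  then have lin: "linear (fderiv ?f (coord c ?p))" by (rule has_derivative_linear)
  have "((\<lambda>t. coord c ?p + t *\<^sub>R v ?p c) has_derivative (\<lambda>t. t *\<^sub>R v ?p c)) (at 0)" by (auto intro!: derivative_eq_intros)
  then have "((\<lambda>t. ?f (coord c ?p + t *\<^sub>R v ?p c)) has_derivative (\<lambda>t. fderiv ?f (coord c ?p) (t *\<^sub>R v ?p c))) (at 0)"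
    using diff_chain_at[of "\<lambda>t. coord c ?p + t *\<^sub>R v ?p c" _ 0 ?f] f by (force simp: o_def)
  then have "((\<lambda>t. ?f (coord c ?p + t *\<^sub>R v ?p c)) has_real_derivative coord_deriv v i (x, ys)) (at 0)"
    by (simp add: D has_field_derivative_def linear_scale[OF lin] mult.commute[of _ "frechet_derivative _ _ _"]
        mult_commute_abs)
  then have lim: "((\<lambda>t. (?f (coord c ?p + t *\<^sub>R v ?p c) - ?f (coord c ?p)) / t) \<longlongrightarrow> coord_deriv v i (x, ys)) (at 0)"
    by (simp add: has_field_derivative_iff)
  have "filterlim (\<lambda>m. inverse (real (Suc m))) (at 0) sequentially"
    unfolding filterlim_at using LIMSEQ_inverse_real_of_nat by auto
  from filterlim_compose[OF lim this]
  have lim': "(\<lambda>m. (?f (coord c ?p + inverse (real (Suc m)) *\<^sub>R v ?p c) - ?f (coord c ?p)) / inverse (real (Suc m)))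
      \<longlonglongrightarrow> coord_deriv v i (x, ys)" . have "(\<lambda>m. coord c ?p + inverse (real (Suc m)) *\<^sub>R v ?p c) \<longlonglongrightarrow> coord c ?p + 0 *\<^sub>R v ?p c"
    by (intro tendsto_intros LIMSEQ_inverse_real_of_nat)
  \<comment> \<open>From some m on the step stays in the chart image, where the totalised maps agree
    with the genuine ones.\<close>
  then have "\<forall>\<^sub>F m in sequentially. coord c ?p + inverse (real (Suc m)) *\<^sub>R v ?p c \<in> chart_img c"
    by (rule topological_tendstoD[OF _ open_chart_img[OF c]]) (use i in simp)
  then have ev: "\<forall>\<^sub>F m in sequentially. (?f (coord c ?p + inverse (real (Suc m)) *\<^sub>R v ?p c) - ?f (coord c ?p)) / inverse (real (Suc m))
     = real (Suc m) * (h x (fst ys, (snd ys)(i := move_point c v (inverse (real (Suc m))) ?p)) - h x ys)"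
  proof eventually_elim
    case (elim m)
    have "unchart c (coord c ?p + inverse (real (Suc m)) *\<^sub>R v ?p c) = move_point c v (inverse (real (Suc m))) ?p"
      using elim i by (simp add: move_point_def unchart_total_def coord_total_def)
    moreover have "h x (fst ys, (snd ys)(i := ?p)) = h x ys" by simp
    ultimately show ?case using c i by (simp add: vary_coord_def divide_inverse)
  qed
  show ?thesis by (rule Lim_transform_eventually[OF lim' ev])
qed

text \<open>The differential is defined by a chart chosen arbitrarily at each point. Independence of
  the chart permits the charts of a countable atlas instead: on the piece A k, where the i-th point
  lies in chart k, the derivative is a limit of measurable difference quotients, and on A0, where
  there is no i-th point, it is zero.\<close>

lemma measurable_coord_deriv [measurable]:
  assumes v: "v \<in> Vect0 X"
  shows "coord_deriv v i \<in> borel_measurable pair_borel"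
proof -
  let ?M = "pair_borel :: 'x marked measure"
  obtain cs :: "nat \<Rightarrow> ('x, 'n) chart"
    where cs: "\<And>n. cs n \<in> Charts X" "(\<Union>n. chart_dom (cs n)) = UNIV" by (rule countable_atlas) blast
  define A where "A k = {z\<in>space ?M. i < fst (snd z) \<and> snd (snd z) i \<in> chart_dom (cs k)}" for k
  have Am [measurable]: "A k \<in> sets ?M" for k using chart_dom_borel[OF cs(1), of k] unfolding A_def by measurable
  define A0 where "A0 = {z\<in>space ?M. \<not> i < fst (snd z)}"
  have A0m [measurable]: "A0 \<in> sets ?M" unfolding A0_def by measurable
  define g where "g k m = (\<lambda>z :: 'x \<times> 'x cluster. if i < fst (snd z)
    then (fst (snd z), (snd (snd z))(i := move_point (cs k) v (inverse (real (Suc m))) (snd (snd z) i)))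
    else snd z)" for k m have gm [measurable]: "g k m \<in> measurable ?M cborel" for k m
  proof (rule measurable_into_cluster)
    note measurable_move_point[OF cs(1) v, measurable]
    show "g k m \<in> space ?M \<rightarrow> clusters" by (auto simp: g_def space_pair_measure in_cluster_iff PiE_iff extensional_def)
    have "(\<lambda>z. fst (g k m z)) = (\<lambda>z. fst (snd z))" by (auto simp: g_def)
    then show "(\<lambda>z. fst (g k m z)) \<in> measurable ?M (count_space UNIV)" by simp
    fix j
    have "(\<lambda>z. snd (g k m z) j) = (\<lambda>z. if i < fst (snd z) \<and> j = i
        then move_point (cs k) v (inverse (real (Suc m))) (snd (snd z) i) else snd (snd z) j)" by (auto simp: g_def)
    then show "(\<lambda>z. snd (g k m z) j) \<in> borel_measurable ?M" by simp
  qed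
  show ?thesis
  proof (rule measurable_piecewise_restrict[of "insert A0 (range A)"])
    show "countable (insert A0 (range A))" by simp
    show "\<Omega> \<inter> space ?M \<in> sets ?M" if "\<Omega> \<in> insert A0 (range A)" for \<Omega> using that by auto
    show "space ?M \<subseteq> \<Union> (insert A0 (range A))"
    proof
      fix z assume z: "z \<in> space ?M"
      obtain k where "snd (snd z) i \<in> chart_dom (cs k)" using cs(2) by blast
      then show "z \<in> \<Union> (insert A0 (range A))" using z by (auto simp: A_def A0_def)
    qed
    fix \<Omega> assume "\<Omega> \<in> insert A0 (range A)"
    then consider "\<Omega> = A0" | k where "\<Omega> = A k" by auto
    then show "coord_deriv v i \<in> borel_measurable (restrict_space ?M \<Omega>)"
    proof cases
      case 1
      have "coord_deriv v i z = 0" if "z \<in> space (restrict_space ?M \<Omega>)" for z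
        using that 1 by (cases z) (auto simp: coord_deriv_def A0_def space_restrict_space)
      then show ?thesis by (subst measurable_cong[where g = "\<lambda>_. 0"]) auto
    next
      case (2 k)
      let ?q = "\<lambda>m z. real (Suc m) * (h (fst z) (g k m z) - h (fst z) (snd z))"
      have "(\<lambda>m. ?q m z) \<longlonglongrightarrow> coord_deriv v i z" if "z \<in> space (restrict_space ?M \<Omega>)" for z
      proof -
        obtain x ys where z: "z = (x, ys)" by (cases z)
        have ys: "ys \<in> clusters" "i < fst ys" "snd ys i \<in> chart_dom (cs k)"
          using that by (auto simp: z 2 A_def space_restrict_space space_pair_measure)
        show ?thesis using coord_deriv_limit[OF cs(1) v ys, of x] ys(2) by (simp add: z g_def)
      qed
      moreover have "?q m \<in> borel_measurable (restrict_space ?M \<Omega>)" for m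
      proof (rule measurable_restrict_space1)
        have "(\<lambda>z. h (fst z) (g k m z)) \<in> borel_measurable ?M" "(\<lambda>z. h (fst z) (snd z)) \<in> borel_measurable ?M"
          by (intro measurable_h_compose; measurable)+
        then show "?q m \<in> borel_measurable ?M" by measurable
      qed
      ultimately show ?thesis by (rule borel_measurable_LIMSEQ_metric[rotated])
    qed
  qed
qed

lemma inner_log_gradient:
  assumes v: "v \<in> Vect0 X" and ys: "ys \<in> clusters" and i: "i < fst ys"
  shows "Metric X (snd ys i) (log_gradient X (h x) ys i) (v (snd ys i)) = 1 / h x ys * coord_deriv v i (x, ys)"
proof -
  have dp: "differentiable_pt (vary_coord (h x) ys i) (snd ys i)" by (rule differentiable_vary_coord[OF h_diff ys i])
  show ?thesis unfolding log_gradient_def cluster_gradient_def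
      Metric_scale[OF gradient(1)[OF dp] Vect0D(1)[OF v]] gradient(2)[OF dp Vect0D(1)[OF v]]
    using i by (simp add: coord_deriv_def)
qed

lemma log_deriv_along_eq:
  assumes v: "v \<in> Vect0 X" and ys: "ys \<in> clusters"
  shows "log_deriv v (x, ys) = (\<Sum>i<fst ys. 1 / h x ys * coord_deriv v i (x, ys)) +
     (\<Sum>i<fst ys. divergence X v (snd ys i))" unfolding log_deriv_along_def cluster_inner_def lift_field_def
  by (simp add: inner_log_gradient[OF v ys] del: divide_inverse)

lemma measurable_inner_part [measurable]:
  assumes v: "v \<in> Vect0 X"
  shows "(\<lambda>z. \<Sum>i<fst (snd z). 1 / h (fst z) (snd z) * coord_deriv v i z) \<in> borel_measurable pair_borel"
proof -
  note measurable_coord_deriv[OF v, measurable]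
  have [measurable]: "(\<lambda>z. h (fst z) (snd z)) \<in> borel_measurable pair_borel" by (intro measurable_h_compose) measurable
  have "(\<lambda>z. (\<lambda>n z. \<Sum>i<n. 1 / h (fst z) (snd z) * coord_deriv v i z) (fst (snd z)) z) \<in> borel_measurable pair_borel"
    by (rule measurable_compose_countable) measurable
  then show ?thesis by simp
qed

lemma measurable_log_deriv_along [measurable]:
  assumes v: "v \<in> Vect0 X"
  shows "log_deriv v \<in> borel_measurable pair_borel"
proof -
  have [measurable]: "divergence X v \<in> borel_measurable borel"
    using continuous_divergence[OF v] by (rule measurable_continuous)
  note measurable_inner_part[OF v, measurable]
  have [measurable]: "(\<lambda>ys. \<Sum>i<fst ys. divergence X v (snd ys i)) \<in> borel_measurable cborel"
    using measurable_cluster_sum[of "divergence X v"] by (simp add: cluster_sum_def[abs_def])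
  have "(\<lambda>z. (\<Sum>i<fst (snd z). 1 / h (fst z) (snd z) * coord_deriv v i z) +
     (\<Sum>i<fst (snd z). divergence X v (snd (snd z) i))) \<in> borel_measurable pair_borel" by measurable
  moreover have "log_deriv v z = (\<Sum>i<fst (snd z). 1 / h (fst z) (snd z) * coord_deriv v i z) +
     (\<Sum>i<fst (snd z). divergence X v (snd (snd z) i))" if "z \<in> space pair_borel" for z
    using that log_deriv_along_eq[OF v, of "snd z" "fst z"] by (auto simp: space_pair_measure)
  ultimately show ?thesis by (subst measurable_cong) auto
qed

lemma tangent_scale_0: "0 \<in> (UNIV :: real set) \<Longrightarrow> \<xi> \<in> tangent_space X x \<Longrightarrow> Metric X x \<xi> (\<lambda>_. 0) = 0"
  using Metric_scale[OF zero_tangent, of \<xi> x 0] Metric_sym[OF _ zero_tangent, of \<xi> x] by (simp add: tangent_scale_def)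

lemma log_gradient_in:
  assumes "ys \<in> clusters" "i < fst ys"
  shows "log_gradient X (h x) ys i \<in> tangent_space X (snd ys i)" unfolding log_gradient_def cluster_gradient_def
  by (intro tangent_scale_in gradient(1) differentiable_vary_coord[OF h_diff assms])

text \<open>Cauchy-Schwarz at each coordinate; coordinates outside K contribute nothing since v
  vanishes there. The indicator of clusters meeting K is what makes (A4) applicable.\<close>

lemma inner_part_bound:
  assumes v: "v \<in> Vect0 X" and ys: "ys \<in> clusters"
  and K: "\<And>x. x \<notin> K \<Longrightarrow> v x = (\<lambda>_. 0)" and C: "\<And>x. tangent_norm X x (v x) \<le> C"
  shows "\<bar>\<Sum>i<fst ys. 1 / h x ys * coord_deriv v i (x, ys)\<bar> \<le>
    C * (log_gradient_norm1 X (h x) ys * indicator (clusters_meeting K) ys)" proof (cases "ys \<in> clusters_meeting K")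
  case True
  have "\<bar>\<Sum>i<fst ys. 1 / h x ys * coord_deriv v i (x, ys)\<bar> \<le> (\<Sum>i<fst ys. \<bar>1 / h x ys * coord_deriv v i (x, ys)\<bar>)"
    by (rule sum_abs)
  also have "\<dots> \<le> (\<Sum>i<fst ys. tangent_norm X (snd ys i) (log_gradient X (h x) ys i) * C)"
  proof (rule sum_mono)
    fix i assume "i \<in> {..<fst ys}"
    then have i: "i < fst ys" by simp
    have "\<bar>1 / h x ys * coord_deriv v i (x, ys)\<bar> \<le>
       tangent_norm X (snd ys i) (log_gradient X (h x) ys i) * tangent_norm X (snd ys i) (v (snd ys i))"
      unfolding inner_log_gradient[OF v ys i, symmetric] by (intro Cauchy_Schwarz_Metric log_gradient_in ys i Vect0D(1)[OF v])
    also have "\<dots> \<le> tangent_norm X (snd ys i) (log_gradient X (h x) ys i) * C"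
    proof (intro mult_left_mono C)
      show "0 \<le> tangent_norm X (snd ys i) (log_gradient X (h x) ys i)" unfolding tangent_norm_def
        using Metric_pos[OF log_gradient_in[OF ys i, of x]] tangent_scale_0[OF UNIV_I zero_tangent]
        by (cases "log_gradient X (h x) ys i = (\<lambda>_. 0)") (auto simp: less_imp_le)
    qed
    finally show "\<bar>1 / h x ys * coord_deriv v i (x, ys)\<bar> \<le> tangent_norm X (snd ys i) (log_gradient X (h x) ys i) * C" .
  qed
  finally show ?thesis using True by (simp add: log_gradient_norm1_def sum_distrib_left mult.commute)
next
  case False
  have "coord_deriv v i (x, ys) = 0" if i: "i < fst ys" for i
  proof -
    have "snd ys i \<notin> K" using False i ys by (auto simp: clusters_meeting_def)
    then have "v (snd ys i) = (\<lambda>_. 0)" by (rule K)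
    then show ?thesis using i differential_zero[OF differentiable_vary_coord[OF h_diff ys i]] by (simp add: coord_deriv_def)
  qed
  then show ?thesis using False by simp
qed

end

section \<open>Configurations\<close>

lemma measurable_nn_integral_count_space:
  fixes f :: "'i \<Rightarrow> 'a \<Rightarrow> ennreal"
  assumes I: "countable I" and f: "\<And>i. i \<in> I \<Longrightarrow> f i \<in> borel_measurable M"
  shows "(\<lambda>x. \<integral>\<^sup>+i. f i x \<partial>count_space I) \<in> borel_measurable M"
proof -
  interpret sigma_finite_measure "count_space I" using I by (rule sigma_finite_measure_count_space_countable)
  have "(\<lambda>z. f (snd z) (fst z)) \<in> borel_measurable (M \<Otimes>\<^sub>M count_space I)"
    by (rule measurable_compose_countable'[where f = "\<lambda>i z. f i (fst z)" and g = snd and I = I])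
      (rule measurable_compose[OF measurable_fst f] measurable_snd I; assumption?)+
  then show ?thesis by (intro borel_measurable_nn_integral) (simp add: split_beta')
qed

text \<open>Meant for G the identity on configurations. These may have infinite total mass, so the
  family is described by its values on sets instead of as a kernel of subprobabilities.\<close>

lemma measurable_nn_integral_family:
  assumes sets: "\<And>x. x \<in> space M \<Longrightarrow> sets (G x) = sets N"
  and em: "\<And>B. B \<in> sets N \<Longrightarrow> (\<lambda>x. emeasure (G x) B) \<in> borel_measurable M"
  and f: "f \<in> borel_measurable N"
  shows "(\<lambda>x. \<integral>\<^sup>+y. f y \<partial>G x) \<in> borel_measurable M"
proof -
  have mG: "g \<in> borel_measurable (G x)" if "x \<in> space M" "g \<in> borel_measurable N" for x and g :: "_ \<Rightarrow> ennreal"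
    using that(2) measurable_cong_sets[OF sets[OF that(1)] refl] by blast
  have sp: "space (G x) = space N" if "x \<in> space M" for x using sets_eq_imp_space_eq[OF sets[OF that]] .
  show ?thesis using f
  proof (induction rule: borel_measurable_induct)
    case (cong f g)
    have eq: "(\<integral>\<^sup>+y. f y \<partial>G x) = (\<integral>\<^sup>+y. g y \<partial>G x)" if "x \<in> space M" for x
      using cong(3) sp[OF that] by (intro nn_integral_cong) auto
    show ?case by (rule measurable_cong[THEN iffD2, OF eq cong(4)])
  next
    case (set A)
    have eq: "(\<integral>\<^sup>+y. indicator A y \<partial>G x) = emeasure (G x) A" if "x \<in> space M" for x
      using set sets[OF that] by (intro nn_integral_indicator) auto
    show ?case by (rule measurable_cong[THEN iffD2, OF eq em[OF set]])
  next
    case (mult u c)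
    have eq: "(\<integral>\<^sup>+y. c * u y \<partial>G x) = c * (\<integral>\<^sup>+y. u y \<partial>G x)" if "x \<in> space M" for x
      using mG[OF that \<open>u \<in> borel_measurable N\<close>] by (rule nn_integral_cmult)
    show ?case by (rule measurable_cong[THEN iffD2, OF eq borel_measurable_times_ennreal[OF borel_measurable_const mult(4)]])
  next
    case (add u v)
    have eq: "(\<integral>\<^sup>+y. v y + u y \<partial>G x) = (\<integral>\<^sup>+y. v y \<partial>G x) + (\<integral>\<^sup>+y. u y \<partial>G x)" if "x \<in> space M" for x
      using mG[OF that \<open>u \<in> borel_measurable N\<close>] mG[OF that \<open>v \<in> borel_measurable N\<close>] by (intro nn_integral_add) auto
    have "(\<lambda>x. (\<integral>\<^sup>+y. v y \<partial>G x) + (\<integral>\<^sup>+y. u y \<partial>G x)) \<in> borel_measurable M" using add by (intro borel_measurable_add) auto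
    then show ?case by (subst measurable_cong[OF eq])
  next
    case (seq U)
    have eq: "(\<integral>\<^sup>+y. (SUP k. U k) y \<partial>G x) = (SUP k. \<integral>\<^sup>+y. U k y \<partial>G x)" if "x \<in> space M" for x
      unfolding SUP_apply using mG[OF that seq(1)] seq(3) by (intro nn_integral_monotone_convergence_SUP) simp_all
    have "(\<lambda>x. SUP k. \<integral>\<^sup>+y. U k y \<partial>G x) \<in> borel_measurable M" using seq by (intro borel_measurable_SUP) auto
    then show ?case by (subst measurable_cong[OF eq])
  qed
qed

lemma sets_configuration [simp]: "configuration T \<gamma> \<Longrightarrow> sets \<gamma> = sets (borel_of T)"
  by (auto simp: configuration_def)

lemma space_configuration: "configuration T \<gamma> \<Longrightarrow> space \<gamma> = topspace T"
  using sets_eq_imp_space_eq[OF sets_configuration] by simp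

lemma configD:
  assumes "proper_configuration T \<gamma>"
  shows "configuration T \<gamma>" "compactin T K \<Longrightarrow> emeasure \<gamma> K < \<infinity>" "x \<in> topspace T \<Longrightarrow> emeasure \<gamma> {x} \<le> 1"
  using assms by (auto simp: proper_configuration_def)

lemma emeasure_count_space_Int:
  "emeasure (count_space S) (A \<inter> S) = (if finite (A \<inter> S) then of_nat (card (A \<inter> S)) else \<infinity>)"
  by (subst emeasure_count_space) auto

text \<open>Interpreted below for X and for X times the space of clusters.\<close>

locale config_space =
  fixes T :: "'s topology" and B :: "'s set set"
  assumes haus: "Hausdorff_space T" and base: "countable_base T B"
begin

lemma singleton_sets [measurable]: "x \<in> topspace T \<Longrightarrow> {x} \<in> sets (borel_of T)"
  by (rule borel_of_singleton[OF haus])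

lemma config_of_set:
  assumes S: "S \<subseteq> topspace T"
  shows "sets (config_of_set T S) = sets (borel_of T)" "space (config_of_set T S) = topspace T"
  and "A \<in> sets (borel_of T) \<Longrightarrow> emeasure (config_of_set T S) A = emeasure (count_space S) (A \<inter> S)"
  and "f \<in> borel_measurable (borel_of T) \<Longrightarrow> (\<integral>\<^sup>+x. f x \<partial>config_of_set T S) = (\<integral>\<^sup>+x. f x \<partial>count_space S)"
  and "pts (config_of_set T S) = S"
proof -
  have m: "(\<lambda>s. s) \<in> measurable (count_space S) (borel_of T)" using S by auto
  show "sets (config_of_set T S) = sets (borel_of T)" and sp: "space (config_of_set T S) = topspace T"
    by (simp_all add: config_of_set_def)
  show em: "emeasure (config_of_set T S) A = emeasure (count_space S) (A \<inter> S)" if "A \<in> sets (borel_of T)" for A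
    unfolding config_of_set_def using m that by (simp add: emeasure_distr)
  show "(\<integral>\<^sup>+x. f x \<partial>config_of_set T S) = (\<integral>\<^sup>+x. f x \<partial>count_space S)" if "f \<in> borel_measurable (borel_of T)"
    unfolding config_of_set_def using m that by (simp add: nn_integral_distr)
  have "emeasure (config_of_set T S) {s} = indicator S s" if "s \<in> topspace T" for s
    using em[OF singleton_sets[OF that]] by (cases "s \<in> S") auto
  then show "pts (config_of_set T S) = S" using S by (auto simp: pts_def sp split: split_indicator_asm)
qed

lemma configuration_config_of_set:
  assumes S: "S \<subseteq> topspace T" "countable S"
  shows "configuration T (config_of_set T S)"
proof -
  let ?I = "to_nat_on S ` S" and ?s = "from_nat_into S"
  have b: "bij_betw ?s ?I S" using S(2) by (intro bij_betwI[where g = "to_nat_on S"]) (auto simp: from_nat_into_to_nat_on)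
  have m: "(\<lambda>s. s) \<in> measurable (count_space S) (borel_of T)" using S by auto
  have "config_of_set T S = distr (distr (count_space ?I) (count_space S) ?s) (borel_of T) (\<lambda>s. s)"
    unfolding config_of_set_def distr_bij_count_space[OF b] ..
  also have "\<dots> = distr (count_space ?I) (borel_of T) ?s" using m bij_betwE[OF b] by (subst distr_distr) (auto simp: o_def)
  finally show ?thesis unfolding configuration_def using S(1) bij_betwE[OF b] by (intro exI[of _ ?I] exI[of _ ?s]) auto
qed

lemma proper_config_of_set:
  assumes S: "S \<subseteq> topspace T" "countable S" and K: "\<And>K. compactin T K \<Longrightarrow> finite (K \<inter> S)"
  shows "proper_configuration T (config_of_set T S)" unfolding proper_configuration_def
proof (intro conjI allI impI ballI configuration_config_of_set S)
  fix K assume c: "compactin T K"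
  then have "K \<in> sets (borel_of T)" using haus by (intro borel_of_closedin compactin_imp_closedin)
  then show "emeasure (config_of_set T S) K < \<infinity>"
    using K[OF c] by (simp add: config_of_set(3)[OF S(1)] emeasure_count_space_Int of_nat_less_top)
next
  fix s assume "s \<in> topspace T"
  then show "emeasure (config_of_set T S) {s} \<le> 1" by (cases "s \<in> S") (auto simp: config_of_set(3)[OF S(1)] singleton_sets)
qed

text \<open>Two indices with the same point would give a singleton of mass at least 2. The indexing
  map is thus injective, and the configuration is the counting measure on its range.\<close>

lemma proper_config_eq:
  assumes \<gamma>: "proper_configuration T \<gamma>"
  shows "\<gamma> = config_of_set T (pts \<gamma>)" "countable (pts \<gamma>)" "pts \<gamma> \<subseteq> topspace T"
proof -
  obtain I :: "nat set" and s where s: "s \<in> I \<rightarrow> topspace T" "\<gamma> = distr (count_space I) (borel_of T) s"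
    using \<gamma> by (auto simp: proper_configuration_def configuration_def)
  have ms: "s \<in> measurable (count_space I) (borel_of T)" using s(1) by auto
  have em: "emeasure \<gamma> {x} = emeasure (count_space I) {i\<in>I. s i = x}" if "x \<in> topspace T" for x
  proof -
    have "s -` {x} \<inter> I = {i\<in>I. s i = x}" by auto
    then show ?thesis using s(2) ms that by (simp add: emeasure_distr singleton_sets)
  qed
  have inj: "inj_on s I"
  proof (rule inj_onI, rule ccontr)
    fix i j assume ij: "i \<in> I" "j \<in> I" "s i = s j" "i \<noteq> j"
    then have x: "s i \<in> topspace T" using s(1) by auto
    have "2 = emeasure (count_space I) {i, j}" using ij by (subst emeasure_count_space) auto
    also have "\<dots> \<le> emeasure (count_space I) {k\<in>I. s k = s i}" using ij by (intro emeasure_mono) auto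
    also have "\<dots> \<le> 1" using configD(3)[OF \<gamma> x] em[OF x] by simp
    finally show False by simp
  qed
  have "emeasure \<gamma> {x} \<noteq> 0 \<longleftrightarrow> x \<in> s ` I" if "x \<in> topspace T" for x
    unfolding em[OF that] by (subst emeasure_count_space_eq_0) auto
  then have p: "pts \<gamma> = s ` I" using s(1) space_configuration[OF configD(1)[OF \<gamma>]] by (auto simp: pts_def)
  then show "countable (pts \<gamma>)" "pts \<gamma> \<subseteq> topspace T" using s(1) by auto
  have b: "bij_betw s I (pts \<gamma>)" unfolding p using inj by (rule inj_on_imp_bij_betw)
  have m: "(\<lambda>s. s) \<in> measurable (count_pts \<gamma>) (borel_of T)" using s(1) p by auto
  have "config_of_set T (pts \<gamma>) = distr (distr (count_space I) (count_pts \<gamma>) s) (borel_of T) (\<lambda>s. s)"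
    unfolding config_of_set_def distr_bij_count_space[OF b] ..
  also have "\<dots> = distr (count_space I) (borel_of T) s" using m bij_betwE[OF b] by (subst distr_distr) (auto simp: o_def)
  finally show "\<gamma> = config_of_set T (pts \<gamma>)" using s(2) by simp
qed

lemma nn_integral_proper:
  assumes \<gamma>: "proper_configuration T \<gamma>" and f: "f \<in> borel_measurable (borel_of T)"
  shows "(\<integral>\<^sup>+x. f x \<partial>\<gamma>) = (\<integral>\<^sup>+x. f x \<partial>count_pts \<gamma>)"
  using config_of_set(4)[OF proper_config_eq(3)[OF \<gamma>] f] proper_config_eq(1)[OF \<gamma>] by simp

lemma emeasure_proper:
  assumes \<gamma>: "proper_configuration T \<gamma>" and A: "A \<in> sets (borel_of T)"
  shows "emeasure \<gamma> A = emeasure (count_pts \<gamma>) (A \<inter> pts \<gamma>)"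
  using config_of_set(3)[OF proper_config_eq(3)[OF \<gamma>] A] proper_config_eq(1)[OF \<gamma>] by simp

lemma finite_pts_compact:
  assumes \<gamma>: "proper_configuration T \<gamma>" and K: "compactin T K"
  shows "finite (K \<inter> pts \<gamma>)"
proof -
  have "K \<in> sets (borel_of T)" using haus K by (intro borel_of_closedin compactin_imp_closedin)
  then have "emeasure (count_pts \<gamma>) (K \<inter> pts \<gamma>) < \<infinity>" using configD(2)[OF \<gamma> K] emeasure_proper[OF \<gamma>] by simp
  then show ?thesis unfolding emeasure_count_space_Int by (auto split: if_splits)
qed

lemma emeasure_proper_eq_0_iff:
  assumes \<gamma>: "proper_configuration T \<gamma>" and A: "A \<in> sets (borel_of T)"
  shows "emeasure \<gamma> A = 0 \<longleftrightarrow> A \<inter> pts \<gamma> = {}" unfolding emeasure_proper[OF assms] by (subst emeasure_count_space_eq_0) auto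

lemma integral_config_of_set:
  fixes f :: "'s \<Rightarrow> real"
  assumes S: "S \<subseteq> topspace T" and f: "f \<in> borel_measurable (borel_of T)"
  shows "(\<integral>x. f x \<partial>config_of_set T S) = infsum f S" "integrable (config_of_set T S) f \<longleftrightarrow> f summable_on S"
proof -
  have m: "(\<lambda>s. s) \<in> measurable (count_space S) (borel_of T)" using S by auto
  have s: "f summable_on S \<longleftrightarrow> integrable (count_space S) f"
    using summable_on_iff_abs_summable_on_real[of f S] abs_summable_equivalent[of f S]
    by (simp only: Infinite_Set_Sum.abs_summable_on_def)
  show "integrable (config_of_set T S) f \<longleftrightarrow> f summable_on S" by (simp add: config_of_set_def integrable_distr_eq[OF m f] s)
  have "(\<integral>x. f x \<partial>config_of_set T S) = (\<integral>x. f x \<partial>count_space S)" by (simp add: config_of_set_def integral_distr[OF m f])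
  also have "\<dots> = infsum f S"
  proof (cases "f summable_on S")
    case True
    then have "Infinite_Set_Sum.abs_summable_on f S" using s by (simp add: Infinite_Set_Sum.abs_summable_on_def)
    from infsetsum_infsum[OF this] show ?thesis by (simp add: infsetsum_def)
  next
    \<comment> \<open>Without summability both sides have the default value zero.\<close>
    case False
    then show ?thesis using s by (simp add: infsum_not_exists not_integrable_integral_eq)
  qed
  finally show "(\<integral>x. f x \<partial>config_of_set T S) = infsum f S" .
qed

lemma pairing_eq_integral:
  assumes \<gamma>: "proper_configuration T \<gamma>" and f: "f \<in> borel_measurable (borel_of T)"
  shows "pairing f \<gamma> = (\<integral>x. f x \<partial>\<gamma>)" "integrable \<gamma> f \<longleftrightarrow> f summable_on pts \<gamma>"
  using integral_config_of_set[OF proper_config_eq(3)[OF \<gamma>] f]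
  unfolding pairing_def proper_config_eq(1)[OF \<gamma>, symmetric] by simp_all

subsection \<open>The \<open>\<sigma>\<close>-algebras on spaces of configurations\<close>

lemma count_algebra:
  shows "space (count_algebra T \<Omega>) = \<Omega>"
  and "A \<in> sets (borel_of T) \<Longrightarrow> (\<lambda>\<gamma>. emeasure \<gamma> A) \<in> borel_measurable (count_algebra T \<Omega>)"
  and "f \<in> space M \<rightarrow> \<Omega> \<Longrightarrow> (\<And>A. A \<in> sets (borel_of T) \<Longrightarrow> (\<lambda>x. emeasure (f x) A) \<in> borel_measurable M) \<Longrightarrow>
      f \<in> measurable M (count_algebra T \<Omega>)" proof - have ne: "{} \<in> sets (borel_of T)" by simp
  show "space (count_algebra T \<Omega>) = \<Omega>" unfolding count_algebra_def using ne by (subst space_Sup_eq_UN) auto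
  show "(\<lambda>\<gamma>. emeasure \<gamma> A) \<in> borel_measurable (count_algebra T \<Omega>)" if "A \<in> sets (borel_of T)" unfolding count_algebra_def
    using that by (intro measurable_Sup1[OF _ measurable_vimage_algebra1]) auto
  show "f \<in> measurable M (count_algebra T \<Omega>)"
    if "f \<in> space M \<rightarrow> \<Omega>" "\<And>A. A \<in> sets (borel_of T) \<Longrightarrow> (\<lambda>x. emeasure (f x) A) \<in> borel_measurable M"
    unfolding count_algebra_def using that ne by (intro measurable_Sup2) (auto intro!: measurable_vimage_algebra2)
qed

lemma space_Proper_Config: "space (Proper_Config T) = {\<gamma>. proper_configuration T \<gamma>}"
  and space_Config: "space (Config T) = {\<gamma>. configuration T \<gamma>}"
  by (simp_all add: Proper_Config_def Config_def count_algebra(1))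

lemma measurable_emeasure_Proper [measurable]:
  "A \<in> sets (borel_of T) \<Longrightarrow> (\<lambda>\<gamma>. emeasure \<gamma> A) \<in> borel_measurable (Proper_Config T)"
  and measurable_emeasure_Config [measurable]:
  "A \<in> sets (borel_of T) \<Longrightarrow> (\<lambda>\<gamma>. emeasure \<gamma> A) \<in> borel_measurable (Config T)"
  by (simp_all add: Proper_Config_def Config_def count_algebra(2))

lemma measurable_into_Proper:
  "f \<in> space M \<rightarrow> {\<gamma>. proper_configuration T \<gamma>} \<Longrightarrow>
    (\<And>A. A \<in> sets (borel_of T) \<Longrightarrow> (\<lambda>x. emeasure (f x) A) \<in> borel_measurable M) \<Longrightarrow>
    f \<in> measurable M (Proper_Config T)" and measurable_into_Config: "f \<in> space M \<rightarrow> {\<gamma>. configuration T \<gamma>} \<Longrightarrow>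
    (\<And>A. A \<in> sets (borel_of T) \<Longrightarrow> (\<lambda>x. emeasure (f x) A) \<in> borel_measurable M) \<Longrightarrow>
    f \<in> measurable M (Config T)" unfolding Proper_Config_def Config_def by (rule count_algebra(3); assumption)+

lemma measurable_nn_integral_Proper [measurable]:
  "f \<in> borel_measurable (borel_of T) \<Longrightarrow> (\<lambda>\<gamma>. \<integral>\<^sup>+x. f x \<partial>\<gamma>) \<in> borel_measurable (Proper_Config T)"
  by (rule measurable_nn_integral_family[where N = "borel_of T"])
    (auto simp: space_Proper_Config dest!: configD(1))

lemma measurable_integral_Proper [measurable]:
  fixes f :: "'s \<Rightarrow> real"
  assumes f: "f \<in> borel_measurable (borel_of T)"
  shows "(\<lambda>\<gamma>. \<integral>x. f x \<partial>\<gamma>) \<in> borel_measurable (Proper_Config T)"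
proof -
  let ?p = "\<lambda>\<gamma>. \<integral>\<^sup>+x. ennreal (f x) \<partial>\<gamma>" and ?n = "\<lambda>\<gamma>. \<integral>\<^sup>+x. ennreal (- f x) \<partial>\<gamma>"
  have [measurable]: "?p \<in> borel_measurable (Proper_Config T)" "?n \<in> borel_measurable (Proper_Config T)"
    using f by (auto intro!: measurable_nn_integral_Proper)
  \<comment> \<open>The formula by positive and negative parts, including the value zero of the
    integral of a function that is not integrable.\<close>
  have "(\<integral>x. f x \<partial>\<gamma>) = (if ?p \<gamma> < \<infinity> \<and> ?n \<gamma> < \<infinity> then enn2real (?p \<gamma>) - enn2real (?n \<gamma>) else 0)"
    if "\<gamma> \<in> space (Proper_Config T)" for \<gamma>
  proof -
    have m: "f \<in> borel_measurable \<gamma>" using that f measurable_cong_sets[OF sets_configuration refl, of T \<gamma> borel]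
      by (auto simp: space_Proper_Config dest: configD(1))
    then have i: "integrable \<gamma> f \<longleftrightarrow> ?p \<gamma> < \<infinity> \<and> ?n \<gamma> < \<infinity>" by (simp add: real_integrable_def less_top)
    show ?thesis using i real_lebesgue_integral_def[of \<gamma> f] not_integrable_integral_eq[of \<gamma> f] by auto
  qed
  then show ?thesis by (subst measurable_cong) auto
qed

lemma separate_finite:
  assumes P: "finite P" "P \<subseteq> topspace T"
  obtains W where "\<And>p. p \<in> P \<Longrightarrow> W p \<in> B" "\<And>p. p \<in> P \<Longrightarrow> p \<in> W p"
    "\<And>p q. p \<in> P \<Longrightarrow> q \<in> P \<Longrightarrow> p \<noteq> q \<Longrightarrow> W p \<inter> W q = {}"
proof -
  have "\<exists>U V. openin T U \<and> openin T V \<and> p \<in> U \<and> q \<in> V \<and> U \<inter> V = {}" if "p \<in> P" "q \<in> P" "p \<noteq> q" for p q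
    using haus that P(2) unfolding Hausdorff_space_def disjnt_def by blast
  then obtain U V where UV: "\<And>p q. p \<in> P \<Longrightarrow> q \<in> P \<Longrightarrow> p \<noteq> q \<Longrightarrow>
      openin T (U p q) \<and> openin T (V p q) \<and> p \<in> U p q \<and> q \<in> V p q \<and> U p q \<inter> V p q = {}" by metis
  \<comment> \<open>Neighbourhoods were chosen for ordered pairs: \<open>U p q\<close> when p comes
    first and \<open>V q p\<close> when it comes second. Both are intersected, so that
    \<open>W p\<close> lies in \<open>U p q\<close> and \<open>W q\<close> in
    \<open>V p q\<close>.\<close>
  define O' where "O' p = topspace T \<inter> (\<Inter>q\<in>P - {p}. U p q \<inter> V q p)" for p
  have "\<exists>W. W \<in> B \<and> p \<in> W \<and> W \<subseteq> O' p" if p: "p \<in> P" for p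
  proof -
    have "openin T (O' p)" unfolding O'_def using UV p P(1) by (intro openin_Int_Inter) auto
    moreover have "p \<in> O' p" unfolding O'_def using UV p P(2) by auto
    ultimately show ?thesis using countable_baseD(3)[OF base] by blast
  qed
  then obtain W where W: "\<And>p. p \<in> P \<Longrightarrow> W p \<in> B \<and> p \<in> W p \<and> W p \<subseteq> O' p" by metis
  have "W p \<inter> W q = {}" if "p \<in> P" "q \<in> P" "p \<noteq> q" for p q
  proof -
    have "W p \<subseteq> U p q" "W q \<subseteq> V p q" using W[OF that(1)] W[OF that(2)] that unfolding O'_def by blast+
    then show ?thesis using UV[OF that] by blast
  qed
  then show ?thesis using that W by blast
qed

definition void_event :: "'s set \<Rightarrow> 's measure set" where
  "void_event A = {\<gamma>. proper_configuration T \<gamma> \<and> emeasure \<gamma> A = 0}"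

definition dissections :: "'s set set set" where
  "dissections = {D. finite D \<and> D \<subseteq> B \<and> disjoint D}"

text \<open>A proper configuration is recovered from the sets that it does not charge: the number of its
  points in \<open>A\<close> is the largest number of disjoint base sets whose intersections with \<open>A\<close> it hits.\<close>

lemma emeasure_eq_SUP_hits:
  assumes \<gamma>: "proper_configuration T \<gamma>" and A: "A \<in> sets (borel_of T)"
  shows "emeasure \<gamma> A = (SUP D\<in>dissections. \<Sum>U\<in>D. if emeasure \<gamma> (A \<inter> U) = 0 then 0 else 1)"
proof (rule antisym)
  have Bm: "U \<in> sets (borel_of T)" if "U \<in> B" for U using countable_baseD(2)[OF base that] by auto
  note em = emeasure_proper[OF \<gamma>]
  show "(SUP D\<in>dissections. \<Sum>U\<in>D. if emeasure \<gamma> (A \<inter> U) = 0 then 0 else 1) \<le> emeasure \<gamma> A"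
  proof (rule SUP_least)
    fix D assume D: "D \<in> dissections"
    have "(\<Sum>U\<in>D. if emeasure \<gamma> (A \<inter> U) = 0 then 0 else 1) \<le> (\<Sum>U\<in>D. emeasure \<gamma> (A \<inter> U))"
    proof (rule sum_mono)
      fix U assume "U \<in> D"
      then have U: "A \<inter> U \<in> sets (borel_of T)" using D A Bm by (auto simp: dissections_def)
      show "(if emeasure \<gamma> (A \<inter> U) = 0 then 0 else 1) \<le> emeasure \<gamma> (A \<inter> U)"
      proof (cases "emeasure \<gamma> (A \<inter> U) = 0")
        case False
        then have ne: "A \<inter> U \<inter> pts \<gamma> \<noteq> {}" using emeasure_proper_eq_0_iff[OF \<gamma> U] by simp
        have "(1::ennreal) \<le> of_nat (card (A \<inter> U \<inter> pts \<gamma>))" if "finite (A \<inter> U \<inter> pts \<gamma>)"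
        proof -
          have "1 \<le> card (A \<inter> U \<inter> pts \<gamma>)" using ne that by (simp add: Suc_leI card_gt_0_iff)
          then show ?thesis by (metis of_nat_1 of_nat_le_iff)
        qed
        then show ?thesis using False by (simp add: em[OF U] emeasure_count_space_Int)
      qed simp
    qed
    also have "\<dots> = emeasure \<gamma> (\<Union>U\<in>D. A \<inter> U)"
    proof (rule sum_emeasure)
      show "(\<lambda>U. A \<inter> U) ` D \<subseteq> sets \<gamma>"
        using D A Bm sets_configuration[OF configD(1)[OF \<gamma>]] by (auto simp: dissections_def)
      show "disjoint_family_on (\<lambda>U. A \<inter> U) D" "finite D"
        using D unfolding dissections_def disjoint_family_on_def disjoint_def by blast+
    qed
    also have "\<dots> \<le> emeasure \<gamma> A" using A \<gamma> by (intro emeasure_mono) (auto dest: configD(1))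
    finally show "(\<Sum>U\<in>D. if emeasure \<gamma> (A \<inter> U) = 0 then 0 else 1) \<le> emeasure \<gamma> A" .
  qed
  \<comment> \<open>Conversely, finitely many points of the configuration in A can be separated by
    disjoint base sets, and each of these is hit.\<close>
  have key: "of_nat (card P) \<le> (SUP D\<in>dissections. \<Sum>U\<in>D. if emeasure \<gamma> (A \<inter> U) = 0 then 0 else (1::ennreal))"
    if P: "finite P" "P \<subseteq> A \<inter> pts \<gamma>" for P
  proof -
    have PT: "P \<subseteq> topspace T" using P proper_config_eq(3)[OF \<gamma>] by blast
    obtain W where W: "\<And>p. p \<in> P \<Longrightarrow> W p \<in> B" "\<And>p. p \<in> P \<Longrightarrow> p \<in> W p"
      "\<And>p q. p \<in> P \<Longrightarrow> q \<in> P \<Longrightarrow> p \<noteq> q \<Longrightarrow> W p \<inter> W q = {}"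
      by (rule separate_finite[OF P(1) PT]) blast
    have inj: "inj_on W P" by (rule inj_onI) (metis W(2,3) disjoint_iff)
    have D: "W ` P \<in> dissections" using P(1) W(1,3) unfolding dissections_def disjoint_def by blast
    have "emeasure \<gamma> (A \<inter> W p) \<noteq> 0" if "p \<in> P" for p
      using that P(2) W(1,2)[OF that] A Bm emeasure_proper_eq_0_iff[OF \<gamma>, of "A \<inter> W p"] by blast
    then have "(\<Sum>U\<in>W ` P. if emeasure \<gamma> (A \<inter> U) = 0 then 0 else (1::ennreal)) = of_nat (card P)"
      by (simp add: sum.reindex[OF inj])
    then show ?thesis using SUP_upper[OF D, of "\<lambda>D. \<Sum>U\<in>D. if emeasure \<gamma> (A \<inter> U) = 0 then 0 else (1::ennreal)"] by simp
  qed
  show "emeasure \<gamma> A \<le> (SUP D\<in>dissections. \<Sum>U\<in>D. if emeasure \<gamma> (A \<inter> U) = 0 then 0 else 1)"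
  proof (cases "finite (A \<inter> pts \<gamma>)")
    case True
    then show ?thesis using key[of "A \<inter> pts \<gamma>"] by (simp add: em[OF A] emeasure_count_space_Int)
  next
    case False
    have "of_nat n \<le> (SUP D\<in>dissections. \<Sum>U\<in>D. if emeasure \<gamma> (A \<inter> U) = 0 then 0 else (1::ennreal))" for n
      using infinite_arbitrarily_large[OF False, of n] key by blast
    then have "(SUP n. of_nat n) \<le> (SUP D\<in>dissections. \<Sum>U\<in>D. if emeasure \<gamma> (A \<inter> U) = 0 then 0 else (1::ennreal))"
      by (rule SUP_least)
    then show ?thesis unfolding ennreal_SUP_of_nat_eq_top by (rule order_trans[OF top_greatest])
  qed
qed

text \<open>By \<open>emeasure_eq_SUP_hits\<close> each count is a supremum, over the countable set
  of dissections, of sums of indicators that some set is charged. So the void events already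
  generate the \<sigma>-algebra.\<close>

lemma sets_Proper_Config:
  "sets (Proper_Config T) = sigma_sets {\<gamma>. proper_configuration T \<gamma>} (void_event ` sets (borel_of T))"
proof (rule antisym)
  let ?\<Omega> = "{\<gamma>. proper_configuration T \<gamma>}"
  let ?V = "sigma ?\<Omega> (void_event ` sets (borel_of T))"
  have sub: "void_event ` sets (borel_of T) \<subseteq> Pow ?\<Omega>" by (auto simp: void_event_def)
  have sV: "sets ?V = sigma_sets ?\<Omega> (void_event ` sets (borel_of T))" "space ?V = ?\<Omega>"
    using sub by (simp_all add: sets_measure_of space_measure_of)
  have "(\<lambda>\<gamma>. \<gamma>) \<in> measurable ?V (Proper_Config T)"
  proof (rule measurable_into_Proper)
    fix A assume A: "A \<in> sets (borel_of T)"
    have v: "(\<lambda>\<gamma>. if emeasure \<gamma> A' = 0 then 0 else (1::ennreal)) \<in> borel_measurable ?V"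
      if "A' \<in> sets (borel_of T)" for A'
    proof -
      have [measurable]: "void_event A' \<in> sets ?V" unfolding sV using that by blast
      have "(\<lambda>\<gamma>. if \<gamma> \<in> void_event A' then 0 else (1::ennreal)) \<in> borel_measurable ?V" by measurable
      moreover have "(if \<gamma> \<in> void_event A' then 0 else (1::ennreal)) = (if emeasure \<gamma> A' = 0 then 0 else 1)"
        if "\<gamma> \<in> space ?V" for \<gamma>
        using that unfolding sV by (simp add: void_event_def)
      ultimately show ?thesis by (rule measurable_cong[THEN iffD1, rotated])
    qed
    have "countable dissections"
    proof -
      have "dissections \<subseteq> {D. finite D \<and> D \<subseteq> B}" by (auto simp: dissections_def)
      then show ?thesis using countable_Collect_finite_subset[OF countable_baseD(1)[OF base]] by (rule countable_subset)
    qed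
    then have "(\<lambda>\<gamma>. SUP D\<in>dissections. \<Sum>U\<in>D. if emeasure \<gamma> (A \<inter> U) = 0 then 0 else (1::ennreal)) \<in> borel_measurable ?V"
      using A countable_baseD(2)[OF base] by (intro borel_measurable_SUP borel_measurable_sum v) (auto simp: dissections_def)
    then show "(\<lambda>\<gamma>. emeasure \<gamma> A) \<in> borel_measurable ?V"
      by (subst measurable_cong[OF emeasure_eq_SUP_hits[OF _ A]]) (auto simp: sV)
  qed (simp add: sV)
  then have "sets (Proper_Config T) \<subseteq> sets ?V" by (rule sets_subset_measurable_id) (simp add: sV space_Proper_Config)
  then show "sets (Proper_Config T) \<subseteq> sigma_sets ?\<Omega> (void_event ` sets (borel_of T))" unfolding sV .
  have "void_event A \<in> sets (Proper_Config T)" if A: "A \<in> sets (borel_of T)" for A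
  proof -
    have "void_event A = {\<gamma>\<in>space (Proper_Config T). emeasure \<gamma> A = 0}" by (simp add: void_event_def space_Proper_Config)
    also have "\<dots> \<in> sets (Proper_Config T)" using A by measurable
    finally show ?thesis .
  qed
  then show "sigma_sets ?\<Omega> (void_event ` sets (borel_of T)) \<subseteq> sets (Proper_Config T)"
    using sets.sigma_sets_subset[of "void_event ` sets (borel_of T)" "Proper_Config T"] by (auto simp: space_Proper_Config)
qed

text \<open>A configuration misses both A and A' iff it misses their union.\<close>

lemma Int_stable_void_event: "Int_stable (void_event ` sets (borel_of T))"
proof (rule Int_stableI_image)
  fix A A' assume A: "A \<in> sets (borel_of T)" "A' \<in> sets (borel_of T)"
  have "emeasure \<gamma> (A \<union> A') = 0 \<longleftrightarrow> emeasure \<gamma> A = 0 \<and> emeasure \<gamma> A' = 0" if "proper_configuration T \<gamma>" for \<gamma>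
    using emeasure_proper_eq_0_iff[OF that] A by (auto simp: Int_Un_distrib2)
  then have "void_event A \<inter> void_event A' = void_event (A \<union> A')" by (auto simp: void_event_def)
  then show "\<exists>C\<in>sets (borel_of T). void_event A \<inter> void_event A' = void_event C" using A by blast
qed

end

section \<open>Marked configurations\<close>

text \<open>A fixed choice, because the interpretations of \<open>config_space\<close> take the base
  as an argument.\<close>

definition point_base :: "'x::second_countable_topology set set" where
  "point_base = (SOME B. countable_base euclidean B)"

definition marked_base :: "('x::second_countable_topology \<times> 'x cluster) set set" where
  "marked_base = (\<lambda>(U, V). U \<times> V) ` (point_base \<times> cluster_base point_base)"

lemma countable_point_base: "countable_base euclidean (point_base :: 'x::second_countable_topology set set)"
  unfolding point_base_def using countable_base_euclidean[where 'a = 'x] by (metis someI)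

lemma config_space_euclidean:
  "config_space (euclidean :: 'x::{second_countable_topology,t2_space} topology) point_base"
proof
  show "Hausdorff_space (euclidean :: 'x topology)"
    unfolding Hausdorff_space_def disjnt_def using hausdorff by (metis open_openin)
qed (rule countable_point_base)

lemma config_space_marked:
  "config_space (marked_top :: ('x::{second_countable_topology,t2_space} \<times> 'x cluster) topology) marked_base"
proof
  show "Hausdorff_space (marked_top :: 'x marked topology)" unfolding marked_top_def Hausdorff_space_prod_topology
    using Hausdorff_cluster config_space.haus[OF config_space_euclidean] by blast
  show "countable_base (marked_top :: 'x marked topology) marked_base" unfolding marked_top_def marked_base_def
    by (intro countable_base_prod countable_base_cluster countable_point_base)
qed

abbreviation mborel :: "('x::topological_space \<times> 'x cluster) measure" where
  "mborel \<equiv> borel_of marked_top"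

lemma sets_marked_borel [measurable_cong]:
  "sets (mborel :: ('x::second_countable_topology \<times> 'x cluster) measure) = sets pair_borel"
  unfolding marked_top_def
  using sets_borel_of_prod[OF countable_point_base countable_base_cluster[OF countable_point_base]] by simp

lemmas measurable_cong_marked = measurable_cong_sets[OF sets_marked_borel refl]

lemma topspace_marked: "topspace marked_top = UNIV \<times> clusters"
  by (simp add: marked_top_def)

interpretation CX: config_space "euclidean :: 'x::{second_countable_topology,t2_space} topology" point_base
  by (rule config_space_euclidean)

interpretation CZ: config_space "marked_top :: ('x::{second_countable_topology,t2_space} \<times> 'x cluster) topology" marked_base
  by (rule config_space_marked)

lemmas countable_pts = CX.proper_config_eq(2)

section \<open>Random marking of a configuration, and its dependence on the configuration\<close>

definition marked :: "'x::topological_space measure \<Rightarrow> ('x \<Rightarrow> 'x cluster) \<Rightarrow> 'x marked measure" where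
  "marked \<gamma> \<omega> = config_of_set marked_top ((\<lambda>x. (x, \<omega> x)) ` pts \<gamma>)"

definition mark_kernel ::
  "('x::topological_space \<Rightarrow> 'x cluster measure) \<Rightarrow> 'x measure \<Rightarrow> 'x marked measure measure" where
  "mark_kernel \<eta> \<gamma> = distr (Pi\<^sub>M (pts \<gamma>) \<eta>) (Proper_Config marked_top) (marked \<gamma>)"

lemma mu_hat_bind: "mu_hat \<mu> \<eta> = \<mu> \<bind> mark_kernel \<eta>"
  by (simp add: mu_hat_def mark_kernel_def[abs_def] marked_def[abs_def])

context cluster_density
begin

abbreviation marks :: "'x measure \<Rightarrow> ('x \<Rightarrow> 'x cluster) measure" where
  "marks \<gamma> \<equiv> Pi\<^sub>M (pts \<gamma>) \<eta>"

lemma prob_marks: "prob_space (Pi\<^sub>M I \<eta>)"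
  by (rule prob_space_PiM) (rule prob_eta)

lemma measurable_mark [measurable]: "x \<in> I \<Longrightarrow> (\<lambda>\<omega>. \<omega> x) \<in> measurable (Pi\<^sub>M I \<eta>) cborel"
  using measurable_component_singleton[of x I \<eta>] by (simp only: measurable_cong_sets[OF refl sets_eta])

lemma mark_in: "\<omega> \<in> space (Pi\<^sub>M I \<eta>) \<Longrightarrow> x \<in> I \<Longrightarrow> \<omega> x \<in> clusters"
  by (auto simp: space_PiM PiE_iff)

lemma measurable_mark_pair [measurable]:
  assumes f: "f \<in> measurable mborel N" and x: "x \<in> I"
  shows "(\<lambda>\<omega>. f (x, \<omega> x)) \<in> measurable (Pi\<^sub>M I \<eta>) N"
proof -
  have "(\<lambda>\<omega>. (x, \<omega> x)) \<in> measurable (Pi\<^sub>M I \<eta>) pair_borel" using x by measurable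
  then have "(\<lambda>\<omega>. (x, \<omega> x)) \<in> measurable (Pi\<^sub>M I \<eta>) mborel"
    by (simp only: measurable_cong_sets[OF refl sets_marked_borel])
  then show ?thesis using f by (rule measurable_compose)
qed

lemma measurable_section [measurable]:
  fixes f :: "'x \<times> 'x cluster \<Rightarrow> 'b"
  assumes f: "f \<in> measurable mborel N"
  shows "(\<lambda>ys. f (x, ys)) \<in> measurable cborel N"
proof -
  have "(\<lambda>ys. (x, ys)) \<in> measurable cborel pair_borel" by measurable
  then have "(\<lambda>ys. (x, ys)) \<in> measurable cborel mborel"
    by (simp only: measurable_cong_sets[OF refl sets_marked_borel])
  then show ?thesis using f by (rule measurable_compose)
qed

lemma mark_set:
  assumes \<gamma>: "proper \<gamma>" and \<omega>: "\<omega> \<in> space (marks \<gamma>)"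
  shows "(\<lambda>x. (x, \<omega> x)) ` pts \<gamma> \<subseteq> topspace marked_top" "countable ((\<lambda>x. (x, \<omega> x)) ` pts \<gamma>)"
  using mark_in[OF \<omega>] countable_pts[OF \<gamma>] by (auto simp: topspace_marked)

text \<open>A compact set of marked points projects to a compact set of centres, which contains
  finitely many points of \<gamma>, and each centre carries a single mark.\<close>

lemma proper_mark_config:
  assumes \<gamma>: "proper \<gamma>" and \<omega>: "\<omega> \<in> space (marks \<gamma>)"
  shows "proper_marked (marked \<gamma> \<omega>)" unfolding marked_def
proof (rule CZ.proper_config_of_set[OF mark_set[OF assms]])
  fix K :: "('x \<times> 'x cluster) set" assume K: "compactin marked_top K"
  then have "compactin euclidean (fst ` K)" by (rule image_compactin) (simp add: marked_top_def continuous_map_fst)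
  then have "finite (fst ` K \<inter> pts \<gamma>)" by (rule CX.finite_pts_compact[OF \<gamma>])
  then have "finite ((\<lambda>x. (x, \<omega> x)) ` (fst ` K \<inter> pts \<gamma>))" by simp
  then show "finite (K \<inter> (\<lambda>x. (x, \<omega> x)) ` pts \<gamma>)" by (rule rev_finite_subset) force
qed

lemma pts_mark_config:
  assumes "proper \<gamma>" "\<omega> \<in> space (marks \<gamma>)"
  shows "pts (marked \<gamma> \<omega>) = (\<lambda>x. (x, \<omega> x)) ` pts \<gamma>"
  unfolding marked_def by (rule CZ.config_of_set(5)[OF mark_set(1)[OF assms]])

lemma nn_integral_mark_config:
  assumes \<gamma>: "proper \<gamma>" and \<omega>: "\<omega> \<in> space (marks \<gamma>)"
  and f: "f \<in> borel_measurable mborel"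
  shows "(\<integral>\<^sup>+z. f z \<partial>marked \<gamma> \<omega>) = (\<integral>\<^sup>+x. f (x, \<omega> x) \<partial>count_pts \<gamma>)"
proof -
  have "bij_betw (\<lambda>x. (x, \<omega> x)) (pts \<gamma>) ((\<lambda>x. (x, \<omega> x)) ` pts \<gamma>)" by (intro inj_on_imp_bij_betw inj_onI) auto
  from nn_integral_bij_count_space[OF this, of f] show ?thesis
    unfolding marked_def CZ.config_of_set(4)[OF mark_set(1)[OF \<gamma> \<omega>] f] by simp
qed

lemma integral_mark_config:
  fixes f :: "'x \<times> 'x cluster \<Rightarrow> real"
  assumes \<gamma>: "proper \<gamma>" and \<omega>: "\<omega> \<in> space (marks \<gamma>)"
  and f: "f \<in> borel_measurable mborel"
  shows "(\<integral>z. f z \<partial>marked \<gamma> \<omega>) = (\<integral>x. f (x, \<omega> x) \<partial>count_pts \<gamma>)"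
proof -
  have b: "bij_betw (\<lambda>x. (x, \<omega> x)) (pts \<gamma>) ((\<lambda>x. (x, \<omega> x)) ` pts \<gamma>)" by (intro inj_on_imp_bij_betw inj_onI) auto
  have m: "(\<lambda>s. s) \<in> measurable (count_space ((\<lambda>x. (x, \<omega> x)) ` pts \<gamma>)) mborel" using mark_set(1)[OF \<gamma> \<omega>] by auto
  show ?thesis unfolding marked_def config_of_set_def integral_distr[OF m f]
    by (rule integral_bij_count_space[OF b, symmetric])
qed

lemma measurable_mark_config [measurable]:
  assumes \<gamma>: "proper \<gamma>"
  shows "marked \<gamma> \<in> measurable (marks \<gamma>) (Proper_Config marked_top)"
proof (rule CZ.measurable_into_Proper)
  show "marked \<gamma> \<in> space (marks \<gamma>) \<rightarrow> {\<gamma>. proper_marked \<gamma>}" using proper_mark_config[OF \<gamma>] by auto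
  fix A :: "('x \<times> 'x cluster) set" assume A: "A \<in> sets mborel"
  have "emeasure (marked \<gamma> \<omega>) A = (\<integral>\<^sup>+x. indicator A (x, \<omega> x) \<partial>count_pts \<gamma>)"
    if \<omega>: "\<omega> \<in> space (marks \<gamma>)" for \<omega>
  proof -
    have "emeasure (marked \<gamma> \<omega>) A = (\<integral>\<^sup>+z. indicator A z \<partial>marked \<gamma> \<omega>)"
      using A sets_configuration[OF configD(1)[OF proper_mark_config[OF \<gamma> \<omega>]]]
      by (intro nn_integral_indicator[symmetric]) auto
    also have "\<dots> = (\<integral>\<^sup>+x. indicator A (x, \<omega> x) \<partial>count_pts \<gamma>)" using A by (intro nn_integral_mark_config[OF \<gamma> \<omega>]) auto
    finally show ?thesis .
  qed
  moreover have "(\<lambda>\<omega>. \<integral>\<^sup>+x. indicator A (x, \<omega> x) \<partial>count_pts \<gamma>) \<in> borel_measurable (marks \<gamma>)" using A countable_pts[OF \<gamma>]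
    by (intro measurable_nn_integral_count_space measurable_mark_pair) auto
  ultimately show "(\<lambda>\<omega>. emeasure (marked \<gamma> \<omega>) A) \<in> borel_measurable (marks \<gamma>)" by (subst measurable_cong) auto
qed

lemma prob_mark_kernel:
  assumes \<gamma>: "proper \<gamma>" shows "prob_space (mark_kernel \<eta> \<gamma>)"
  unfolding mark_kernel_def by (rule prob_space.prob_space_distr[OF prob_marks measurable_mark_config[OF \<gamma>]])

text \<open>That no centre in \<open>K n\<close> produces a marked point in A is a cylinder event,
  with a finite product as its probability by independence. These events decrease to the void event
  as n grows.\<close>

lemma void_prob:
  assumes \<gamma>: "proper \<gamma>" and A: "A \<in> sets mborel"
  and K: "\<And>n. compact (K n)" "incseq K" "(\<Union>n. K n) = UNIV"
  shows "emeasure (mark_kernel \<eta> \<gamma>) (CZ.void_event A) =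
    (INF n. \<Prod>x\<in>K n \<inter> pts \<gamma>. emeasure (\<eta> x) {ys\<in>clusters. (x, ys) \<notin> A})" proof - let ?E = "\<lambda>x. {ys\<in>clusters. (x, ys) \<notin> A}"
  let ?P = "marks \<gamma>"
  interpret P: prob_space ?P by (rule prob_marks)
  have Em: "?E x \<in> sets cborel" for x
  proof -
    have "(\<lambda>z. z \<in> A) \<in> measurable mborel (count_space UNIV)" using A by measurable
    from measurable_section[OF this, of x]
    have [measurable]: "Measurable.pred cborel (\<lambda>ys. (x, ys) \<in> A)" .
    have "{ys\<in>space cborel. (x, ys) \<notin> A} \<in> sets cborel" by measurable
    then show ?thesis unfolding space_borel_of .
  qed
  have fin: "finite (K n \<inter> pts \<gamma>)" for n using CX.finite_pts_compact[OF \<gamma>, of "K n"] K(1) by simp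
  define F where "F n = prod_emb (pts \<gamma>) \<eta> (K n \<inter> pts \<gamma>) (PiE (K n \<inter> pts \<gamma>) ?E)" for n
  have Fm: "F n \<in> sets ?P" for n unfolding F_def by (rule sets_PiM_I[OF fin Int_lower2]) (simp add: Em)
  have F_iff: "\<omega> \<in> F n \<longleftrightarrow> \<omega> \<in> space ?P \<and> (\<forall>x\<in>K n \<inter> pts \<gamma>. (x, \<omega> x) \<notin> A)" for \<omega> n
  proof -
    have "\<omega> \<in> F n \<longleftrightarrow> restrict \<omega> (K n \<inter> pts \<gamma>) \<in> PiE (K n \<inter> pts \<gamma>) ?E \<and> \<omega> \<in> space ?P"
      unfolding F_def prod_emb_def space_PiM by blast
    then show ?thesis unfolding restrict_PiE_iff using mark_in[of \<omega> "pts \<gamma>"] by blast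
  qed
  have Fe: "emeasure ?P (F n) = (\<Prod>x\<in>K n \<inter> pts \<gamma>. emeasure (\<eta> x) (?E x))" for n
    unfolding F_def by (rule emeasure_PiM_emb[OF prob_eta Int_lower2 fin]) (simp only: sets_eta Em)
  have vm: "CZ.void_event A \<in> sets (Proper_Config marked_top)" unfolding CZ.sets_Proper_Config using A by blast
  have "marked \<gamma> -` CZ.void_event A \<inter> space ?P = (\<Inter>n. F n)"
  proof (rule set_eqI)
    fix \<omega>
    show "\<omega> \<in> marked \<gamma> -` CZ.void_event A \<inter> space ?P \<longleftrightarrow> \<omega> \<in> (\<Inter>n. F n)"
    proof (cases "\<omega> \<in> space ?P")
      case True
      have "\<omega> \<in> marked \<gamma> -` CZ.void_event A \<longleftrightarrow> A \<inter> (\<lambda>x. (x, \<omega> x)) ` pts \<gamma> = {}" unfolding CZ.void_event_def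
        using proper_mark_config[OF \<gamma> True] CZ.emeasure_proper_eq_0_iff[OF proper_mark_config[OF \<gamma> True] A]
        by (simp add: pts_mark_config[OF \<gamma> True])
      also have "\<dots> \<longleftrightarrow> (\<forall>x\<in>pts \<gamma>. (x, \<omega> x) \<notin> A)" by blast
      also have "\<dots> \<longleftrightarrow> (\<forall>n. \<forall>x\<in>K n \<inter> pts \<gamma>. (x, \<omega> x) \<notin> A)" using K(3) by blast
      finally show ?thesis using True F_iff by blast
    qed (use F_iff in blast)
  qed
  then have "emeasure (mark_kernel \<eta> \<gamma>) (CZ.void_event A) = emeasure ?P (\<Inter>n. F n)"
    unfolding mark_kernel_def using emeasure_distr[OF measurable_mark_config[OF \<gamma>] vm] by simp
  also have "\<dots> = (INF n. emeasure ?P (F n))"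
  proof (rule INF_emeasure_decseq[symmetric])
    show "range F \<subseteq> sets ?P" using Fm by auto
    show "decseq F" unfolding decseq_def
    proof (intro allI impI subsetI)
      fix m n \<omega> assume "m \<le> n" "\<omega> \<in> F n"
      then show "\<omega> \<in> F m" using incseqD[OF K(2), of m n] unfolding F_iff by blast
    qed
  qed simp
  finally show ?thesis unfolding Fe .
qed

text \<open>A logarithm turns the product over the points in K into an integral against \<gamma>,
  which is measurable in \<gamma>. Points where a vanishes form the set \<open>?Z\<close>; charging
  it makes the product zero and is a measurable event.\<close>

lemma measurable_prod_pts:
  fixes a :: "'x \<Rightarrow> ennreal"
  assumes K: "compact K" and a: "a \<in> borel_measurable borel" "\<And>x. a x \<le> 1"
  shows "(\<lambda>\<gamma>. \<Prod>x\<in>K \<inter> pts \<gamma>. a x) \<in> borel_measurable (Proper_Config euclidean)"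
proof -
  note a(1)[measurable]
  have Km [measurable]: "K \<in> sets borel" using compact_imp_closed[OF K] by auto
  let ?Z = "K \<inter> {x. a x = 0}"
  have Zm [measurable]: "?Z \<in> sets borel" by measurable
  let ?l = "\<lambda>x. ennreal (- ln (enn2real (a x))) * indicator K x"
  let ?g = "\<lambda>\<gamma>. if emeasure \<gamma> ?Z \<noteq> 0 then 0 else ennreal (exp (- enn2real (\<integral>\<^sup>+x. ?l x \<partial>\<gamma>)))"
  have "?g \<in> borel_measurable (Proper_Config euclidean)"
  proof -
    have E: "(\<lambda>\<gamma>. emeasure \<gamma> ?Z) \<in> borel_measurable (Proper_Config euclidean)" by (rule CX.measurable_emeasure_Proper) simp
    have I: "(\<lambda>\<gamma>. \<integral>\<^sup>+x. ?l x \<partial>\<gamma>) \<in> borel_measurable (Proper_Config euclidean)" by (rule CX.measurable_nn_integral_Proper) simp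
    have "(\<lambda>\<gamma>. if E \<gamma> \<noteq> (0::ennreal) then 0 else ennreal (exp (- enn2real (I \<gamma>)))) \<in> borel_measurable M"
      if [measurable]: "E \<in> borel_measurable M" "I \<in> borel_measurable M" for E I and M :: "'x measure measure"
      by measurable
    from this[OF E I] show ?thesis .
  qed
  moreover have eq: "(\<Prod>x\<in>K \<inter> pts \<gamma>. a x) = ?g \<gamma>" if "\<gamma> \<in> space (Proper_Config euclidean)" for \<gamma>
  proof -
    have \<gamma>: "proper \<gamma>" using that by (simp add: CX.space_Proper_Config)
    have fin: "finite (K \<inter> pts \<gamma>)" using CX.finite_pts_compact[OF \<gamma>, of K] K by simp
    show ?thesis
    proof (cases "emeasure \<gamma> ?Z = 0")
      case False
      then have "?Z \<inter> pts \<gamma> \<noteq> {}" using CX.emeasure_proper_eq_0_iff[OF \<gamma>, of ?Z] Zm by simp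
      then obtain x where "x \<in> K \<inter> pts \<gamma>" "a x = 0" by blast
      then have "(\<Prod>x\<in>K \<inter> pts \<gamma>. a x) = 0" using fin by (intro prod_zero) auto
      then show ?thesis using False by simp
    next
      case True
      then have pos: "a x \<noteq> 0" if "x \<in> K \<inter> pts \<gamma>" for x using that CX.emeasure_proper_eq_0_iff[OF \<gamma>, of ?Z] Zm by auto
      define r where "r x = enn2real (a x)" for x
      have ar: "a x = ennreal (r x)" for x
        using a(2)[of x] unfolding r_def by (metis ennreal_enn2real ennreal_one_neq_top top.not_eq_extremum top.extremum_uniqueI)
      have r: "0 < r x" "r x \<le> 1" if "x \<in> K \<inter> pts \<gamma>" for x
      proof -
        show "r x \<le> 1" unfolding r_def using a(2)[of x] by (metis enn2real_mono enn2real_1 ennreal_one_less_top)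
        have "r x \<noteq> 0" using pos[OF that] ar[of x] by auto
        then show "0 < r x" unfolding r_def using enn2real_nonneg[of "a x"] by linarith
      qed
      have "(\<integral>\<^sup>+x. ?l x \<partial>\<gamma>) = (\<integral>\<^sup>+x. ?l x \<partial>count_pts \<gamma>)" by (rule CX.nn_integral_proper[OF \<gamma>]) simp
      also have "\<dots> = (\<Sum>x\<in>K \<inter> pts \<gamma>. ?l x)" by (rule nn_integral_count_space'[OF fin]) (auto split: split_indicator)
      also have "\<dots> = ennreal (\<Sum>x\<in>K \<inter> pts \<gamma>. - ln (r x))"
        using r by (subst sum_ennreal[symmetric]) (auto intro!: sum.cong simp: r_def)
      finally have "(\<integral>\<^sup>+x. ?l x \<partial>\<gamma>) = ennreal (\<Sum>x\<in>K \<inter> pts \<gamma>. - ln (r x))" .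
      then have "enn2real (\<integral>\<^sup>+x. ?l x \<partial>\<gamma>) = (\<Sum>x\<in>K \<inter> pts \<gamma>. - ln (r x))"
      proof -
        have "0 \<le> (\<Sum>x\<in>K \<inter> pts \<gamma>. - ln (r x))" using r by (intro sum_nonneg) auto
        then show ?thesis using \<open>(\<integral>\<^sup>+x. ?l x \<partial>\<gamma>) = ennreal (\<Sum>x\<in>K \<inter> pts \<gamma>. - ln (r x))\<close> by (simp only: enn2real_ennreal)
      qed
      then have "ennreal (exp (- enn2real (\<integral>\<^sup>+x. ?l x \<partial>\<gamma>))) = ennreal (\<Prod>x\<in>K \<inter> pts \<gamma>. exp (ln (r x)))"
        using fin by (simp add: sum_negf exp_sum)
      also have "\<dots> = (\<Prod>x\<in>K \<inter> pts \<gamma>. a x)"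
      proof -
        have "(\<Prod>x\<in>K \<inter> pts \<gamma>. exp (ln (r x))) = (\<Prod>x\<in>K \<inter> pts \<gamma>. r x)" using r(1) by (intro prod.cong) auto
        moreover have "(\<Prod>x\<in>K \<inter> pts \<gamma>. ennreal (r x)) = ennreal (\<Prod>x\<in>K \<inter> pts \<gamma>. r x)"
          using r(1) by (intro prod_ennreal less_imp_le)
        ultimately show ?thesis by (simp only: ar)
      qed
      finally show ?thesis using True by simp
    qed
  qed
  ultimately show ?thesis by (rule measurable_cong[THEN iffD2, rotated])
qed

text \<open>Measurability in \<gamma> need only be checked on a generator closed under intersection.
  On void events the value is, by \<open>void_prob\<close>, an infimum of products treated in
  \<open>measurable_prod_pts\<close>.\<close>

lemma measurable_mark_kernel [measurable]:
  "mark_kernel \<eta> \<in> measurable (Proper_Config euclidean) (subprob_algebra (Proper_Config marked_top))"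
proof (rule measurable_subprob_algebra_generated[OF CZ.sets_Proper_Config CZ.Int_stable_void_event])
  show "CZ.void_event ` sets mborel \<subseteq> Pow {\<gamma>. proper_marked \<gamma>}" by (auto simp: CZ.void_event_def)
  have p: "proper \<gamma>" if "\<gamma> \<in> space (Proper_Config euclidean)" for \<gamma> :: "'x measure"
    using that by (simp add: CX.space_Proper_Config)
  show "subprob_space (mark_kernel \<eta> \<gamma>)" if "\<gamma> \<in> space (Proper_Config euclidean)" for \<gamma>
    by (intro prob_space_imp_subprob_space prob_mark_kernel p that)
  show "sets (mark_kernel \<eta> \<gamma>) = sets (Proper_Config marked_top)" for \<gamma> by (simp add: mark_kernel_def)
  have "emeasure (mark_kernel \<eta> \<gamma>) {\<gamma>. proper_marked \<gamma>} = 1"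
    if "\<gamma> \<in> space (Proper_Config euclidean)" for \<gamma>
    using prob_space.emeasure_space_1[OF prob_mark_kernel[OF p[OF that]]]
    by (simp add: mark_kernel_def CZ.space_Proper_Config)
  then show "(\<lambda>\<gamma>. emeasure (mark_kernel \<eta> \<gamma>) {\<gamma>. proper_marked \<gamma>}) \<in> borel_measurable (Proper_Config euclidean)"
    by (subst measurable_cong[where g = "\<lambda>_. 1"]) auto
  fix V assume "V \<in> CZ.void_event ` sets (mborel :: 'x marked measure)"
  then obtain A where A: "A \<in> sets (mborel :: 'x marked measure)" "V = CZ.void_event A" by blast
  obtain K :: "nat \<Rightarrow> 'x set" where K: "\<And>n. compact (K n)" "incseq K" "(\<Union>n. K n) = UNIV" by (rule compact_exhaustion) blast
  have am: "(\<lambda>x. emeasure (\<eta> x) {ys\<in>clusters. (x, ys) \<notin> A}) \<in> borel_measurable borel"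
  proof -
    have "A \<in> sets pair_borel" using A(1) sets_marked_borel by blast
    then have "(SIGMA x:space borel. {ys\<in>space cborel. (x, ys) \<notin> A}) \<in> sets pair_borel"
    proof -
      assume A': "A \<in> sets pair_borel"
      have "space pair_borel - A \<in> sets pair_borel" using A' by (rule sets.compl_sets)
      moreover have "space pair_borel - A = (SIGMA x:space borel. {ys\<in>space cborel. (x, ys) \<notin> A})"
        by (auto simp: space_pair_measure)
      ultimately show ?thesis by simp
    qed
    from emeasure_measurable_subprob_algebra2[OF this eta_kernel] show ?thesis by simp
  qed
  have le: "emeasure (\<eta> x) {ys\<in>clusters. (x, ys) \<notin> A} \<le> 1" for x using prob_space.emeasure_le_1[OF prob_eta] .
  have "(\<lambda>\<gamma>. INF n. \<Prod>x\<in>K n \<inter> pts \<gamma>. emeasure (\<eta> x) {ys\<in>clusters. (x, ys) \<notin> A})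
      \<in> borel_measurable (Proper_Config euclidean)" by (intro borel_measurable_INF measurable_prod_pts K am le) auto
  then show "(\<lambda>\<gamma>. emeasure (mark_kernel \<eta> \<gamma>) V) \<in> borel_measurable (Proper_Config euclidean)"
    unfolding A(2) by (subst measurable_cong[OF void_prob[OF p A(1) K]]) auto
qed

end

section \<open>Expectations over the marked process\<close>

locale cluster_process = cluster_density X \<eta> h
  for X :: "('x::{second_countable_topology,t2_space}, 'n::finite) riem"
    and \<eta> :: "'x \<Rightarrow> 'x cluster measure" and h :: "'x \<Rightarrow> 'x cluster \<Rightarrow> real" +
  fixes \<mu> :: "'x measure measure" and \<theta> :: "'x measure"
  assumes prob_mu: "prob_space \<mu>"
  and sets_mu [simp, measurable_cong]: "sets \<mu> = sets (Proper_Config euclidean)"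
  and sets_theta [simp, measurable_cong]: "sets \<theta> = sets borel"
  and mu_M1: "\<mu> \<in> M1 \<theta>"
  and A2: "\<And>B. compact B \<Longrightarrow> (\<integral>\<^sup>+x. (\<integral>\<^sup>+ys\<in>clusters_meeting B. of_nat (cluster_size ys) \<partial>\<eta> x) \<partial>\<theta>) < \<infinity>"
  and A4: "\<And>B. compact B \<Longrightarrow>
         (\<integral>\<^sup>+z\<in>marked_meeting B. ennreal (log_gradient_norm1 X (h (fst z)) (snd z)) \<partial>sigma_hat \<theta> \<eta>) < \<infinity>" begin

lemma space_mu: "\<gamma> \<in> space \<mu> \<longleftrightarrow> proper \<gamma>"
  using sets_eq_imp_space_eq[OF sets_mu] by (simp add: CX.space_Proper_Config)

lemma space_theta [simp]: "space \<theta> = UNIV"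
  using sets_eq_imp_space_eq[OF sets_theta] by simp

abbreviation "\<mu>h \<equiv> mu_hat \<mu> \<eta>"

lemma kernel_mu: "mark_kernel \<eta> \<in> measurable \<mu> (subprob_algebra (Proper_Config marked_top))"
  using measurable_mark_kernel by (simp only: measurable_cong_sets[OF sets_mu refl])

lemma space_mu_nonempty: "space \<mu> \<noteq> {}"
  using prob_mu by (rule prob_space.not_empty)

lemma sets_mu_hat [simp, measurable_cong]: "sets \<mu>h = sets (Proper_Config marked_top)"
  unfolding mu_hat_bind by (rule sets_bind[OF sets_kernel[OF kernel_mu] space_mu_nonempty])

lemmas measurable_cong_mu_hat = measurable_cong_sets[OF sets_mu_hat refl]

lemma space_mu_hat: "\<gamma>' \<in> space \<mu>h \<longleftrightarrow> proper_marked \<gamma>'"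
  using sets_eq_imp_space_eq[OF sets_mu_hat] by (simp add: CZ.space_Proper_Config)

lemma nn_integral_mu_hat:
  assumes f: "f \<in> borel_measurable (Proper_Config marked_top)"
  shows "(\<integral>\<^sup>+\<gamma>'. f \<gamma>' \<partial>\<mu>h) = (\<integral>\<^sup>+\<gamma>. \<integral>\<^sup>+\<omega>. f (marked \<gamma> \<omega>) \<partial>marks \<gamma> \<partial>\<mu>)"
proof -
  have "(\<integral>\<^sup>+\<gamma>'. f \<gamma>' \<partial>\<mu>h) = (\<integral>\<^sup>+\<gamma>. \<integral>\<^sup>+\<gamma>'. f \<gamma>' \<partial>mark_kernel \<eta> \<gamma> \<partial>\<mu>)"
    unfolding mu_hat_bind by (rule nn_integral_bind[OF f kernel_mu])
  also have "\<dots> = (\<integral>\<^sup>+\<gamma>. \<integral>\<^sup>+\<omega>. f (marked \<gamma> \<omega>) \<partial>marks \<gamma> \<partial>\<mu>)" unfolding mark_kernel_def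
    using f by (intro nn_integral_cong nn_integral_distr measurable_mark_config) (auto simp: space_mu)
  finally show ?thesis .
qed

lemma prob_mu_hat: "prob_space \<mu>h"
proof
  have "emeasure \<mu>h (space \<mu>h) = (\<integral>\<^sup>+\<gamma>'. 1 \<partial>\<mu>h)" by simp
  also have "\<dots> = (\<integral>\<^sup>+\<gamma>. \<integral>\<^sup>+\<omega>. 1 \<partial>marks \<gamma> \<partial>\<mu>)" by (rule nn_integral_mu_hat) simp
  also have "\<dots> = 1" by (simp add: prob_space.emeasure_space_1[OF prob_marks] prob_space.emeasure_space_1[OF prob_mu])
  finally show "emeasure \<mu>h (space \<mu>h) = 1" .
qed

lemma AE_mu_hat:
  assumes P: "Measurable.pred (Proper_Config marked_top) P"
  shows "(AE \<gamma>' in \<mu>h. P \<gamma>') \<longleftrightarrow> (AE \<gamma> in \<mu>. AE \<omega> in marks \<gamma>. P (marked \<gamma> \<omega>))"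
proof -
  have "(AE \<gamma>' in \<mu>h. P \<gamma>') \<longleftrightarrow> (AE \<gamma> in \<mu>. AE \<gamma>' in mark_kernel \<eta> \<gamma>. P \<gamma>')"
    unfolding mu_hat_bind by (rule AE_bind[OF kernel_mu P])
  also have "\<dots> \<longleftrightarrow> (AE \<gamma> in \<mu>. AE \<omega> in marks \<gamma>. P (marked \<gamma> \<omega>))"
  proof (rule AE_cong)
    fix \<gamma> assume "\<gamma> \<in> space \<mu>"
    then have "proper \<gamma>" by (simp add: space_mu)
    from measurable_mark_config[OF this] show "(AE \<gamma>' in mark_kernel \<eta> \<gamma>. P \<gamma>') \<longleftrightarrow> (AE \<omega> in marks \<gamma>. P (marked \<gamma> \<omega>))"
      unfolding mark_kernel_def using P by (intro AE_distr_iff) (auto simp: pred_def)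
  qed
  finally show ?thesis .
qed

lemma nn_integral_marks_component:
  assumes x: "x \<in> I" and f: "f \<in> borel_measurable cborel"
  shows "(\<integral>\<^sup>+\<omega>. f (\<omega> x) \<partial>Pi\<^sub>M I \<eta>) = (\<integral>\<^sup>+ys. f ys \<partial>\<eta> x)"
proof -
  have "distr (Pi\<^sub>M I \<eta>) (\<eta> x) (\<lambda>\<omega>. \<omega> x) = \<eta> x" by (rule distr_PiM_component[of I \<eta> x, OF prob_eta x])
  then have "(\<integral>\<^sup>+ys. f ys \<partial>\<eta> x) = (\<integral>\<^sup>+ys. f ys \<partial>distr (Pi\<^sub>M I \<eta>) (\<eta> x) (\<lambda>\<omega>. \<omega> x))" by simp
  also have "\<dots> = (\<integral>\<^sup>+\<omega>. f (\<omega> x) \<partial>Pi\<^sub>M I \<eta>)"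
  proof (rule nn_integral_distr[OF measurable_component_singleton[OF x]])
    have "f \<in> borel_measurable (\<eta> x)" using f by (simp only: measurable_cong_eta)
    then show "f \<in> borel_measurable (distr (Pi\<^sub>M I \<eta>) (\<eta> x) (\<lambda>\<omega>. \<omega> x))" by simp
  qed
  finally show ?thesis by simp
qed

lemma measurable_eta_integral:
  assumes f: "f \<in> borel_measurable mborel"
  shows "(\<lambda>x. \<integral>\<^sup>+ys. f (x, ys) \<partial>\<eta> x) \<in> borel_measurable borel"
proof -
  have "(\<lambda>(x, ys). f (x, ys)) \<in> borel_measurable pair_borel" using f by (simp add: measurable_cong_marked)
  from nn_integral_measurable_subprob_algebra2[OF this eta_kernel] show ?thesis .
qed

lemma nn_integral_marks_sum:
  fixes g :: "'x \<Rightarrow> 'x cluster \<Rightarrow> ennreal"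
  assumes I: "countable I" and g: "\<And>x. x \<in> I \<Longrightarrow> g x \<in> borel_measurable cborel"
  shows "(\<integral>\<^sup>+\<omega>. \<integral>\<^sup>+x. g x (\<omega> x) \<partial>count_space I \<partial>Pi\<^sub>M I \<eta>) = (\<integral>\<^sup>+x. (\<integral>\<^sup>+ys. g x ys \<partial>\<eta> x) \<partial>count_space I)"
proof -
  have "(\<integral>\<^sup>+\<omega>. \<integral>\<^sup>+x. g x (\<omega> x) \<partial>count_space I \<partial>Pi\<^sub>M I \<eta>) = (\<integral>\<^sup>+x. \<integral>\<^sup>+\<omega>. g x (\<omega> x) \<partial>Pi\<^sub>M I \<eta> \<partial>count_space I)"
    using I g by (intro nn_integral_count_space_nn_integral measurable_compose[OF measurable_mark g]) auto
  also have "\<dots> = (\<integral>\<^sup>+x. (\<integral>\<^sup>+ys. g x ys \<partial>\<eta> x) \<partial>count_space I)"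
    using g by (intro nn_integral_cong nn_integral_marks_component) auto
  finally show ?thesis .
qed

lemma AE_marks_sum_finite:
  fixes g :: "'x \<Rightarrow> 'x cluster \<Rightarrow> ennreal"
  assumes I: "countable I" and g: "\<And>x. x \<in> I \<Longrightarrow> g x \<in> borel_measurable cborel"
  and fin: "(\<integral>\<^sup>+x. (\<integral>\<^sup>+ys. g x ys \<partial>\<eta> x) \<partial>count_space I) < \<infinity>"
  shows "AE \<omega> in Pi\<^sub>M I \<eta>. (\<integral>\<^sup>+x. g x (\<omega> x) \<partial>count_space I) < \<infinity>"
proof -
  have "(\<lambda>\<omega>. \<integral>\<^sup>+x. g x (\<omega> x) \<partial>count_space I) \<in> borel_measurable (Pi\<^sub>M I \<eta>)"
    by (intro measurable_nn_integral_count_space I measurable_compose[OF measurable_mark g])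
  moreover have "(\<integral>\<^sup>+\<omega>. \<integral>\<^sup>+x. g x (\<omega> x) \<partial>count_space I \<partial>Pi\<^sub>M I \<eta>) \<noteq> \<infinity>" using fin by (subst nn_integral_marks_sum[OF I g]) auto
  ultimately have "AE \<omega> in Pi\<^sub>M I \<eta>. (\<integral>\<^sup>+x. g x (\<omega> x) \<partial>count_space I) \<noteq> \<infinity>" by (rule nn_integral_PInf_AE)
  then show ?thesis by (simp add: less_top)
qed

lemma marks_mean:
  assumes \<gamma>: "proper \<gamma>" and f: "f \<in> borel_measurable mborel"
  shows "(\<integral>\<^sup>+\<omega>. \<integral>\<^sup>+x. f (x, \<omega> x) \<partial>count_pts \<gamma> \<partial>marks \<gamma>) = (\<integral>\<^sup>+x. (\<integral>\<^sup>+ys. f (x, ys) \<partial>\<eta> x) \<partial>\<gamma>)"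
proof -
  have "(\<integral>\<^sup>+x. (\<integral>\<^sup>+ys. f (x, ys) \<partial>\<eta> x) \<partial>\<gamma>) = (\<integral>\<^sup>+x. (\<integral>\<^sup>+ys. f (x, ys) \<partial>\<eta> x) \<partial>count_pts \<gamma>)"
    using measurable_eta_integral[OF f] by (intro CX.nn_integral_proper[OF \<gamma>]) simp
  then show ?thesis using nn_integral_marks_sum[OF countable_pts[OF \<gamma>], of "\<lambda>x ys. f (x, ys)"] measurable_section[OF f]
    by simp
qed

text \<open>Tonelli for the sum over the points of \<gamma> and the product measure of marks, whose
  coordinate at x has law \<open>\<eta> x\<close>.\<close>

lemma campbell:
  assumes f: "f \<in> borel_measurable mborel"
  shows "(\<integral>\<^sup>+\<gamma>'. \<integral>\<^sup>+z. f z \<partial>\<gamma>' \<partial>\<mu>h) = (\<integral>\<^sup>+\<gamma>. \<integral>\<^sup>+x. (\<integral>\<^sup>+ys. f (x, ys) \<partial>\<eta> x) \<partial>\<gamma> \<partial>\<mu>)"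
proof -
  have "(\<integral>\<^sup>+\<gamma>'. \<integral>\<^sup>+z. f z \<partial>\<gamma>' \<partial>\<mu>h) = (\<integral>\<^sup>+\<gamma>. \<integral>\<^sup>+\<omega>. (\<integral>\<^sup>+z. f z \<partial>marked \<gamma> \<omega>) \<partial>marks \<gamma> \<partial>\<mu>)"
    using f by (intro nn_integral_mu_hat) auto
  also have "\<dots> = (\<integral>\<^sup>+\<gamma>. \<integral>\<^sup>+\<omega>. \<integral>\<^sup>+x. f (x, \<omega> x) \<partial>count_pts \<gamma> \<partial>marks \<gamma> \<partial>\<mu>)"
    using f by (intro nn_integral_cong nn_integral_mark_config) (auto simp: space_mu)
  also have "\<dots> = (\<integral>\<^sup>+\<gamma>. \<integral>\<^sup>+x. (\<integral>\<^sup>+ys. f (x, ys) \<partial>\<eta> x) \<partial>\<gamma> \<partial>\<mu>)"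
    using f by (intro nn_integral_cong marks_mean) (auto simp: space_mu)
  finally show ?thesis .
qed

text \<open>The indicator of N and the zero function represent the same class, so their pairings
  agree almost surely. Summability then allows the vanishing sum of nonnegative terms to be read
  termwise.\<close>

lemma M1_null:
  assumes N: "N \<in> null_sets \<theta>" shows "AE \<gamma> in \<mu>. N \<inter> pts \<gamma> = {}"
proof -
  have Nm: "N \<in> sets borel" using N by auto
  let ?i = "indicator N :: 'x \<Rightarrow> real"
  have i: "integrable \<theta> ?i" "integrable \<theta> (\<lambda>_. 0 :: real)" using N by (auto simp: null_sets_def)
  have "AE x in \<theta>. ?i x = 0" using AE_not_in[OF N] by eventually_elim simp
  then have "AE \<gamma> in \<mu>. pairing ?i \<gamma> = pairing (\<lambda>_. 0) \<gamma>" using mu_M1 i unfolding M1_def by blast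
  moreover have "AE \<gamma> in \<mu>. ?i summable_on pts \<gamma>" using mu_M1 i unfolding M1_def by blast
  moreover have "AE \<gamma> in \<mu>. \<gamma> \<in> space \<mu>" by (rule AE_space)
  ultimately show ?thesis
  proof eventually_elim
    case (elim \<gamma>)
    have "infsum ?i (pts \<gamma>) = 0" using elim(1) by (simp add: pairing_def)
    then have "?i x = 0" if "x \<in> pts \<gamma>" for x using that elim(2) by (intro nonneg_infsum_le_0D[of ?i "pts \<gamma>"]) auto
    then show ?case by (auto simp: indicator_def split: if_splits)
  qed
qed

text \<open>The definition of \<open>M1\<close> speaks of real functions. The set where b is
  infinite is a null set of \<theta>, which almost no configuration hits; off it b equals the
  integrable function \<open>enn2real\<close> of b.\<close>

lemma M1_finite:
  fixes b :: "'x \<Rightarrow> ennreal"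
  assumes b: "b \<in> borel_measurable borel" and fin: "(\<integral>\<^sup>+x. b x \<partial>\<theta>) < \<infinity>"
  shows "(\<integral>\<^sup>+\<gamma>. \<integral>\<^sup>+x. b x \<partial>\<gamma> \<partial>\<mu>) < \<infinity>"
proof -
  have bm: "b \<in> borel_measurable \<theta>" using b by simp
  let ?N = "b -` {\<infinity>} \<inter> space \<theta>"
  have Nm: "?N \<in> sets \<theta>" using bm by (rule measurable_sets) simp
  have "AE x in \<theta>. b x \<noteq> \<infinity>" using nn_integral_PInf_AE[OF bm] fin by (simp add: less_top)
  then have "?N \<in> null_sets \<theta>" by (subst AE_iff_null_sets[OF Nm]) auto
  from M1_null[OF this] have N: "AE \<gamma> in \<mu>. ?N \<inter> pts \<gamma> = {}" .
  define f where "f x = enn2real (b x)" for x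
  have fm: "f \<in> borel_measurable borel" unfolding f_def using b by measurable
  have "(\<integral>\<^sup>+x. ennreal (f x) \<partial>\<theta>) \<le> (\<integral>\<^sup>+x. b x \<partial>\<theta>)" unfolding f_def by (intro nn_integral_mono) (simp add: ennreal_enn2real_if)
  then have "(\<integral>\<^sup>+x. ennreal (f x) \<partial>\<theta>) < \<infinity>" using fin by (rule order.strict_trans1)
  then have fi: "integrable \<theta> f" using fm by (intro integrableI_nonneg) (auto simp: f_def)
  have s: "AE \<gamma> in \<mu>. f summable_on pts \<gamma>" and pi: "integrable \<mu> (\<lambda>\<gamma>. \<bar>pairing f \<gamma>\<bar>)"
    using mu_M1 fi unfolding M1_def by blast+
  have "AE \<gamma> in \<mu>. (\<integral>\<^sup>+x. b x \<partial>\<gamma>) = ennreal \<bar>pairing f \<gamma>\<bar>" using s N AE_space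
  proof eventually_elim
    case (elim \<gamma>)
    then have \<gamma>: "proper \<gamma>" by (simp add: space_mu)
    have "(\<integral>\<^sup>+x. b x \<partial>\<gamma>) = (\<integral>\<^sup>+x. b x \<partial>count_pts \<gamma>)" using b by (intro CX.nn_integral_proper[OF \<gamma>]) simp
    also have "\<dots> = (\<integral>\<^sup>+x. ennreal (f x) \<partial>count_pts \<gamma>)"
    proof (rule nn_integral_cong)
      fix x assume "x \<in> space (count_pts \<gamma>)"
      then have "b x \<noteq> \<infinity>" using elim(2) by auto
      then show "b x = ennreal (f x)" unfolding f_def by (simp add: less_top)
    qed
    also have "\<dots> = (\<integral>\<^sup>+x. ennreal (f x) \<partial>\<gamma>)" using fm by (intro CX.nn_integral_proper[OF \<gamma>, symmetric]) simp
    also have "\<dots> = ennreal (\<integral>x. f x \<partial>\<gamma>)"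
    proof (rule nn_integral_eq_integral)
      show "integrable \<gamma> f" using CX.pairing_eq_integral(2)[OF \<gamma>, of f] fm elim(1) by simp
    qed (simp add: f_def)
    also have "(\<integral>x. f x \<partial>\<gamma>) = pairing f \<gamma>" using CX.pairing_eq_integral(1)[OF \<gamma>, of f] fm by simp
    also have "pairing f \<gamma> = \<bar>pairing f \<gamma>\<bar>"
      unfolding pairing_def by (intro abs_of_nonneg[symmetric] infsum_nonneg) (simp add: f_def)
    finally show ?case .
  qed
  then have "(\<integral>\<^sup>+\<gamma>. \<integral>\<^sup>+x. b x \<partial>\<gamma> \<partial>\<mu>) = (\<integral>\<^sup>+\<gamma>. ennreal \<bar>pairing f \<gamma>\<bar> \<partial>\<mu>)" by (rule nn_integral_cong_AE)
  also have "\<dots> < \<infinity>" using pi by (simp add: integrable_iff_bounded)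
  finally show ?thesis .
qed

lemma AE_mu_finite:
  fixes b :: "'x \<Rightarrow> ennreal"
  assumes b: "b \<in> borel_measurable borel" and fin: "(\<integral>\<^sup>+x. b x \<partial>\<theta>) < \<infinity>"
  shows "AE \<gamma> in \<mu>. (\<integral>\<^sup>+x. b x \<partial>\<gamma>) < \<infinity>"
proof -
  have "(\<lambda>\<gamma>. \<integral>\<^sup>+x. b x \<partial>\<gamma>) \<in> borel_measurable (Proper_Config euclidean)"
    using b by (intro CX.measurable_nn_integral_Proper) simp
  then have "(\<lambda>\<gamma>. \<integral>\<^sup>+x. b x \<partial>\<gamma>) \<in> borel_measurable \<mu>" by (simp only: measurable_cong_sets[OF sets_mu refl])
  from nn_integral_PInf_AE[OF this] M1_finite[OF b fin] show ?thesis by (auto simp: less_top)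
qed

lemma nn_integral_sigma_hat:
  assumes f: "f \<in> borel_measurable mborel"
  shows "(\<integral>\<^sup>+z. f z \<partial>sigma_hat \<theta> \<eta>) = (\<integral>\<^sup>+x. \<integral>\<^sup>+ys. f (x, ys) \<partial>\<eta> x \<partial>\<theta>)"
proof -
  have pm: "(\<lambda>ys. (x, ys)) \<in> measurable cborel mborel" for x :: 'x
  proof -
    have "(\<lambda>ys. (x, ys)) \<in> measurable cborel pair_borel" by measurable
    then show ?thesis by (simp only: measurable_cong_sets[OF refl sets_marked_borel])
  qed
  have "(\<lambda>x. distr (\<eta> x) mborel (\<lambda>ys. (x, ys))) \<in> measurable borel (subprob_algebra mborel)"
  proof (rule measurable_distr2[OF _ eta_kernel])
    have "(\<lambda>z. z) \<in> measurable pair_borel (pair_borel :: 'x marked measure)" by measurable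
    then have "(\<lambda>z. z) \<in> measurable pair_borel (mborel :: 'x marked measure)"
      by (simp only: measurable_cong_sets[OF refl sets_marked_borel])
    then show "case_prod Pair \<in> measurable pair_borel (mborel :: 'x marked measure)" by simp
  qed
  then have k: "(\<lambda>x. distr (\<eta> x) mborel (\<lambda>ys. (x, ys))) \<in> measurable \<theta> (subprob_algebra mborel)"
    by (simp only: measurable_cong_sets[OF sets_theta refl])
  have "(\<integral>\<^sup>+z. f z \<partial>sigma_hat \<theta> \<eta>) = (\<integral>\<^sup>+x. \<integral>\<^sup>+z. f z \<partial>distr (\<eta> x) mborel (\<lambda>ys. (x, ys)) \<partial>\<theta>)"
    unfolding sigma_hat_def by (rule nn_integral_bind[OF f k])
  also have "\<dots> = (\<integral>\<^sup>+x. \<integral>\<^sup>+ys. f (x, ys) \<partial>\<eta> x \<partial>\<theta>)" using f pm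
    by (intro nn_integral_cong nn_integral_distr) (simp_all add: measurable_cong_eta)
  finally show ?thesis .
qed

end

section \<open>The cluster configuration\<close>

lemma sets_cluster_config [simp]: "sets (cluster_config ys) = sets borel"
  by (simp add: cluster_config_def)

lemma nn_integral_cluster_config:
  assumes f: "f \<in> borel_measurable borel"
  shows "(\<integral>\<^sup>+x. f x \<partial>cluster_config ys) = cluster_sum f ys" unfolding cluster_config_def cluster_sum_def using f
  by (subst nn_integral_distr) (auto simp: nn_integral_count_space_finite)

lemma emeasure_cluster_config:
  fixes ys :: "'x::topological_space cluster"
  assumes "B \<in> sets borel" shows "emeasure (cluster_config ys) B = cluster_sum (indicator B) ys"
proof -
  have "emeasure (cluster_config ys) B = (\<integral>\<^sup>+x. indicator B x \<partial>cluster_config ys)"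
    using assms by (intro nn_integral_indicator[symmetric]) auto
  also have "\<dots> = cluster_sum (indicator B) ys" using assms by (intro nn_integral_cluster_config) simp
  finally show ?thesis .
qed

lemma measurable_sum_snd [measurable]:
  fixes f :: "'x::{second_countable_topology,t2_space} \<Rightarrow> 'b::{second_countable_topology,topological_comm_monoid_add}"
  assumes [measurable]: "f \<in> borel_measurable borel"
  shows "(\<lambda>z. cluster_sum f (snd z)) \<in> borel_measurable mborel"
proof -
  have "(\<lambda>z. cluster_sum f (snd z)) \<in> borel_measurable pair_borel" by measurable
  then show ?thesis by (simp only: measurable_cong_marked)
qed

lemma
  fixes \<gamma>' :: "('x::{second_countable_topology,t2_space} \<times> 'x cluster) measure"
  shows sets_q_map: "sets (q_map \<gamma>') = sets borel"
  and nn_integral_q_map_count: "f \<in> borel_measurable borel \<Longrightarrow>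
      (\<integral>\<^sup>+x. f x \<partial>q_map \<gamma>') = (\<integral>\<^sup>+z. cluster_sum f (snd z) \<partial>count_space (pts \<gamma>'))" and emeasure_q_map_count: "B \<in> sets borel \<Longrightarrow>
      emeasure (q_map \<gamma>') B = (\<integral>\<^sup>+z. cluster_sum (indicator B) (snd z) \<partial>count_space (pts \<gamma>'))" proof -
  have M: "q_map \<gamma>' = measure_of (space borel) (sets borel)
      (\<lambda>B. \<integral>\<^sup>+z. emeasure (cluster_config (snd z)) B \<partial>count_space (pts \<gamma>'))" by (simp add: q_map_def)
  note sm = sum_measure[of "pts \<gamma>'" "\<lambda>z. cluster_config (snd z)" borel, OF sets_cluster_config M]
  show "sets (q_map \<gamma>') = sets borel" by (rule sm(1))
  show "(\<integral>\<^sup>+x. f x \<partial>q_map \<gamma>') = (\<integral>\<^sup>+z. cluster_sum f (snd z) \<partial>count_space (pts \<gamma>'))"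
    if "f \<in> borel_measurable borel"
    using sm(4)[OF that] by (simp add: nn_integral_cluster_config[OF that])
  show "emeasure (q_map \<gamma>') B = (\<integral>\<^sup>+z. cluster_sum (indicator B) (snd z) \<partial>count_space (pts \<gamma>'))"
    if "B \<in> sets borel"
    using sm(3)[OF that] by (simp add: emeasure_cluster_config[OF that])
qed

lemma nn_integral_q_map:
  fixes \<gamma>' :: "('x::{second_countable_topology,t2_space} \<times> 'x cluster) measure"
  assumes \<gamma>': "proper_marked \<gamma>'" and f: "f \<in> borel_measurable borel"
  shows "(\<integral>\<^sup>+x. f x \<partial>q_map \<gamma>') = (\<integral>\<^sup>+z. cluster_sum f (snd z) \<partial>\<gamma>')" unfolding nn_integral_q_map_count[OF f]
  using f by (intro CZ.nn_integral_proper[OF \<gamma>', symmetric] measurable_sum_snd)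

lemma emeasure_q_map:
  fixes \<gamma>' :: "('x::{second_countable_topology,t2_space} \<times> 'x cluster) measure"
  assumes \<gamma>': "proper_marked \<gamma>'" and B: "B \<in> sets borel"
  shows "emeasure (q_map \<gamma>') B = (\<integral>\<^sup>+z. cluster_sum (indicator B) (snd z) \<partial>\<gamma>')" unfolding emeasure_q_map_count[OF B]
  using B by (intro CZ.nn_integral_proper[OF \<gamma>', symmetric] measurable_sum_snd) simp

lemma configuration_distr_countable:
  assumes J: "countable J" and s: "s \<in> J \<rightarrow> topspace T"
  shows "configuration T (distr (count_space J) (borel_of T) s)"
proof -
  let ?I = "to_nat_on J ` J"
  have b: "bij_betw (from_nat_into J) ?I J"
    using J by (intro bij_betwI[where g = "to_nat_on J"]) (auto simp: from_nat_into_to_nat_on)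
  have ms: "s \<in> measurable (count_space J) (borel_of T)" using s by auto
  have "distr (count_space J) (borel_of T) s =
      distr (distr (count_space ?I) (count_space J) (from_nat_into J)) (borel_of T) s"
    unfolding distr_bij_count_space[OF b] ..
  also have "\<dots> = distr (count_space ?I) (borel_of T) (s \<circ> from_nat_into J)"
    using ms bij_betwE[OF b] by (intro distr_distr) auto
  finally show ?thesis unfolding configuration_def using s bij_betwE[OF b]
    by (intro exI[of _ ?I] exI[of _ "s \<circ> from_nat_into J"]) auto
qed

text \<open>Index by pairs of a marked point and a coordinate of its cluster. This index set is
  countable, and the image of its counting measure keeps the multiplicities that a set of points
  would lose.\<close>

lemma configuration_q_map:
  fixes \<gamma>' :: "('x::{second_countable_topology,t2_space} \<times> 'x cluster) measure"
  assumes \<gamma>': "proper_marked \<gamma>'"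
  shows "configuration euclidean (q_map \<gamma>')"
proof -
  let ?J = "SIGMA z:pts \<gamma>'. {..<fst (snd z)}"
  let ?s = "\<lambda>(z :: 'x \<times> 'x cluster, i). snd (snd z) i"
  have J: "countable ?J" using CZ.proper_config_eq(2)[OF \<gamma>'] by auto
  have "q_map \<gamma>' = distr (count_space ?J) borel ?s"
  proof (rule measure_eqI)
    fix B assume "B \<in> sets (q_map \<gamma>')"
    then have B: "B \<in> sets borel" by (simp add: sets_q_map)
    let ?f = "\<lambda>p. indicator B (?s p) * indicator ?J p :: ennreal"
    have "emeasure (distr (count_space ?J) borel ?s) B = (\<integral>\<^sup>+p. indicator B (?s p) \<partial>count_space ?J)"
    proof -
      have "emeasure (distr (count_space ?J) borel ?s) B = (\<integral>\<^sup>+x. indicator B x \<partial>distr (count_space ?J) borel ?s)"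
        using B by (intro nn_integral_indicator[symmetric]) auto
      also have "\<dots> = (\<integral>\<^sup>+p. indicator B (?s p) \<partial>count_space ?J)" using B by (intro nn_integral_distr) auto
      finally show ?thesis .
    qed
    also have "\<dots> = (\<integral>\<^sup>+p. ?f p \<partial>count_space UNIV)" by (rule nn_integral_count_space_indicator) simp
    also have "\<dots> = (\<integral>\<^sup>+z. \<integral>\<^sup>+i. ?f (z, i) \<partial>count_space UNIV \<partial>count_space UNIV)"
      by (rule nn_integral_fst_count_space[symmetric])
    also have "\<dots> = (\<integral>\<^sup>+z. cluster_sum (indicator B) (snd z) * indicator (pts \<gamma>') z \<partial>count_space UNIV)"
    proof (rule nn_integral_cong)
      fix z :: "'x \<times> 'x cluster"
      have "(\<integral>\<^sup>+i. ?f (z, i) \<partial>count_space UNIV) =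
          (\<integral>\<^sup>+i. (indicator B (snd (snd z) i) * indicator (pts \<gamma>') z) * indicator {..<fst (snd z)} i \<partial>count_space UNIV)"
        by (intro nn_integral_cong) (auto split: split_indicator)
      also have "\<dots> = (\<integral>\<^sup>+i. indicator B (snd (snd z) i) * indicator (pts \<gamma>') z \<partial>count_space {..<fst (snd z)})"
        by (rule nn_integral_count_space_indicator[symmetric]) simp
      also have "\<dots> = cluster_sum (indicator B) (snd z) * indicator (pts \<gamma>') z"
        by (simp add: nn_integral_count_space_finite cluster_sum_def sum_distrib_right)
      finally show "(\<integral>\<^sup>+i. ?f (z, i) \<partial>count_space UNIV) = cluster_sum (indicator B) (snd z) * indicator (pts \<gamma>') z" .
    qed
    also have "\<dots> = emeasure (q_map \<gamma>') B"
      unfolding emeasure_q_map_count[OF B] by (rule nn_integral_count_space_indicator[symmetric]) simp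
    finally show "emeasure (q_map \<gamma>') B = emeasure (distr (count_space ?J) borel ?s) B" by simp
  qed (simp add: sets_q_map)
  then show ?thesis using configuration_distr_countable[OF J, of ?s euclidean] by simp
qed

lemma measurable_q_map [measurable]:
  "q_map \<in> measurable (Proper_Config (marked_top :: ('x::{second_countable_topology,t2_space} \<times> 'x cluster) topology))
     (Config euclidean)" proof (rule CX.measurable_into_Config)
  show "q_map \<in> space (Proper_Config (marked_top :: 'x marked topology)) \<rightarrow> {\<gamma>. configuration euclidean \<gamma>}"
    by (auto simp: CZ.space_Proper_Config configuration_q_map)
  fix A :: "'x set" assume "A \<in> sets (borel_of euclidean)"
  then have A: "A \<in> sets borel" by simp
  have "(\<lambda>\<gamma>'. \<integral>\<^sup>+z. cluster_sum (indicator A) (snd z) \<partial>\<gamma>') \<in> borel_measurable (Proper_Config marked_top)"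
    using A by (intro CZ.measurable_nn_integral_Proper measurable_sum_snd) simp
  then show "(\<lambda>\<gamma>'. emeasure (q_map \<gamma>') A) \<in> borel_measurable (Proper_Config marked_top)"
    by (rule measurable_cong[THEN iffD2, rotated]) (simp add: CZ.space_Proper_Config emeasure_q_map A)
qed

context riemannian
begin

text \<open>Replaces quantification over all compact sets and all points by countably many
  conditions: a finite cover of each \<open>K n\<close> by base sets of mass at most one bounds the
  mass of \<open>K n\<close> and also excludes multiple points. \<open>measurable_proper\<close>
  rests on it.\<close>

lemma proper_configuration_iff:
  assumes K: "\<And>n. compact (K n)" "\<And>L. compact L \<Longrightarrow> \<exists>n. L \<subseteq> K n" "(\<Union>n. K n) = (UNIV :: 'x set)"
  shows "proper \<gamma> \<longleftrightarrow> configuration euclidean \<gamma> \<and>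
    (\<forall>n. \<exists>J\<in>{J. finite J \<and> J \<subseteq> point_base}. K n \<subseteq> \<Union>J \<and> (\<forall>U\<in>J. emeasure \<gamma> U \<le> 1))" proof (intro iffI conjI allI)
  assume \<gamma>: "proper \<gamma>"
  show "configuration euclidean \<gamma>" using configD(1)[OF \<gamma>] .
  fix n
  have "\<exists>U. U \<in> point_base \<and> p \<in> U \<and> emeasure \<gamma> U \<le> 1" for p
  proof -
    obtain W L where W: "open W" "p \<in> W" "W \<subseteq> L" "compact L" by (rule open_subset_compact[OF open_UNIV UNIV_I[of p]]) blast
    have fin: "finite (L \<inter> pts \<gamma>)" using CX.finite_pts_compact[OF \<gamma>, of L] W(4) by simp
    \<comment> \<open>W without the other points of the configuration. Those in the compact set L
      are finitely many, so the difference is still open.\<close>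
    let ?W = "W - (L \<inter> pts \<gamma> - {p})"
    have "open ?W" using W(1) fin by (intro open_Diff finite_imp_closed) auto
    then obtain U where U: "U \<in> point_base" "p \<in> U" "U \<subseteq> ?W"
      using countable_baseD(3)[OF countable_point_base, of ?W p] W(2) by auto
    have Um: "U \<in> sets borel" using countable_baseD(2)[OF countable_point_base U(1)] by auto
    have "U \<inter> pts \<gamma> \<subseteq> {p}" using U(3) W(3) by blast
    then have "emeasure (count_pts \<gamma>) (U \<inter> pts \<gamma>) \<le> 1"
      using finite_subset[of "U \<inter> pts \<gamma>" "{p}"] card_mono[of "{p}" "U \<inter> pts \<gamma>"] by (simp add: emeasure_count_space_Int)
    then have "emeasure \<gamma> U \<le> 1" using CX.emeasure_proper[OF \<gamma>, of U] Um by simp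
    then show ?thesis using U by blast
  qed
  then obtain V where V: "\<And>p. V p \<in> point_base" "\<And>p. p \<in> V p" "\<And>p. emeasure \<gamma> (V p) \<le> 1" by metis
  have Vo: "open (V p)" for p using countable_baseD(2)[OF countable_point_base V(1)[of p]] by simp
  have cov: "K n \<subseteq> (\<Union>p. V p)" using V(2) by blast
  obtain P where P: "finite P" "K n \<subseteq> (\<Union>p\<in>P. V p)" by (rule compactE_image[OF K(1) Vo cov]) blast
  show "\<exists>J\<in>{J. finite J \<and> J \<subseteq> point_base}. K n \<subseteq> \<Union>J \<and> (\<forall>U\<in>J. emeasure \<gamma> U \<le> 1)" using P V by (intro bexI[of _ "V ` P"]) auto
next
  assume *: "configuration euclidean \<gamma> \<and> (\<forall>n. \<exists>J\<in>{J. finite J \<and> J \<subseteq> point_base}. K n \<subseteq> \<Union>J \<and> (\<forall>U\<in>J. emeasure \<gamma> U \<le> 1))"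
  then have c: "configuration euclidean \<gamma>" by blast
  have s: "sets \<gamma> = sets borel" using sets_configuration[OF c] by simp
  have Um: "U \<in> sets \<gamma>" if "U \<in> point_base" for U using countable_baseD(2)[OF countable_point_base that] s by auto
  show "proper \<gamma>" unfolding proper_configuration_def
  proof (intro conjI allI impI ballI c)
    fix L :: "'x set" assume "compactin euclidean L"
    then obtain n where n: "L \<subseteq> K n" using K(2) by auto
    obtain J where J: "finite J" "J \<subseteq> point_base" "K n \<subseteq> \<Union>J" "\<forall>U\<in>J. emeasure \<gamma> U \<le> 1" using * by blast
    have "emeasure \<gamma> L \<le> emeasure \<gamma> (\<Union>U\<in>J. U)" using n J by (intro emeasure_mono sets.finite_UN) (auto intro: Um)
    also have "\<dots> \<le> (\<Sum>U\<in>J. emeasure \<gamma> U)" using J(1,2) by (intro emeasure_subadditive_finite) (auto intro: Um)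
    also have "\<dots> \<le> (\<Sum>U\<in>J. 1)" using J(4) by (intro sum_mono) auto
    also have "\<dots> < \<infinity>" by (simp add: of_nat_less_top)
    finally show "emeasure \<gamma> L < \<infinity>" .
  next
    fix x :: 'x
    obtain n where "x \<in> K n" using K(3) by blast
    then obtain U where U: "U \<in> point_base" "x \<in> U" "emeasure \<gamma> U \<le> 1" using * by blast
    have "emeasure \<gamma> {x} \<le> emeasure \<gamma> U" using U Um by (intro emeasure_mono) auto
    then show "emeasure \<gamma> {x} \<le> 1" using U(3) by simp
  qed
qed

lemma measurable_proper:
  "{\<gamma>. proper \<gamma>} \<in> sets (Config (euclidean :: 'x topology))"
proof -
  obtain K :: "nat \<Rightarrow> 'x set" where K: "\<And>n. compact (K n)" "\<And>L. compact L \<Longrightarrow> \<exists>n. L \<subseteq> K n" "(\<Union>n. K n) = UNIV"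
    by (rule compact_exhaustion) blast
  let ?F = "{J. finite J \<and> J \<subseteq> (point_base :: 'x set set)}"
  have F: "countable ?F" by (rule countable_Collect_finite_subset[OF countable_baseD(1)[OF countable_point_base]])
  let ?S = "\<lambda>J. {\<gamma> \<in> space (Config euclidean). \<forall>U\<in>J. emeasure \<gamma> U \<le> 1}"
  have S: "?S J \<in> sets (Config euclidean)" if "J \<in> ?F" for J
  proof -
    have "(\<lambda>\<gamma>. emeasure \<gamma> U) \<in> borel_measurable (Config euclidean)" if "U \<in> J" for U
      using that \<open>J \<in> ?F\<close> countable_baseD(2)[OF countable_point_base, of U] by (intro CX.measurable_emeasure_Config) auto
    then show ?thesis using that by (cases "J = {}") (auto intro!: sets.sets_Collect_finite_All')
  qed
  have iff: "proper \<gamma> \<longleftrightarrow> configuration euclidean \<gamma> \<and> (\<forall>n. \<exists>J\<in>?F. K n \<subseteq> \<Union>J \<and> (\<forall>U\<in>J. emeasure \<gamma> U \<le> 1))" for \<gamma>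
    by (rule proper_configuration_iff[OF K(1) K(2) K(3)])
  have "{\<gamma>. proper \<gamma>} = (\<Inter>n. \<Union>J\<in>{J\<in>?F. K n \<subseteq> \<Union>J}. ?S J)"
  proof (rule set_eqI)
    fix \<gamma> :: "'x measure"
    show "\<gamma> \<in> {\<gamma>. proper \<gamma>} \<longleftrightarrow> \<gamma> \<in> (\<Inter>n. \<Union>J\<in>{J\<in>?F. K n \<subseteq> \<Union>J}. ?S J)"
      unfolding mem_Collect_eq iff CX.space_Config INT_iff UN_iff by blast
  qed
  also have "\<dots> \<in> sets (Config euclidean)"
  proof (rule sets.countable_INT[OF image_subsetI])
    fix n :: nat
    have "countable {J \<in> ?F. K n \<subseteq> \<Union>J}" by (rule countable_subset[OF _ F]) blast
    then show "(\<Union>J\<in>{J\<in>?F. K n \<subseteq> \<Union>J}. ?S J) \<in> sets (Config euclidean)" using S by (intro sets.countable_UN') blast+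
  qed auto
  finally show ?thesis .
qed

end

section \<open>Almost sure properness of the cluster configuration\<close>

context cluster_density
begin

lemma AE_eta_avoid: "countable S \<Longrightarrow> AE ys in \<eta> x. \<forall>i<fst ys. snd ys i \<notin> S"
  by (rule AE_eta_cvol[OF AE_cvol_avoid])

lemma AE_eta_distinct: "AE ys in \<eta> x. inj_on (snd ys) {..<fst ys}"
  by (rule AE_eta_cvol[OF AE_cvol_distinct])

text \<open>Splits off the mark at x as an independent factor, so that results about one cluster can
  be integrated over the remaining marks.\<close>

lemma marks_insert:
  assumes x: "x \<in> I"
  shows measurable_marks_insert:
      "(\<lambda>(ys, \<omega>). fun_upd \<omega> x ys) \<in> measurable (\<eta> x \<Otimes>\<^sub>M Pi\<^sub>M (I - {x}) \<eta>) (Pi\<^sub>M I \<eta>)"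
  and distr_marks_insert:
      "distr (\<eta> x \<Otimes>\<^sub>M Pi\<^sub>M (I - {x}) \<eta>) (Pi\<^sub>M I \<eta>) (\<lambda>(ys, \<omega>). fun_upd \<omega> x ys) = Pi\<^sub>M I \<eta>"
  and pair_marks_insert: "pair_sigma_finite (\<eta> x) (Pi\<^sub>M (I - {x}) \<eta>)"
proof -
  have I: "insert x (I - {x}) = I" using x by auto
  show "distr (\<eta> x \<Otimes>\<^sub>M Pi\<^sub>M (I - {x}) \<eta>) (Pi\<^sub>M I \<eta>) (\<lambda>(ys, \<omega>). fun_upd \<omega> x ys) = Pi\<^sub>M I \<eta>"
    using distr_pair_PiM_eq_PiM[of "I - {x}" \<eta> x] prob_eta unfolding I by blast
  show "(\<lambda>(ys, \<omega>). fun_upd \<omega> x ys) \<in> measurable (\<eta> x \<Otimes>\<^sub>M Pi\<^sub>M (I - {x}) \<eta>) (Pi\<^sub>M I \<eta>)"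
    unfolding split_beta' using I by (intro measurable_fun_upd[where J = "I - {x}"]) auto
  interpret A: prob_space "\<eta> x" by (rule prob_eta)
  interpret B: prob_space "Pi\<^sub>M (I - {x}) \<eta>" by (rule prob_marks)
  show "pair_sigma_finite (\<eta> x) (Pi\<^sub>M (I - {x}) \<eta>)" ..
qed

lemma nn_integral_marks_split:
  assumes x: "x \<in> I" and f: "f \<in> borel_measurable (Pi\<^sub>M I \<eta>)"
  shows "(\<integral>\<^sup>+\<omega>. f \<omega> \<partial>Pi\<^sub>M I \<eta>) = (\<integral>\<^sup>+\<omega>. (\<integral>\<^sup>+ys. f (fun_upd \<omega> x ys) \<partial>\<eta> x) \<partial>Pi\<^sub>M (I - {x}) \<eta>)"
proof -
  let ?u = "\<lambda>(ys, \<omega>). fun_upd \<omega> x ys"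
  note m = measurable_marks_insert[OF x] and P = pair_marks_insert[OF x]
  have "(\<integral>\<^sup>+\<omega>. f \<omega> \<partial>Pi\<^sub>M I \<eta>) = (\<integral>\<^sup>+p. f (?u p) \<partial>(\<eta> x \<Otimes>\<^sub>M Pi\<^sub>M (I - {x}) \<eta>))"
    by (subst distr_marks_insert[OF x, symmetric]) (rule nn_integral_distr[OF m], simp add: f)
  also have "\<dots> = (\<integral>\<^sup>+\<omega>. (\<integral>\<^sup>+ys. f (?u (ys, \<omega>)) \<partial>\<eta> x) \<partial>Pi\<^sub>M (I - {x}) \<eta>)"
    using measurable_compose[OF m f] by (intro pair_sigma_finite.nn_integral_snd[OF P, symmetric]) simp
  finally show ?thesis by simp
qed

lemma integral_marks_split:
  fixes f :: "_ \<Rightarrow> real"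
  assumes x: "x \<in> I" and f: "integrable (Pi\<^sub>M I \<eta>) f"
  shows "(\<integral>\<omega>. f \<omega> \<partial>Pi\<^sub>M I \<eta>) = (\<integral>\<omega>. (\<integral>ys. f (fun_upd \<omega> x ys) \<partial>\<eta> x) \<partial>Pi\<^sub>M (I - {x}) \<eta>)"
proof -
  let ?u = "\<lambda>(ys, \<omega>). fun_upd \<omega> x ys"
  note m = measurable_marks_insert[OF x] and P = pair_marks_insert[OF x]
  have "integrable (\<eta> x \<Otimes>\<^sub>M Pi\<^sub>M (I - {x}) \<eta>) (\<lambda>p. f (?u p))"
    by (rule integrable_distr[OF m]) (simp only: distr_marks_insert[OF x] f)
  then have i: "integrable (\<eta> x \<Otimes>\<^sub>M Pi\<^sub>M (I - {x}) \<eta>) (\<lambda>(ys, \<omega>). f (fun_upd \<omega> x ys))" by (simp add: split_beta')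
  have "(\<integral>\<omega>. f \<omega> \<partial>Pi\<^sub>M I \<eta>) = (\<integral>p. f (?u p) \<partial>(\<eta> x \<Otimes>\<^sub>M Pi\<^sub>M (I - {x}) \<eta>))"
    by (subst distr_marks_insert[OF x, symmetric]) (rule integral_distr[OF m borel_measurable_integrable[OF f]])
  also have "\<dots> = (\<integral>\<omega>. (\<integral>ys. f (fun_upd \<omega> x ys) \<partial>\<eta> x) \<partial>Pi\<^sub>M (I - {x}) \<eta>)"
    using pair_sigma_finite.integral_snd[OF P i] by (simp add: split_beta')
  finally show ?thesis .
qed

lemma AE_marks_split:
  assumes x: "x \<in> I" and P: "Measurable.pred (Pi\<^sub>M I \<eta>) P"
  and ae: "\<And>\<omega>. \<omega> \<in> space (Pi\<^sub>M (I - {x}) \<eta>) \<Longrightarrow> AE ys in \<eta> x. P (fun_upd \<omega> x ys)"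
  shows "AE \<omega> in Pi\<^sub>M I \<eta>. P \<omega>"
proof -
  note P[measurable]
  let ?f = "\<lambda>\<omega>. if P \<omega> then 0 else (1::ennreal)"
  have m: "?f \<in> borel_measurable (Pi\<^sub>M I \<eta>)" by measurable
  have "(\<integral>\<^sup>+\<omega>. ?f \<omega> \<partial>Pi\<^sub>M I \<eta>) = (\<integral>\<^sup>+\<omega>. (\<integral>\<^sup>+ys. ?f (fun_upd \<omega> x ys) \<partial>\<eta> x) \<partial>Pi\<^sub>M (I - {x}) \<eta>)"
    by (rule nn_integral_marks_split[OF x m])
  also have "\<dots> = (\<integral>\<^sup>+\<omega>. (\<integral>\<^sup>+ys. 0 \<partial>\<eta> x) \<partial>Pi\<^sub>M (I - {x}) \<eta>)"
  proof (rule nn_integral_cong)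
    fix \<omega> assume "\<omega> \<in> space (Pi\<^sub>M (I - {x}) \<eta>)"
    from ae[OF this] have "AE ys in \<eta> x. ?f (fun_upd \<omega> x ys) = 0" by eventually_elim simp
    then show "(\<integral>\<^sup>+ys. ?f (fun_upd \<omega> x ys) \<partial>\<eta> x) = (\<integral>\<^sup>+ys. 0 \<partial>\<eta> x)" by (rule nn_integral_cong_AE)
  qed
  finally have "AE \<omega> in Pi\<^sub>M I \<eta>. ?f \<omega> = 0" unfolding nn_integral_0_iff_AE[OF m, symmetric] by simp
  then show ?thesis by eventually_elim (auto split: if_splits)
qed

text \<open>With all other marks fixed, the points of the cluster at x' form a finite set, which the
  cluster at x avoids almost surely because its law has a density.\<close>

lemma AE_marks_no_collision:
  assumes x: "x \<in> I" "x' \<in> I" "x \<noteq> x'"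
  shows "AE \<omega> in Pi\<^sub>M I \<eta>. \<forall>i<fst (\<omega> x). \<forall>j<fst (\<omega> x'). snd (\<omega> x) i \<noteq> snd (\<omega> x') j"
proof (rule AE_marks_split[OF x(1)])
  show "Measurable.pred (Pi\<^sub>M I \<eta>) (\<lambda>\<omega>. \<forall>i<fst (\<omega> x). \<forall>j<fst (\<omega> x'). snd (\<omega> x) i \<noteq> snd (\<omega> x') j)"
  proof -
    have s: "Measurable.pred (Pi\<^sub>M I \<eta>) (\<lambda>\<omega>. i < fst (\<omega> z))" if "z \<in> I" for z i
      using measurable_compose[OF measurable_compose[OF measurable_mark[OF that] measurable_cluster_size]
          measurable_count_space, of "\<lambda>n. i < n"] .
    have c: "(\<lambda>\<omega>. snd (\<omega> z) i) \<in> borel_measurable (Pi\<^sub>M I \<eta>)" if "z \<in> I" for z i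
      by (rule measurable_compose[OF measurable_mark[OF that] measurable_cluster_component])
    have "Measurable.pred (Pi\<^sub>M I \<eta>) (\<lambda>\<omega>. \<forall>i j. i < fst (\<omega> x) \<longrightarrow> j < fst (\<omega> x') \<longrightarrow> snd (\<omega> x) i \<noteq> snd (\<omega> x') j)"
      by (intro pred_intros_countable pred_intros_logic s c pred_eq_point x)
    then show ?thesis by (rule measurable_cong[THEN iffD1, rotated]) blast
  qed
  fix \<omega> assume "\<omega> \<in> space (Pi\<^sub>M (I - {x}) \<eta>)"
  have "countable (snd (\<omega> x') ` {..<fst (\<omega> x')})" by simp
  from AE_eta_avoid[OF this, of x] show "AE ys in \<eta> x. \<forall>i<fst ((fun_upd \<omega> x ys) x). \<forall>j<fst ((fun_upd \<omega> x ys) x').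
      snd ((fun_upd \<omega> x ys) x) i \<noteq> snd ((fun_upd \<omega> x ys) x') j" by eventually_elim (use x(3) in auto) qed

lemma AE_marks_distinct:
  assumes "x \<in> I" shows "AE \<omega> in Pi\<^sub>M I \<eta>. inj_on (snd (\<omega> x)) {..<fst (\<omega> x)}"
  using AE_PiM_component[of I \<eta> x "\<lambda>ys. inj_on (snd ys) {..<fst ys}"] prob_eta assms AE_eta_distinct by blast

text \<open>The deterministic half of properness: the counts on an exhaustion bound the mass of
  compact sets, while injectivity within clusters and disjointness between clusters bound the
  multiplicities.\<close>

lemma proper_q_mark_config:
  assumes \<gamma>: "proper \<gamma>" and \<omega>: "\<omega> \<in> space (marks \<gamma>)"
  and K: "\<And>L. compact L \<Longrightarrow> \<exists>n. L \<subseteq> K n" "\<And>n. compact (K n)"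
  and fin: "\<And>n :: nat. (\<integral>\<^sup>+x. cluster_sum (indicator (K n)) (\<omega> x) \<partial>count_pts \<gamma>) < \<infinity>"
  and inj: "\<And>x. x \<in> pts \<gamma> \<Longrightarrow> inj_on (snd (\<omega> x)) {..<fst (\<omega> x)}"
  and dis: "\<And>x x'. x \<in> pts \<gamma> \<Longrightarrow> x' \<in> pts \<gamma> \<Longrightarrow> x \<noteq> x' \<Longrightarrow> \<forall>i<fst (\<omega> x). \<forall>j<fst (\<omega> x'). snd (\<omega> x) i \<noteq> snd (\<omega> x') j"
  shows "proper (q_map (marked \<gamma> \<omega>))"
proof -
  note p = proper_mark_config[OF \<gamma> \<omega>]
  have em: "emeasure (q_map (marked \<gamma> \<omega>)) B = (\<integral>\<^sup>+x. cluster_sum (indicator B) (\<omega> x) \<partial>count_pts \<gamma>)"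
    if "B \<in> sets borel" for B
    unfolding emeasure_q_map[OF p that]
    using nn_integral_mark_config[OF \<gamma> \<omega>, of "\<lambda>z. cluster_sum (indicator B) (snd z)"] that by simp
  show ?thesis unfolding proper_configuration_def
  proof (intro conjI allI impI ballI configuration_q_map[OF p])
    fix L :: "'x set" assume "compactin euclidean L"
    then have L: "compact L" by simp
    then obtain n where n: "L \<subseteq> K n" using K(1) by blast
    have "emeasure (q_map (marked \<gamma> \<omega>)) L \<le> emeasure (q_map (marked \<gamma> \<omega>)) (K n)"
      using n compact_imp_closed[OF K(2)] by (intro emeasure_mono) (auto simp: sets_q_map)
    also have "\<dots> < \<infinity>" using fin[of n] compact_imp_closed[OF K(2)] by (simp add: em)
    finally show "emeasure (q_map (marked \<gamma> \<omega>)) L < \<infinity>" .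
  next
    fix s :: 'x
    show "emeasure (q_map (marked \<gamma> \<omega>)) {s} \<le> 1"
    proof (cases "\<exists>x\<in>pts \<gamma>. \<exists>i<fst (\<omega> x). snd (\<omega> x) i = s")
      case False
      then have "cluster_sum (indicator {s}) (\<omega> x) = (0::ennreal)" if "x \<in> pts \<gamma>" for x
        using that unfolding cluster_sum_def by (intro sum.neutral) (auto split: split_indicator)
      then have "emeasure (q_map (marked \<gamma> \<omega>)) {s} = (\<integral>\<^sup>+x. 0 \<partial>count_pts \<gamma>)"
        unfolding em[OF borel_singleton[OF sets.empty_sets]] by (intro nn_integral_cong) simp
      then show ?thesis by simp
    next
      case True
      \<comment> \<open>Only the cluster at x0, and in it only coordinate i0, can hit s, so the mass
        at s is exactly one.\<close>
      then obtain x0 i0 where x0: "x0 \<in> pts \<gamma>" "i0 < fst (\<omega> x0)" "snd (\<omega> x0) i0 = s" by blast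
      have z: "cluster_sum (indicator {s}) (\<omega> x) = (0::ennreal)" if "x \<in> pts \<gamma>" "x \<noteq> x0" for x unfolding cluster_sum_def
      proof (rule sum.neutral, rule ballI)
        fix i assume "i \<in> {..<fst (\<omega> x)}"
        then have "snd (\<omega> x) i \<noteq> s" using dis[OF that(1) x0(1) that(2)] x0(2,3) by auto
        then show "indicator {s} (snd (\<omega> x) i) = (0::ennreal)" by simp
      qed
      have "cluster_sum (indicator {s}) (\<omega> x0) = (\<Sum>i<fst (\<omega> x0). if i = i0 then 1 else (0::ennreal))"
        unfolding cluster_sum_def
      proof (rule sum.cong[OF refl])
        fix i assume i: "i \<in> {..<fst (\<omega> x0)}"
        have "snd (\<omega> x0) i = s \<longleftrightarrow> i = i0" using inj_on_eq_iff[OF inj[OF x0(1)] i, of i0] x0(2,3) by simp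
        then show "indicator {s} (snd (\<omega> x0) i) = (if i = i0 then 1 else (0::ennreal))" by (simp add: indicator_def)
      qed
      also have "\<dots> = 1" using x0(2) by simp
      finally have o: "cluster_sum (indicator {s}) (\<omega> x0) = (1::ennreal)" .
      have "emeasure (q_map (marked \<gamma> \<omega>)) {s} = (\<integral>\<^sup>+x. indicator {x0} x \<partial>count_pts \<gamma>)"
        unfolding em[OF borel_singleton[OF sets.empty_sets]]
      proof (rule nn_integral_cong)
        fix x assume "x \<in> space (count_pts \<gamma>)"
        then show "cluster_sum (indicator {s}) (\<omega> x) = (indicator {x0} x :: ennreal)"
          using z[of x] o by (cases "x = x0") simp_all
      qed
      also have "\<dots> = emeasure (count_pts \<gamma>) {x0}" using x0(1) by (intro nn_integral_indicator) auto
      finally show ?thesis using x0(1) by simp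
    qed
  qed
qed

end

context cluster_process
begin

definition mean_hits :: "'x set \<Rightarrow> 'x \<Rightarrow> ennreal" where
  "mean_hits K x = (\<integral>\<^sup>+ys. count_in K ys \<partial>\<eta> x)"

lemma measurable_mean_hits [measurable]:
  assumes "K \<in> sets borel" shows "mean_hits K \<in> borel_measurable borel"
proof -
  have "(\<lambda>z. count_in K (snd z) :: ennreal) \<in> borel_measurable mborel"
    using assms by (intro measurable_sum_snd) simp
  from measurable_eta_integral[OF this] show ?thesis by (simp add: mean_hits_def[abs_def])
qed

text \<open>The number of cluster points in K is zero unless the cluster meets K and never exceeds
  its size; this is the second bound in (A2).\<close>

lemma mean_hits_theta:
  assumes K: "compact K" shows "(\<integral>\<^sup>+x. mean_hits K x \<partial>\<theta>) < \<infinity>"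
proof -
  have "mean_hits K x \<le> (\<integral>\<^sup>+ys\<in>clusters_meeting K. of_nat (cluster_size ys) \<partial>\<eta> x)" for x unfolding mean_hits_def
  proof (rule nn_integral_mono)
    fix ys assume ys: "ys \<in> space (\<eta> x)"
    show "count_in K ys \<le> (of_nat (cluster_size ys) * indicator (clusters_meeting K) ys :: ennreal)"
    proof (cases "ys \<in> clusters_meeting K")
      case True
      have "(count_in K ys :: ennreal) \<le> (\<Sum>i<fst ys. 1)"
        unfolding cluster_sum_def by (intro sum_mono) (auto split: split_indicator)
      then show ?thesis using True by (simp add: cluster_size_def)
    next
      case False
      then have "count_in K ys = (0::ennreal)" using ys unfolding cluster_sum_def clusters_meeting_def
        by (intro sum.neutral) (auto split: split_indicator)
      then show ?thesis by simp
    qed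
  qed
  then have "(\<integral>\<^sup>+x. mean_hits K x \<partial>\<theta>) \<le> (\<integral>\<^sup>+x. (\<integral>\<^sup>+ys\<in>clusters_meeting K. of_nat (cluster_size ys) \<partial>\<eta> x) \<partial>\<theta>)"
    by (intro nn_integral_mono)
  then show ?thesis using A2[OF K] by (rule order.strict_trans1)
qed

lemma AE_mean_hits:
  assumes K: "compact K" shows "AE \<gamma> in \<mu>. (\<integral>\<^sup>+x. mean_hits K x \<partial>\<gamma>) < \<infinity>"
  using compact_imp_closed[OF K] mean_hits_theta[OF K] by (intro AE_mu_finite measurable_mean_hits) auto

lemma AE_marks_hits:
  assumes \<gamma>: "proper \<gamma>" and K: "K \<in> sets borel"
  and fin: "(\<integral>\<^sup>+x. mean_hits K x \<partial>\<gamma>) < \<infinity>"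
  shows "AE \<omega> in marks \<gamma>. (\<integral>\<^sup>+x. count_in K (\<omega> x) \<partial>count_pts \<gamma>) < \<infinity>"
proof (rule AE_marks_sum_finite[OF countable_pts[OF \<gamma>]])
  show "(\<integral>\<^sup>+x. (\<integral>\<^sup>+ys. count_in K ys \<partial>\<eta> x) \<partial>count_pts \<gamma>) < \<infinity>"
    using fin CX.nn_integral_proper[OF \<gamma>, of "mean_hits K"] measurable_mean_hits[OF K] by (simp add: mean_hits_def)
qed (use K in simp)

text \<open>The exceptional events are indexed by the sets of an exhaustion, by points of \<gamma>
  and by pairs of such points, hence are countably many.\<close>

lemma AE_proper_q_marks:
  "AE \<gamma> in \<mu>. AE \<omega> in marks \<gamma>. proper (q_map (marked \<gamma> \<omega>))"
proof -
  obtain K :: "nat \<Rightarrow> 'x set" where K: "\<And>n. compact (K n)" "incseq K" "\<And>L. compact L \<Longrightarrow> \<exists>n. L \<subseteq> K n"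
    by (rule compact_exhaustion) blast
  have "AE \<gamma> in \<mu>. \<forall>n. (\<integral>\<^sup>+x. mean_hits (K n) x \<partial>\<gamma>) < \<infinity>" using AE_mean_hits[OF K(1)] by (simp add: AE_all_countable)
  then show ?thesis using AE_space
  proof eventually_elim
    case (elim \<gamma>)
    then have \<gamma>: "proper \<gamma>" by (simp add: space_mu)
    have c: "countable (pts \<gamma>)" using countable_pts[OF \<gamma>] .
    have 1: "AE \<omega> in marks \<gamma>. \<forall>n. (\<integral>\<^sup>+x. cluster_sum (indicator (K n)) (\<omega> x) \<partial>count_pts \<gamma>) < \<infinity>"
      using AE_marks_hits[OF \<gamma>] compact_imp_closed[OF K(1)] elim(1) by (simp add: AE_all_countable)
    have 2: "AE \<omega> in marks \<gamma>. \<forall>x\<in>pts \<gamma>. inj_on (snd (\<omega> x)) {..<fst (\<omega> x)}"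
      using AE_marks_distinct by (simp add: AE_ball_countable[OF c])
    have 3: "AE \<omega> in marks \<gamma>. \<forall>x\<in>pts \<gamma>. \<forall>x'\<in>pts \<gamma>. x \<noteq> x' \<longrightarrow> (\<forall>i<fst (\<omega> x). \<forall>j<fst (\<omega> x'). snd (\<omega> x) i \<noteq> snd (\<omega> x') j)"
      unfolding AE_ball_countable[OF c]
    proof (intro ballI)
      fix x x' assume "x \<in> pts \<gamma>" "x' \<in> pts \<gamma>"
      then show "AE \<omega> in marks \<gamma>. x \<noteq> x' \<longrightarrow> (\<forall>i<fst (\<omega> x). \<forall>j<fst (\<omega> x'). snd (\<omega> x) i \<noteq> snd (\<omega> x') j)"
        using AE_marks_no_collision[of x "pts \<gamma>" x'] by (cases "x = x'") auto
    qed
    from 1 2 3 AE_space show ?case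
    proof eventually_elim
      case (elim \<omega>)
      show ?case by (rule proper_q_mark_config[OF \<gamma> elim(4) K(3) K(1)]) (use elim(1-3) in blast)+
    qed
  qed
qed

lemma measurable_proper_q: "Measurable.pred (Proper_Config marked_top) (\<lambda>\<gamma>'. proper (q_map \<gamma>' :: 'x measure))"
proof -
  have "q_map -` {\<gamma>. proper \<gamma>} \<inter> space (Proper_Config marked_top) \<in> sets (Proper_Config (marked_top :: 'x marked topology))"
    by (rule measurable_sets[OF measurable_q_map measurable_proper])
  then show ?thesis by (simp add: pred_def vimage_def Int_def conj_commute)
qed

lemma AE_proper_q: "AE \<gamma>' in \<mu>h. proper (q_map \<gamma>')"
  unfolding AE_mu_hat[OF measurable_proper_q] by (rule AE_proper_q_marks)

end

section \<open>Integration by parts for one cluster\<close>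

lemma bounded_linear_apply_bcontfun: "bounded_linear (\<lambda>u. apply_bcontfun u i)"
  by (rule bounded_linear_intro[where K = 1])
    (auto simp: plus_bcontfun.rep_eq scaleR_bcontfun.rep_eq norm_bounded)

lemma open_cluster_chart_img:
  assumes "\<And>i. i < n \<Longrightarrow> open (chart_img (cs i))" shows "open (cluster_chart_img n cs)"
proof -
  have "cluster_chart_img n cs = (\<Inter>i\<in>{..<n}. (\<lambda>u. apply_bcontfun u i) -` chart_img (cs i))"
    by (auto simp: cluster_chart_img_def)
  also have "open \<dots>" using assms by (intro open_INT ballI open_vimage linear_continuous_on bounded_linear_apply_bcontfun) auto
  finally show ?thesis .
qed

lemma norm_cluster_sum_le:
  fixes f :: "'x \<Rightarrow> 'b::real_normed_vector"
  assumes "\<And>x. norm (f x) \<le> C" "\<And>x. x \<notin> K \<Longrightarrow> f x = 0"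
  shows "norm (cluster_sum f ys) \<le> C * count_in K ys"
proof -
  have "norm (f x) \<le> C * indicator K x" for x using assms by (cases "x \<in> K") auto
  then show ?thesis unfolding cluster_sum_def sum_distrib_left by (intro order_trans[OF norm_sum] sum_mono)
qed

lemma ennreal_cluster_sum_indicator: "ennreal (count_in K ys) = count_in K ys"
  unfolding cluster_sum_def by (subst sum_ennreal[symmetric]) (auto simp: ennreal_indicator)

lemma Cb_infD:
  fixes f :: "real ^ 'k::finite \<Rightarrow> real"
  assumes f: "f \<in> Cb_inf"
  shows Cb_inf_smooth: "smooth_on UNIV f"
  and Cb_inf_bound: "\<exists>C\<ge>0. \<forall>p. \<bar>f p\<bar> \<le> C"
  and Cb_inf_deriv_bound: "\<exists>C\<ge>0. \<forall>p w. \<bar>fderiv f p w\<bar> \<le> C * norm w"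
  and Cb_inf_linear: "linear (fderiv f p)"
  and Cb_inf_continuous: "continuous_on UNIV f"
  and Cb_inf_deriv_continuous: "continuous_on UNIV (\<lambda>p. fderiv f p w)"
  and Cb_inf_deriv_sum: "fderiv f p w = (\<Sum>k\<in>UNIV. w $ k * fderiv f p (axis k 1))"
proof -
  show sm: "smooth_on UNIV f" using f by (simp add: Cb_inf_def)
  show lin: "linear (fderiv f p)" for p by (rule linear_frechet_derivative[OF smooth_on_differentiable[OF sm UNIV_I]])
  show "continuous_on UNIV f" by (rule smooth_on_continuous_on[OF sm])
  show "continuous_on UNIV (\<lambda>p. fderiv f p w)" for w by (rule smooth_on_continuous_on[OF smooth_on_frechet_derivative[OF sm]])
  show s: "fderiv f p w = (\<Sum>k\<in>UNIV. w $ k * fderiv f p (axis k 1))" for p w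
  proof -
    have "fderiv f p w = fderiv f p (\<Sum>k\<in>UNIV. (w $ k) *s axis k 1)" unfolding basis_expansion ..
    then show ?thesis by (simp add: linear_sum[OF lin] linear_scale[OF lin] scalar_mult_eq_scaleR)
  qed
  have bd: "\<exists>C\<ge>0. \<forall>p. \<bar>iter_deriv f vs p\<bar> \<le> C" for vs
  proof -
    have "bounded (range (iter_deriv f vs))" using f by (simp add: Cb_inf_def)
    then obtain C where "\<And>p. \<bar>iter_deriv f vs p\<bar> \<le> C" by (auto simp: bounded_iff)
    then show ?thesis using order_trans[OF abs_ge_zero] by blast
  qed
  show "\<exists>C\<ge>0. \<forall>p. \<bar>f p\<bar> \<le> C" using bd[of "[]"] by simp
  have "\<forall>k. \<exists>C\<ge>0. \<forall>p. \<bar>fderiv f p (axis k 1)\<bar> \<le> C" using bd[of "[axis k 1]" for k] by simp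
  then obtain C where C: "\<And>k. C k \<ge> 0" "\<And>k p. \<bar>fderiv f p (axis k 1)\<bar> \<le> C k" by metis
  have "\<bar>fderiv f p w\<bar> \<le> (\<Sum>k\<in>UNIV. C k) * norm w" for p w
  proof -
    have "\<bar>fderiv f p w\<bar> \<le> (\<Sum>k\<in>UNIV. \<bar>w $ k * fderiv f p (axis k 1)\<bar>)" unfolding s[of p w] by (rule sum_abs)
    also have "\<dots> \<le> (\<Sum>k\<in>UNIV. norm w * C k)" unfolding abs_mult by (intro sum_mono mult_mono component_le_norm_cart C) auto
    finally show ?thesis by (simp add: sum_distrib_left mult.commute)
  qed
  then show "\<exists>C\<ge>0. \<forall>p w. \<bar>fderiv f p w\<bar> \<le> C * norm w" using C(1) by (intro exI[of _ "\<Sum>k\<in>UNIV. C k"]) (auto intro: sum_nonneg)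
qed

lemma has_derivative_vec:
  assumes "\<And>k :: 'k::finite. (f k has_derivative f' k) (at x)"
  shows "((\<lambda>x. \<chi> k. f k x) has_derivative (\<lambda>w. (\<chi> k. f' k w) :: real ^ 'k)) (at x)"
proof -
  have "((\<lambda>x. \<Sum>k\<in>UNIV. f k x *\<^sub>R (axis k 1 :: real ^ 'k)) has_derivative (\<lambda>w. \<Sum>k\<in>UNIV. f' k w *\<^sub>R axis k 1)) (at x)"
    by (intro has_derivative_sum has_derivative_scaleR_left assms)
  moreover have "(\<Sum>k\<in>UNIV. u k *\<^sub>R (axis k 1 :: real ^ 'k)) = (\<chi> k. u k)" for u
    by (simp add: vec_eq_iff axis_def if_distrib sum.If_cases cong: if_cong)
  ultimately show ?thesis by simp
qed

lemma measurable_Cb_inf_deriv: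
  fixes f :: "real ^ 'k::finite \<Rightarrow> real"
  assumes f: "f \<in> Cb_inf" and [measurable]: "p \<in> borel_measurable M" "w \<in> borel_measurable M"
  shows "(\<lambda>x. fderiv f (p x) (w x)) \<in> borel_measurable M"
proof -
  have [measurable]: "(\<lambda>p. fderiv f p (axis k 1)) \<in> borel_measurable borel" for k
    using Cb_inf_deriv_continuous[OF f] by (rule measurable_continuous)
  have [measurable]: "(\<lambda>x. w x $ k) \<in> borel_measurable M" for k
    using measurable_compose[OF assms(3), of "\<lambda>w. w $ k"] measurable_continuous[OF continuous_on_component[OF continuous_on_id]]
    by blast
  have "(\<lambda>x. \<Sum>k\<in>UNIV. w x $ k * fderiv f (p x) (axis k 1)) \<in> borel_measurable M" by measurable
  then show ?thesis unfolding Cb_inf_deriv_sum[OF f, of "p x" "w x" for x] .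
qed

context riemannian
begin

text \<open>The test functions of a cylinder function are packed into one vector-valued map, so that
  a single integral of that map carries all the pairings.\<close>

definition test_map :: "('x \<Rightarrow> real ^ 'k::finite) \<Rightarrow> bool" where
  "test_map \<Phi> \<longleftrightarrow> (\<forall>k. (\<lambda>x. \<Phi> x $ k) \<in> C0_inf X)"

definition field_deriv :: "('x \<Rightarrow> ('x, 'n) tangent) \<Rightarrow> ('x \<Rightarrow> real ^ 'k::finite) \<Rightarrow> 'x \<Rightarrow> real ^ 'k" where
  "field_deriv v \<Phi> x = (\<chi> k. differential X (\<lambda>z. \<Phi> z $ k) x (v x))"

lemma test_map_smooth: "test_map \<Phi> \<Longrightarrow> smooth_fun X (\<lambda>x. \<Phi> x $ k)"
  by (auto simp: test_map_def C0_inf_def)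

lemma test_map_continuous: "test_map \<Phi> \<Longrightarrow> continuous_on UNIV \<Phi>"
proof -
  assume \<Phi>: "test_map \<Phi>"
  have "continuous_on UNIV (\<lambda>x. \<chi> k. \<Phi> x $ k)" by (intro continuous_on_vec_lambda smooth_fun_continuous test_map_smooth \<Phi>)
  then show ?thesis by simp
qed

lemma field_deriv_continuous: "test_map \<Phi> \<Longrightarrow> v \<in> Vect0 X \<Longrightarrow> continuous_on UNIV (field_deriv v \<Phi>)"
  unfolding field_deriv_def[abs_def]
  by (intro continuous_on_vec_lambda smooth_fun_continuous smooth_fun_differential test_map_smooth)

lemma field_deriv_outside: "test_map \<Phi> \<Longrightarrow> v x = (\<lambda>_. 0) \<Longrightarrow> field_deriv v \<Phi> x = 0"
  unfolding field_deriv_def by (simp add: differential_zero smooth_fun_differentiable_pt test_map_smooth vec_eq_iff)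

lemma compact_support_bound:
  fixes f :: "'x \<Rightarrow> 'b::real_normed_vector"
  assumes f: "continuous_on UNIV f" and K: "compact K" "\<And>x. x \<notin> K \<Longrightarrow> f x = 0"
  obtains C where "C \<ge> 0" "\<And>x. norm (f x) \<le> C"
proof -
  have "bounded (f ` K)" by (intro compact_imp_bounded compact_continuous_image continuous_on_subset[OF f] K) auto
  then obtain C where C: "\<And>x. x \<in> K \<Longrightarrow> norm (f x) \<le> C" by (auto simp: bounded_iff)
  have "norm (f x) \<le> max C 0" for x using C[of x] K(2)[of x] by (cases "x \<in> K") auto
  then show ?thesis by (intro that[of "max C 0"]) auto
qed

lemma test_map_support:
  assumes \<Phi>: "test_map \<Phi>" obtains K where "compact K" "\<And>x. x \<notin> K \<Longrightarrow> \<Phi> x = 0"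
proof -
  have "\<forall>k. \<exists>K. compact K \<and> (\<forall>x. x \<notin> K \<longrightarrow> \<Phi> x $ k = 0)" using \<Phi> by (auto simp: test_map_def C0_inf_def)
  then obtain K where K: "\<And>k. compact (K k)" "\<And>k x. x \<notin> K k \<Longrightarrow> \<Phi> x $ k = 0" by metis
  have 1: "compact (\<Union>k. K k)" using K(1) by (intro compact_UN) auto
  have 2: "\<Phi> x = 0" if "x \<notin> (\<Union>k. K k)" for x using K(2) that by (auto simp: vec_eq_iff)
  show ?thesis by (rule that[OF 1 2])
qed

section \<open>Compactly supported test functions on the space of clusters\<close>

lemma smooth_on_pull:
  assumes f: "smooth_fun X f" and cs: "\<And>i. i < n \<Longrightarrow> cs i \<in> Charts X" and i: "i < n"
  shows "smooth_on (cluster_chart_img n cs) (\<lambda>u. f (unchart (cs i) (apply_bcontfun u i)))"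
proof -
  have "smooth_on (cluster_chart_img n cs) (\<lambda>u. (f \<circ> unchart (cs i)) (apply_bcontfun u i))"
  proof (rule smooth_on_compose[where T = "chart_img (cs i)" and f = "f \<circ> unchart (cs i)"])
    show "open (cluster_chart_img n cs)" by (intro open_cluster_chart_img open_chart_img cs)
    show "open (chart_img (cs i))" by (intro open_chart_img cs i)
    show "(\<lambda>u. apply_bcontfun u i) ` cluster_chart_img n cs \<subseteq> chart_img (cs i)" using i by (auto simp: cluster_chart_img_def)
    show "smooth_on (chart_img (cs i)) (f \<circ> unchart (cs i))" by (rule smooth_funD[OF f cs[OF i]])
  qed (rule smooth_on_bounded_linear[OF bounded_linear_apply_bcontfun])
  then show ?thesis by simp
qed

text \<open>Compact sets of clusters bound the number of points as well as their positions. The size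
  is therefore cut at m, and each point contributes a factor \<rho>. Components of different size
  are disjoint, so the sharp cut in size keeps smoothness.\<close>

definition cutoff :: "nat \<Rightarrow> ('x \<Rightarrow> real) \<Rightarrow> 'x cluster \<Rightarrow> real" where
  "cutoff m \<rho> ys = (if fst ys \<le> m then \<Prod>i<fst ys. \<rho> (snd ys i) else 0)"

lemma compact_cutoff_support:
  assumes K: "compact K"
  shows "compactin cluster_top (\<Union>n\<in>{..m}. Pair n ` ({..<n} \<rightarrow>\<^sub>E K))"
proof -
  have "compactin cluster_top (Pair n ` ({..<n} \<rightarrow>\<^sub>E K))" for n
  proof (rule image_compactin)
    show "compactin (product_topology (\<lambda>_. euclidean) {..<n}) ({..<n} \<rightarrow>\<^sub>E K)" using K by (simp add: compactin_PiE)
    show "continuous_map (product_topology (\<lambda>_. euclidean) {..<n}) cluster_top (Pair n)"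
      unfolding cluster_top_def by (rule continuous_map_component_injection) simp
  qed
  then show ?thesis by (intro compactin_Union) auto
qed

lemma cutoff_test_smooth:
  fixes f :: "real ^ 'k::finite \<Rightarrow> real"
  assumes \<rho>: "\<rho> \<in> C0_inf X" and f: "smooth_on UNIV f" and \<Phi>: "test_map \<Phi>"
  shows "(\<lambda>ys. cutoff m \<rho> ys * f (c + cluster_sum \<Phi> ys)) \<in> cluster_C0_inf X"
proof -
  let ?g = "\<lambda>ys. cutoff m \<rho> ys * f (c + cluster_sum \<Phi> ys)"
  have \<rho>s: "smooth_fun X \<rho>" using \<rho> by (simp add: C0_inf_def)
  obtain K where K: "compact K" "\<And>x. x \<notin> K \<Longrightarrow> \<rho> x = 0" using \<rho> by (auto simp: C0_inf_def)
  have "smooth_on (cluster_chart_img n cs) (pull_cluster ?g n cs)" if cs: "\<And>i. i < n \<Longrightarrow> cs i \<in> Charts X" for n cs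
  proof (cases "n \<le> m")
    case True
    let ?S = "cluster_chart_img n cs"
    let ?u = "\<lambda>i u. unchart (cs i) (apply_bcontfun u i)"
    have S: "open ?S" by (intro open_cluster_chart_img open_chart_img cs)
    have e: "pull_cluster ?g n cs = (\<lambda>u. (\<Prod>i<n. \<rho> (?u i u)) * f (c + (\<Sum>i<n. \<Phi> (?u i u))))"
      using True by (auto simp: pull_cluster_def cutoff_def cluster_sum_def fun_eq_iff)
    have "smooth_on ?S (\<lambda>u. \<Phi> (?u i u))" if "i < n" for i
    proof -
      have "smooth_on ?S (\<lambda>u. \<chi> k. \<Phi> (?u i u) $ k)"
        by (intro smooth_on_vec[OF S] smooth_on_pull[OF test_map_smooth[OF \<Phi>] cs that])
      then show ?thesis by simp
    qed
    then have "smooth_on ?S (\<lambda>u. c + (\<Sum>i<n. \<Phi> (?u i u)))"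
      by (intro smooth_on_add[OF S] smooth_on_sum[OF S] smooth_on_const) auto
    then have "smooth_on ?S (\<lambda>u. f (c + (\<Sum>i<n. \<Phi> (?u i u))))" by (rule smooth_on_compose[OF S open_UNIV subset_UNIV f])
    then show ?thesis unfolding e using smooth_on_pull[OF \<rho>s cs] by (intro smooth_on_mult[OF S] smooth_on_prod[OF S]) auto
  next
    case False
    then have "pull_cluster ?g n cs = (\<lambda>_. 0)" by (auto simp: pull_cluster_def cutoff_def)
    then show ?thesis by simp
  qed
  moreover have "?g ys = 0" if ys: "ys \<in> clusters" "ys \<notin> (\<Union>n\<in>{..m}. Pair n ` ({..<n} \<rightarrow>\<^sub>E K))" for ys
  proof (cases "fst ys \<le> m")
    case True
    have "\<exists>i<fst ys. snd ys i \<notin> K"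
    proof (rule ccontr)
      assume "\<not> (\<exists>i<fst ys. snd ys i \<notin> K)"
      then have "snd ys \<in> {..<fst ys} \<rightarrow>\<^sub>E K" using ys(1) by (auto simp: in_cluster_iff PiE_iff)
      then have "(fst ys, snd ys) \<in> (\<Union>n\<in>{..m}. Pair n ` ({..<n} \<rightarrow>\<^sub>E K))" using True by blast
      then show False using ys(2) by simp
    qed
    then obtain i where "i < fst ys" "\<rho> (snd ys i) = 0" using K(2) by blast
    then have "(\<Prod>i<fst ys. \<rho> (snd ys i)) = 0" by (intro prod_zero) auto
    then show ?thesis by (simp add: cutoff_def)
  qed (simp add: cutoff_def)
  ultimately show ?thesis
    unfolding cluster_C0_inf_def smooth_cluster_fun_def using compact_cutoff_support[OF K(1), of m] by blast
qed

text \<open>The term with the derivative of \<rho> drops out: where v is nonzero, \<rho> attains its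
  maximum 1 and its derivative vanishes; where v is zero, so is the derivative along v. The
  constants A and b stand for the factors and the summands that come from the other points of the
  cluster.\<close>

lemma differential_cutoff:
  fixes f :: "real ^ 'k::finite \<Rightarrow> real"
  assumes \<rho>: "smooth_fun X \<rho>" "\<And>x. \<rho> x \<le> 1" and f: "smooth_on UNIV f" and \<Phi>: "test_map \<Phi>"
  and v: "v \<in> Vect0 X" and flat: "v y \<noteq> (\<lambda>_. 0) \<Longrightarrow> \<rho> y = 1"
  shows "differential X (\<lambda>z. A * (\<rho> z * f (b + \<Phi> z))) y (v y) = A * (\<rho> y * fderiv f (b + \<Phi> y) (field_deriv v \<Phi> y))"
proof -
  let ?c = "chart_at X y"
  let ?p = "coord ?c y"
  let ?\<rho> = "\<rho> \<circ> unchart ?c"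
  let ?\<rho>' = "fderiv ?\<rho> ?p"
  let ?\<Phi>' = "\<lambda>w. \<chi> k. fderiv ((\<lambda>z. \<Phi> z $ k) \<circ> unchart ?c) ?p w"
  let ?f' = "fderiv f (b + \<Phi> y)"
  have c: "?c \<in> charts_at X y" by (rule chart_at_in)
  have c': "?c \<in> Charts X" "y \<in> chart_dom ?c" using charts_atD[OF c] by blast+
  have p: "?p \<in> chart_img ?c" using c'(2) by simp
  have u: "unchart ?c ?p = y" using c' by simp
  have D: "((g \<circ> unchart ?c) has_derivative fderiv (g \<circ> unchart ?c) ?p) (at ?p)"
    if "smooth_fun X g" for g
    using smooth_fun_differentiable_pt[OF that] c by (simp add: differentiable_pt_def frechet_derivative_works)
  have 1: "(?\<rho> has_derivative ?\<rho>') (at ?p)" by (rule D[OF \<rho>(1)])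
  have "((\<lambda>w. \<chi> k. \<Phi> (unchart ?c w) $ k) has_derivative ?\<Phi>') (at ?p)"
    using D[OF test_map_smooth[OF \<Phi>]] by (intro has_derivative_vec) (simp add: o_def)
  then have "((\<lambda>w. b + \<Phi> (unchart ?c w)) has_derivative ?\<Phi>') (at ?p)" by (auto intro!: derivative_eq_intros)
  moreover have "(f has_derivative ?f') (at (b + \<Phi> (unchart ?c ?p)))"
    unfolding u using smooth_on_differentiable[OF f UNIV_I] by (simp add: frechet_derivative_works)
  ultimately have 2: "((\<lambda>w. f (b + \<Phi> (unchart ?c w))) has_derivative (\<lambda>w. ?f' (?\<Phi>' w))) (at ?p)"
    by (rule has_derivative_compose)
  have "((\<lambda>w. A * (?\<rho> w * f (b + \<Phi> (unchart ?c w)))) has_derivative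
      (\<lambda>w. A * (?\<rho> ?p * ?f' (?\<Phi>' w) + ?\<rho>' w * f (b + \<Phi> (unchart ?c ?p))))) (at ?p)"
    by (intro has_derivative_mult_right has_derivative_mult 1 2)
  then have d: "differential X (\<lambda>z. A * (\<rho> z * f (b + \<Phi> z))) y (v y) =
      A * (\<rho> y * ?f' (?\<Phi>' (v y ?c)) + ?\<rho>' (v y ?c) * f (b + \<Phi> y))" unfolding differential_def Let_def
    by (subst frechet_derivative_at[symmetric]) (auto simp: o_def u)
  have "?\<rho>' (v y ?c) = 0"
  proof (cases "v y = (\<lambda>_. 0)")
    case True
    then show ?thesis using linear_0[OF has_derivative_linear[OF 1]] by simp
  next
    case False
    have "?\<rho>' = (\<lambda>_. 0)"
    proof (rule differential_zero_maxmin[OF p open_chart_img[OF c'(1)] 1])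
      show "(\<forall>w\<in>chart_img ?c. ?\<rho> w \<le> ?\<rho> ?p) \<or> (\<forall>w\<in>chart_img ?c. ?\<rho> ?p \<le> ?\<rho> w)" using flat[OF False] \<rho>(2) by (simp add: u)
    qed
    then show ?thesis by (rule fun_cong)
  qed
  moreover have "?\<Phi>' (v y ?c) = field_deriv v \<Phi> y" unfolding field_deriv_def differential_def Let_def ..
  ultimately show ?thesis unfolding d by simp
qed

lemma cutoff_test_deriv:
  fixes f :: "real ^ 'k::finite \<Rightarrow> real"
  assumes \<rho>: "smooth_fun X \<rho>" "\<And>x. \<rho> x \<le> 1" and f: "smooth_on UNIV f" and \<Phi>: "test_map \<Phi>"
  and v: "v \<in> Vect0 X" and flat: "\<And>y. v y \<noteq> (\<lambda>_. 0) \<Longrightarrow> \<rho> y = 1"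
  shows "cluster_dir_deriv X (lift_field v) (\<lambda>ys. cutoff m \<rho> ys * f (c + cluster_sum \<Phi> ys)) ys =
    cutoff m \<rho> ys * fderiv f (c + cluster_sum \<Phi> ys) (cluster_sum (field_deriv v \<Phi>) ys)" proof -
  let ?g = "\<lambda>ys. cutoff m \<rho> ys * f (c + cluster_sum \<Phi> ys)"
  let ?f' = "fderiv f (c + cluster_sum \<Phi> ys)"
  have lin: "linear ?f'" by (rule linear_frechet_derivative[OF smooth_on_differentiable[OF f UNIV_I]])
  have "differential X (vary_coord ?g ys i) (snd ys i) (v (snd ys i)) = cutoff m \<rho> ys * ?f' (field_deriv v \<Phi> (snd ys i))"
    if i: "i < fst ys" for i
  proof (cases "fst ys \<le> m")
    case True
    \<comment> \<open>Separates the varied coordinate from the others, which are frozen into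
      \<open>?A\<close> and \<open>?b\<close>.\<close>
    let ?I = "{..<fst ys} - {i}"
    let ?A = "\<Prod>j\<in>?I. \<rho> (snd ys j)" and ?b = "c + (\<Sum>j\<in>?I. \<Phi> (snd ys j))"
    have 1: "(\<Prod>j<fst ys. \<rho> (((snd ys)(i := z)) j)) = \<rho> z * ?A" for z using i by (subst prod.remove[of _ i]) auto
    have 2: "(\<Sum>j<fst ys. \<Phi> (((snd ys)(i := z)) j)) = \<Phi> z + (\<Sum>j\<in>?I. \<Phi> (snd ys j))" for z
      using i by (subst sum.remove[of _ i]) auto
    have "vary_coord ?g ys i = (\<lambda>z. ?A * (\<rho> z * f (?b + \<Phi> z)))"
      using True unfolding vary_coord_def cutoff_def cluster_sum_def fst_conv snd_conv 1 2 by (simp add: ac_simps)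
    then have "differential X (vary_coord ?g ys i) (snd ys i) (v (snd ys i)) =
        ?A * (\<rho> (snd ys i) * fderiv f (?b + \<Phi> (snd ys i)) (field_deriv v \<Phi> (snd ys i)))"
      using differential_cutoff[OF \<rho> f \<Phi> v flat, of "snd ys i" ?A ?b] by simp
    moreover have "?b + \<Phi> (snd ys i) = c + cluster_sum \<Phi> ys" using 2[of "snd ys i"] by (simp add: cluster_sum_def ac_simps)
    moreover have "cutoff m \<rho> ys = \<rho> (snd ys i) * ?A" using 1[of "snd ys i"] True by (simp add: cutoff_def)
    ultimately show ?thesis by simp
  next
    case False
    \<comment> \<open>Above size m the function vanishes for every value of the varied coordinate,
      which is the case A = 0.\<close>
    then have "vary_coord ?g ys i = (\<lambda>z. 0 * (\<rho> z * f (c + \<Phi> z)))" by (auto simp: vary_coord_def cutoff_def)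
    then show ?thesis using differential_cutoff[OF \<rho> f \<Phi> v flat, of "snd ys i" 0 c] False by (simp add: cutoff_def)
  qed
  then show ?thesis unfolding cluster_dir_deriv_def lift_field_def cluster_sum_def[of "field_deriv v \<Phi>"]
    by (simp add: linear_sum[OF lin] sum_distrib_left)
qed

lemma cutoff_bounds:
  assumes "\<And>x. 0 \<le> \<rho> x" "\<And>x. \<rho> x \<le> 1" shows "\<bar>cutoff m \<rho> ys\<bar> \<le> 1"
  using assms by (auto simp: cutoff_def abs_prod intro!: prod_le_1)

lemma measurable_cutoff:
  assumes [measurable]: "\<rho> \<in> borel_measurable borel" shows "cutoff m \<rho> \<in> borel_measurable cborel"
proof -
  have "(\<lambda>ys. (\<lambda>n ys. if n \<le> m then \<Prod>i<n. \<rho> (snd ys i) else 0) (fst ys) ys) \<in> borel_measurable cborel"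
    by (rule measurable_compose_countable) measurable
  then show ?thesis by (simp add: cutoff_def[abs_def])
qed

end

context cluster_density
begin

text \<open>The two terms are dominated separately: the derivative of f along the field by a
  multiple of the number of points in K, the other term by a multiple of the absolute logarithmic
  derivative.\<close>

lemma cluster_integration_by_parts:
  fixes f :: "real ^ 'k::finite \<Rightarrow> real"
  assumes f: "f \<in> Cb_inf" and \<Phi>: "test_map \<Phi>" and v: "v \<in> Vect0 X"
    and \<beta>: "integrable (\<eta> x) (\<lambda>ys. log_deriv v (x, ys))"
  and K: "compact K" "\<And>x. x \<notin> K \<Longrightarrow> v x = (\<lambda>_. 0)"
  and hits: "(\<integral>\<^sup>+ys. count_in K ys \<partial>\<eta> x) < \<infinity>"
  shows "(\<integral>ys. fderiv f (c + cluster_sum \<Phi> ys) (cluster_sum (field_deriv v \<Phi>) ys) +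
    f (c + cluster_sum \<Phi> ys) * log_deriv v (x, ys) \<partial>\<eta> x) = 0" proof - let ?\<beta> = "\<lambda>ys. log_deriv v (x, ys)"
  let ?D = "\<lambda>ys. fderiv f (c + cluster_sum \<Phi> ys) (cluster_sum (field_deriv v \<Phi>) ys)"
  let ?F = "\<lambda>ys. f (c + cluster_sum \<Phi> ys)"
  obtain L :: "nat \<Rightarrow> 'x set" where L: "\<And>n. compact (L n)" "incseq L" "\<And>S. compact S \<Longrightarrow> \<exists>n. S \<subseteq> L n"
    by (rule compact_exhaustion) blast
  \<comment> \<open>The cutoffs equal 1 on K for every m, which keeps their derivative along v zero,
    and on L m, which makes them converge to 1.\<close>
  have "\<exists>\<rho>. \<rho> \<in> C0_inf X \<and> (\<forall>x. 0 \<le> \<rho> x \<and> \<rho> x \<le> 1) \<and> (\<forall>x\<in>L m \<union> K. \<rho> x = 1)" for m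
    by (rule ex_cutoff[OF compact_Un[OF L(1) K(1)], of m]) blast
  then obtain \<rho> where \<rho>: "\<And>m. \<rho> m \<in> C0_inf X" "\<And>m x. 0 \<le> \<rho> m x" "\<And>m x. \<rho> m x \<le> 1"
    "\<And>m x. x \<in> L m \<union> K \<Longrightarrow> \<rho> m x = 1" by metis
  have \<rho>s: "smooth_fun X (\<rho> m)" for m using \<rho>(1)[of m] by (simp add: C0_inf_def)
  have flat: "\<rho> m y = 1" if "v y \<noteq> (\<lambda>_. 0)" for m y using \<rho>(4) K(2) that by blast
  note fs = Cb_inf_smooth[OF f]
  obtain C where C: "C \<ge> 0" "\<And>p. \<bar>f p\<bar> \<le> C" using Cb_inf_bound[OF f] by blast
  obtain C' where C': "C' \<ge> 0" "\<And>p w. \<bar>fderiv f p w\<bar> \<le> C' * norm w" using Cb_inf_deriv_bound[OF f] by blast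
  obtain C2 where C2: "C2 \<ge> 0" "\<And>x. norm (field_deriv v \<Phi> x) \<le> C2"
    by (rule compact_support_bound[OF field_deriv_continuous[OF \<Phi> v] K(1) field_deriv_outside[OF \<Phi> K(2)]]) blast+
  let ?w = "\<lambda>ys. C' * (C2 * count_in K ys) :: real"
  have Kb: "K \<in> sets borel" using compact_imp_closed[OF K(1)] by simp
  have hi: "integrable (\<eta> x) (\<lambda>ys. count_in K ys :: real)"
  proof (rule integrableI_nonneg)
    show "(\<lambda>ys. count_in K ys :: real) \<in> borel_measurable (\<eta> x)"
      using measurable_cluster_sum[of "indicator K :: 'x \<Rightarrow> real"] Kb by (simp add: measurable_cong_eta)
    show "AE ys in \<eta> x. 0 \<le> (count_in K ys :: real)" by (simp add: cluster_sum_def sum_nonneg)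
    show "(\<integral>\<^sup>+ys. ennreal (count_in K ys) \<partial>\<eta> x) < \<infinity>" using hits by (simp add: ennreal_cluster_sum_indicator)
  qed
  have D_le: "\<bar>?D ys\<bar> \<le> ?w ys" for ys
  proof -
    have "\<bar>?D ys\<bar> \<le> C' * norm (cluster_sum (field_deriv v \<Phi>) ys)" by (rule C')
    also have "\<dots> \<le> C' * (C2 * count_in K ys)"
      by (intro mult_left_mono norm_cluster_sum_le C2 C'(1) field_deriv_outside[OF \<Phi> K(2)])
    finally show ?thesis .
  qed
  have cm: "cluster_sum \<Phi> \<in> borel_measurable cborel" "cluster_sum (field_deriv v \<Phi>) \<in> borel_measurable cborel"
    by (intro measurable_cluster_sum measurable_continuous test_map_continuous field_deriv_continuous \<Phi> v)+
  have Dm: "?D \<in> borel_measurable (\<eta> x)" unfolding measurable_cong_eta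
    using cm by (intro measurable_Cb_inf_deriv[OF f] borel_measurable_add) auto
  have Fm: "?F \<in> borel_measurable (\<eta> x)" unfolding measurable_cong_eta
    using cm(1) by (intro measurable_compose[OF _ measurable_continuous[OF Cb_inf_continuous[OF f]]] borel_measurable_add) auto
  have wi: "integrable (\<eta> x) ?w" using hi by simp
  have Di: "integrable (\<eta> x) ?D" by (rule Bochner_Integration.integrable_bound[OF wi Dm], rule AE_I2)
      (simp only: real_norm_def order_trans[OF D_le abs_ge_self])
  have Fb: "\<bar>?F ys * ?\<beta> ys\<bar> \<le> C * \<bar>?\<beta> ys\<bar>" for ys unfolding abs_mult by (intro mult_right_mono C) auto
  have Cbi: "integrable (\<eta> x) (\<lambda>ys. C * \<bar>?\<beta> ys\<bar>)" using \<beta> by simp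
  have Fi: "integrable (\<eta> x) (\<lambda>ys. ?F ys * ?\<beta> ys)"
    by (rule Bochner_Integration.integrable_bound[OF Cbi borel_measurable_times[OF Fm borel_measurable_integrable[OF \<beta>]]], rule AE_I2)
      (simp only: real_norm_def order_trans[OF Fb abs_ge_self])
  let ?\<kappa> = "\<lambda>m ys. cutoff m (\<rho> m) ys"
  \<comment> \<open>A fixed cluster has finitely many points, so from some m on both its size and
    its points are inside the region where the cutoff is 1.\<close>
  have \<kappa>1: "\<forall>\<^sub>F m in sequentially. ?\<kappa> m ys = 1" for ys
  proof -
    have "compact (snd ys ` {..<fst ys})" by (intro finite_imp_compact) auto
    then obtain n where n: "snd ys ` {..<fst ys} \<subseteq> L n" using L(3) by blast
    show ?thesis
    proof (rule eventually_sequentiallyI[of "max n (fst ys)"])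
      fix m assume m: "max n (fst ys) \<le> m"
      then have "L n \<subseteq> L m" using L(2) by (auto simp: incseq_def)
      then have "\<rho> m (snd ys i) = 1" if "i < fst ys" for i using n that by (intro \<rho>(4)) auto
      then show "?\<kappa> m ys = 1" using m by (simp add: cutoff_def)
    qed
  qed
  have \<kappa>b: "\<bar>?\<kappa> m ys * t\<bar> \<le> \<bar>t\<bar>" for m ys and t :: real
    unfolding abs_mult using mult_right_mono[OF cutoff_bounds[OF \<rho>(2,3)], of "\<bar>t\<bar>"] by simp
  have \<kappa>m: "?\<kappa> m \<in> borel_measurable (\<eta> x)" for m unfolding measurable_cong_eta
    by (intro measurable_cutoff measurable_continuous smooth_fun_continuous \<rho>s)
  have lim: "(\<lambda>m. \<integral>ys. ?\<kappa> m ys * t ys \<partial>\<eta> x) \<longlonglongrightarrow> (\<integral>ys. t ys \<partial>\<eta> x)" if t: "integrable (\<eta> x) t" for t :: "'x cluster \<Rightarrow> real"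
  proof (rule integral_dominated_convergence[where w = "\<lambda>ys. \<bar>t ys\<bar>"])
    show "t \<in> borel_measurable (\<eta> x)" "integrable (\<eta> x) (\<lambda>ys. \<bar>t ys\<bar>)" using t by auto
    show "(\<lambda>ys. ?\<kappa> m ys * t ys) \<in> borel_measurable (\<eta> x)" for m using \<kappa>m[of m] t by auto
    show "AE ys in \<eta> x. (\<lambda>m. ?\<kappa> m ys * t ys) \<longlonglongrightarrow> t ys"
    proof (rule AE_I2)
      fix ys
      have "\<forall>\<^sub>F m in sequentially. ?\<kappa> m ys * t ys = t ys" using \<kappa>1[of ys] by eventually_elim simp
      then show "(\<lambda>m. ?\<kappa> m ys * t ys) \<longlonglongrightarrow> t ys" by (rule tendsto_eventually)
    qed
    show "AE ys in \<eta> x. norm (?\<kappa> m ys * t ys) \<le> \<bar>t ys\<bar>" for m using \<kappa>b by simp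
  qed
  have "(\<integral>ys. ?\<kappa> m ys * ?D ys \<partial>\<eta> x) = - (\<integral>ys. ?\<kappa> m ys * (?F ys * ?\<beta> ys) \<partial>\<eta> x)" for m
  proof -
    have "cluster_dir_deriv X (lift_field v) (\<lambda>ys. ?\<kappa> m ys * ?F ys) = (\<lambda>ys. ?\<kappa> m ys * ?D ys)"
      by (rule ext, rule cutoff_test_deriv[OF \<rho>s \<rho>(3) fs \<Phi> v flat])
    then show ?thesis using parts[OF v cutoff_test_smooth[OF \<rho>(1) fs \<Phi>], of x m m c] by (simp add: mult.assoc)
  qed
  then have "(\<lambda>m. - (\<integral>ys. ?\<kappa> m ys * (?F ys * ?\<beta> ys) \<partial>\<eta> x)) \<longlonglongrightarrow> (\<integral>ys. ?D ys \<partial>\<eta> x)" using lim[OF Di] by simp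
  moreover have "(\<lambda>m. - (\<integral>ys. ?\<kappa> m ys * (?F ys * ?\<beta> ys) \<partial>\<eta> x)) \<longlonglongrightarrow> - (\<integral>ys. ?F ys * ?\<beta> ys \<partial>\<eta> x)" by (intro tendsto_minus lim Fi)
  ultimately have "(\<integral>ys. ?D ys \<partial>\<eta> x) = - (\<integral>ys. ?F ys * ?\<beta> ys \<partial>\<eta> x)" by (rule LIMSEQ_unique)
  then show ?thesis using Bochner_Integration.integral_add[OF Di Fi] by simp
qed

end

section \<open>Integration by parts for independent clusters\<close>

lemma nn_count_space_subset:
  assumes "A \<subseteq> B" shows "(\<integral>\<^sup>+x. f x \<partial>count_space A) \<le> (\<integral>\<^sup>+x. f x \<partial>count_space B)"
proof -
  have "(\<integral>\<^sup>+x. f x * indicator A x \<partial>count_space UNIV) \<le> (\<integral>\<^sup>+x. f x * indicator B x \<partial>count_space UNIV)"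
    using assms by (intro nn_integral_mono) (auto split: split_indicator)
  then show ?thesis by (simp add: nn_integral_count_space_indicator)
qed

lemma integral_count_space_remove:
  fixes f :: "'a \<Rightarrow> 'b::{banach,second_countable_topology}"
  assumes x: "x \<in> I" and f: "integrable (count_space (I - {x})) f"
  shows "(\<integral>y. f y \<partial>count_space I) = f x + (\<integral>y. f y \<partial>count_space (I - {x}))"
proof -
  have I: "I = {x} \<union> (I - {x})" using x by blast
  have "infsetsum f ({x} \<union> (I - {x})) = infsetsum f {x} + infsetsum f (I - {x})"
    using f by (intro infsetsum_Un_disjoint) (auto simp: abs_summable_on_def integrable_count_space)
  then show ?thesis unfolding I[symmetric] by (simp add: infsetsum_def[symmetric])
qed

context cluster_process
begin

lemma measurable_marks_integral:
  fixes g :: "'x \<Rightarrow> 'x cluster \<Rightarrow> 'b::{second_countable_topology,banach}"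
  assumes I: "countable I" and g: "\<And>x. x \<in> I \<Longrightarrow> g x \<in> borel_measurable cborel"
  shows "(\<lambda>\<omega>. \<integral>x. g x (\<omega> x) \<partial>count_space I) \<in> borel_measurable (Pi\<^sub>M I \<eta>)"
proof -
  interpret sigma_finite_measure "count_space I" by (rule sigma_finite_measure_count_space_countable[OF I])
  have "(\<lambda>(x, \<omega>). g x (\<omega> x)) \<in> borel_measurable (count_space I \<Otimes>\<^sub>M Pi\<^sub>M I \<eta>)"
    by (rule measurable_pair_measure_countable1[OF I]) (simp add: measurable_compose[OF measurable_mark g])
  then have "(\<lambda>(\<omega>, x). g x (\<omega> x)) \<in> borel_measurable (Pi\<^sub>M I \<eta> \<Otimes>\<^sub>M count_space I)" by (subst measurable_pair_swap_iff) simp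
  then show ?thesis by (rule borel_measurable_lebesgue_integral)
qed

lemma integrable_cluster_sum:
  fixes \<Phi> :: "'x \<Rightarrow> 'b::{banach,second_countable_topology}"
  assumes "\<And>x. norm (\<Phi> x) \<le> C" "\<And>x. x \<notin> K \<Longrightarrow> \<Phi> x = 0"
  and fin: "(\<integral>\<^sup>+x. count_in K (\<omega> x) \<partial>count_space I) < \<infinity>"
  shows "integrable (count_space I) (\<lambda>x. cluster_sum \<Phi> (\<omega> x))"
proof (rule Bochner_Integration.integrable_bound)
  have "integrable (count_space I) (\<lambda>x. count_in K (\<omega> x) :: real)"
  proof (rule integrableI_nonneg)
    show "AE x in count_space I. 0 \<le> (count_in K (\<omega> x) :: real)" by (simp add: cluster_sum_def sum_nonneg)
  qed (use fin in \<open>simp_all add: ennreal_cluster_sum_indicator\<close>)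
  then show "integrable (count_space I) (\<lambda>x. C * count_in K (\<omega> x))" by simp
  show "AE x in count_space I. norm (cluster_sum \<Phi> (\<omega> x)) \<le> norm (C * count_in K (\<omega> x))"
  proof (rule AE_I2)
    fix x
    have "norm (cluster_sum \<Phi> (\<omega> x)) \<le> C * count_in K (\<omega> x)" by (rule norm_cluster_sum_le[OF assms(1,2)])
    then show "norm (cluster_sum \<Phi> (\<omega> x)) \<le> norm (C * count_in K (\<omega> x))" by simp
  qed
qed simp

lemma marks_integration_by_parts:
  fixes f :: "real ^ 'k::finite \<Rightarrow> real" and I :: "'x set"
  assumes I: "countable I" and f: "f \<in> Cb_inf" and \<Phi>: "test_map \<Phi>" and v: "v \<in> Vect0 X"
  and K: "compact K" "\<And>x. x \<notin> K \<Longrightarrow> v x = (\<lambda>_. 0)" "\<And>x. x \<notin> K \<Longrightarrow> \<Phi> x = 0"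
  and hits: "(\<integral>\<^sup>+x. mean_hits K x \<partial>count_space I) < \<infinity>"
    and \<beta>: "(\<integral>\<^sup>+x. mean_log_deriv v x \<partial>count_space I) < \<infinity>"
  defines "W \<equiv> \<lambda>\<omega>. fderiv f (\<integral>x. cluster_sum \<Phi> (\<omega> x) \<partial>count_space I)
      (\<integral>x. cluster_sum (field_deriv v \<Phi>) (\<omega> x) \<partial>count_space I) +
    f (\<integral>x. cluster_sum \<Phi> (\<omega> x) \<partial>count_space I) * (\<integral>x. log_deriv v (x, \<omega> x) \<partial>count_space I)"
  shows "integrable (Pi\<^sub>M I \<eta>) W" "(\<integral>\<omega>. W \<omega> \<partial>Pi\<^sub>M I \<eta>) = 0"
proof -
  let ?C = "count_space I" and ?P = "Pi\<^sub>M I \<eta>"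
  let ?f' = "\<lambda>p. fderiv f p"
  let ?\<beta> = "log_deriv v"
  define S where "S \<omega> = (\<integral>x. cluster_sum \<Phi> (\<omega> x) \<partial>?C)" for \<omega>
  \<comment> \<open>The share of the cluster at x. The argument S \<omega> keeps the contributions
    of all clusters, so summing the shares over x gives W.\<close>
  define t where "t x \<omega> = ?f' (S \<omega>) (cluster_sum (field_deriv v \<Phi>) (\<omega> x)) + f (S \<omega>) * ?\<beta> (x, \<omega> x)" for x \<omega>
  interpret C: sigma_finite_measure ?C by (rule sigma_finite_measure_count_space_countable[OF I])
  interpret P: prob_space ?P by (rule prob_marks)
  interpret CP: pair_sigma_finite ?C ?P ..
  obtain C where C: "C \<ge> 0" "\<And>p. \<bar>f p\<bar> \<le> C" using Cb_inf_bound[OF f] by blast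
  obtain C' where C': "C' \<ge> 0" "\<And>p w. \<bar>?f' p w\<bar> \<le> C' * norm w" using Cb_inf_deriv_bound[OF f] by blast
  obtain C1 where C1: "C1 \<ge> 0" "\<And>x. norm (\<Phi> x) \<le> C1"
    by (rule compact_support_bound[OF test_map_continuous[OF \<Phi>] K(1) K(3)]) blast+
  note out = field_deriv_outside[OF \<Phi> K(2)]
  obtain C2 where C2: "C2 \<ge> 0" "\<And>x. norm (field_deriv v \<Phi> x) \<le> C2"
    by (rule compact_support_bound[OF field_deriv_continuous[OF \<Phi> v] K(1) out]) blast+
  have Kb: "K \<in> sets borel" using compact_imp_closed[OF K(1)] by simp
  have indm: "(\<lambda>ys. count_in K ys :: ennreal) \<in> borel_measurable cborel"
    using Kb by (intro measurable_cluster_sum) simp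
  have \<beta>m': "?\<beta> \<in> borel_measurable mborel" using measurable_log_deriv_along[OF v] by (simp only: measurable_cong_marked)
  have \<beta>m: "(\<lambda>ys. ?\<beta> (x, ys)) \<in> borel_measurable cborel" for x by (rule measurable_section[OF \<beta>m'])
  have \<beta>em: "(\<lambda>ys. ennreal \<bar>?\<beta> (x, ys)\<bar>) \<in> borel_measurable cborel" for x using \<beta>m[of x] by measurable
  have cm: "cluster_sum \<Phi> \<in> borel_measurable cborel" "cluster_sum (field_deriv v \<Phi>) \<in> borel_measurable cborel"
    by (intro measurable_cluster_sum measurable_continuous test_map_continuous field_deriv_continuous \<Phi> v)+
  have Sm: "S \<in> borel_measurable ?P" unfolding S_def[abs_def] by (intro measurable_marks_integral I cm)
  have fm: "(\<lambda>\<omega>. f (S \<omega>)) \<in> borel_measurable ?P"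
    by (rule measurable_compose[OF Sm measurable_continuous[OF Cb_inf_continuous[OF f]]])
  have tm: "t x \<in> borel_measurable ?P" if "x \<in> I" for x unfolding t_def[abs_def]
    by (intro borel_measurable_add borel_measurable_times fm measurable_Cb_inf_deriv[OF f Sm]
        measurable_compose[OF measurable_mark[OF that] cm(2)] measurable_compose[OF measurable_mark[OF that] \<beta>m])
  \<comment> \<open>A bound for the share at x that depends on the mark at x alone. Its integral is
    computed under \<open>\<eta> x\<close>, which gives the absolute integrability needed for
    Fubini.\<close>
  let ?w = "\<lambda>x ys. ennreal (C' * C2) * count_in K ys + ennreal C * ennreal \<bar>?\<beta> (x, ys)\<bar>"
  have wm: "?w x \<in> borel_measurable cborel" for x using indm \<beta>em[of x] by measurable
  have tw: "ennreal \<bar>t x \<omega>\<bar> \<le> ?w x (\<omega> x)" for x \<omega>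
  proof -
    have "\<bar>t x \<omega>\<bar> \<le> \<bar>?f' (S \<omega>) (cluster_sum (field_deriv v \<Phi>) (\<omega> x))\<bar> + \<bar>f (S \<omega>)\<bar> * \<bar>?\<beta> (x, \<omega> x)\<bar>"
      unfolding t_def by (rule order_trans[OF abs_triangle_ineq]) (simp add: abs_mult)
    also have "\<dots> \<le> C' * norm (cluster_sum (field_deriv v \<Phi>) (\<omega> x)) + C * \<bar>?\<beta> (x, \<omega> x)\<bar>"
      by (intro add_mono C' mult_right_mono C) simp
    also have "\<dots> \<le> C' * (C2 * count_in K (\<omega> x)) + C * \<bar>?\<beta> (x, \<omega> x)\<bar>"
      by (intro add_right_mono mult_left_mono norm_cluster_sum_le C2 out C'(1))
    finally have "ennreal \<bar>t x \<omega>\<bar> \<le> ennreal (C' * C2 * count_in K (\<omega> x) + C * \<bar>?\<beta> (x, \<omega> x)\<bar>)"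
      by (simp add: ennreal_leI mult.assoc)
    also have "\<dots> = ?w x (\<omega> x)" using C(1) C'(1) C2(1)
      by (simp add: ennreal_plus ennreal_mult ennreal_cluster_sum_indicator[symmetric] cluster_sum_def[of "indicator K :: _ \<Rightarrow> real"] sum_nonneg)
    finally show ?thesis .
  qed
  have wint: "(\<integral>\<^sup>+ys. ?w x ys \<partial>\<eta> x) = ennreal (C' * C2) * mean_hits K x + ennreal C * mean_log_deriv v x" for x
  proof -
    have m: "(\<lambda>ys. count_in K ys :: ennreal) \<in> borel_measurable (\<eta> x)"
      "(\<lambda>ys. ennreal \<bar>?\<beta> (x, ys)\<bar>) \<in> borel_measurable (\<eta> x)"
      using indm \<beta>em[of x] by (simp_all only: measurable_cong_eta)
    show ?thesis unfolding mean_hits_def using m by (simp add: nn_integral_add nn_integral_cmult)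
  qed
  have wfin: "(\<integral>\<^sup>+x. (\<integral>\<^sup>+ys. ?w x ys \<partial>\<eta> x) \<partial>?C) < \<infinity>"
    unfolding wint using hits \<beta> by (simp add: nn_integral_add nn_integral_cmult ennreal_mult_less_top)
  have wx: "(\<integral>\<^sup>+\<omega>. ?w x (\<omega> x) \<partial>?P) = (\<integral>\<^sup>+ys. ?w x ys \<partial>\<eta> x)" if "x \<in> I" for x by (rule nn_integral_marks_component[OF that wm])
  have hAE: "AE \<omega> in Pi\<^sub>M I' \<eta>. (\<integral>\<^sup>+x. count_in K (\<omega> x) \<partial>count_space I') < \<infinity>"
    if "I' \<subseteq> I" for I'
  proof (rule AE_marks_sum_finite[OF countable_subset[OF that I] indm])
    show "(\<integral>\<^sup>+x. (\<integral>\<^sup>+ys. count_in K ys \<partial>\<eta> x) \<partial>count_space I') < \<infinity>"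
      using order.strict_trans1[OF nn_count_space_subset[OF that] hits] by (simp only: mean_hits_def)
  qed
  have bAE: "AE \<omega> in ?P. (\<integral>\<^sup>+x. ennreal \<bar>?\<beta> (x, \<omega> x)\<bar> \<partial>?C) < \<infinity>" using \<beta> by (rule AE_marks_sum_finite[OF I \<beta>em])
  \<comment> \<open>Almost surely the number of points in K is finite and the logarithmic
    derivatives are summable. There the sum can be taken term by term and moved into the linear
    derivative of f.\<close>
  have tsum: "AE \<omega> in ?P. (\<integral>x. t x \<omega> \<partial>?C) = W \<omega>" using hAE[OF subset_refl] bAE
  proof eventually_elim
    case (elim \<omega>)
    have 1: "integrable ?C (\<lambda>x. cluster_sum (field_deriv v \<Phi>) (\<omega> x))" by (rule integrable_cluster_sum[OF C2(2) out elim(1)])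
    have 2: "integrable ?C (\<lambda>x. ?\<beta> (x, \<omega> x))" using elim(2) by (intro integrableI_bounded) simp_all
    have L: "bounded_linear (?f' (S \<omega>))" using Cb_inf_linear[OF f] by (simp add: linear_conv_bounded_linear)
    show ?case unfolding t_def W_def S_def[symmetric]
      using integral_bounded_linear[OF L 1] integrable_bounded_linear[OF L 1] 2 by simp
  qed
  have ti: "integrable (?C \<Otimes>\<^sub>M ?P) (\<lambda>(x, \<omega>). t x \<omega>)"
  proof (rule integrableI_bounded)
    show m: "(\<lambda>(x, \<omega>). t x \<omega>) \<in> borel_measurable (?C \<Otimes>\<^sub>M ?P)"
      by (rule measurable_pair_measure_countable1[OF I]) (simp add: tm)
    have "(\<integral>\<^sup>+p. ennreal (norm (case p of (x, \<omega>) \<Rightarrow> t x \<omega>)) \<partial>(?C \<Otimes>\<^sub>M ?P)) = (\<integral>\<^sup>+x. \<integral>\<^sup>+\<omega>. ennreal \<bar>t x \<omega>\<bar> \<partial>?P \<partial>?C)"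
      using m by (subst P.nn_integral_fst[symmetric]) auto
    also have "\<dots> \<le> (\<integral>\<^sup>+x. \<integral>\<^sup>+\<omega>. ?w x (\<omega> x) \<partial>?P \<partial>?C)" by (intro nn_integral_mono tw)
    also have "\<dots> = (\<integral>\<^sup>+x. (\<integral>\<^sup>+ys. ?w x ys \<partial>\<eta> x) \<partial>?C)" by (intro nn_integral_cong wx) simp
    also note wfin
    finally show "(\<integral>\<^sup>+p. ennreal (norm (case p of (x, \<omega>) \<Rightarrow> t x \<omega>)) \<partial>(?C \<Otimes>\<^sub>M ?P)) < \<infinity>" .
  qed
  have t0: "(\<integral>\<omega>. t x \<omega> \<partial>?P) = 0" if x: "x \<in> I" for x
  proof -
    have fx: "(\<integral>\<^sup>+ys. ?w x ys \<partial>\<eta> x) < \<infinity>" using order.strict_trans1[OF nn_integral_ge_point[OF x] wfin] .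
    have tix: "integrable ?P (t x)"
    proof (rule integrableI_bounded[OF tm[OF x]])
      have "(\<integral>\<^sup>+\<omega>. ennreal (norm (t x \<omega>)) \<partial>?P) \<le> (\<integral>\<^sup>+\<omega>. ?w x (\<omega> x) \<partial>?P)" using tw by (intro nn_integral_mono) simp
      then show "(\<integral>\<^sup>+\<omega>. ennreal (norm (t x \<omega>)) \<partial>?P) < \<infinity>" using fx unfolding wx[OF x] by (rule order.strict_trans1)
    qed
    have hx: "(\<integral>\<^sup>+ys. count_in K ys \<partial>\<eta> x) < \<infinity>"
      using order.strict_trans1[OF nn_integral_ge_point[OF x] hits] by (simp only: mean_hits_def)
    have bx: "integrable (\<eta> x) (\<lambda>ys. ?\<beta> (x, ys))"
    proof (rule integrableI_bounded)
      show "(\<lambda>ys. ?\<beta> (x, ys)) \<in> borel_measurable (\<eta> x)" using \<beta>m[of x] by (simp only: measurable_cong_eta)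
      show "(\<integral>\<^sup>+ys. ennreal (norm (?\<beta> (x, ys))) \<partial>\<eta> x) < \<infinity>" using order.strict_trans1[OF nn_integral_ge_point[OF x] \<beta>] by simp
    qed
    have "AE \<omega> in Pi\<^sub>M (I - {x}) \<eta>. (\<integral>ys. t x (fun_upd \<omega> x ys) \<partial>\<eta> x) = 0" using hAE[OF Diff_subset]
    proof eventually_elim
      case (elim \<omega>)
      \<comment> \<open>The contribution of the other clusters; it does not change when the mark at
        x is replaced.\<close>
      define c where "c = (\<integral>x'. cluster_sum \<Phi> (\<omega> x') \<partial>count_space (I - {x}))"
      have Sx: "S (fun_upd \<omega> x ys) = c + cluster_sum \<Phi> ys" for ys
      proof -
        have i: "integrable (count_space (I - {x})) (\<lambda>x'. cluster_sum \<Phi> (\<omega> x'))"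
          by (rule integrable_cluster_sum[OF C1(2) K(3) elim])
        have e: "integrable (count_space (I - {x})) (\<lambda>x'. cluster_sum \<Phi> ((fun_upd \<omega> x ys) x')) \<longleftrightarrow>
            integrable (count_space (I - {x})) (\<lambda>x'. cluster_sum \<Phi> (\<omega> x'))"
          by (intro Bochner_Integration.integrable_cong refl) simp
        have "S (fun_upd \<omega> x ys) = cluster_sum \<Phi> ((fun_upd \<omega> x ys) x) +
            (\<integral>x'. cluster_sum \<Phi> ((fun_upd \<omega> x ys) x') \<partial>count_space (I - {x}))"
          unfolding S_def using i e by (intro integral_count_space_remove x) blast
        also have "(\<integral>x'. cluster_sum \<Phi> ((fun_upd \<omega> x ys) x') \<partial>count_space (I - {x})) = c"
          unfolding c_def by (intro lebesgue_cong) simp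
        finally show ?thesis unfolding fun_upd_same by (rule trans) (rule add.commute)
      qed
      show ?case unfolding t_def Sx fun_upd_same by (rule cluster_integration_by_parts[OF f \<Phi> v bx K(1,2) hx])
    qed
    then show ?thesis unfolding integral_marks_split[OF x tix] by (rule integral_eq_zero_AE)
  qed
  have Wm: "W \<in> borel_measurable ?P" unfolding W_def S_def[symmetric]
    by (intro borel_measurable_add borel_measurable_times fm measurable_Cb_inf_deriv[OF f Sm]
        measurable_marks_integral[OF I, where g = "\<lambda>x. cluster_sum (field_deriv v \<Phi>)"]
        measurable_marks_integral[OF I, where g = "\<lambda>x ys. ?\<beta> (x, ys)"] cm \<beta>m)
  have i: "integrable ?P (\<lambda>\<omega>. \<integral>x. t x \<omega> \<partial>?C)" by (rule CP.integrable_snd[OF ti])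
  show "integrable ?P W" by (rule integrable_cong_AE_imp[OF i Wm]) (use tsum in eventually_elim, simp)
  have "(\<integral>\<omega>. W \<omega> \<partial>?P) = (\<integral>\<omega>. (\<integral>x. t x \<omega> \<partial>?C) \<partial>?P)" using tsum Wm i by (intro integral_cong_AE) (auto simp: eq_commute)
  also have "\<dots> = (\<integral>x. (\<integral>\<omega>. t x \<omega> \<partial>?P) \<partial>?C)" by (rule CP.Fubini_integral[OF ti])
  also have "\<dots> = (\<integral>x. 0 \<partial>?C)" by (intro Bochner_Integration.integral_cong refl t0) simp
  finally show "(\<integral>\<omega>. W \<omega> \<partial>?P) = 0" by simp
qed

end

section \<open>Projection of densities\<close>

text \<open>The image under q of the measure with density G is absolutely continuous with respect to
  the image of P. Its Radon-Nikodym derivative is the conditional expectation of G given q, written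
  as a function on the target.\<close>

lemma ex_pushed_density_nonneg:
  fixes G :: "'a \<Rightarrow> real" and q :: "'a \<Rightarrow> 'b"
  assumes P: "finite_measure P" and q: "q \<in> measurable P N" and G: "integrable P G" "\<And>x. 0 \<le> G x"
  shows "\<exists>H. integrable (distr P N q) H \<and> (\<forall>F :: 'b \<Rightarrow> real. F \<in> borel_measurable N \<and> (\<exists>C. AE y in distr P N q. \<bar>F y\<bar> \<le> C) \<longrightarrow>
      integrable (distr P N q) (\<lambda>y. F y * H y) \<and> (\<integral>y. F y * H y \<partial>distr P N q) = (\<integral>x. F (q x) * G x \<partial>P))" proof -
  interpret P: finite_measure P by (rule P)
  let ?M = "distr P N q" and ?PG = "density P (\<lambda>x. ennreal (G x))"
  let ?N = "distr ?PG N q"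
  interpret M: finite_measure ?M by (rule P.finite_measure_distr[OF q])
  have Gm: "G \<in> borel_measurable P" using G(1) by simp
  have q': "q \<in> measurable ?PG N" using q by simp
  have "emeasure ?PG (space ?PG) = (\<integral>\<^sup>+x. ennreal (G x) \<partial>P)" using Gm by (simp add: emeasure_density cong: nn_integral_cong)
  also have "\<dots> < \<infinity>" using G by (simp add: integrable_iff_bounded)
  finally have PG: "finite_measure ?PG" by (intro finite_measureI) simp
  have N: "finite_measure ?N" by (rule finite_measure.finite_measure_distr[OF PG q'])
  then have Ns: "sigma_finite_measure ?N" by (rule finite_measure.axioms)
  have ac: "absolutely_continuous ?M ?N" unfolding absolutely_continuous_def
  proof
    fix A assume "A \<in> null_sets ?M"
    then have A: "A \<in> sets N" "q -` A \<inter> space P \<in> null_sets P" using null_sets_distr_iff[OF q] by auto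
    have "emeasure ?N A = (\<integral>\<^sup>+x. ennreal (G x) * indicator (q -` A \<inter> space P) x \<partial>P)"
      using A q Gm by (subst emeasure_distr[OF q']) (auto simp: emeasure_density)
    also have "\<dots> = 0" using nn_integral_null_set[OF A(2)] by simp
    finally show "A \<in> null_sets ?N" using A(1) by (simp add: null_sets_def)
  qed
  have s: "sets ?N = sets ?M" by simp
  let ?D = "\<lambda>y. enn2real (RN_deriv ?M ?N y)"
  note RN = M.RN_deriv_integrable[OF Ns ac s] M.RN_deriv_integral[OF Ns ac s]
  show ?thesis
  proof (intro exI[of _ ?D] conjI allI impI)
    \<comment> \<open>Integrability of the derivative is the case of the constant function 1 and
      expresses that the image measure is finite.\<close>
    have "integrable ?N (\<lambda>_. 1 :: real)" by (rule finite_measure.integrable_const[OF N])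
    then have "integrable ?M (\<lambda>y. ?D y * 1)" by (rule iffD1[OF RN(1), rotated]) simp
    then show "integrable ?M ?D" by (simp only: mult_1_right)
    fix F :: "'b \<Rightarrow> real" assume F: "F \<in> borel_measurable N \<and> (\<exists>C. AE y in ?M. \<bar>F y\<bar> \<le> C)"
    then obtain C where C: "AE y in ?M. \<bar>F y\<bar> \<le> C" by blast
    have F0 [measurable]: "F \<in> borel_measurable N" using F by (rule conjunct1)
    then have Fm: "F \<in> borel_measurable ?M" "F \<in> borel_measurable ?N" by simp_all
    have S: "{y \<in> space N. \<bar>F y\<bar> \<le> C} \<in> sets N" by measurable
    have "AE x in P. \<bar>F (q x)\<bar> \<le> C" using C unfolding AE_distr_iff[OF q S] .
    then have "AE x in ?PG. \<bar>F (q x)\<bar> \<le> C" using Gm by (subst AE_density) auto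
    then have "AE y in ?N. \<bar>F y\<bar> \<le> C" unfolding AE_distr_iff[OF q' S] .
    then have i: "integrable ?N F" using Fm(2) by (intro finite_measure.integrable_const_bound[OF N]) simp_all
    show "integrable ?M (\<lambda>y. F y * ?D y)" using i RN(1)[OF Fm(1)] by (simp add: mult.commute)
    have "(\<integral>y. F y * ?D y \<partial>?M) = (\<integral>y. F y \<partial>?N)" using RN(2)[OF Fm(1)] by (simp add: mult.commute)
    also have "\<dots> = (\<integral>x. F (q x) \<partial>?PG)" by (rule integral_distr[OF q' F0])
    also have "\<dots> = (\<integral>x. G x * F (q x) \<partial>P)" using Gm G(2) measurable_compose[OF q F0] by (subst integral_real_density) auto
    finally show "(\<integral>y. F y * ?D y \<partial>?M) = (\<integral>x. F (q x) * G x \<partial>P)" by (simp add: mult.commute)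
  qed
qed

lemma ex_pushed_density:
  fixes G :: "'a \<Rightarrow> real" and q :: "'a \<Rightarrow> 'b"
  assumes P: "finite_measure P" and q: "q \<in> measurable P N" and G: "integrable P G"
  shows "\<exists>H. integrable (distr P N q) H \<and> (\<forall>F :: 'b \<Rightarrow> real. F \<in> borel_measurable N \<and> (\<exists>C. AE y in distr P N q. \<bar>F y\<bar> \<le> C) \<longrightarrow>
      (\<integral>y. F y * H y \<partial>distr P N q) = (\<integral>x. F (q x) * G x \<partial>P))" proof - let ?M = "distr P N q"
  let ?B = "\<lambda>F :: 'b \<Rightarrow> real. F \<in> borel_measurable N \<and> (\<exists>C. AE y in ?M. \<bar>F y\<bar> \<le> C)"
  have i: "integrable P (\<lambda>x. max 0 (G x))" "integrable P (\<lambda>x. max 0 (- G x))" using G by simp_all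
  obtain H1 where H1: "integrable ?M H1" "\<And>F. ?B F \<Longrightarrow> integrable ?M (\<lambda>y. F y * H1 y)"
      "\<And>F. ?B F \<Longrightarrow> (\<integral>y. F y * H1 y \<partial>?M) = (\<integral>x. F (q x) * max 0 (G x) \<partial>P)"
    using ex_pushed_density_nonneg[OF P q i(1)] by auto
  obtain H2 where H2: "integrable ?M H2" "\<And>F. ?B F \<Longrightarrow> integrable ?M (\<lambda>y. F y * H2 y)"
      "\<And>F. ?B F \<Longrightarrow> (\<integral>y. F y * H2 y \<partial>?M) = (\<integral>x. F (q x) * max 0 (- G x) \<partial>P)"
    using ex_pushed_density_nonneg[OF P q i(2)] by auto
  show ?thesis
  proof (intro exI[of _ "\<lambda>y. H1 y - H2 y"] conjI allI impI)
    show "integrable ?M (\<lambda>y. H1 y - H2 y)" using H1(1) H2(1) by simp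
    fix F :: "'b \<Rightarrow> real" assume F: "?B F"
    then obtain C where C: "AE y in ?M. \<bar>F y\<bar> \<le> C" by blast
    have F0 [measurable]: "F \<in> borel_measurable N" using F by (rule conjunct1)
    have S: "{y \<in> space N. \<bar>F y\<bar> \<le> C} \<in> sets N" by measurable
    have b: "AE x in P. \<bar>F (q x)\<bar> \<le> C" using C unfolding AE_distr_iff[OF q S] .
    have Fq: "(\<lambda>x. F (q x)) \<in> borel_measurable P" by (rule measurable_compose[OF q F0])
    have int: "integrable P (\<lambda>x. F (q x) * g x)" if g: "integrable P g" for g :: "'a \<Rightarrow> real"
    proof (rule Bochner_Integration.integrable_bound)
      show "integrable P (\<lambda>x. C * g x)" using g by simp
      show "(\<lambda>x. F (q x) * g x) \<in> borel_measurable P" using Fq g by simp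
      show "AE x in P. norm (F (q x) * g x) \<le> norm (C * g x)" using b
      proof eventually_elim
        case (elim x)
        have "\<bar>F (q x)\<bar> * \<bar>g x\<bar> \<le> \<bar>C\<bar> * \<bar>g x\<bar>" using order_trans[OF elim abs_ge_self] by (intro mult_right_mono) auto
        then show ?case by (simp add: abs_mult)
      qed
    qed
    have "(\<integral>y. F y * (H1 y - H2 y) \<partial>?M) = (\<integral>y. F y * H1 y - F y * H2 y \<partial>?M)" by (simp add: algebra_simps)
    also have "\<dots> = (\<integral>x. F (q x) * max 0 (G x) \<partial>P) - (\<integral>x. F (q x) * max 0 (- G x) \<partial>P)"
      using H1(2,3)[OF F] H2(2,3)[OF F] by simp
    also have "\<dots> = (\<integral>x. F (q x) * max 0 (G x) - F (q x) * max 0 (- G x) \<partial>P)" using int[OF i(1)] int[OF i(2)] by simp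
    also have "\<dots> = (\<integral>x. F (q x) * G x \<partial>P)" by (intro lebesgue_cong) (auto simp: max_def)
    finally show "(\<integral>y. F y * (H1 y - H2 y) \<partial>?M) = (\<integral>x. F (q x) * G x \<partial>P)" .
  qed
qed

lemma measurable_vec_iff:
  fixes g :: "'a \<Rightarrow> real ^ 'k::finite"
  assumes "\<And>k. (\<lambda>x. g x $ k) \<in> borel_measurable M" shows "g \<in> borel_measurable M"
  using assms by (subst borel_measurable_euclidean_space) (auto simp: Basis_vec_def inner_axis)

section \<open>Cylinder functions\<close>

abbreviation cylinder :: "(real ^ 'k::finite \<Rightarrow> real) \<Rightarrow> ('x \<Rightarrow> real ^ 'k) \<Rightarrow> 'x measure \<Rightarrow> real" where
  "cylinder f \<Phi> \<equiv> \<lambda>\<gamma>. f (\<chi> k. pairing (\<lambda>x. \<Phi> x $ k) \<gamma>)"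

context riemannian
begin

lemma differential_cong_open:
  assumes U: "open U" "x \<in> U" and eq: "\<And>y. y \<in> U \<Longrightarrow> g y = g' y" and d: "differentiable_pt g' x"
    and \<xi>: "\<xi> \<in> tangent_space X x"
  shows "differentiable_pt g x" "differential X g x \<xi> = differential X g' x \<xi>"
proof -
  let ?c = "chart_at X x"
  have c: "?c \<in> charts_at X x" by (rule chart_at_in)
  have c': "?c \<in> Charts X" "x \<in> chart_dom ?c" using charts_atD[OF c] by blast+
  let ?T = "coord ?c ` (chart_dom ?c \<inter> U)"
  let ?g' = "fderiv (g' \<circ> unchart ?c) (coord ?c x)"
  have T: "open ?T" using open_chart_dom[OF c'(1)] U(1) by (intro open_coord_image c') auto
  have "((g' \<circ> unchart ?c) has_derivative ?g') (at (coord ?c x))"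
    using d c by (simp add: differentiable_pt_def frechet_derivative_works)
  then have D: "((g \<circ> unchart ?c) has_derivative ?g') (at (coord ?c x))"
  proof (rule has_derivative_transform_within_open[OF _ T])
    show "coord ?c x \<in> ?T" using U(2) c'(2) by blast
    show "(g' \<circ> unchart ?c) w = (g \<circ> unchart ?c) w" if "w \<in> ?T" for w using that eq unchart_coord[OF c'(1)] by auto
  qed
  show dg: "differentiable_pt g x" using D by (intro differentiable_ptI[OF c]) (auto simp: differentiable_def)
  show "differential X g x \<xi> = differential X g' x \<xi>"
    unfolding differential_eq[OF dg c \<xi>] differential_eq[OF d c \<xi>] frechet_derivative_at[OF D, symmetric] ..
qed

lemma integrable_test_map:
  fixes \<Phi> :: "'x \<Rightarrow> 'b::{banach,second_countable_topology}"
  assumes \<gamma>: "proper \<gamma>" and \<Phi>: "continuous_on UNIV \<Phi>"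
  and K: "compact K" "\<And>x. x \<notin> K \<Longrightarrow> \<Phi> x = 0"
  shows "integrable \<gamma> \<Phi>"
proof -
  have s: "sets \<gamma> = sets borel" using sets_configuration[OF configD(1)[OF \<gamma>]] by simp
  have m: "\<Phi> \<in> borel_measurable \<gamma>" using measurable_continuous[OF \<Phi>] by (simp only: measurable_cong_sets[OF s refl])
  obtain C where C: "C \<ge> 0" "\<And>x. norm (\<Phi> x) \<le> C" by (rule compact_support_bound[OF \<Phi> K]) blast+
  have "integrable \<gamma> (\<lambda>x. indicator K x * C)"
    using configD(2)[OF \<gamma>, of K] K(1) compact_imp_closed[OF K(1)] s by simp
  then show ?thesis
  proof (rule Bochner_Integration.integrable_bound[OF _ m], intro AE_I2)
    show "norm (\<Phi> x) \<le> norm (indicator K x * C)" for x using C(2)[of x] C(1) K(2)[of x] by (cases "x \<in> K") auto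
  qed
qed

lemma pairing_test_map:
  assumes \<gamma>: "proper \<gamma>" and \<Phi>: "continuous_on UNIV (\<Phi> :: 'x \<Rightarrow> real ^ 'k::finite)"
  and K: "compact K" "\<And>x. x \<notin> K \<Longrightarrow> \<Phi> x = 0"
  shows "(\<chi> k. pairing (\<lambda>x. \<Phi> x $ k) \<gamma>) = (\<integral>x. \<Phi> x \<partial>\<gamma>)"
proof (rule vec_eq_iff[THEN iffD2], intro allI)
  fix k
  have "(\<lambda>x. \<Phi> x $ k) \<in> borel_measurable borel" by (intro measurable_continuous continuous_on_component \<Phi>)
  then have "pairing (\<lambda>x. \<Phi> x $ k) \<gamma> = (\<integral>x. \<Phi> x $ k \<partial>\<gamma>)" by (intro CX.pairing_eq_integral[OF \<gamma>]) simp
  also have "\<dots> = (\<integral>x. \<Phi> x \<partial>\<gamma>) $ k" by (rule integral_bounded_linear[OF bounded_linear_vec_nth integrable_test_map[OF \<gamma> \<Phi> K]])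
  finally show "(\<chi> k. pairing (\<lambda>x. \<Phi> x $ k) \<gamma>) $ k = (\<integral>x. \<Phi> x \<partial>\<gamma>) $ k" by simp
qed

text \<open>Moving the point x to y changes the vector of pairings to b + \<Phi> y as long as y is
  not another point of the configuration. Since points do not accumulate, this holds on a
  neighbourhood of x, which is all that the gradient sees.\<close>

lemma config_gradient_cylinder:
  fixes f :: "real ^ 'k::finite \<Rightarrow> real"
  assumes \<gamma>: "proper \<gamma>" and x: "x \<in> pts \<gamma>" and f: "smooth_on UNIV f"
    and \<Phi>: "test_map \<Phi>" and v: "v \<in> Vect0 X"
  shows "Metric X x (config_gradient X (cylinder f \<Phi>) \<gamma> x) (v x) =
    fderiv f (\<chi> k. pairing (\<lambda>x. \<Phi> x $ k) \<gamma>) (field_deriv v \<Phi> x)" proof - let ?S = "pts \<gamma> - {x}"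
  define b where "b = (\<chi> k. infsum (\<lambda>x. \<Phi> x $ k) ?S)"
  let ?g = "\<lambda>y. f (\<chi> k. pairing (\<lambda>x. \<Phi> x $ k) (config_of_set euclidean (?S \<union> {y})))"
  let ?g' = "\<lambda>y. f (b + \<Phi> y)"
  obtain K where K: "compact K" "\<And>x. x \<notin> K \<Longrightarrow> \<Phi> x = 0" by (rule test_map_support[OF \<Phi>]) blast
  have "finite (K \<inter> pts \<gamma>)" using CX.finite_pts_compact[OF \<gamma>, of K] K(1) by simp
  then have finS: "finite (K \<inter> ?S)" by (rule rev_finite_subset) blast
  have sm: "(\<lambda>x. \<Phi> x $ k) summable_on ?S" for k
    using finS K(2) by (subst summable_on_cong_neutral[where T = "K \<inter> ?S" and g = "\<lambda>x. \<Phi> x $ k"]) auto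
  \<comment> \<open>If y were already in \<open>?S\<close>, the union would gain no point and the
    summand \<Phi> y would be missing.\<close>
  have sum: "(\<chi> k. pairing (\<lambda>x. \<Phi> x $ k) (config_of_set euclidean (?S \<union> {y}))) = b + \<Phi> y" if "y \<notin> ?S" for y
  proof (rule vec_eq_iff[THEN iffD2], intro allI)
    fix k
    have "pairing (\<lambda>x. \<Phi> x $ k) (config_of_set euclidean (insert y ?S)) = infsum (\<lambda>x. \<Phi> x $ k) (insert y ?S)"
      unfolding pairing_def using CX.config_of_set(5)[of "insert y ?S"] by simp
    also have "\<dots> = \<Phi> y $ k + infsum (\<lambda>x. \<Phi> x $ k) ?S" by (rule infsum_insert[OF sm that])
    finally show "(\<chi> k. pairing (\<lambda>x. \<Phi> x $ k) (config_of_set euclidean (?S \<union> {y}))) $ k = (b + \<Phi> y) $ k" by (simp add: b_def)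
  qed
  have ins: "?S \<union> {x} = pts \<gamma>" using x by blast
  have bx: "(\<chi> k. pairing (\<lambda>x. \<Phi> x $ k) \<gamma>) = b + \<Phi> x"
    using sum[of x] unfolding ins CX.proper_config_eq(1)[OF \<gamma>, symmetric] by blast
  obtain W L where W: "open W" "x \<in> W" "W \<subseteq> L" "compact L" by (rule open_subset_compact[OF open_UNIV UNIV_I[of x]]) blast
  have "finite (L \<inter> pts \<gamma>)" using CX.finite_pts_compact[OF \<gamma>, of L] W(4) by simp
  then have "closed (L \<inter> ?S)" by (intro finite_imp_closed rev_finite_subset[of "L \<inter> pts \<gamma>" "L \<inter> ?S"]) blast+
  \<comment> \<open>Deletes the finitely many other points of the configuration inside the compact
    set L around x.\<close>
  then have U: "open (W - L \<inter> ?S)" "x \<in> W - L \<inter> ?S" using W by (auto intro: open_Diff)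
  have eq: "?g y = ?g' y" if "y \<in> W - L \<inter> ?S" for y
  proof -
    have "y \<notin> ?S" using that W(3) by blast
    from sum[OF this] show ?thesis by (rule arg_cong)
  qed
  have "smooth_fun X ?g'" unfolding smooth_fun_def
  proof
    fix c assume c: "c \<in> Charts X"
    have o: "open (chart_img c)" by (rule open_chart_img[OF c])
    have "smooth_on (chart_img c) (\<lambda>w. \<chi> k. (b + \<Phi> (unchart c w)) $ k)" using smooth_funD[OF test_map_smooth[OF \<Phi>] c]
      by (intro smooth_on_vec[OF o]) (auto simp: o_def intro!: smooth_on_add[OF o])
    then have "smooth_on (chart_img c) (\<lambda>w. b + \<Phi> (unchart c w))" by (simp only: vec_lambda_eta)
    then have "smooth_on (chart_img c) (\<lambda>w. f (b + \<Phi> (unchart c w)))"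
      by (rule smooth_on_compose[OF o open_UNIV subset_UNIV f])
    then show "smooth_on (chart_img c) (?g' \<circ> unchart c)" by (simp add: o_def)
  qed
  then have dg': "differentiable_pt ?g' x" by (rule smooth_fun_differentiable_pt)
  note vx = Vect0D(1)[OF v, of x]
  have dg: "differentiable_pt ?g x" by (rule differential_cong_open(1)[OF U eq dg' vx])
  have "Metric X x (config_gradient X (cylinder f \<Phi>) \<gamma> x) (v x) = differential X ?g x (v x)"
    unfolding config_gradient_def by (rule gradient(2)[OF dg vx])
  also have "\<dots> = differential X ?g' x (v x)" by (rule differential_cong_open(2)[OF U eq dg' vx])
  also have "\<dots> = fderiv f (b + \<Phi> x) (field_deriv v \<Phi> x)"
  proof -
    have "smooth_fun X (\<lambda>_. 1)" by (simp add: smooth_fun_def o_def)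
    \<comment> \<open>The instance with constant cutoff 1 and factor A = 1 is the plain chain
      rule.\<close>
    from differential_cutoff[OF this _ f \<Phi> v, of x 1 b] show ?thesis by simp
  qed
  finally show ?thesis unfolding bx .
qed

text \<open>The derivative of f is linear, so the sum over the points moves inside it and becomes an
  integral of \<open>field_deriv v \<Phi>\<close> against the configuration.\<close>

lemma cylinder_divergence:
  fixes f :: "real ^ 'k::finite \<Rightarrow> real"
  assumes \<gamma>: "proper \<gamma>" and f: "f \<in> Cb_inf" and \<Phi>: "test_map \<Phi>" and v: "v \<in> Vect0 X"
  and K: "compact K" "\<And>x. x \<notin> K \<Longrightarrow> v x = (\<lambda>_. 0)" "\<And>x. x \<notin> K \<Longrightarrow> \<Phi> x = 0"
  shows "(\<Sum>\<^sub>\<infinity>x\<in>pts \<gamma>. Metric X x (config_gradient X (cylinder f \<Phi>) \<gamma> x) (v x)) =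
    fderiv f (\<integral>x. \<Phi> x \<partial>\<gamma>) (\<integral>x. field_deriv v \<Phi> x \<partial>\<gamma>)" proof - let ?f' = "fderiv f (\<integral>x. \<Phi> x \<partial>\<gamma>)"
  have L: "bounded_linear ?f'" using Cb_inf_linear[OF f] by (simp add: linear_conv_bounded_linear)
  note dc = field_deriv_continuous[OF \<Phi> v] and out = field_deriv_outside[OF \<Phi> K(2)]
  have pt: "(\<chi> k. pairing (\<lambda>x. \<Phi> x $ k) \<gamma>) = (\<integral>x. \<Phi> x \<partial>\<gamma>)" by (rule pairing_test_map[OF \<gamma> test_map_continuous[OF \<Phi>] K(1,3)])
  have "(\<Sum>\<^sub>\<infinity>x\<in>pts \<gamma>. Metric X x (config_gradient X (cylinder f \<Phi>) \<gamma> x) (v x)) = (\<Sum>\<^sub>\<infinity>x\<in>pts \<gamma>. ?f' (field_deriv v \<Phi> x))"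
    by (intro infsum_cong)
      (simp only: config_gradient_cylinder[OF \<gamma> _ Cb_inf_smooth[OF f] \<Phi> v] pt)
  also have "\<dots> = pairing (\<lambda>x. ?f' (field_deriv v \<Phi> x)) \<gamma>" by (simp add: pairing_def)
  also have "\<dots> = (\<integral>x. ?f' (field_deriv v \<Phi> x) \<partial>\<gamma>)" by (intro CX.pairing_eq_integral[OF \<gamma>])
      (simp, intro measurable_continuous bounded_linear.continuous_on[OF L] dc)
  also have "\<dots> = ?f' (\<integral>x. field_deriv v \<Phi> x \<partial>\<gamma>)" by (rule integral_bounded_linear[OF L integrable_test_map[OF \<gamma> dc K(1) out]])
  finally show ?thesis .
qed

lemma measurable_integral_test_map:
  assumes \<Phi>: "continuous_on UNIV (\<Phi> :: 'x \<Rightarrow> real ^ 'k::finite)" and K: "compact K" "\<And>x. x \<notin> K \<Longrightarrow> \<Phi> x = 0"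
  shows "(\<lambda>\<gamma>. \<integral>x. \<Phi> x \<partial>\<gamma>) \<in> borel_measurable (Proper_Config euclidean)"
proof (rule measurable_vec_iff)
  fix k
  have "(\<lambda>x. \<Phi> x $ k) \<in> borel_measurable borel" by (intro measurable_continuous continuous_on_component \<Phi>)
  then have "(\<lambda>\<gamma>. \<integral>x. \<Phi> x $ k \<partial>\<gamma>) \<in> borel_measurable (Proper_Config (euclidean :: 'x topology))"
    by (intro CX.measurable_integral_Proper) simp
  then show "(\<lambda>\<gamma>. (\<integral>x. \<Phi> x \<partial>\<gamma>) $ k) \<in> borel_measurable (Proper_Config (euclidean :: 'x topology))"
  proof (rule measurable_cong[THEN iffD2, rotated])
    fix \<gamma> :: "'x measure" assume "\<gamma> \<in> space (Proper_Config euclidean)"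
    then have "proper \<gamma>" by (simp add: CX.space_Proper_Config)
    from integral_bounded_linear[OF bounded_linear_vec_nth integrable_test_map[OF this \<Phi> K]]
    show "(\<integral>x. \<Phi> x \<partial>\<gamma>) $ k = (\<integral>x. \<Phi> x $ k \<partial>\<gamma>)" by simp
  qed
qed

end

section \<open>Integration by parts for the cluster measure\<close>

context cluster_process
begin

text \<open>The logarithmic derivative has two parts. The inner product with v is bounded by the
  norm of the logarithmic gradient on clusters meeting the support of v, as in (A4); the divergence
  part is bounded by the number of points in the support, as in (A2).\<close>

lemma log_deriv_along_theta:
  assumes v: "v \<in> Vect0 X"
  shows "(\<integral>\<^sup>+x. mean_log_deriv v x \<partial>\<theta>) < \<infinity>"
proof -
  obtain K where K: "compact K" "\<And>x. x \<notin> K \<Longrightarrow> v x = (\<lambda>_. 0)" using v by (auto simp: Vect0_def)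
  have Kc: "closed K" by (rule compact_imp_closed[OF K(1)])
  have tn0: "tangent_norm X x (v x) = 0" if "x \<notin> K" for x
    using tangent_scale_0[OF UNIV_I zero_tangent] by (simp add: tangent_norm_def K(2)[OF that])
  obtain C0 where C0: "C0 \<ge> 0" "\<And>x. norm (tangent_norm X x (v x)) \<le> C0"
    by (rule compact_support_bound[OF continuous_tangent_norm[OF v] K(1) tn0]) blast+
  obtain C2 where C2: "C2 \<ge> 0" "\<And>x. norm (divergence X v x) \<le> C2"
    by (rule compact_support_bound[OF continuous_divergence[OF v] K(1) divergence_outside[OF v Kc K(2)]]) blast+
  define C where "C = C0 + 1"
  have C: "C > 0" "\<And>x. tangent_norm X x (v x) \<le> C"
    using C0(1) order_trans[OF abs_ge_self C0(2)[unfolded real_norm_def]] by (auto simp: C_def intro: add_increasing2)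
  define a where "a z = (\<Sum>i<fst (snd z). 1 / h (fst z) (snd z) * coord_deriv v i z)" for z
  have am: "a \<in> borel_measurable mborel" using measurable_inner_part[OF v] unfolding a_def[abs_def]
    by (simp only: measurable_cong_marked)
  \<comment> \<open>The constant is divided out on the measurable side, so that monotonicity of the
    integral alone brings in (A4) and no measurability of \<open>log_gradient_norm1\<close> has to
    be shown. Adding 1 to C0 makes the divisor positive.\<close>
  have aC: "(\<lambda>z. ennreal (\<bar>a z\<bar> / C)) \<in> borel_measurable mborel" using am by measurable
  have "(\<integral>\<^sup>+z. ennreal (\<bar>a z\<bar> / C) \<partial>sigma_hat \<theta> \<eta>) \<le>
      (\<integral>\<^sup>+z\<in>marked_meeting K. ennreal (log_gradient_norm1 X (h (fst z)) (snd z)) \<partial>sigma_hat \<theta> \<eta>)"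
  proof (rule nn_integral_mono)
    fix z assume z: "z \<in> space (sigma_hat \<theta> \<eta>)"
    have "sets (sigma_hat \<theta> \<eta>) = sets (mborel :: 'x marked measure)" unfolding sigma_hat_def by (rule sets_bind) auto
    then have "space (sigma_hat \<theta> \<eta>) = space (mborel :: 'x marked measure)" by (rule sets_eq_imp_space_eq)
    then have "snd z \<in> clusters" using z by (simp only: space_borel_of topspace_marked mem_Times_iff)
    from inner_part_bound[OF v this K(2) C(2), where x = "fst z"]
    have "\<bar>a z\<bar> / C \<le> log_gradient_norm1 X (h (fst z)) (snd z) * indicator (clusters_meeting K) (snd z)"
      using C(1) by (simp add: a_def divide_le_eq mult.commute)
    then have "ennreal (\<bar>a z\<bar> / C) \<le> ennreal (log_gradient_norm1 X (h (fst z)) (snd z) * indicator (clusters_meeting K) (snd z))"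
      by (rule ennreal_leI)
    also have "\<dots> = ennreal (log_gradient_norm1 X (h (fst z)) (snd z)) * indicator (marked_meeting K) z"
      by (cases z) (auto simp: marked_meeting_def split: split_indicator)
    finally show "ennreal (\<bar>a z\<bar> / C) \<le> ennreal (log_gradient_norm1 X (h (fst z)) (snd z)) * indicator (marked_meeting K) z" .
  qed
  also note A4[OF K(1)]
  finally have fa: "(\<integral>\<^sup>+x. \<integral>\<^sup>+ys. ennreal (\<bar>a (x, ys)\<bar> / C) \<partial>\<eta> x \<partial>\<theta>) < \<infinity>" unfolding nn_integral_sigma_hat[OF aC] .
  have le: "mean_log_deriv v x \<le>
      ennreal C * (\<integral>\<^sup>+ys. ennreal (\<bar>a (x, ys)\<bar> / C) \<partial>\<eta> x) + ennreal C2 * mean_hits K x" for x proof -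
    have m1: "(\<lambda>ys. ennreal (\<bar>a (x, ys)\<bar> / C)) \<in> borel_measurable (\<eta> x)"
      using measurable_section[OF aC, of x] by (simp only: measurable_cong_eta)
    have "(\<lambda>ys. count_in K ys :: ennreal) \<in> borel_measurable cborel" using Kc by (intro measurable_cluster_sum) simp
    then have m2: "(\<lambda>ys. count_in K ys :: ennreal) \<in> borel_measurable (\<eta> x)" by (simp only: measurable_cong_eta)
    have "mean_log_deriv v x \<le>
        (\<integral>\<^sup>+ys. ennreal C * ennreal (\<bar>a (x, ys)\<bar> / C) + ennreal C2 * count_in K ys \<partial>\<eta> x)" proof (rule nn_integral_mono)
      fix ys assume "ys \<in> space (\<eta> x)"
      then have ys: "ys \<in> clusters" by simp
      have "\<bar>log_deriv v (x, ys)\<bar> \<le> \<bar>a (x, ys)\<bar> + norm (cluster_sum (divergence X v) ys)"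
        unfolding log_deriv_along_eq[OF v ys] by (simp add: a_def cluster_sum_def abs_triangle_ineq)
      also have "\<dots> \<le> C * (\<bar>a (x, ys)\<bar> / C) + C2 * count_in K ys"
        using norm_cluster_sum_le[of "divergence X v" C2 K ys] C2(2) divergence_outside[OF v Kc K(2)] C(1) by simp
      finally have "ennreal \<bar>log_deriv v (x, ys)\<bar> \<le> ennreal (C * (\<bar>a (x, ys)\<bar> / C) + C2 * count_in K ys)"
        by (rule ennreal_leI)
      also have "\<dots> = ennreal (C * (\<bar>a (x, ys)\<bar> / C)) + ennreal (C2 * count_in K ys)"
        using C(1) C2(1) by (intro ennreal_plus) (simp_all add: cluster_sum_def sum_nonneg)
      also have "\<dots> = ennreal C * ennreal (\<bar>a (x, ys)\<bar> / C) + ennreal C2 * count_in K ys"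
        unfolding ennreal_cluster_sum_indicator[symmetric]
        using C(1) C2(1) by (intro arg_cong2[where f = "(+)"] ennreal_mult) (simp_all add: cluster_sum_def sum_nonneg)
      finally show "ennreal \<bar>log_deriv v (x, ys)\<bar> \<le> ennreal C * ennreal (\<bar>a (x, ys)\<bar> / C) + ennreal C2 * count_in K ys" . qed
    also have "\<dots> = ennreal C * (\<integral>\<^sup>+ys. ennreal (\<bar>a (x, ys)\<bar> / C) \<partial>\<eta> x) + ennreal C2 * mean_hits K x"
      unfolding mean_hits_def using m1 m2 by (simp add: nn_integral_add nn_integral_cmult)
    finally show ?thesis .
  qed
  have i1: "(\<lambda>x. \<integral>\<^sup>+ys. ennreal (\<bar>a (x, ys)\<bar> / C) \<partial>\<eta> x) \<in> borel_measurable \<theta>"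
    using measurable_eta_integral[OF aC] by (simp only: measurable_cong_sets[OF sets_theta refl])
  have i2: "mean_hits K \<in> borel_measurable \<theta>"
    using measurable_mean_hits[of K] Kc by (simp add: measurable_cong_sets[OF sets_theta refl])
  have "(\<integral>\<^sup>+x. mean_log_deriv v x \<partial>\<theta>) \<le>
      (\<integral>\<^sup>+x. ennreal C * (\<integral>\<^sup>+ys. ennreal (\<bar>a (x, ys)\<bar> / C) \<partial>\<eta> x) + ennreal C2 * mean_hits K x \<partial>\<theta>)"
    by (intro nn_integral_mono le)
  also have "\<dots> = ennreal C * (\<integral>\<^sup>+x. \<integral>\<^sup>+ys. ennreal (\<bar>a (x, ys)\<bar> / C) \<partial>\<eta> x \<partial>\<theta>) + ennreal C2 * (\<integral>\<^sup>+x. mean_hits K x \<partial>\<theta>)"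
    using i1 i2 by (simp add: nn_integral_add nn_integral_cmult)
  also have "\<dots> < \<infinity>" using fa mean_hits_theta[OF K(1)] by (simp add: ennreal_mult_less_top)
  finally show ?thesis .
qed

lemma measurable_log_deriv:
  "v \<in> Vect0 X \<Longrightarrow> log_deriv v \<in> borel_measurable mborel"
  using measurable_log_deriv_along by (simp only: measurable_cong_marked)

lemma B_hat_eq_integral:
  assumes "v \<in> Vect0 X" "proper_marked \<gamma>'"
  shows "B_hat X h v \<gamma>' = (\<integral>z. log_deriv v z \<partial>\<gamma>')"
  using CZ.pairing_eq_integral(1)[OF assms(2) measurable_log_deriv[OF assms(1)]]
  by (simp add: B_hat_def pairing_def)

text \<open>Campbell's formula bounds the expectation by that of the integral of
  \<open>mean_log_deriv v\<close> against the centres, to which \<open>M1_finite\<close>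
  applies.\<close>

lemma integrable_B_hat:
  assumes v: "v \<in> Vect0 X"
  and fin: "(\<integral>\<^sup>+x. mean_log_deriv v x \<partial>\<theta>) < \<infinity>"
  shows "integrable \<mu>h (B_hat X h v)"
proof (rule integrableI_bounded)
  let ?\<beta> = "log_deriv v"
  note bm = measurable_log_deriv[OF v]
  have abm: "(\<lambda>z. ennreal \<bar>?\<beta> z\<bar>) \<in> borel_measurable mborel" using bm by measurable
  have "(\<lambda>\<gamma>'. \<integral>z. ?\<beta> z \<partial>\<gamma>') \<in> borel_measurable (Proper_Config marked_top)" by (rule CZ.measurable_integral_Proper[OF bm])
  then have "B_hat X h v \<in> borel_measurable (Proper_Config marked_top)"
    by (rule measurable_cong[THEN iffD2, rotated]) (simp add: CZ.space_Proper_Config B_hat_eq_integral[OF v])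
  then show "B_hat X h v \<in> borel_measurable \<mu>h" by (simp only: measurable_cong_mu_hat)
  have "(\<integral>\<^sup>+\<gamma>'. ennreal (norm (B_hat X h v \<gamma>')) \<partial>\<mu>h) \<le> (\<integral>\<^sup>+\<gamma>'. \<integral>\<^sup>+z. ennreal \<bar>?\<beta> z\<bar> \<partial>\<gamma>' \<partial>\<mu>h)"
  proof (rule nn_integral_mono)
    fix \<gamma>' assume "\<gamma>' \<in> space \<mu>h"
    then have \<gamma>': "proper_marked \<gamma>'" by (simp add: space_mu_hat)
    show "ennreal (norm (B_hat X h v \<gamma>')) \<le> (\<integral>\<^sup>+z. ennreal \<bar>?\<beta> z\<bar> \<partial>\<gamma>')"
    proof (cases "integrable \<gamma>' ?\<beta>")
      case True
      then show ?thesis unfolding B_hat_eq_integral[OF v \<gamma>'] using integral_norm_bound_ennreal[of \<gamma>' ?\<beta>] by simp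
    next
      case False
      then show ?thesis unfolding B_hat_eq_integral[OF v \<gamma>'] by (simp add: not_integrable_integral_eq)
    qed
  qed
  also have "\<dots> = (\<integral>\<^sup>+\<gamma>. \<integral>\<^sup>+x. mean_log_deriv v x \<partial>\<gamma> \<partial>\<mu>)" by (rule campbell[OF abm])
  also have "\<dots> < \<infinity>" by (rule M1_finite[OF measurable_eta_integral[OF abm] fin])
  finally show "(\<integral>\<^sup>+\<gamma>'. ennreal (norm (B_hat X h v \<gamma>')) \<partial>\<mu>h) < \<infinity>" .
qed

text \<open>The map \<open>\<qq>\<close>, changed on a null set so that all its values are proper.\<close>

definition q_proper :: "'x marked measure \<Rightarrow> 'x measure" where
  "q_proper \<gamma>' = (if proper (q_map \<gamma>') then q_map \<gamma>' else config_of_set euclidean {})"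

lemma proper_empty: "proper (config_of_set euclidean ({} :: 'x set))"
  by (rule CX.proper_config_of_set) auto

lemma proper_q_proper [simp]: "proper (q_proper \<gamma>')"
  by (simp add: q_proper_def proper_empty)

lemma space_mu_cl: "space (mu_cl \<mu> \<eta>) = {\<gamma>. proper \<gamma>}"
  by (auto simp: mu_cl_def space_restrict_space CX.space_Config CX.space_Proper_Config dest: configD(1))

lemma measurable_q_proper: "q_proper \<in> measurable \<mu>h (mu_cl \<mu> \<eta>)"
proof -
  have pm: "Measurable.pred \<mu>h (\<lambda>\<gamma>'. proper (q_map \<gamma>' :: 'x measure))"
    using measurable_proper_q by (simp only: measurable_cong_mu_hat)
  have qm: "q_map \<in> measurable \<mu>h (Config (euclidean :: 'x topology))"
    using measurable_q_map by (simp only: measurable_cong_mu_hat)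
  have "q_proper \<in> measurable \<mu>h (Config euclidean)" unfolding q_proper_def[abs_def]
    using configD(1)[OF proper_empty]
    by (intro measurable_If qm measurable_const) (use pm in \<open>simp_all add: CX.space_Config pred_def\<close>)
  then have "q_proper \<in> measurable \<mu>h (distr \<mu>h (Config euclidean) q_map)" by simp
  then show ?thesis unfolding mu_cl_def by (intro measurable_restrict_space2) (auto simp: CX.space_Proper_Config)
qed

lemma measurable_mu_cl:
  assumes "f \<in> measurable (Proper_Config euclidean) N" shows "f \<in> measurable (mu_cl \<mu> \<eta>) N"
proof -
  have "(\<lambda>\<gamma>. \<gamma>) \<in> measurable (mu_cl \<mu> \<eta>) (Proper_Config (euclidean :: 'x topology))"
  proof (rule CX.measurable_into_Proper)
    show "(\<lambda>\<gamma>. \<gamma>) \<in> space (mu_cl \<mu> \<eta>) \<rightarrow> {\<gamma>. proper \<gamma>}" by (simp add: space_mu_cl)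
    show "(\<lambda>\<gamma>. emeasure \<gamma> A) \<in> borel_measurable (mu_cl \<mu> \<eta>)" if "A \<in> sets (borel_of (euclidean :: 'x topology))" for A
    proof -
      have "(\<lambda>\<gamma>. emeasure \<gamma> A) \<in> borel_measurable (distr \<mu>h (Config (euclidean :: 'x topology)) q_map)"
        using CX.measurable_emeasure_Config[OF that] by simp
      then show ?thesis unfolding mu_cl_def by (rule measurable_restrict_space1)
    qed
  qed
  then show ?thesis using assms by (rule measurable_compose)
qed

lemma AE_q_proper: "AE \<gamma>' in \<mu>h. q_proper \<gamma>' = q_map \<gamma>'"
  using AE_proper_q by eventually_elim (simp add: q_proper_def)

text \<open>Presents the cluster measure, defined as a restriction, as an image of
  \<open>mu_hat\<close>; integrals and densities can then be transported along
  \<open>q_proper\<close>.\<close>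

lemma mu_cl_distr: "mu_cl \<mu> \<eta> = distr \<mu>h (mu_cl \<mu> \<eta>) q_proper"
proof (rule measure_eqI)
  fix A assume A: "A \<in> sets (mu_cl \<mu> \<eta>)"
  let ?\<Omega> = "space (Proper_Config (euclidean :: 'x topology))"
  have qm: "q_map \<in> measurable \<mu>h (Config (euclidean :: 'x topology))"
    using measurable_q_map by (simp only: measurable_cong_mu_hat)
  have \<Omega>: "?\<Omega> \<inter> space (distr \<mu>h (Config euclidean) q_map) \<in> sets (distr \<mu>h (Config euclidean) q_map)"
    using measurable_proper by (auto simp: CX.space_Proper_Config)
  have A': "A \<in> sets (Config euclidean)" "A \<subseteq> ?\<Omega>" using A \<Omega> sets_restrict_space_iff[OF \<Omega>] by (auto simp: mu_cl_def)
  have "emeasure (mu_cl \<mu> \<eta>) A = emeasure (distr \<mu>h (Config euclidean) q_map) A"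
    unfolding mu_cl_def using A' by (intro emeasure_restrict_space[OF \<Omega>])
  also have "\<dots> = emeasure \<mu>h (q_map -` A \<inter> space \<mu>h)" by (rule emeasure_distr[OF qm A'(1)])
  also have "\<dots> = emeasure \<mu>h (q_proper -` A \<inter> space \<mu>h)"
  proof (rule emeasure_eq_AE)
    show "AE \<gamma>' in \<mu>h. \<gamma>' \<in> q_map -` A \<inter> space \<mu>h \<longleftrightarrow> \<gamma>' \<in> q_proper -` A \<inter> space \<mu>h" using AE_q_proper by eventually_elim simp
    show "q_map -` A \<inter> space \<mu>h \<in> sets \<mu>h" by (rule measurable_sets[OF qm A'(1)])
    show "q_proper -` A \<inter> space \<mu>h \<in> sets \<mu>h" by (rule measurable_sets[OF measurable_q_proper A])
  qed
  also have "\<dots> = emeasure (distr \<mu>h (mu_cl \<mu> \<eta>) q_proper) A" by (rule emeasure_distr[OF measurable_q_proper A, symmetric])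
  finally show "emeasure (mu_cl \<mu> \<eta>) A = emeasure (distr \<mu>h (mu_cl \<mu> \<eta>) q_proper) A" .
qed simp

lemma integral_q_proper:
  assumes F: "F \<in> borel_measurable (mu_cl \<mu> \<eta>)" and G: "G \<in> borel_measurable \<mu>h"
  shows "(\<integral>\<gamma>'. indicator (space (Proper_Config euclidean)) (q_map \<gamma>') * F (q_map \<gamma>') * G \<gamma>' \<partial>\<mu>h) =
    (\<integral>\<gamma>'. F (q_proper \<gamma>') * G \<gamma>' \<partial>\<mu>h :: real)" proof - let ?F = "\<lambda>\<gamma>'. if proper (q_map \<gamma>') then F (q_proper \<gamma>') * G \<gamma>' else 0"
  have pm: "Measurable.pred \<mu>h (\<lambda>\<gamma>'. proper (q_map \<gamma>' :: 'x measure))"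
    using measurable_proper_q by (simp only: measurable_cong_mu_hat)
  have Fq: "(\<lambda>\<gamma>'. F (q_proper \<gamma>') * G \<gamma>') \<in> borel_measurable \<mu>h"
    using measurable_compose[OF measurable_q_proper F] G by (rule borel_measurable_times)
  have "(\<integral>\<gamma>'. indicator (space (Proper_Config euclidean)) (q_map \<gamma>') * F (q_map \<gamma>') * G \<gamma>' \<partial>\<mu>h) = (\<integral>\<gamma>'. ?F \<gamma>' \<partial>\<mu>h)"
    by (intro lebesgue_cong) (simp add: q_proper_def CX.space_Proper_Config)
  also have "\<dots> = (\<integral>\<gamma>'. F (q_proper \<gamma>') * G \<gamma>' \<partial>\<mu>h)"
  proof (rule integral_cong_AE[OF _ Fq])
    show "?F \<in> borel_measurable \<mu>h" using pm by (intro measurable_If Fq) (auto simp: pred_def)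
    show "AE \<gamma>' in \<mu>h. ?F \<gamma>' = F (q_proper \<gamma>') * G \<gamma>'" using AE_proper_q by eventually_elim simp
  qed
  finally show ?thesis .
qed

text \<open>Gives the choice in \<open>q_adjoint\<close> its meaning. The pushed density along
  \<open>q_proper\<close> qualifies, because \<open>q_map\<close> differs from
  \<open>q_proper\<close> only on a null set.\<close>

lemma ex_q_adjoint:
  assumes G: "integrable \<mu>h G" shows "\<exists>H. is_q_adjoint \<mu> \<eta> G H"
proof -
  have "finite_measure \<mu>h" using prob_mu_hat by (rule prob_space.finite_measure)
  from ex_pushed_density[OF this measurable_q_proper G] obtain H where H: "integrable (mu_cl \<mu> \<eta>) H"
    "\<forall>F :: 'x measure \<Rightarrow> real. F \<in> borel_measurable (mu_cl \<mu> \<eta>) \<and> (\<exists>C. AE y in mu_cl \<mu> \<eta>. \<bar>F y\<bar> \<le> C) \<longrightarrow>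
      (\<integral>y. F y * H y \<partial>mu_cl \<mu> \<eta>) = (\<integral>x. F (q_proper x) * G x \<partial>\<mu>h)"
    unfolding mu_cl_distr[symmetric] by blast
  have "is_q_adjoint \<mu> \<eta> G H" unfolding is_q_adjoint_def
  proof (intro conjI allI impI H(1))
    fix F :: "'x measure \<Rightarrow> real" assume F: "F \<in> borel_measurable (mu_cl \<mu> \<eta>) \<and> (\<exists>C. AE \<gamma> in mu_cl \<mu> \<eta>. \<bar>F \<gamma>\<bar> \<le> C)"
    show "(\<integral>\<gamma>. F \<gamma> * H \<gamma> \<partial>mu_cl \<mu> \<eta>) =
        (\<integral>\<gamma>'. indicator (space (Proper_Config euclidean)) (q_map \<gamma>') * F (q_map \<gamma>') * G \<gamma>' \<partial>\<mu>h)"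
      unfolding integral_q_proper[OF conjunct1[OF F] borel_measurable_integrable[OF G]] by (rule H(2)[rule_format, OF F])
  qed
  then show ?thesis by blast
qed

lemma is_q_adjoint_integral:
  assumes H: "is_q_adjoint \<mu> \<eta> G H" and F: "F \<in> borel_measurable (mu_cl \<mu> \<eta>)" "\<And>\<gamma>. \<bar>F \<gamma>\<bar> \<le> C"
  and G: "integrable \<mu>h G"
  shows "(\<integral>\<gamma>. F \<gamma> * H \<gamma> \<partial>mu_cl \<mu> \<eta>) = (\<integral>\<gamma>'. F (q_proper \<gamma>') * G \<gamma>' \<partial>\<mu>h)"
  unfolding integral_q_proper[OF F(1) borel_measurable_integrable[OF G], symmetric]
  using H F unfolding is_q_adjoint_def by blast

section \<open>Integrals against the cluster configuration\<close>

lemma integral_q_mark_nonneg: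
  fixes \<psi> :: "'x \<Rightarrow> real"
  assumes \<gamma>: "proper \<gamma>" and \<omega>: "\<omega> \<in> space (marks \<gamma>)"
    and \<psi>: "\<psi> \<in> borel_measurable borel" "\<And>x. 0 \<le> \<psi> x"
  shows "(\<integral>x. \<psi> x \<partial>q_map (marked \<gamma> \<omega>)) = (\<integral>x. cluster_sum \<psi> (\<omega> x) \<partial>count_pts \<gamma>)"
proof -
  have pm: "\<psi> \<in> borel_measurable (q_map (marked \<gamma> \<omega>))"
    using \<psi>(1) by (simp only: measurable_cong_sets[OF sets_q_map refl])
  have em: "(\<lambda>x. ennreal (\<psi> x)) \<in> borel_measurable borel" using \<psi>(1) by measurable
  have cs: "cluster_sum (\<lambda>x. ennreal (\<psi> x)) ys = ennreal (cluster_sum \<psi> ys)" for ys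
    unfolding cluster_sum_def using \<psi>(2) by (simp add: sum_ennreal)
  have "(\<integral>x. \<psi> x \<partial>q_map (marked \<gamma> \<omega>)) = enn2real (\<integral>\<^sup>+x. ennreal (\<psi> x) \<partial>q_map (marked \<gamma> \<omega>))"
    using pm \<psi>(2) by (intro integral_eq_nn_integral) auto
  also have "(\<integral>\<^sup>+x. ennreal (\<psi> x) \<partial>q_map (marked \<gamma> \<omega>)) =
      (\<integral>\<^sup>+z. cluster_sum (\<lambda>x. ennreal (\<psi> x)) (snd z) \<partial>marked \<gamma> \<omega>)"
    by (rule nn_integral_q_map[OF proper_mark_config[OF \<gamma> \<omega>] em])
  also have "\<dots> = (\<integral>\<^sup>+x. cluster_sum (\<lambda>x. ennreal (\<psi> x)) (\<omega> x) \<partial>count_pts \<gamma>)"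
    using nn_integral_mark_config[OF \<gamma> \<omega> measurable_sum_snd[OF em]] by simp
  also have "enn2real \<dots> = (\<integral>x. cluster_sum \<psi> (\<omega> x) \<partial>count_pts \<gamma>)"
    unfolding cs using \<psi>(2) by (intro integral_eq_nn_integral[symmetric]) (auto simp: cluster_sum_def sum_nonneg)
  finally show ?thesis .
qed

text \<open>Integrals against \<open>q_map\<close> are known first for nonnegative functions.
  Splitting \<phi> into positive and negative parts is allowed because the image is proper and
  \<phi> has compact support, so all four integrals are finite.\<close>

lemma integral_q_mark:
  assumes \<gamma>: "proper \<gamma>" and \<omega>: "\<omega> \<in> space (marks \<gamma>)"
  and q: "proper (q_map (marked \<gamma> \<omega>))"
    and \<phi>: "continuous_on UNIV (\<phi> :: 'x \<Rightarrow> real)" and K: "compact K" "\<And>x. x \<notin> K \<Longrightarrow> \<phi> x = 0"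
  and hits: "(\<integral>\<^sup>+x. count_in K (\<omega> x) \<partial>count_pts \<gamma>) < \<infinity>"
  shows "(\<integral>x. \<phi> x \<partial>q_map (marked \<gamma> \<omega>)) = (\<integral>x. cluster_sum \<phi> (\<omega> x) \<partial>count_pts \<gamma>)"
proof -
  let ?q = "q_map (marked \<gamma> \<omega>)" and ?C = "count_pts \<gamma>"
  let ?p = "\<lambda>x. max 0 (\<phi> x)" and ?n = "\<lambda>x. max 0 (- \<phi> x)"
  have c: "continuous_on UNIV ?p" "continuous_on UNIV ?n" using \<phi> by (auto intro!: continuous_intros)
  have z: "?p x = 0" "?n x = 0" if "x \<notin> K" for x using K(2)[OF that] by auto
  have i: "integrable ?q ?p" "integrable ?q ?n"
    by (rule integrable_test_map[OF q c(1) K(1) z(1)], assumption, rule integrable_test_map[OF q c(2) K(1) z(2)], assumption)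
  obtain C1 where C1: "\<And>x. norm (?p x) \<le> C1" by (rule compact_support_bound[OF c(1) K(1) z(1)]) blast+
  obtain C2 where C2: "\<And>x. norm (?n x) \<le> C2" by (rule compact_support_bound[OF c(2) K(1) z(2)]) blast+
  have j: "integrable ?C (\<lambda>x. cluster_sum ?p (\<omega> x))" "integrable ?C (\<lambda>x. cluster_sum ?n (\<omega> x))"
    by (rule integrable_cluster_sum[OF C1 z(1) hits], assumption, rule integrable_cluster_sum[OF C2 z(2) hits], assumption)
  have "(\<integral>x. \<phi> x \<partial>?q) = (\<integral>x. ?p x - ?n x \<partial>?q)" by (intro lebesgue_cong) auto
  also have "\<dots> = (\<integral>x. ?p x \<partial>?q) - (\<integral>x. ?n x \<partial>?q)" by (rule Bochner_Integration.integral_diff[OF i])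
  also have "\<dots> = (\<integral>x. cluster_sum ?p (\<omega> x) \<partial>?C) - (\<integral>x. cluster_sum ?n (\<omega> x) \<partial>?C)"
    using c by (intro arg_cong2[where f = "(-)"] integral_q_mark_nonneg[OF \<gamma> \<omega>] measurable_continuous) auto
  also have "\<dots> = (\<integral>x. cluster_sum ?p (\<omega> x) - cluster_sum ?n (\<omega> x) \<partial>?C)"
    by (rule Bochner_Integration.integral_diff[OF j, symmetric])
  also have "\<dots> = (\<integral>x. cluster_sum \<phi> (\<omega> x) \<partial>?C)" unfolding cluster_sum_def sum_subtractf[symmetric]
    by (intro Bochner_Integration.integral_cong sum.cong refl) auto
  finally show ?thesis .
qed

lemma integral_vec_q_mark:
  assumes \<gamma>: "proper \<gamma>" and \<omega>: "\<omega> \<in> space (marks \<gamma>)"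
  and q: "proper (q_map (marked \<gamma> \<omega>))"
    and \<Phi>: "continuous_on UNIV (\<Phi> :: 'x \<Rightarrow> real ^ 'k::finite)" and K: "compact K" "\<And>x. x \<notin> K \<Longrightarrow> \<Phi> x = 0"
  and hits: "(\<integral>\<^sup>+x. count_in K (\<omega> x) \<partial>count_pts \<gamma>) < \<infinity>"
  shows "(\<integral>x. \<Phi> x \<partial>q_map (marked \<gamma> \<omega>)) = (\<integral>x. cluster_sum \<Phi> (\<omega> x) \<partial>count_pts \<gamma>)"
proof (rule vec_eq_iff[THEN iffD2], intro allI)
  fix k
  let ?C = "count_pts \<gamma>"
  obtain C1 where C1: "\<And>x. norm (\<Phi> x) \<le> C1" by (rule compact_support_bound[OF \<Phi> K]) blast+
  have j: "integrable ?C (\<lambda>x. cluster_sum \<Phi> (\<omega> x))" by (rule integrable_cluster_sum[OF C1 K(2) hits])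
  have "(\<integral>x. \<Phi> x \<partial>q_map (marked \<gamma> \<omega>)) $ k = (\<integral>x. \<Phi> x $ k \<partial>q_map (marked \<gamma> \<omega>))"
    by (rule integral_bounded_linear[OF bounded_linear_vec_nth integrable_test_map[OF q \<Phi> K], symmetric])
  also have "\<dots> = (\<integral>x. cluster_sum (\<lambda>x. \<Phi> x $ k) (\<omega> x) \<partial>?C)"
    by (rule integral_q_mark[OF \<gamma> \<omega> q continuous_on_component[OF \<Phi>] K(1) _ hits]) (simp add: K(2))
  also have "\<dots> = (\<integral>x. cluster_sum \<Phi> (\<omega> x) $ k \<partial>?C)" by (simp add: cluster_sum_def)
  also have "\<dots> = (\<integral>x. cluster_sum \<Phi> (\<omega> x) \<partial>?C) $ k" by (rule integral_bounded_linear[OF bounded_linear_vec_nth j])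
  finally show "(\<integral>x. \<Phi> x \<partial>q_map (marked \<gamma> \<omega>)) $ k = (\<integral>x. cluster_sum \<Phi> (\<omega> x) \<partial>?C) $ k" .
qed

text \<open>For almost every \<gamma> the positive and the negative part of W have the same integral
  over the marks, so they also have the same integral over \<open>mu_hat\<close>. If W is not
  integrable, its integral is zero by convention.\<close>

lemma integral_mu_hat_0:
  fixes W :: "_ \<Rightarrow> real"
  assumes W: "W \<in> borel_measurable (Proper_Config marked_top)"
  and z: "AE \<gamma> in \<mu>. integrable (marks \<gamma>) (\<lambda>\<omega>. W (marked \<gamma> \<omega>)) \<and> (\<integral>\<omega>. W (marked \<gamma> \<omega>) \<partial>marks \<gamma>) = 0"
  shows "(\<integral>\<gamma>'. W \<gamma>' \<partial>\<mu>h) = 0"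
proof (cases "integrable \<mu>h W")
  case True
  have "(\<integral>\<^sup>+\<gamma>'. ennreal (W \<gamma>') \<partial>\<mu>h) = (\<integral>\<^sup>+\<gamma>. \<integral>\<^sup>+\<omega>. ennreal (W (marked \<gamma> \<omega>)) \<partial>marks \<gamma> \<partial>\<mu>)"
    using W by (intro nn_integral_mu_hat) measurable
  also have "\<dots> = (\<integral>\<^sup>+\<gamma>. \<integral>\<^sup>+\<omega>. ennreal (- W (marked \<gamma> \<omega>)) \<partial>marks \<gamma> \<partial>\<mu>)"
  proof (rule nn_integral_cong_AE)
    show "AE \<gamma> in \<mu>. (\<integral>\<^sup>+\<omega>. ennreal (W (marked \<gamma> \<omega>)) \<partial>marks \<gamma>) = (\<integral>\<^sup>+\<omega>. ennreal (- W (marked \<gamma> \<omega>)) \<partial>marks \<gamma>)"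
      using z
    proof eventually_elim
      case (elim \<gamma>)
      then have i: "integrable (marks \<gamma>) (\<lambda>\<omega>. W (marked \<gamma> \<omega>))" by blast
      show ?case using elim real_lebesgue_integral_def[OF i] i[unfolded real_integrable_def]
        by (metis diff_eq_eq add_0 ennreal_enn2real_if infinity_ennreal_def)
    qed
  qed
  also have "\<dots> = (\<integral>\<^sup>+\<gamma>'. ennreal (- W \<gamma>') \<partial>\<mu>h)" using W by (intro nn_integral_mu_hat[symmetric]) measurable
  finally show ?thesis using real_lebesgue_integral_def[OF True] by simp
qed (simp add: not_integrable_integral_eq)

theorem integration_by_parts:
  fixes f :: "real ^ 'k::finite \<Rightarrow> real"
  assumes f: "f \<in> Cb_inf" and \<Phi>: "test_map \<Phi>" and v: "v \<in> Vect0 X"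
  defines "F \<equiv> cylinder f \<Phi>"
  shows "integrable \<mu>h (B_hat X h v)" "is_q_adjoint \<mu> \<eta> (B_hat X h v) (B_cl X \<mu> \<eta> h v)"
  and "integrable (mu_cl \<mu> \<eta>) (\<lambda>\<gamma>. \<Sum>\<^sub>\<infinity>x\<in>pts \<gamma>. Metric X x (config_gradient X F \<gamma> x) (v x))"
  and "(\<integral>\<gamma>. (\<Sum>\<^sub>\<infinity>x\<in>pts \<gamma>. Metric X x (config_gradient X F \<gamma> x) (v x)) \<partial>mu_cl \<mu> \<eta>) =
      - (\<integral>\<gamma>. F \<gamma> * B_cl X \<mu> \<eta> h v \<gamma> \<partial>mu_cl \<mu> \<eta>)" proof - let ?\<beta> = "log_deriv v" and ?M = "mu_cl \<mu> \<eta>"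
  let ?grad = "\<lambda>\<gamma>. \<Sum>\<^sub>\<infinity>x\<in>pts \<gamma>. Metric X x (config_gradient X F \<gamma> x) (v x)"
  have bfin: "(\<integral>\<^sup>+x. mean_log_deriv v x \<partial>\<theta>) < \<infinity>" by (rule log_deriv_along_theta[OF v])
  show B: "integrable \<mu>h (B_hat X h v)" by (rule integrable_B_hat[OF v bfin])
  show adj: "is_q_adjoint \<mu> \<eta> (B_hat X h v) (B_cl X \<mu> \<eta> h v)"
    unfolding B_cl_def q_adjoint_def by (rule someI_ex[OF ex_q_adjoint[OF B]])
  obtain K1 where K1: "compact K1" "\<And>x. x \<notin> K1 \<Longrightarrow> v x = (\<lambda>_. 0)" using v by (auto simp: Vect0_def)
  obtain K2 where K2: "compact K2" "\<And>x. x \<notin> K2 \<Longrightarrow> \<Phi> x = 0" by (rule test_map_support[OF \<Phi>]) blast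
  \<comment> \<open>One compact set for the supports of the field and of all test functions.\<close>
  define K where "K = K1 \<union> K2"
  have K: "compact K" "\<And>x. x \<notin> K \<Longrightarrow> v x = (\<lambda>_. 0)" "\<And>x. x \<notin> K \<Longrightarrow> \<Phi> x = 0" using K1 K2 by (auto simp: K_def)
  have Kb: "K \<in> sets borel" using compact_imp_closed[OF K(1)] by simp
  note pc = test_map_continuous[OF \<Phi>] and dc = field_deriv_continuous[OF \<Phi> v]
  have out: "field_deriv v \<Phi> x = 0" if "x \<notin> K" for x using that by (intro field_deriv_outside \<Phi> K(2))
  obtain C where C: "C \<ge> 0" "\<And>p. \<bar>f p\<bar> \<le> C" using Cb_inf_bound[OF f] by blast
  obtain C' where C': "C' \<ge> 0" "\<And>p w. \<bar>fderiv f p w\<bar> \<le> C' * norm w" using Cb_inf_deriv_bound[OF f] by blast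
  obtain C2 where C2: "C2 \<ge> 0" "\<And>x. norm (field_deriv v \<Phi> x) \<le> C2" by (rule compact_support_bound[OF dc K(1) out]) blast+
  \<comment> \<open>D and E agree with the sum of gradients and with F on proper configurations.
    Being built from integrals of continuous compactly supported maps, they are visibly
    measurable.\<close>
  define D where "D \<gamma> = fderiv f (\<integral>x. \<Phi> x \<partial>\<gamma>) (\<integral>x. field_deriv v \<Phi> x \<partial>\<gamma>)" for \<gamma>
  define E where "E \<gamma> = f (\<integral>x. \<Phi> x \<partial>\<gamma>)" for \<gamma>
  have grad: "?grad \<gamma> = D \<gamma>" if "proper \<gamma>" for \<gamma> unfolding F_def D_def by (rule cylinder_divergence[OF that f \<Phi> v K])
  have FE: "F \<gamma> = E \<gamma>" if "proper \<gamma>" for \<gamma> unfolding F_def E_def by (rule arg_cong[OF pairing_test_map[OF that pc K(1,3)]])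
  have I1: "(\<lambda>\<gamma>. \<integral>x. \<Phi> x \<partial>\<gamma>) \<in> borel_measurable (Proper_Config euclidean)"
    by (rule measurable_integral_test_map[OF pc K(1,3)])
  have I2: "(\<lambda>\<gamma>. \<integral>x. field_deriv v \<Phi> x \<partial>\<gamma>) \<in> borel_measurable (Proper_Config euclidean)"
    by (rule measurable_integral_test_map[OF dc K(1) out])
  have Dm: "D \<in> borel_measurable ?M" unfolding D_def[abs_def] by (intro measurable_mu_cl measurable_Cb_inf_deriv[OF f] I1 I2)
  have Em: "E \<in> borel_measurable ?M" unfolding E_def[abs_def]
    by (intro measurable_mu_cl measurable_compose[OF I1 measurable_continuous[OF Cb_inf_continuous[OF f]]])
  have Dq: "(\<lambda>\<gamma>'. D (q_proper \<gamma>')) \<in> borel_measurable \<mu>h" and Eq: "(\<lambda>\<gamma>'. E (q_proper \<gamma>')) \<in> borel_measurable \<mu>h"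
    by (rule measurable_compose[OF measurable_q_proper Dm], rule measurable_compose[OF measurable_q_proper Em])
  \<comment> \<open>Bounds D by the number of points in K, whose expectation Campbell's formula and
    (A2) make finite.\<close>
  have D_le: "ennreal \<bar>D \<gamma>\<bar> \<le> ennreal (C' * C2) * emeasure \<gamma> K" if \<gamma>: "proper \<gamma>" for \<gamma>
  proof -
    have s: "sets \<gamma> = sets borel" using sets_configuration[OF configD(1)[OF \<gamma>]] by simp
    have "ennreal \<bar>D \<gamma>\<bar> \<le> ennreal (C' * norm (\<integral>x. field_deriv v \<Phi> x \<partial>\<gamma>))" unfolding D_def by (intro ennreal_leI C')
    also have "\<dots> = ennreal C' * ennreal (norm (\<integral>x. field_deriv v \<Phi> x \<partial>\<gamma>))" by (rule ennreal_mult) (simp_all add: C')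
    also have "\<dots> \<le> ennreal C' * (\<integral>\<^sup>+x. ennreal (norm (field_deriv v \<Phi> x)) \<partial>\<gamma>)"
      by (intro mult_left_mono integral_norm_bound_ennreal integrable_test_map[OF \<gamma> dc K(1) out]) auto
    also have "\<dots> \<le> ennreal C' * (\<integral>\<^sup>+x. ennreal C2 * indicator K x \<partial>\<gamma>)"
    proof (intro mult_left_mono nn_integral_mono)
      show "ennreal (norm (field_deriv v \<Phi> x)) \<le> ennreal C2 * indicator K x" for x
        using C2 out[of x] by (cases "x \<in> K") (auto intro: ennreal_leI)
    qed simp
    also have "\<dots> = ennreal (C' * C2) * emeasure \<gamma> K"
      using Kb s C'(1) C2(1) by (simp add: nn_integral_cmult ennreal_mult mult.assoc)
    finally show ?thesis .
  qed
  have Di: "integrable \<mu>h (\<lambda>\<gamma>'. D (q_proper \<gamma>'))"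
  proof (rule integrableI_bounded[OF Dq])
    have cm: "(\<lambda>z. count_in K (snd z) :: ennreal) \<in> borel_measurable (mborel :: 'x marked measure)"
      using Kb by (intro measurable_sum_snd) simp
    have "(\<integral>\<^sup>+\<gamma>'. ennreal (norm (D (q_proper \<gamma>'))) \<partial>\<mu>h) \<le> (\<integral>\<^sup>+\<gamma>'. ennreal (C' * C2) * (\<integral>\<^sup>+z. count_in K (snd z) \<partial>\<gamma>') \<partial>\<mu>h)"
    proof (rule nn_integral_mono_AE)
      show "AE \<gamma>' in \<mu>h. ennreal (norm (D (q_proper \<gamma>'))) \<le> ennreal (C' * C2) * (\<integral>\<^sup>+z. count_in K (snd z) \<partial>\<gamma>')"
        using AE_q_proper AE_space
      proof eventually_elim
        case (elim \<gamma>')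
        then have "proper_marked \<gamma>'" by (simp add: space_mu_hat)
        from emeasure_q_map[OF this Kb] show ?case using D_le[OF proper_q_proper, of \<gamma>'] elim(1) by simp
      qed
    qed
    also have "\<dots> = ennreal (C' * C2) * (\<integral>\<^sup>+\<gamma>'. \<integral>\<^sup>+z. count_in K (snd z) \<partial>\<gamma>' \<partial>\<mu>h)"
      using CZ.measurable_nn_integral_Proper[OF cm] by (intro nn_integral_cmult) (simp only: measurable_cong_mu_hat)
    also have "(\<integral>\<^sup>+\<gamma>'. \<integral>\<^sup>+z. count_in K (snd z) \<partial>\<gamma>' \<partial>\<mu>h) = (\<integral>\<^sup>+\<gamma>. \<integral>\<^sup>+x. mean_hits K x \<partial>\<gamma> \<partial>\<mu>)"
      using campbell[OF cm] by (simp add: mean_hits_def)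
    also have "ennreal (C' * C2) * \<dots> < \<infinity>"
      using M1_finite[OF measurable_mean_hits[OF Kb] mean_hits_theta[OF K(1)]] by (simp add: ennreal_mult_less_top)
    finally show "(\<integral>\<^sup>+\<gamma>'. ennreal (norm (D (q_proper \<gamma>'))) \<partial>\<mu>h) < \<infinity>" .
  qed
  have Dcl: "integrable ?M D" "(\<integral>\<gamma>. D \<gamma> \<partial>?M) = (\<integral>\<gamma>'. D (q_proper \<gamma>') \<partial>\<mu>h)"
  proof -
    show "integrable ?M D" by (subst mu_cl_distr) (simp add: integrable_distr_eq[OF measurable_q_proper Dm] Di)
    show "(\<integral>\<gamma>. D \<gamma> \<partial>?M) = (\<integral>\<gamma>'. D (q_proper \<gamma>') \<partial>\<mu>h)" by (subst mu_cl_distr) (rule integral_distr[OF measurable_q_proper Dm])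
  qed
  show "integrable ?M ?grad"
    by (rule Bochner_Integration.integrable_cong[THEN iffD2, OF refl _ Dcl(1)]) (simp add: space_mu_cl grad)
  have EBi: "integrable \<mu>h (\<lambda>\<gamma>'. E (q_proper \<gamma>') * B_hat X h v \<gamma>')"
  proof (rule Bochner_Integration.integrable_bound)
    show "integrable \<mu>h (\<lambda>\<gamma>'. C * B_hat X h v \<gamma>')" using B by simp
    show "(\<lambda>\<gamma>'. E (q_proper \<gamma>') * B_hat X h v \<gamma>') \<in> borel_measurable \<mu>h" using Eq B by simp
    show "AE \<gamma>' in \<mu>h. norm (E (q_proper \<gamma>') * B_hat X h v \<gamma>') \<le> norm (C * B_hat X h v \<gamma>')"
      using C by (intro AE_I2) (auto simp: abs_mult E_def intro!: mult_right_mono)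
  qed
  \<comment> \<open>The sum of the two integrands pulled back along \<open>q_proper\<close>. That
    its integral vanishes is the whole formula on the level of \<open>mu_hat\<close>.\<close>
  let ?W = "\<lambda>\<gamma>'. D (q_proper \<gamma>') + E (q_proper \<gamma>') * B_hat X h v \<gamma>'"
  have "(\<integral>\<gamma>'. ?W \<gamma>' \<partial>\<mu>h) = 0"
  proof (rule integral_mu_hat_0)
    have "?W \<in> borel_measurable \<mu>h" using Di EBi by simp
    then show "?W \<in> borel_measurable (Proper_Config marked_top)" by (simp only: measurable_cong_mu_hat)
    have abm: "(\<lambda>z. ennreal \<bar>?\<beta> z\<bar>) \<in> borel_measurable mborel"
      using measurable_log_deriv[OF v] by measurable
    show "AE \<gamma> in \<mu>. integrable (marks \<gamma>) (\<lambda>\<omega>. ?W (marked \<gamma> \<omega>)) \<and> (\<integral>\<omega>. ?W (marked \<gamma> \<omega>) \<partial>marks \<gamma>) = 0"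
      using AE_mean_hits[OF K(1)] AE_mu_finite[OF measurable_eta_integral[OF abm] bfin] AE_proper_q_marks AE_space
    proof eventually_elim
      case (elim \<gamma>)
      then have \<gamma>: "proper \<gamma>" by (simp add: space_mu)
      let ?I = "pts \<gamma>"
      have hits: "(\<integral>\<^sup>+x. mean_hits K x \<partial>count_space ?I) < \<infinity>"
        using elim(1) CX.nn_integral_proper[OF \<gamma>, of "mean_hits K"] measurable_mean_hits[OF Kb] by simp
      have bI: "(\<integral>\<^sup>+x. mean_log_deriv v x \<partial>count_space ?I) < \<infinity>"
        using elim(2) CX.nn_integral_proper[OF \<gamma>, of "\<lambda>x. mean_log_deriv v x"] measurable_eta_integral[OF abm] by simp
      let ?V = "\<lambda>\<omega>. fderiv f (\<integral>x. cluster_sum \<Phi> (\<omega> x) \<partial>count_space ?I)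
          (\<integral>x. cluster_sum (field_deriv v \<Phi>) (\<omega> x) \<partial>count_space ?I) +
        f (\<integral>x. cluster_sum \<Phi> (\<omega> x) \<partial>count_space ?I) * (\<integral>x. ?\<beta> (x, \<omega> x) \<partial>count_space ?I)"
      have ibp: "integrable (marks \<gamma>) ?V" "(\<integral>\<omega>. ?V \<omega> \<partial>marks \<gamma>) = 0"
        by (rule marks_integration_by_parts[OF countable_pts[OF \<gamma>] f \<Phi> v K hits bI]; assumption)+
      \<comment> \<open>For almost all marks the image is proper and K contains finitely many
        cluster points. Then integrals against the image are sums over the clusters, and
        \<open>?W\<close> takes the form handled by
        \<open>marks_integration_by_parts\<close>.\<close>
      have VW: "AE \<omega> in marks \<gamma>. ?V \<omega> = ?W (marked \<gamma> \<omega>)" using elim(3) AE_marks_hits[OF \<gamma> Kb elim(1)] AE_space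
      proof eventually_elim
        case (elim \<omega>)
        have q: "q_proper (marked \<gamma> \<omega>) = q_map (marked \<gamma> \<omega>)" using elim(1) by (simp add: q_proper_def)
        have e1: "(\<integral>x. \<Phi> x \<partial>q_map (marked \<gamma> \<omega>)) = (\<integral>x. cluster_sum \<Phi> (\<omega> x) \<partial>count_space ?I)"
          by (rule integral_vec_q_mark[OF \<gamma> elim(3) elim(1) pc K(1,3) elim(2)])
        have e2: "(\<integral>x. field_deriv v \<Phi> x \<partial>q_map (marked \<gamma> \<omega>)) =
            (\<integral>x. cluster_sum (field_deriv v \<Phi>) (\<omega> x) \<partial>count_space ?I)"
          by (rule integral_vec_q_mark[OF \<gamma> elim(3) elim(1) dc K(1) out elim(2)])
        show ?case unfolding q D_def E_def B_hat_eq_integral[OF v proper_mark_config[OF \<gamma> elim(3)]]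
            e1 e2
            integral_mark_config[OF \<gamma> elim(3) measurable_log_deriv[OF v]] ..
      qed
      have Wm: "(\<lambda>\<omega>. ?W (marked \<gamma> \<omega>)) \<in> borel_measurable (marks \<gamma>)"
        using \<open>?W \<in> borel_measurable (Proper_Config marked_top)\<close> by (rule measurable_compose[OF measurable_mark_config[OF \<gamma>]])
      have "integrable (marks \<gamma>) (\<lambda>\<omega>. ?W (marked \<gamma> \<omega>))"
        by (rule integrable_cong_AE_imp[OF ibp(1) Wm]) (use VW in eventually_elim, simp)
      moreover have "(\<integral>\<omega>. ?W (marked \<gamma> \<omega>) \<partial>marks \<gamma>) = (\<integral>\<omega>. ?V \<omega> \<partial>marks \<gamma>)"
        using ibp(1) Wm VW by (intro integral_cong_AE) (auto simp: eq_commute)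
      ultimately show ?case using ibp(2) by simp
    qed
  qed
  then have "(\<integral>\<gamma>'. D (q_proper \<gamma>') \<partial>\<mu>h) = - (\<integral>\<gamma>'. E (q_proper \<gamma>') * B_hat X h v \<gamma>' \<partial>\<mu>h)"
    using Bochner_Integration.integral_add[OF Di EBi] by simp
  moreover have "(\<integral>\<gamma>. ?grad \<gamma> \<partial>?M) = (\<integral>\<gamma>. D \<gamma> \<partial>?M)" by (intro lebesgue_cong) (simp add: space_mu_cl grad)
  moreover have "(\<integral>\<gamma>. F \<gamma> * B_cl X \<mu> \<eta> h v \<gamma> \<partial>?M) = (\<integral>\<gamma>. E \<gamma> * B_cl X \<mu> \<eta> h v \<gamma> \<partial>?M)"
    by (intro lebesgue_cong) (simp add: space_mu_cl FE)
  moreover have "(\<integral>\<gamma>. E \<gamma> * B_cl X \<mu> \<eta> h v \<gamma> \<partial>?M) = (\<integral>\<gamma>'. E (q_proper \<gamma>') * B_hat X h v \<gamma>' \<partial>\<mu>h)"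
    by (rule is_q_adjoint_integral[OF adj Em _ B, of C]) (simp add: E_def C)
  ultimately show "(\<integral>\<gamma>. ?grad \<gamma> \<partial>?M) = - (\<integral>\<gamma>. F \<gamma> * B_cl X \<mu> \<eta> h v \<gamma> \<partial>?M)" using Dcl(2) by simp
qed

end

theorem theorem4p10:
  fixes X :: "('x::{second_countable_topology,t2_space}, 'n::finite) riem"
    and \<mu> :: "'x measure measure"
    and \<eta> :: "'x \<Rightarrow> 'x cluster measure"
    and h :: "'x \<Rightarrow> 'x cluster \<Rightarrow> real"
    and \<theta> :: "'x measure"
    and v :: "'x \<Rightarrow> ('x, 'n) tangent"
    and F :: "'x measure \<Rightarrow> real"
  assumes X: "riemannian_manifold X"
    and mu: "prob_space \<mu>" "sets \<mu> = sets (Proper_Config euclidean)"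
    and eta: "cluster_family \<eta>"
    and A1: "sets \<theta> = sets borel" "\<And>K. compact K \<Longrightarrow> emeasure \<theta> K < \<infinity>" "\<mu> \<in> M1 \<theta>"
    and A2: "\<And>B. compact B \<Longrightarrow> (\<integral>\<^sup>+x. emeasure (\<eta> x) (clusters_meeting B) \<partial>\<theta>) < \<infinity>"
      "\<And>B. compact B \<Longrightarrow>
         (\<integral>\<^sup>+x. (\<integral>\<^sup>+ys\<in>clusters_meeting B. of_nat (cluster_size ys) \<partial>\<eta> x) \<partial>\<theta>) < \<infinity>"
    and A3_density: "\<And>x ys. ys \<in> topspace cluster_top \<Longrightarrow> h x ys \<ge> 0"
      "\<And>x. differentiable_cluster_fun X (h x)"
      "\<And>x. \<eta> x = density (cluster_volume X) (\<lambda>ys. ennreal (h x ys))"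
    and A3_parts: "\<And>x w f. w \<in> Vect0 X \<Longrightarrow> f \<in> cluster_C0_inf X \<Longrightarrow>
         integrable (\<eta> x) (\<lambda>ys. f ys * log_deriv_along X h w (x, ys)) \<and>
         (\<integral>ys. cluster_dir_deriv X (lift_field w) f ys \<partial>\<eta> x) =
         - (\<integral>ys. f ys * log_deriv_along X h w (x, ys) \<partial>\<eta> x)"
    and A4: "\<And>B. compact B \<Longrightarrow>
         (\<integral>\<^sup>+z\<in>marked_meeting B.
            ennreal (log_gradient_norm1 X (h (fst z)) (snd z)) \<partial>sigma_hat \<theta> \<eta>) < \<infinity>"
    and v: "v \<in> Vect0 X"
    and F: "F \<in> FC TYPE('k::finite) X"
  shows "integrable (mu_hat \<mu> \<eta>) (B_hat X h v) \<and>
    is_q_adjoint \<mu> \<eta> (B_hat X h v) (B_cl X \<mu> \<eta> h v) \<and>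
    integrable (mu_cl \<mu> \<eta>) (\<lambda>\<gamma>. \<Sum>\<^sub>\<infinity>x\<in>pts \<gamma>. Metric X x (config_gradient X F \<gamma> x) (v x)) \<and>
    (\<integral>\<gamma>. (\<Sum>\<^sub>\<infinity>x\<in>pts \<gamma>. Metric X x (config_gradient X F \<gamma> x) (v x)) \<partial>mu_cl \<mu> \<eta>) =
    - (\<integral>\<gamma>. F \<gamma> * B_cl X \<mu> \<eta> h v \<gamma> \<partial>mu_cl \<mu> \<eta>)"
proof -
  interpret cluster_process X \<eta> h \<mu> \<theta>
    by (intro cluster_process.intro cluster_density.intro riemannian.intro cluster_density_axioms.intro
        cluster_process_axioms.intro; (rule X eta mu A1 A2 A3_density A3_parts A4; assumption?))
  obtain f :: "real ^ 'k \<Rightarrow> real" and \<phi> where f: "f \<in> Cb_inf" and \<phi>: "\<And>i. \<phi> i \<in> C0_inf X"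
    and F_eq: "F = (\<lambda>\<gamma>. f (\<chi> i. pairing (\<phi> i) \<gamma>))"
    using F unfolding FC_def by blast
  define \<Phi> where "\<Phi> x = (\<chi> i. \<phi> i x)" for x
  have \<Phi>: "test_map \<Phi>" using \<phi> by (simp add: test_map_def \<Phi>_def)
  have F_\<Phi>: "F = (\<lambda>\<gamma>. f (\<chi> i. pairing (\<lambda>x. \<Phi> x $ i) \<gamma>))" by (simp add: F_eq \<Phi>_def)
  show ?thesis
    unfolding F_\<Phi>
    by (intro conjI integration_by_parts[OF f \<Phi> v])
qed

end
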